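(* Let $q\ge r\ge 1$ be integers and assume that $q-5r-1>0$. Then, for any $v_x>0$, $v_y>0$ and $v_0\ge v_x$, the Bayesian predictive density $\hat p_{GB}(Y\mid X)$ with respect to the hierarchical prior with parameters $(a,b)$ defined in the context is admissible and minimax relative to the Kullback-Leibler loss if $$a>0,\qquad b>2,\qquad a+b\le (q-5r+3)/2.$$
   Context: Prediction problem: $X\mid\Theta\sim\mathcal N_{r\times q}(\Theta,v_xI_r\otimes I_q)$ and $Y\mid\Theta\sim\mathcal N_{r\times q}(\Theta,v_yI_r\otimes I_q)$ are independent given $\Theta$, i.e. $p(X\mid\Theta)=(2\pi v_x)^{-qr/2}\exp(-\|X-\Theta\|^2/(2v_x))$ and similarly $p(Y\mid\Theta)$ with $v_y$, where $\|A\|^2=\mathrm{tr}(AA^\top)$; $v_x,v_y$ are known. The matrix $\Theta\in\mathbb R^{r\times q}$ is unknown. A predictive density $\hat p=\hat p(Y\mid X)$ is an estimate of the density $p(Y\mid\Theta)$ based on $X$. The Kullback-Leibler (KL) loss is $L_{KL}(\Theta,\hat p)=\int_{\mathbb R^{r\times q}}p(Y\mid\Theta)\log\frac{p(Y\mid\Theta)}{\hat p(Y\mid X)}\,dY$ and the risk is $R_{KL}(\Theta,\hat p)=\int_{\mathbb R^{r\times q}} p(X\mid\Theta)L_{KL}(\Theta,\hat p)\,dX$. $\hat p$ is minimax if $\sup_\Theta R_{KL}(\Theta,\hat p)=\inf_{\tilde p}\sup_\Theta R_{KL}(\Theta,\tilde p)$ over all predictive densities $\tilde p$; $\hat p$ is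 admissible if there is no predictive density $\tilde p$ with $R_{KL}(\Theta,\tilde p)\le R_{KL}(\Theta,\hat p)$ for all $\Theta$ and strict inequality for some $\Theta$. For a (proper or improper) prior density $\pi(\Theta)$ with $\int p(X\mid\Theta)\pi(\Theta)\,d\Theta<\infty$ for all $X$, the Bayesian predictive density is $\hat p_\pi(Y\mid X)=\dfrac{\int p(X\mid\Theta)p(Y\mid\Theta)\pi(\Theta)\,d\Theta}{\int p(X\mid\Theta)\pi(\Theta)\,d\Theta}$. Hierarchical prior: let $\mathcal R_r$ be the set of real symmetric $r\times r$ matrices $\Omega$ such that $\Omega$ and $I_r-\Omega$ are both positive definite. Given $\Omega\in\mathcal R_r$, $\Theta\sim\mathcal N_{r\times q}(0,v_0\Omega^{-1}(I_r-\Omega)\otimes I_q)$, with density $$\pi_1(\Theta\mid\Omega)=(2\pi v_0)^{-qr/2}|\Omega(I_r-\Omega)^{-1}|^{q/2}\exp\Big[-\frac1{2v_0}\mathrm{tr}\{\Omega(I_r-\Omega)^{-1}\Theta\Theta^\top\}\Big],$$ and the second-stage density on $\mathcal R_r$ is $\pi_{GB}(\Omega)=K_{a,b}|\Omega|^{a/2-1}|I_r-\Omega|^{b/2-1}$, with $K_{a,b}>0$ a (normalizing) constant. The prior is $\pi(\Theta)=\int_{\mathcal R_r}\pi_1(\Theta\mid\Omega)\pi_{GB}(\Omega)\,d\Omega$, and $\hat p_{GB}$ is the corresponding Bayesian predictive density. *)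

theory Defs
  imports "HOL-Probability.Probability"
begin

text \<open>
  An \<open>r \<times> q\<close> matrix has type \<^typ>\<open>real ^ 'q ^ 'r\<close>, with \<open>r = CARD('r)\<close> and \<open>q = CARD('q)\<close>.
  \<^term>\<open>lborel\<close> on this type is Lebesgue measure in the \<open>r * q\<close> matrix entries.
\<close>

definition sq_norm :: "real ^ 'q ^ 'r \<Rightarrow> real" where
  "sq_norm A = trace (A ** transpose A)"

definition normal_dens :: "real \<Rightarrow> real ^ 'q ^ 'r \<Rightarrow> real ^ 'q ^ 'r \<Rightarrow> real" where
  "normal_dens v \<Theta> X =
     (2 * pi * v) powr (- (real CARD('q) * real CARD('r) / 2)) *
     exp (- sq_norm (X - \<Theta>) / (2 * v))"

text \<open>
  The Bochner integral returns \<open>0\<close> on non-integrable functions, so the Kullback-Leibler loss and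
  risk, which may be infinite, use an integral with values in \<^typ>\<open>ereal\<close>: integral of the positive
  part minus integral of the negative part.  (\<^term>\<open>e2ennreal\<close> maps negative arguments to \<open>0\<close>.)
  For the loss, the negative part always has a finite integral.
\<close>

definition ext_integral :: "'a measure \<Rightarrow> ('a \<Rightarrow> ereal) \<Rightarrow> ereal" where
  "ext_integral M f =
     enn2ereal (\<integral>\<^sup>+ x. e2ennreal (f x) \<partial>M) - enn2ereal (\<integral>\<^sup>+ x. e2ennreal (- f x) \<partial>M)"

text \<open>A predictive density \<open>phat\<close> is curried: \<open>phat X Y\<close> stands for \<open>phat(Y | X)\<close>.\<close>

definition predictive_density ::
  "(real ^ 'q ^ 'r \<Rightarrow> real ^ 'q ^ 'r \<Rightarrow> real) \<Rightarrow> bool" where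
  "predictive_density phat \<longleftrightarrow>
     (\<lambda>(X, Y). phat X Y) \<in> borel_measurable borel \<and>
     (\<forall>X Y. 0 \<le> phat X Y) \<and>
     (\<forall>X. (\<integral>\<^sup>+ Y. ennreal (phat X Y) \<partial>lborel) = 1)"

text \<open>
  \<open>p * log (p / ph)\<close> for \<open>p > 0\<close> and \<open>ph \<ge> 0\<close>; normal densities never vanish, so \<open>p = 0\<close> does not
  occur.
\<close>

definition kl_integrand :: "real \<Rightarrow> real \<Rightarrow> ereal" where
  "kl_integrand p ph = (if ph = 0 then \<infinity> else ereal (p * ln (p / ph)))"

definition KL_loss ::
  "real \<Rightarrow> real ^ 'q ^ 'r \<Rightarrow> (real ^ 'q ^ 'r \<Rightarrow> real) \<Rightarrow> ereal" where
  "KL_loss v\<^sub>y \<Theta> ph = ext_integral lborel (\<lambda>Y. kl_integrand (normal_dens v\<^sub>y \<Theta> Y) (ph Y))"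

definition KL_risk ::
  "real \<Rightarrow> real \<Rightarrow> real ^ 'q ^ 'r \<Rightarrow> (real ^ 'q ^ 'r \<Rightarrow> real ^ 'q ^ 'r \<Rightarrow> real) \<Rightarrow> ereal" where
  "KL_risk v\<^sub>x v\<^sub>y \<Theta> phat =
     ext_integral lborel (\<lambda>X. ereal (normal_dens v\<^sub>x \<Theta> X) * KL_loss v\<^sub>y \<Theta> (phat X))"

definition minimax ::
  "real \<Rightarrow> real \<Rightarrow> (real ^ 'q ^ 'r \<Rightarrow> real ^ 'q ^ 'r \<Rightarrow> real) \<Rightarrow> bool" where
  "minimax v\<^sub>x v\<^sub>y phat \<longleftrightarrow>
     predictive_density phat \<and>
     (SUP \<Theta>. KL_risk v\<^sub>x v\<^sub>y \<Theta> phat) =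
       (INF pt \<in> {pt :: real ^ 'q ^ 'r \<Rightarrow> real ^ 'q ^ 'r \<Rightarrow> real. predictive_density pt}.
          SUP \<Theta>. KL_risk v\<^sub>x v\<^sub>y \<Theta> pt)"

definition admissible ::
  "real \<Rightarrow> real \<Rightarrow> (real ^ 'q ^ 'r \<Rightarrow> real ^ 'q ^ 'r \<Rightarrow> real) \<Rightarrow> bool" where
  "admissible v\<^sub>x v\<^sub>y phat \<longleftrightarrow>
     predictive_density phat \<and>
     \<not> (\<exists>pt :: real ^ 'q ^ 'r \<Rightarrow> real ^ 'q ^ 'r \<Rightarrow> real. predictive_density pt \<and>
          (\<forall>\<Theta>. KL_risk v\<^sub>x v\<^sub>y \<Theta> pt \<le> KL_risk v\<^sub>x v\<^sub>y \<Theta> phat) \<and>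
          (\<exists>\<Theta>. KL_risk v\<^sub>x v\<^sub>y \<Theta> pt < KL_risk v\<^sub>x v\<^sub>y \<Theta> phat))"

text \<open>
  Prior densities take values in \<^typ>\<open>ennreal\<close>: they may be improper, and the hierarchical prior
  below may be infinite on a null set (such as at \<open>\<Theta> = 0\<close>).  The outer \<^term>\<open>enn2real\<close> loses
  nothing when the marginal density of \<open>X\<close> is finite and positive.
\<close>

definition bayes_pred ::
  "real \<Rightarrow> real \<Rightarrow> (real ^ 'q ^ 'r \<Rightarrow> ennreal) \<Rightarrow> real ^ 'q ^ 'r \<Rightarrow> real ^ 'q ^ 'r \<Rightarrow> real" where
  "bayes_pred v\<^sub>x v\<^sub>y \<pi> X Y =
     enn2real
       ((\<integral>\<^sup>+ \<Theta>. ennreal (normal_dens v\<^sub>x \<Theta> X * normal_dens v\<^sub>y \<Theta> Y) * \<pi> \<Theta> \<partial>lborel) /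
        (\<integral>\<^sup>+ \<Theta>. ennreal (normal_dens v\<^sub>x \<Theta> X) * \<pi> \<Theta> \<partial>lborel))"

definition pos_def :: "real ^ 'r ^ 'r \<Rightarrow> bool" where
  "pos_def A \<longleftrightarrow> transpose A = A \<and> (\<forall>x. x \<noteq> 0 \<longrightarrow> 0 < x \<bullet> (A *v x))"

definition R_set :: "(real ^ 'r ^ 'r) set" where
  "R_set = {\<Omega>. pos_def \<Omega> \<and> pos_def (mat 1 - \<Omega>)}"

text \<open>
  Lebesgue measure \<open>d\<Omega>\<close> in the \<open>r (r + 1) / 2\<close> free entries of a symmetric matrix, as a measure on
  all \<open>r \<times> r\<close> matrices.  The entries \<open>(i, j)\<close> and \<open>(j, i)\<close> share the coordinate indexed by the
  set \<open>{i, j}\<close>.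
\<close>

definition sym_mat :: "('r set \<Rightarrow> real) \<Rightarrow> real ^ 'r ^ 'r" where
  "sym_mat \<omega> = (\<chi> i j. \<omega> {i, j})"

definition sym_lborel :: "(real ^ 'r ^ 'r) measure" where
  "sym_lborel = distr (\<Pi>\<^sub>M s \<in> {{i, j} |i j :: 'r. True}. lborel) borel sym_mat"

lemma measurable_sym_mat:
  "sym_mat \<in> borel_measurable (\<Pi>\<^sub>M s \<in> {{i, j} |i j :: 'r::finite. True}. lborel)"
proof -
  have "(\<lambda>\<omega>. \<omega> {i, j}) \<in>
      borel_measurable (\<Pi>\<^sub>M s \<in> {{i, j} |i j :: 'r. True}. lborel)" for i j :: 'r
    by (subst measurable_cong_sets[OF refl sets_lborel[symmetric]])
      (rule measurable_component_singleton, blast)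
  then show ?thesis
    by (auto simp: borel_measurable_euclidean_space[of sym_mat] Basis_vec_def inner_axis sym_mat_def)
qed

definition prior1 :: "real \<Rightarrow> real ^ 'r ^ 'r \<Rightarrow> real ^ 'q ^ 'r \<Rightarrow> real" where
  "prior1 v\<^sub>0 \<Omega> \<Theta> =
     (2 * pi * v\<^sub>0) powr (- (real CARD('q) * real CARD('r) / 2)) *
     det (\<Omega> ** matrix_inv (mat 1 - \<Omega>)) powr (real CARD('q) / 2) *
     exp (- (1 / (2 * v\<^sub>0)) *
       trace (\<Omega> ** matrix_inv (mat 1 - \<Omega>) ** (\<Theta> ** transpose \<Theta>)))"

text \<open>
  \<open>K\<close> is the constant \<open>K_{a,b}\<close>.  It cancels in \<open>phat_GB\<close> below, so it is kept as an arbitrary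
  parameter instead of being fixed to the normalizing value.
\<close>

definition pi_GB :: "real \<Rightarrow> real \<Rightarrow> real \<Rightarrow> real ^ 'r ^ 'r \<Rightarrow> real" where
  "pi_GB K a b \<Omega> = K * det \<Omega> powr (a / 2 - 1) * det (mat 1 - \<Omega>) powr (b / 2 - 1)"

definition prior_GB :: "real \<Rightarrow> real \<Rightarrow> real \<Rightarrow> real \<Rightarrow> real ^ 'q ^ 'r \<Rightarrow> ennreal" where
  "prior_GB K v\<^sub>0 a b \<Theta> =
     (\<integral>\<^sup>+ \<Omega> \<in> R_set. ennreal (prior1 v\<^sub>0 \<Omega> \<Theta> * pi_GB K a b \<Omega>) \<partial>sym_lborel)"

definition phat_GB ::
  "real \<Rightarrow> real \<Rightarrow> real \<Rightarrow> real \<Rightarrow> real \<Rightarrow> real \<Rightarrow>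
     real ^ 'q ^ 'r \<Rightarrow> real ^ 'q ^ 'r \<Rightarrow> real" where
  "phat_GB K v\<^sub>x v\<^sub>y v\<^sub>0 a b = bayes_pred v\<^sub>x v\<^sub>y (prior_GB K v\<^sub>0 a b)"

end

theory Submission
  imports Defs
begin

text \<open>
  Let \<open>m v\<close> be the marginal density of \<open>X\<close> at noise level \<open>v\<close> and \<open>w = v\<^sub>x v\<^sub>y / (v\<^sub>x + v\<^sub>y)\<close>.  The risk of
  the Bayesian predictive density at \<open>\<Theta>\<close> is the constant \<open>(q r / 2) log ((v\<^sub>x + v\<^sub>y) / v\<^sub>y)\<close> minus
  \<open>E log m w (Z\<^sub>w) - E log m v\<^sub>x (Z\<^sub>v\<^sub>x)\<close>, where \<open>Z\<^sub>v\<close> is normal with mean \<open>\<Theta>\<close> and variance \<open>v\<close>.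
  Proper normal priors with variance tending to infinity show that no predictive density has smaller
  supremal risk than this constant.  As \<open>d/dv E log m v (Z\<^sub>v)\<close> is the mean of \<open>2 \<Delta>(\<surd>m v) / \<surd>m v\<close>,
  minimaxity follows when \<open>\<surd>m v\<close> is superharmonic for \<open>v \<le> v\<^sub>x\<close>, that is,
  \<open>2 m \<Delta>m \<le> |\<nabla>m|\<^sup>2\<close>.  Admissibility follows because the prior is proper and the Bayes risk finite.

  Given \<open>\<Omega>\<close>, the gradient of \<open>log m\<close> is \<open>- \<Lambda> z / v\<close> with
  \<open>\<Lambda> = (1 - s) \<Omega> (I - s \<Omega>)\<inverse>\<close> and \<open>s = 1 - v / v\<^sub>0\<close>, so superharmonicity is an inequality between the
  means of \<open>|\<Lambda> z|\<^sup>2\<close>, \<open>tr \<Lambda>\<close> and \<open>\<Lambda>\<close> under a density proportional to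
  \<open>|\<Omega>|\<^sup>\<alpha> |I - \<Omega>|\<^sup>\<beta> |I - s \<Omega>|\<^sup>-\<^sup>q\<^sup>/\<^sup>2 exp (- \<langle>\<Lambda> z, z\<rangle> / (2 v))\<close> with \<open>\<alpha> = (a + q) / 2 - 1\<close> and
  \<open>\<beta> = b / 2 - 1\<close>.  It is obtained by integrating by parts two fields of symmetric matrices.
\<close>

section \<open>Integration by parts and Gaussian densities\<close>

text \<open>The required inequality bounds the mean of |\<Lambda> z|^2 by the squared mean of
  \<Lambda> z up to a trace term, whereas Jensen's inequality orders these two quantities the other
  way; so the quadratic terms cannot be compared directly. Each is exchanged for traces instead: if
  pairing a field with the gradient of the exponent reproduces the quadratic term, its divergence
  identity expresses the mean of that term by means of traces alone. Two fields are needed because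
  the squared mean is no mean of a function of \<Omega>; it becomes one, linear in \<Lambda>, once
  one factor is frozen as a constant matrix M. The price is a trace that is unbounded where I -
  \<Omega> degenerates. It occurs in both identities, and since M lies between 0 and I the net
  contribution has the favourable sign. What survives is a multiple of the trace of the mean of
  \<Lambda>, and the demand that this multiple be nonpositive is exactly a + b \<le> (q - 5 r + 3) /
  2.\<close>

lemma has_real_derivative_integral:
  fixes f f' :: "real \<Rightarrow> 'b \<Rightarrow> real"
  assumes S: "convex S" "x0 \<in> S"
    and int: "\<And>x. x \<in> S \<Longrightarrow> integrable M (f x)"
    and der: "\<And>x w. x \<in> S \<Longrightarrow> w \<in> space M \<Longrightarrow>
      ((\<lambda>x. f x w) has_real_derivative f' x w) (at x within S)"
    and bnd: "\<And>x w. x \<in> S \<Longrightarrow> w \<in> space M \<Longrightarrow> \<bar>f' x w\<bar> \<le> W w"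
    and W: "integrable M W" and meas: "f' x0 \<in> borel_measurable M"
  shows "((\<lambda>x. \<integral>w. f x w \<partial>M) has_real_derivative (\<integral>w. f' x0 w \<partial>M)) (at x0 within S)"
proof -
  have "((\<lambda>y. ((\<integral>w. f y w \<partial>M) - (\<integral>w. f x0 w \<partial>M)) / (y - x0)) \<longlongrightarrow> (\<integral>w. f' x0 w \<partial>M)) (at x0 within S)"
    unfolding tendsto_at_iff_sequentially
  proof (intro allI impI)
    fix X assume X: "\<forall>i. X i \<in> S - {x0}" "X \<longlonglongrightarrow> x0"
    have "(\<lambda>i. \<integral>w. (f (X i) w - f x0 w) / (X i - x0) \<partial>M) \<longlonglongrightarrow> (\<integral>w. f' x0 w \<partial>M)"
    proof (rule integral_dominated_convergence)
      show "AE w in M. (\<lambda>i. (f (X i) w - f x0 w) / (X i - x0)) \<longlonglongrightarrow> f' x0 w"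
      proof (rule AE_I2)
        fix w assume w: "w \<in> space M"
        have "((\<lambda>y. (f y w - f x0 w) / (y - x0)) \<longlongrightarrow> f' x0 w) (at x0 within S)"
          using der[OF S(2) w] by (simp add: has_field_derivative_iff)
        then show "(\<lambda>i. (f (X i) w - f x0 w) / (X i - x0)) \<longlonglongrightarrow> f' x0 w"
          unfolding tendsto_at_iff_sequentially comp_def using X by blast
      qed
      show "AE w in M. norm ((f (X i) w - f x0 w) / (X i - x0)) \<le> W w" for i
      proof (rule AE_I2)
        fix w assume w: "w \<in> space M"
        \<comment> \<open>The mean value inequality turns the bound on the derivative into a bound
          on the difference quotients that is uniform along the sequence.\<close>
        have "norm (f (X i) w - f x0 w) \<le> W w * norm (X i - x0)"
          using X S der[OF _ w] bnd[OF _ w]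
          by (intro field_differentiable_bound[of S "\<lambda>x. f x w" "\<lambda>x. f' x w"]) auto
        then show "norm ((f (X i) w - f x0 w) / (X i - x0)) \<le> W w"
          using X by (simp add: divide_le_eq)
      qed
      show "(\<lambda>w. (f (X i) w - f x0 w) / (X i - x0)) \<in> borel_measurable M" for i
        using borel_measurable_integrable[OF int[OF S(2)]]
          borel_measurable_integrable[OF int[of "X i"]] X by auto
    qed (use W meas in auto)
    moreover have "(\<integral>w. (f (X i) w - f x0 w) / (X i - x0) \<partial>M) =
        ((\<integral>w. f (X i) w \<partial>M) - (\<integral>w. f x0 w \<partial>M)) / (X i - x0)" for i
    proof -
      have "X i \<in> S" using X by auto
      from Bochner_Integration.integral_diff[OF int[OF this] int[OF S(2)]] show ?thesis by simp
    qed
    ultimately show "((\<lambda>y. ((\<integral>w. f y w \<partial>M) - (\<integral>w. f x0 w \<partial>M)) / (y - x0)) \<circ> X) \<longlonglongrightarrow> (\<integral>w. f' x0 w \<partial>M)"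
      by (simp only: comp_def)
  qed
  then show ?thesis by (simp add: has_field_derivative_iff)
qed

text \<open>
  By Fubini and translation invariance, the integral of \<open>g'\<close> is the integral of
  \<open>\<integral>\<^sub>0\<^sup>1 g' (x + t e) dt = g (x + e) - g x\<close>.
\<close>

lemma integral_directional_derivative:
  fixes M :: "'a::euclidean_space measure" and g g' :: "'a \<Rightarrow> real"
  assumes sf: "sigma_finite_measure M" and sM: "sets M = sets borel"
    and inv: "\<And>t. distr M borel (\<lambda>x. x + t *\<^sub>R e) = M"
    and g: "integrable M g" and g': "integrable M g'"
    and ftc: "\<And>x. ((\<lambda>t. g' (x + t *\<^sub>R e)) has_integral (g (x + e) - g x)) {0..1}"
  shows "(\<integral>x. g' x \<partial>M) = 0"
proof -
  interpret M: sigma_finite_measure M by fact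
  interpret pair_sigma_finite M "lborel :: real measure" ..
  note [measurable_cong] = sM
  have [measurable]: "g \<in> borel_measurable borel" "g' \<in> borel_measurable borel"
    using borel_measurable_integrable[OF g] borel_measurable_integrable[OF g']
    by (simp_all cong: measurable_cong_sets[OF sM refl])
  have shift_nn: "(\<integral>\<^sup>+x. f (x + t *\<^sub>R e) \<partial>M) = (\<integral>\<^sup>+x. f x \<partial>M)"
    if [measurable]: "f \<in> borel_measurable borel" for f :: "'a \<Rightarrow> ennreal" and t
  proof -
    have "(\<integral>\<^sup>+x. f x \<partial>M) = (\<integral>\<^sup>+x. f x \<partial>distr M borel (\<lambda>x. x + t *\<^sub>R e))"
      by (simp add: inv)
    also have "\<dots> = (\<integral>\<^sup>+x. f (x + t *\<^sub>R e) \<partial>M)"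
      by (rule nn_integral_distr) measurable
    finally show ?thesis by simp
  qed
  have shift: "(\<integral>x. f (x + t *\<^sub>R e) \<partial>M) = (\<integral>x. f x \<partial>M)"
    if [measurable]: "f \<in> borel_measurable borel" for f :: "'a \<Rightarrow> real" and t
  proof -
    have "(\<integral>x. f x \<partial>M) = (\<integral>x. f x \<partial>distr M borel (\<lambda>x. x + t *\<^sub>R e))"
      by (simp add: inv)
    also have "\<dots> = (\<integral>x. f (x + t *\<^sub>R e) \<partial>M)"
      by (rule integral_distr) measurable
    finally show ?thesis by simp
  qed
  define h where "h = (\<lambda>(x, t). indicator {0..1} t * g' (x + t *\<^sub>R e))"
  have [measurable]: "h \<in> borel_measurable (M \<Otimes>\<^sub>M lborel)"
    unfolding h_def by measurable
  have "(\<integral>\<^sup>+z. ennreal (norm (h z)) \<partial>(M \<Otimes>\<^sub>M lborel)) =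
      (\<integral>\<^sup>+t. \<integral>\<^sup>+x. ennreal (norm (h (x, t))) \<partial>M \<partial>lborel)"
    by (rule nn_integral_snd[symmetric]) measurable
  also have "\<dots> = (\<integral>\<^sup>+t. indicator {0..1} t * (\<integral>\<^sup>+x. ennreal (norm (g' (x + t *\<^sub>R e))) \<partial>M) \<partial>lborel)"
    unfolding h_def
    by (intro nn_integral_cong) (auto simp: indicator_def nn_integral_cmult[symmetric])
  also have "\<dots> = (\<integral>\<^sup>+t. (\<integral>\<^sup>+x. ennreal (norm (g' x)) \<partial>M) * indicator {0..1} (t::real) \<partial>lborel)"
    by (subst shift_nn[of "\<lambda>x. ennreal (norm (g' x))"]) (auto simp: mult.commute)
  also have "\<dots> = (\<integral>\<^sup>+x. ennreal (norm (g' x)) \<partial>M)"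
    by (subst nn_integral_cmult_indicator) auto
  also have "\<dots> < \<infinity>" using g' by (simp add: integrable_iff_bounded)
  finally have hint: "integrable (M \<Otimes>\<^sub>M lborel) h"
    by (intro integrableI_bounded) auto
  have "(\<integral>z. h z \<partial>(M \<Otimes>\<^sub>M lborel)) = (\<integral>t. \<integral>x. h (x, t) \<partial>M \<partial>lborel)"
    using integral_snd[of "\<lambda>x t. h (x, t)"] hint by simp
  also have "\<dots> = (\<integral>t. indicator {0..1} (t::real) * (\<integral>x. g' x \<partial>M) \<partial>lborel)"
    unfolding h_def by (simp add: shift)
  also have "\<dots> = (\<integral>x. g' x \<partial>M)"
    by simp
  finally have 1: "(\<integral>z. h z \<partial>(M \<Otimes>\<^sub>M lborel)) = (\<integral>x. g' x \<partial>M)" .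
  have "(\<integral>z. h z \<partial>(M \<Otimes>\<^sub>M lborel)) = (\<integral>x. \<integral>t. h (x, t) \<partial>lborel \<partial>M)"
    using integral_fst[of "\<lambda>x t. h (x, t)"] hint by simp
  also have "\<dots> = (\<integral>x. g (x + e) - g x \<partial>M)"
  proof (rule integral_cong_AE)
    \<comment> \<open>The hypothesis \<open>ftc\<close> uses the gauge integral, so it can be met by
      functions with exceptional points on a line. Almost every slice is also Lebesgue integrable,
      and there the two integrals agree.\<close>
    show "AE x in M. (\<integral>t. h (x, t) \<partial>lborel) = g (x + e) - g x"
      using AE_integrable_fst'[OF hint]
    proof eventually_elim
      case (elim x)
      then have "set_integrable lborel {0..1} (\<lambda>t. g' (x + t *\<^sub>R e))"
        by (simp add: set_integrable_def h_def)
      then have "((\<lambda>t. g' (x + t *\<^sub>R e)) has_integral (LINT t:{0..1}|lborel. g' (x + t *\<^sub>R e))) {0..1}"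
        by (metis set_borel_integral_eq_integral(1,2) has_integral_integral)
      with ftc[of x] have "(LINT t:{0..1}|lborel. g' (x + t *\<^sub>R e)) = g (x + e) - g x"
        using has_integral_unique by blast
      then show ?case by (simp add: h_def set_lebesgue_integral_def)
    qed
  qed measurable
  also have "\<dots> = (\<integral>x. g (x + e) \<partial>M) - (\<integral>x. g x \<partial>M)"
  proof (rule Bochner_Integration.integral_diff)
    show "integrable M (\<lambda>x. g (x + e))"
      using shift_nn[of "\<lambda>x. ennreal (norm (g x))" 1] g
      by (auto simp: integrable_iff_bounded)
  qed (fact g)
  also have "\<dots> = 0" using shift[of g 1] by simp
  finally show ?thesis using 1 by simp
qed

lemma lborel_distr_plus_right: "distr lborel borel (\<lambda>x. x + c) = (lborel :: 'a::euclidean_space measure)"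
  using lborel_distr_plus[of c] by (simp add: add.commute[of c] cong: distr_cong)

lemma integral_directional_derivative_lborel:
  fixes g g' :: "'a::euclidean_space \<Rightarrow> real"
  assumes g: "integrable lborel g" and g': "integrable lborel g'"
    and der: "\<And>x. ((\<lambda>t. g (x + t *\<^sub>R e)) has_real_derivative g' x) (at 0)"
  shows "(\<integral>x. g' x \<partial>lborel) = 0"
proof (rule integral_directional_derivative[OF _ _ _ g g'])
  fix x
  have "((\<lambda>t. g (x + t *\<^sub>R e)) has_real_derivative g' (x + t *\<^sub>R e)) (at t)" for t
  proof -
    have "((\<lambda>s. g ((x + t *\<^sub>R e) + s *\<^sub>R e)) has_real_derivative g' (x + t *\<^sub>R e)) (at (t - t))"
      using der[of "x + t *\<^sub>R e"] by simp
    then have "((\<lambda>s. g ((x + t *\<^sub>R e) + (s - t) *\<^sub>R e)) has_real_derivative g' (x + t *\<^sub>R e) * 1) (at t)"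
      by (rule DERIV_chain2) (auto intro!: derivative_eq_intros)
    then show ?thesis
      by (simp add: algebra_simps)
  qed
  then have "((\<lambda>t. g (x + t *\<^sub>R e)) has_vector_derivative g' (x + t *\<^sub>R e)) (at t within {0..1})" for t
    by (meson has_field_derivative_at_within has_real_derivative_iff_has_vector_derivative)
  then have "((\<lambda>t. g' (x + t *\<^sub>R e)) has_integral (g (x + 1 *\<^sub>R e) - g (x + 0 *\<^sub>R e))) {0..1}"
    by (intro fundamental_theorem_of_calculus) auto
  then show "((\<lambda>t. g' (x + t *\<^sub>R e)) has_integral (g (x + e) - g x)) {0..1}"
    by simp
qed (auto simp: lborel_distr_plus_right intro: lborel.sigma_finite_measure_axioms)

section \<open>Isotropic Gaussian densities on a Euclidean space\<close>

definition gauss :: "real \<Rightarrow> 'a::euclidean_space \<Rightarrow> 'a \<Rightarrow> real" where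
  "gauss v \<theta> x = (2 * pi * v) powr (- (real DIM('a) / 2)) * exp (- (norm (x - \<theta>))\<^sup>2 / (2 * v))"

lemma gauss_pos: "v > 0 \<Longrightarrow> gauss v \<theta> x > 0"
  by (simp add: gauss_def)

lemma gauss_nonneg [simp]: "gauss v \<theta> x \<ge> 0"
  by (simp add: gauss_def)

lemma gauss_commute: "gauss v \<theta> x = gauss v x \<theta>"
  by (simp add: gauss_def norm_minus_commute)

lemma gauss_le: "v > 0 \<Longrightarrow> gauss v \<theta> (x::'a::euclidean_space) \<le> (2 * pi * v) powr (- (real DIM('a) / 2))"
  by (simp add: gauss_def mult_left_le)

lemma measurable_gauss [measurable]:
  assumes [measurable]: "f \<in> borel_measurable M" "g \<in> borel_measurable M" "h \<in> borel_measurable M"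
  shows "(\<lambda>x. gauss (f x) (g x) (h x :: 'a::euclidean_space)) \<in> borel_measurable M"
  unfolding gauss_def by measurable

lemma gauss_eq_prod:
  assumes v: "v > 0"
  shows "gauss v \<theta> (x::'a::euclidean_space) = (\<Prod>b\<in>Basis. normal_density (\<theta> \<bullet> b) (sqrt v) (x \<bullet> b))"
proof -
  have "(norm (x - \<theta>))\<^sup>2 = (\<Sum>b\<in>Basis. (x \<bullet> b - \<theta> \<bullet> b)\<^sup>2)"
    unfolding power2_norm_eq_inner
    by (subst euclidean_inner) (simp add: inner_diff_left power2_eq_square)
  then have e: "exp (- (norm (x - \<theta>))\<^sup>2 / (2 * v)) = (\<Prod>b\<in>Basis. exp (- (x \<bullet> b - \<theta> \<bullet> b)\<^sup>2 / (2 * v)))"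
    by (simp add: exp_sum[symmetric] sum_negf sum_divide_distrib)
  have "1 / sqrt (2 * pi * v) = (2 * pi * v) powr (- 1 / 2)"
    using v by (simp add: powr_minus_divide powr_half_sqrt)
  then have "(1 / sqrt (2 * pi * v)) ^ DIM('a) = (2 * pi * v) powr (- (real DIM('a) / 2))"
    using v by (simp add: powr_realpow[symmetric] powr_powr)
  with e have "gauss v \<theta> x = (\<Prod>b::'a\<in>Basis. 1 / sqrt (2 * pi * v)) *
      (\<Prod>b\<in>Basis. exp (- (x \<bullet> b - \<theta> \<bullet> b)\<^sup>2 / (2 * v)))"
    unfolding gauss_def by simp
  also have "\<dots> = (\<Prod>b\<in>Basis. normal_density (\<theta> \<bullet> b) (sqrt v) (x \<bullet> b))"
    using v unfolding prod.distrib[symmetric] by (simp add: normal_density_def)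
  finally show ?thesis .
qed

lemma nn_integral_gauss:
  assumes "v > 0"
  shows "(\<integral>\<^sup>+x. ennreal (gauss v \<theta> x) \<partial>lborel) = 1"
proof -
  have 1: "(\<integral>\<^sup>+x. ennreal (normal_density m (sqrt v) x) \<partial>lborel) = 1" for m
    using assms by (subst nn_integral_eq_integral) auto
  have "(\<integral>\<^sup>+x. ennreal (gauss v \<theta> x) \<partial>lborel) =
      (\<integral>\<^sup>+x. (\<Prod>b\<in>Basis. ennreal (normal_density (\<theta> \<bullet> b) (sqrt v) (x \<bullet> b))) \<partial>lborel)"
    using assms by (simp add: gauss_eq_prod prod_ennreal)
  also have "\<dots> = (\<Prod>b\<in>Basis. (\<integral>\<^sup>+x. ennreal (normal_density (\<theta> \<bullet> b) (sqrt v) x) \<partial>lborel))"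
    by (rule nn_integral_lborel_prod) auto
  finally show ?thesis by (simp add: 1)
qed

lemma nn_integral_gauss': "v > 0 \<Longrightarrow> (\<integral>\<^sup>+\<theta>. ennreal (gauss v \<theta> x) \<partial>lborel) = 1"
  using nn_integral_gauss[of v x] by (simp add: gauss_commute[of v _ x])

lemma integrable_gauss: "v > 0 \<Longrightarrow> integrable lborel (gauss v \<theta>)"
  using nn_integral_gauss[of v \<theta>] by (intro integrableI_bounded) auto

lemma integral_gauss: "v > 0 \<Longrightarrow> (\<integral>x. gauss v \<theta> x \<partial>lborel) = 1"
  using nn_integral_gauss[of v \<theta>] by (subst integral_eq_nn_integral) auto

text \<open>A single term of the exponential series of \<open>c * x\<close> is at most its
  sum.\<close>

lemma power_exp_bounded:
  fixes c :: real assumes "c > 0"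
  shows "\<exists>K\<ge>0. \<forall>x\<ge>0. x ^ k * exp (- c * x) \<le> K"
proof (intro exI conjI allI impI)
  show "fact k / c ^ k \<ge> 0" using assms by simp
  fix x :: real assume x: "x \<ge> 0"
  have "(\<lambda>n. (c * x) ^ n /\<^sub>R fact n) sums exp (c * x)" by (rule exp_converges)
  then have "(c * x) ^ k /\<^sub>R fact k \<le> exp (c * x)"
  proof -
    have "sum (\<lambda>n. (c * x) ^ n /\<^sub>R fact n) {k} \<le> (\<Sum>n. (c * x) ^ n /\<^sub>R fact n)"
      using assms x summable_exp_generic[of "c * x"] by (intro sum_le_suminf) auto
    then show ?thesis by (simp add: exp_def)
  qed
  then have "(c * x) ^ k \<le> fact k * exp (c * x)"
    by (simp add: inverse_eq_divide pos_divide_le_eq mult.commute)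
  then have "x ^ k \<le> fact k / c ^ k * exp (c * x)"
    using assms by (simp add: power_mult_distrib pos_le_divide_eq mult.commute)
  then have "x ^ k * exp (- c * x) \<le> fact k / c ^ k * exp (c * x) * exp (- c * x)"
    by (rule mult_right_mono) simp
  then show "x ^ k * exp (- c * x) \<le> fact k / c ^ k"
    by (simp add: mult.assoc exp_add[symmetric])
qed

lemma integrable_exp_neg_norm:
  assumes "c > 0"
  shows "integrable lborel (\<lambda>x::'a::euclidean_space. exp (- c * (norm x)\<^sup>2))"
proof -
  have "integrable lborel (\<lambda>x::'a. (2 * pi * (1 / (2 * c))) powr (real DIM('a) / 2) * gauss (1 / (2 * c)) 0 x)"
    using assms by (intro integrable_mult_right integrable_gauss) auto
  moreover have "(2 * pi * (1 / (2 * c))) powr (real DIM('a) / 2) * gauss (1 / (2 * c)) 0 x =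
      exp (- c * (norm x)\<^sup>2)" for x :: 'a
  proof -
    have "(2 * pi * (1 / (2 * c))) powr (real DIM('a) / 2) *
        (2 * pi * (1 / (2 * c))) powr (- (real DIM('a) / 2)) = 1"
      using assms by (subst powr_add[symmetric]) simp
    then show ?thesis
      using assms by (simp only: gauss_def mult.assoc[symmetric]) simp
  qed
  ultimately show ?thesis by (simp only:)
qed

text \<open>Half of the exponent absorbs the polynomial, and the other half is integrable.\<close>

lemma integrable_power_exp_neg_norm:
  assumes c: "c > 0"
  shows "integrable lborel (\<lambda>x::'a::euclidean_space. (1 + (norm x)\<^sup>2) ^ k * exp (- c * (norm x)\<^sup>2))"
proof -
  obtain K where K: "K \<ge> 0" "\<And>x::real. x \<ge> 0 \<Longrightarrow> x ^ k * exp (- (c / 2) * x) \<le> K"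
    using power_exp_bounded[of "c/2" k] c by (auto simp del: mult_minus_left)
  show ?thesis
  proof (rule Bochner_Integration.integrable_bound)
    show "integrable lborel (\<lambda>x::'a. (K * exp (c / 2)) * exp (- (c / 2) * (norm x)\<^sup>2))"
      using c integrable_exp_neg_norm[of "c/2"] by (intro integrable_mult_right) auto
    show "AE x::'a in lborel. norm ((1 + (norm x)\<^sup>2) ^ k * exp (- c * (norm x)\<^sup>2)) \<le>
        norm ((K * exp (c / 2)) * exp (- (c / 2) * (norm x)\<^sup>2))"
    proof (rule AE_I2)
      fix x :: 'a
      have "(1 + (norm x)\<^sup>2) ^ k * exp (- c * (norm x)\<^sup>2) =
          ((1 + (norm x)\<^sup>2) ^ k * exp (- (c / 2) * (1 + (norm x)\<^sup>2))) * (exp (c / 2) * exp (- (c / 2) * (norm x)\<^sup>2))"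
        by (simp add: exp_add[symmetric] algebra_simps)
      also have "\<dots> \<le> K * (exp (c / 2) * exp (- (c / 2) * (norm x)\<^sup>2))"
        by (intro mult_right_mono K) auto
      finally show "norm ((1 + (norm x)\<^sup>2) ^ k * exp (- c * (norm x)\<^sup>2)) \<le>
          norm ((K * exp (c / 2)) * exp (- (c / 2) * (norm x)\<^sup>2))"
        using K(1) by (simp add: abs_mult mult.assoc)
    qed
  qed auto
qed

lemma norm_diff_sq_ge:
  fixes x \<theta> :: "'a::euclidean_space"
  shows "(norm x)\<^sup>2 / 2 - (norm \<theta>)\<^sup>2 \<le> (norm (x - \<theta>))\<^sup>2"
proof -
  have "(norm x)\<^sup>2 \<le> (norm (x - \<theta>) + norm \<theta>)\<^sup>2"
    by (metis diff_add_cancel norm_ge_zero norm_triangle_ineq power_mono)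
  also have "\<dots> \<le> 2 * (norm (x - \<theta>))\<^sup>2 + 2 * (norm \<theta>)\<^sup>2"
    using sum_squares_bound[of "norm (x - \<theta>)" "norm \<theta>"] by (simp add: power2_sum)
  finally show ?thesis by simp
qed

lemma norm_diff_sq_le:
  fixes x \<theta> :: "'a::euclidean_space"
  shows "(norm (x - \<theta>))\<^sup>2 \<le> 2 * (norm x)\<^sup>2 + 2 * (norm \<theta>)\<^sup>2"
proof -
  have "(norm (x - \<theta>))\<^sup>2 \<le> (norm x + norm \<theta>)\<^sup>2"
    by (simp add: norm_triangle_ineq4 power_mono)
  also have "\<dots> \<le> 2 * (norm x)\<^sup>2 + 2 * (norm \<theta>)\<^sup>2"
    using sum_squares_bound[of "norm x" "norm \<theta>"] by (simp add: power2_sum)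
  finally show ?thesis by simp
qed

text \<open>A majorant centred at 0 and independent of \<open>v\<close>, for differentiation in the
  variance under the integral. It rests on \<open>norm_diff_sq_ge\<close>, which costs a factor 2 in
  the exponent.\<close>

lemma gauss_le_exp:
  assumes "0 < v1" "v1 \<le> v" "v \<le> v2"
  shows "gauss v \<theta> (x::'a::euclidean_space) \<le>
     (2 * pi * v1) powr (- (real DIM('a) / 2)) * exp ((norm \<theta>)\<^sup>2 / (2 * v2)) * exp (- (1 / (4 * v2)) * (norm x)\<^sup>2)"
proof -
  have 1: "(2 * pi * v) powr (- (real DIM('a) / 2)) \<le> (2 * pi * v1) powr (- (real DIM('a) / 2))"
    using assms by (intro powr_mono2') auto
  have "- (norm (x - \<theta>))\<^sup>2 / (2 * v) \<le> - (norm (x - \<theta>))\<^sup>2 / (2 * v2)"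
    using assms by (simp add: frac_le)
  also have "\<dots> \<le> - ((norm x)\<^sup>2 / 2 - (norm \<theta>)\<^sup>2) / (2 * v2)"
    using norm_diff_sq_ge[of x \<theta>] assms by (intro divide_right_mono) auto
  also have "\<dots> = (norm \<theta>)\<^sup>2 / (2 * v2) + (- (1 / (4 * v2)) * (norm x)\<^sup>2)"
    using assms by (simp add: field_simps)
  finally have "exp (- (norm (x - \<theta>))\<^sup>2 / (2 * v)) \<le> exp ((norm \<theta>)\<^sup>2 / (2 * v2)) * exp (- (1 / (4 * v2)) * (norm x)\<^sup>2)"
    by (simp add: exp_add[symmetric])
  with 1 show ?thesis unfolding gauss_def mult.assoc by (intro mult_mono) auto
qed

lemma integrable_poly_gauss:
  fixes f :: "'a::euclidean_space \<Rightarrow> real"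
  assumes v: "v > 0" and [measurable]: "f \<in> borel_measurable borel"
    and b: "\<And>x. \<bar>f x\<bar> \<le> C * (1 + (norm x)\<^sup>2) ^ k * gauss v \<theta> x"
  shows "integrable lborel f"
proof -
  let ?c = "(2 * pi * v) powr (- (real DIM('a) / 2)) * exp ((norm \<theta>)\<^sup>2 / (2 * v))"
  show ?thesis
  proof (rule Bochner_Integration.integrable_bound)
    show "integrable lborel (\<lambda>x::'a. (\<bar>C\<bar> * ?c) * ((1 + (norm x)\<^sup>2) ^ k * exp (- (1 / (4 * v)) * (norm x)\<^sup>2)))"
      using v by (intro integrable_mult_right integrable_power_exp_neg_norm) auto
    show "AE x in lborel. norm (f x) \<le> norm ((\<bar>C\<bar> * ?c) * ((1 + (norm x)\<^sup>2) ^ k * exp (- (1 / (4 * v)) * (norm x)\<^sup>2)))"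
    proof (rule AE_I2)
      fix x
      have "\<bar>f x\<bar> \<le> C * (1 + (norm x)\<^sup>2) ^ k * gauss v \<theta> x" by (rule b)
      also have "\<dots> \<le> \<bar>C\<bar> * (1 + (norm x)\<^sup>2) ^ k * gauss v \<theta> x"
        by (intro mult_right_mono) auto
      also have "\<dots> \<le> \<bar>C\<bar> * (1 + (norm x)\<^sup>2) ^ k * (?c * exp (- (1 / (4 * v)) * (norm x)\<^sup>2))"
        using gauss_le_exp[of v v v \<theta> x] v by (intro mult_left_mono) auto
      finally show "norm (f x) \<le> norm ((\<bar>C\<bar> * ?c) * ((1 + (norm x)\<^sup>2) ^ k * exp (- (1 / (4 * v)) * (norm x)\<^sup>2)))"
        by (simp add: abs_mult mult_ac)
    qed
  qed auto
qed

section \<open>Gaussian mixtures\<close>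

lemma norm_sq_eq_sum_Basis: "(norm x)\<^sup>2 = (\<Sum>b\<in>Basis. (x \<bullet> b)\<^sup>2)"
  for x :: "'a::euclidean_space"
  unfolding power2_norm_eq_inner by (subst euclidean_inner) (simp add: power2_eq_square)

text \<open>The prior as a measure of arbitrary finite positive mass, since the mass cancels from
  the predictive density. It is instantiated with the normal priors of the lower bound and with the
  hierarchical prior.\<close>

locale gauss_mixture = finite_measure M for M :: "'a::euclidean_space measure" +
  assumes sets_M [measurable_cong]: "sets M = sets borel"
    and M_nonzero: "measure M (space M) > 0"
begin

definition mix :: "real \<Rightarrow> 'a \<Rightarrow> real" where
  "mix v z = (\<integral>\<theta>. gauss v \<theta> z \<partial>M)"

text \<open>The moments that express derivatives of \<open>mix\<close> in \<open>z\<close>: the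
  derivative along \<open>e\<close> is - \<open>mix1\<close> / v, the second derivative along
  \<open>e\<close> is \<open>mix11\<close> / v^2 - \<open>mix\<close> / v, and the Laplacian is
  \<open>mix2\<close> / v^2 - n \<open>mix\<close> / v with n the dimension.\<close>

definition mix1 :: "real \<Rightarrow> 'a \<Rightarrow> 'a \<Rightarrow> real" where
  "mix1 v z e = (\<integral>\<theta>. ((z - \<theta>) \<bullet> e) * gauss v \<theta> z \<partial>M)"

definition mix11 :: "real \<Rightarrow> 'a \<Rightarrow> 'a \<Rightarrow> real" where
  "mix11 v z e = (\<integral>\<theta>. ((z - \<theta>) \<bullet> e)\<^sup>2 * gauss v \<theta> z \<partial>M)"

definition mix2 :: "real \<Rightarrow> 'a \<Rightarrow> real" where
  "mix2 v z = (\<integral>\<theta>. (norm (z - \<theta>))\<^sup>2 * gauss v \<theta> z \<partial>M)"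

text \<open>Without the normalising power of \<open>v\<close> the integrand is at most 1, so the
  logarithm of this quantity has an upper bound free of \<open>z\<close> and
  \<open>v\<close>.\<close>

definition expmix :: "real \<Rightarrow> 'a \<Rightarrow> real" where
  "expmix v z = (\<integral>\<theta>. exp (- (norm (z - \<theta>))\<^sup>2 / (2 * v)) \<partial>M)"

lemma measurable_mix [measurable]:
  "mix v \<in> borel_measurable borel" "(\<lambda>z. mix1 v z e) \<in> borel_measurable borel"
  "(\<lambda>z. mix11 v z e) \<in> borel_measurable borel" "mix2 v \<in> borel_measurable borel"
  unfolding mix_def[abs_def] mix1_def mix11_def mix2_def[abs_def] by measurable

text \<open>As the mixing measure is finite, a constant serves as dominating function for all
  integrals over \<theta>.\<close>

lemma second_moment_gauss_bounded:
  assumes "0 < v1" "v1 \<le> v2"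
  shows "\<exists>K\<ge>0. \<forall>v\<in>{v1..v2}. \<forall>z \<theta>::'a. (1 + (norm (z - \<theta>))\<^sup>2) * gauss v \<theta> z \<le> K"
proof -
  obtain K where K: "K \<ge> 0" "\<And>x::real. x \<ge> 0 \<Longrightarrow> x ^ 1 * exp (- (1 / (2 * v2)) * x) \<le> K"
    using power_exp_bounded[of "1 / (2 * v2)" 1] assms by (auto simp del: mult_minus_left)
  define C where "C = (2 * pi * v1) powr (- (real DIM('a) / 2))"
  show ?thesis
  proof (intro exI conjI ballI allI)
    show "C * (K * exp (1 / (2 * v2))) \<ge> 0" using K(1) by (simp add: C_def)
    fix v and z \<theta> :: 'a assume v: "v \<in> {v1..v2}"
    define p where "p = (norm (z - \<theta>))\<^sup>2"
    have p: "p \<ge> 0" by (simp add: p_def)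
    have "gauss v \<theta> z \<le> C * exp (- p / (2 * v2))"
      unfolding gauss_def C_def p_def using assms v
      by (intro mult_mono powr_mono2') (auto simp: frac_le)
    then have "(1 + p) * gauss v \<theta> z \<le> (1 + p) * (C * exp (- p / (2 * v2)))"
      using p by (intro mult_left_mono) auto
    also have "exp (- p / (2 * v2)) = exp (- (1 / (2 * v2)) * (1 + p)) * exp (1 / (2 * v2))"
      by (simp add: exp_add[symmetric] field_simps add_divide_distrib[symmetric])
    also have "(1 + p) * (C * (exp (- (1 / (2 * v2)) * (1 + p)) * exp (1 / (2 * v2)))) =
        C * (((1 + p) ^ 1 * exp (- (1 / (2 * v2)) * (1 + p))) * exp (1 / (2 * v2)))"
      by simp
    also have "\<dots> \<le> C * (K * exp (1 / (2 * v2)))"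
      using p by (intro mult_left_mono mult_right_mono K) (auto simp: C_def)
    finally show "(1 + (norm (z - \<theta>))\<^sup>2) * gauss v \<theta> z \<le> C * (K * exp (1 / (2 * v2)))"
      by (simp add: p_def)
  qed
qed

lemma inner_le_one_norm_sq:
  fixes x e :: 'a assumes "norm e = 1"
  shows "\<bar>x \<bullet> e\<bar> \<le> 1 + (norm x)\<^sup>2" "(x \<bullet> e)\<^sup>2 \<le> (norm x)\<^sup>2"
proof -
  have 1: "\<bar>x \<bullet> e\<bar> \<le> norm x" using Cauchy_Schwarz_ineq2[of x e] assms by simp
  also have "norm x \<le> 1 + (norm x)\<^sup>2"
    using sum_squares_bound[of 1 "norm x"] by (simp add: power2_eq_square) (smt (verit) zero_le_square)
  finally show "\<bar>x \<bullet> e\<bar> \<le> 1 + (norm x)\<^sup>2" .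
  show "(x \<bullet> e)\<^sup>2 \<le> (norm x)\<^sup>2" using 1 by (metis abs_le_square_iff abs_norm_cancel)
qed

lemma integrable_gauss_times:
  fixes f :: "'a \<Rightarrow> real"
  assumes v: "v > 0" and [measurable]: "f \<in> borel_measurable borel"
    and b: "\<And>\<theta>. \<bar>f \<theta>\<bar> \<le> c * (1 + (norm (z - \<theta>))\<^sup>2)"
  shows "integrable M (\<lambda>\<theta>. f \<theta> * gauss v \<theta> z)"
proof -
  obtain K where K: "K \<ge> 0" "\<And>\<theta>. (1 + (norm (z - \<theta>))\<^sup>2) * gauss v \<theta> z \<le> K"
    using second_moment_gauss_bounded[of v v] v by auto
  have "\<bar>f \<theta> * gauss v \<theta> z\<bar> \<le> \<bar>c\<bar> * K" for \<theta>
  proof -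
    have "\<bar>f \<theta> * gauss v \<theta> z\<bar> \<le> c * (1 + (norm (z - \<theta>))\<^sup>2) * gauss v \<theta> z"
      using b[of \<theta>] by (simp add: abs_mult mult_right_mono)
    also have "\<dots> \<le> \<bar>c\<bar> * ((1 + (norm (z - \<theta>))\<^sup>2) * gauss v \<theta> z)"
      by (simp add: mult.assoc mult_right_mono)
    also have "\<dots> \<le> \<bar>c\<bar> * K" by (intro mult_left_mono K) auto
    finally show ?thesis .
  qed
  then show ?thesis by (intro integrable_const_bound[of _ "\<bar>c\<bar> * K"]) auto
qed

lemma integrable_mix:
  assumes v: "v > 0"
  shows "integrable M (\<lambda>\<theta>. gauss v \<theta> z)"
    and "integrable M (\<lambda>\<theta>. (norm (z - \<theta>))\<^sup>2 * gauss v \<theta> z)"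
    and "norm e = 1 \<Longrightarrow> integrable M (\<lambda>\<theta>. ((z - \<theta>) \<bullet> e) * gauss v \<theta> z)"
    and "norm e = 1 \<Longrightarrow> integrable M (\<lambda>\<theta>. ((z - \<theta>) \<bullet> e)\<^sup>2 * gauss v \<theta> z)"
proof -
  show "integrable M (\<lambda>\<theta>. gauss v \<theta> z)"
    using integrable_gauss_times[OF v, of "\<lambda>_. 1" 1 z] by simp
  show "integrable M (\<lambda>\<theta>. (norm (z - \<theta>))\<^sup>2 * gauss v \<theta> z)"
    by (rule integrable_gauss_times[OF v, of _ 1]) auto
  show "integrable M (\<lambda>\<theta>. ((z - \<theta>) \<bullet> e) * gauss v \<theta> z)" if "norm e = 1"
    using inner_le_one_norm_sq[OF that] by (intro integrable_gauss_times[OF v, of _ 1]) auto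
  show "integrable M (\<lambda>\<theta>. ((z - \<theta>) \<bullet> e)\<^sup>2 * gauss v \<theta> z)" if "norm e = 1"
    using inner_le_one_norm_sq(2)[OF that]
    by (intro integrable_gauss_times[OF v, of _ 1]) (auto intro: add_increasing)
qed

lemma sum_mix11:
  assumes v: "v > 0"
  shows "(\<Sum>e\<in>Basis. mix11 v z e) = mix2 v z"
proof -
  have "(\<Sum>e\<in>Basis. mix11 v z e) = (\<integral>\<theta>. (\<Sum>e\<in>Basis. ((z - \<theta>) \<bullet> e)\<^sup>2 * gauss v \<theta> z) \<partial>M)"
    unfolding mix11_def using v by (subst Bochner_Integration.integral_sum) (auto intro: integrable_mix)
  also have "(\<lambda>\<theta>. (\<Sum>e\<in>Basis. ((z - \<theta>) \<bullet> e)\<^sup>2 * gauss v \<theta> z)) = (\<lambda>\<theta>. (norm (z - \<theta>))\<^sup>2 * gauss v \<theta> z)"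
    by (simp only: sum_distrib_right[symmetric] norm_sq_eq_sum_Basis)
  finally show ?thesis by (simp add: mix2_def)
qed

lemma mix_eq_expmix: "mix v z = (2 * pi * v) powr (- (real DIM('a) / 2)) * expmix v z"
  unfolding mix_def expmix_def gauss_def by simp

lemma integral_pos:
  assumes "integrable M f" "\<And>x. f x > (0::real)"
  shows "(\<integral>x. f x \<partial>M) > 0"
proof -
  have "(\<integral>x. f x \<partial>M) \<noteq> 0"
  proof
    assume "(\<integral>x. f x \<partial>M) = 0"
    then have "AE x in M. f x = 0"
      using assms by (subst (asm) integral_nonneg_eq_0_iff_AE) (auto intro: less_imp_le)
    moreover have "f x \<noteq> 0" for x using assms(2)[of x] by simp
    ultimately have "AE x in M. False" by simp
    then have "emeasure M (space M) = 0"
      by (simp add: eventually_False ae_filter_eq_bot_iff)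
    then show False using M_nonzero by (simp add: measure_def)
  qed
  moreover have "(\<integral>x. f x \<partial>M) \<ge> 0" using assms by (intro Bochner_Integration.integral_nonneg) (auto intro: less_imp_le)
  ultimately show ?thesis by simp
qed

lemma integrable_exp_sq: "v > 0 \<Longrightarrow> integrable M (\<lambda>\<theta>. exp (- (norm (z - \<theta>))\<^sup>2 / v))"
  by (intro integrable_const_bound[of _ 1]) auto

lemma mix_pos: "v > 0 \<Longrightarrow> mix v z > 0"
  unfolding mix_def by (intro integral_pos integrable_mix gauss_pos)

text \<open>The lower bound separates \<open>z\<close> from \<theta> by |z - \<theta>|^2 \<le> 2
  |z|^2 + 2 |\<theta>|^2. The remaining integral of exp (- |\<theta>|^2 / v1) is
  \<open>expmix\<close> at 0 with variance v1 / 2.\<close>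

lemma expmix_bounds:
  assumes "0 < v1" "v1 \<le> v"
  shows "expmix v z \<le> measure M (space M)"
    and "expmix v z \<ge> exp (- (norm z)\<^sup>2 / v1) * expmix (v1 / 2) 0" and "expmix v z > 0"
proof -
  have v: "v > 0" using assms by simp
  have int: "integrable M (\<lambda>\<theta>. exp (- (norm (z - \<theta>))\<^sup>2 / (2 * v)))"
    using integrable_exp_sq[of "2 * v" z] v by simp
  have "expmix v z \<le> (\<integral>\<theta>. 1 \<partial>M)"
    unfolding expmix_def using int v by (intro integral_mono) auto
  then show "expmix v z \<le> measure M (space M)" by simp
  show "expmix v z > 0" unfolding expmix_def using int by (intro integral_pos) auto
  have "exp (- (norm z)\<^sup>2 / v1) * expmix (v1 / 2) 0 =
      (\<integral>\<theta>. exp (- (norm z)\<^sup>2 / v1) * exp (- (norm (0 - \<theta>))\<^sup>2 / v1) \<partial>M)"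
    unfolding expmix_def by simp
  also have "\<dots> \<le> expmix v z"
    unfolding expmix_def
  proof (rule integral_mono)
    show "integrable M (\<lambda>\<theta>. exp (- (norm z)\<^sup>2 / v1) * exp (- (norm (0 - \<theta>))\<^sup>2 / v1))"
      using integrable_exp_sq[of v1 0] assms by (intro integrable_mult_right) auto
    fix \<theta>
    have "(norm (z - \<theta>))\<^sup>2 / (2 * v) \<le> (norm (z - \<theta>))\<^sup>2 / (2 * v1)"
      using assms by (intro frac_le) auto
    also have "\<dots> \<le> (2 * (norm z)\<^sup>2 + 2 * (norm \<theta>)\<^sup>2) / (2 * v1)"
      using assms norm_diff_sq_le[of z \<theta>] by (intro divide_right_mono) auto
    also have "\<dots> = (norm z)\<^sup>2 / v1 + (norm (0 - \<theta>))\<^sup>2 / v1"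
      using assms by (simp add: field_simps)
    finally show "exp (- (norm z)\<^sup>2 / v1) * exp (- (norm (0 - \<theta>))\<^sup>2 / v1) \<le> exp (- (norm (z - \<theta>))\<^sup>2 / (2 * v))"
      by (simp add: exp_add[symmetric])
  qed (fact int)
  finally show "expmix v z \<ge> exp (- (norm z)\<^sup>2 / v1) * expmix (v1 / 2) 0" .
qed

lemma ln_expmix_bounds:
  assumes "0 < v1" "v1 \<le> v"
  shows "ln (expmix v z) \<le> ln (measure M (space M))"
    and "ln (expmix v z) \<ge> ln (expmix (v1 / 2) 0) - (norm z)\<^sup>2 / v1"
proof -
  note b = expmix_bounds[OF assms, of z]
  have p: "expmix (v1 / 2) 0 > 0" using expmix_bounds(3)[of "v1/2" "v1/2"] assms by simp
  show "ln (expmix v z) \<le> ln (measure M (space M))" using b by simp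
  have "ln (exp (- (norm z)\<^sup>2 / v1) * expmix (v1 / 2) 0) \<le> ln (expmix v z)" using b p by simp
  then show "ln (expmix v z) \<ge> ln (expmix (v1 / 2) 0) - (norm z)\<^sup>2 / v1"
    using p by (simp add: ln_mult)
qed

text \<open>
  Gibbs' variational inequality for the posterior: with \<open>f = |z - \<theta>|\<^sup>2 / (2v)\<close> and \<open>exp (-L)\<close> the mean
  of \<open>exp (-f)\<close>, integrate \<open>(f - L) exp (-f) \<le> exp (-L) - exp (-f)\<close>.
\<close>

lemma mix2_le:
  assumes v: "v > 0"
  shows "mix2 v z \<le> 2 * v * (ln (measure M (space M)) - ln (expmix v z)) * mix v z"
proof -
  define f where "f \<theta> = (norm (z - \<theta>))\<^sup>2 / (2 * v)" for \<theta>
  define L where "L = ln (measure M (space M)) - ln (expmix v z)"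
  have ep: "expmix v z > 0" using expmix_bounds(3)[of v v] v by simp
  have eL: "exp (- L) = expmix v z / measure M (space M)"
    using ep M_nonzero by (simp add: L_def exp_diff)
  have fi: "integrable M (\<lambda>\<theta>. exp (- f \<theta>))" using integrable_exp_sq[of "2 * v" z] v by (simp add: f_def)
  have pp: "(2 * pi * v) powr (- (real DIM('a) / 2)) > 0" using v by simp
  have ffi: "integrable M (\<lambda>\<theta>. f \<theta> * exp (- f \<theta>))"
  proof -
    have "integrable M (\<lambda>\<theta>. (1 / (2 * v) / (2 * pi * v) powr (- (real DIM('a) / 2))) * ((norm (z - \<theta>))\<^sup>2 * gauss v \<theta> z))"
      by (intro integrable_mult_right integrable_mix v)
    then show ?thesis using pp by (simp add: gauss_def f_def)
  qed
  have "(f \<theta> - L) * exp (- f \<theta>) \<le> exp (- L) - exp (- f \<theta>)" for \<theta>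
  proof -
    have "(f \<theta> - L) * exp (- f \<theta>) \<le> (exp (f \<theta> - L) - 1) * exp (- f \<theta>)"
      using exp_ge_add_one_self[of "f \<theta> - L"] by (intro mult_right_mono) (auto simp: algebra_simps)
    also have "\<dots> = exp (- L) - exp (- f \<theta>)"
      by (simp add: left_diff_distrib exp_add[symmetric])
    finally show ?thesis .
  qed
  then have "(\<integral>\<theta>. f \<theta> * exp (- f \<theta>) - L * exp (- f \<theta>) \<partial>M) \<le> (\<integral>\<theta>. exp (- L) - exp (- f \<theta>) \<partial>M)"
    using fi ffi by (intro integral_mono) (auto simp: algebra_simps)
  then have "(\<integral>\<theta>. f \<theta> * exp (- f \<theta>) \<partial>M) - L * expmix v z \<le> exp (- L) * measure M (space M) - expmix v z"
    using fi ffi by (simp add: expmix_def f_def mult.commute)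
  then have 1: "(\<integral>\<theta>. f \<theta> * exp (- f \<theta>) \<partial>M) \<le> L * expmix v z"
    using M_nonzero by (simp add: eL)
  have "mix2 v z = (\<integral>\<theta>. (2 * v * (2 * pi * v) powr (- (real DIM('a) / 2))) * (f \<theta> * exp (- f \<theta>)) \<partial>M)"
    unfolding mix2_def gauss_def f_def using v by (intro Bochner_Integration.integral_cong) auto
  also have "\<dots> = (2 * v * (2 * pi * v) powr (- (real DIM('a) / 2))) * (\<integral>\<theta>. f \<theta> * exp (- f \<theta>) \<partial>M)"
    by simp
  also have "\<dots> \<le> (2 * v * (2 * pi * v) powr (- (real DIM('a) / 2))) * (L * expmix v z)"
    using 1 v by (intro mult_left_mono) auto
  finally show ?thesis unfolding L_def mix_eq_expmix by (simp only: mult_ac)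
qed

text \<open>The quotients are posterior moments. By \<open>mix2_le\<close> the second one is
  controlled by the logarithm of the marginal density, which grows at most quadratically in
  \<open>z\<close> by \<open>ln_expmix_bounds\<close>. This growth rate provides the integrability
  needed to differentiate the mean of \<open>ln (mix v z)\<close>.\<close>

lemma ratio_bounds:
  assumes "0 < v1" "v1 \<le> v2"
  shows "\<exists>C\<ge>0. \<forall>v\<in>{v1..v2}. \<forall>z. \<bar>ln (mix v z)\<bar> \<le> C * (1 + (norm z)\<^sup>2) \<and>
    mix2 v z / mix v z \<le> C * (1 + (norm z)\<^sup>2) \<and>
    (\<forall>e. norm e = 1 \<longrightarrow> \<bar>mix1 v z e / mix v z\<bar> \<le> C * (1 + (norm z)\<^sup>2) \<and>
      0 \<le> mix11 v z e \<and> mix11 v z e / mix v z \<le> C * (1 + (norm z)\<^sup>2))"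
proof -
  define a where "a = \<bar>ln (measure M (space M))\<bar> + \<bar>ln (expmix (v1 / 2) 0)\<bar>"
  define l where "l = \<bar>ln (2 * pi * v1)\<bar> + \<bar>ln (2 * pi * v2)\<bar>"
  \<comment> \<open>\<open>C0\<close> bounds the logarithm of the marginal density: \<open>a\<close>
    and 1 / v1 account for \<open>expmix\<close>, the last term for the normalising power. In
    \<open>C\<close>, the multiple by 2 * v2 is the factor of \<open>mix2_le\<close>, and the 1
    comes from estimating a first moment by one plus the second moment.\<close>
  define C0 where "C0 = a + 1 / v1 + real DIM('a) / 2 * l"
  define C where "C = C0 + 2 * v2 * C0 + 1"
  have nn: "a \<ge> 0" "l \<ge> 0" "C0 \<ge> 0" using assms by (auto simp: a_def l_def C0_def)
  show ?thesis
  proof (intro exI[of _ C] conjI ballI allI)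
    show "C \<ge> 0" using nn assms by (simp add: C_def)
  next
    fix v and z :: 'a assume v: "v \<in> {v1..v2}"
    then have vp: "v > 0" using assms by simp
    define s where "s = 1 + (norm z)\<^sup>2"
    have s: "s \<ge> 1" by (simp add: s_def)
    have "v1 \<le> v" using v by simp
    note lb = ln_expmix_bounds[OF assms(1) this, of z]
    have "(norm z)\<^sup>2 / v1 \<le> 1 / v1 * s" using assms by (simp add: s_def divide_right_mono)
    moreover have s1: "0 \<le> 1 / v1 * s" using s assms by simp
    ultimately have "\<bar>ln (expmix v z)\<bar> \<le> a + 1 / v1 * s \<and> ln (measure M (space M)) - ln (expmix v z) \<le> a + 1 / v1 * s"
      unfolding a_def using lb s1 by (intro conjI; linarith)
    then have ab: "\<bar>ln (expmix v z)\<bar> \<le> a + 1 / v1 * s" "ln (measure M (space M)) - ln (expmix v z) \<le> a + 1 / v1 * s"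
      by auto
    have as: "a + 1 / v1 * s \<le> (a + 1 / v1) * s"
      using mult_left_mono[OF s nn(1)] by (simp add: distrib_right)
    have ep: "expmix v z > 0" using expmix_bounds(3)[of v v] vp by simp
    have "ln (2 * pi * v1) \<le> ln (2 * pi * v)" "ln (2 * pi * v) \<le> ln (2 * pi * v2)"
      using v assms by auto
    then have l: "\<bar>ln (2 * pi * v)\<bar> \<le> l" unfolding l_def by linarith
    have "ln (mix v z) = - (real DIM('a) / 2) * ln (2 * pi * v) + ln (expmix v z)"
      using ep vp by (simp add: mix_eq_expmix ln_mult ln_powr)
    then have "\<bar>ln (mix v z)\<bar> \<le> \<bar>(real DIM('a) / 2) * ln (2 * pi * v)\<bar> + \<bar>ln (expmix v z)\<bar>"
      by (simp add: abs_triangle_ineq)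
    also have "\<bar>(real DIM('a) / 2) * ln (2 * pi * v)\<bar> \<le> real DIM('a) / 2 * l * 1"
      using l by (simp add: abs_mult mult_left_mono)
    also have "\<dots> \<le> real DIM('a) / 2 * l * s" using s nn by (intro mult_left_mono) auto
    finally have lnb: "\<bar>ln (mix v z)\<bar> \<le> C0 * s"
      using ab as by (simp add: C0_def distrib_right)
    have C0s: "(a + 1 / v1) * s \<le> C0 * s" using nn s by (simp add: C0_def mult_right_mono)
    have m: "mix v z > 0" by (rule mix_pos[OF vp])
    have "mix2 v z \<le> 2 * v * (C0 * s) * mix v z"
    proof (rule order_trans[OF mix2_le[OF vp]])
      show "2 * v * (ln (measure M (space M)) - ln (expmix v z)) * mix v z \<le> 2 * v * (C0 * s) * mix v z"
        using m vp ab(2) as C0s by (intro mult_right_mono mult_left_mono) auto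
    qed
    also have "\<dots> \<le> 2 * v2 * (C0 * s) * mix v z"
      using v nn s m by (intro mult_right_mono) auto
    finally have m2: "mix2 v z / mix v z \<le> 2 * v2 * C0 * s"
      using m by (simp add: pos_divide_le_eq mult.assoc)
    have le1: "C0 * s \<le> C * s" "2 * v2 * C0 * s \<le> C * s" "s + 2 * v2 * C0 * s \<le> C * s"
      using s nn assms unfolding C_def distrib_right by (auto simp: mult.assoc)
    show "\<bar>ln (mix v z)\<bar> \<le> C * (1 + (norm z)\<^sup>2)" using lnb le1 by (simp add: s_def)
    show "mix2 v z / mix v z \<le> C * (1 + (norm z)\<^sup>2)" using m2 le1 by (simp add: s_def)
    show "norm e = 1 \<longrightarrow> \<bar>mix1 v z e / mix v z\<bar> \<le> C * (1 + (norm z)\<^sup>2) \<and>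
      0 \<le> mix11 v z e \<and> mix11 v z e / mix v z \<le> C * (1 + (norm z)\<^sup>2)" for e
    proof (intro impI conjI)
      assume e: "norm e = 1"
      have "\<bar>mix1 v z e\<bar> \<le> (\<integral>\<theta>. \<bar>((z - \<theta>) \<bullet> e) * gauss v \<theta> z\<bar> \<partial>M)"
        unfolding mix1_def by (rule integral_abs_bound)
      also have "\<dots> \<le> (\<integral>\<theta>. gauss v \<theta> z + (norm (z - \<theta>))\<^sup>2 * gauss v \<theta> z \<partial>M)"
      proof (rule integral_mono)
        show "\<bar>(z - \<theta>) \<bullet> e * gauss v \<theta> z\<bar> \<le> gauss v \<theta> z + (norm (z - \<theta>))\<^sup>2 * gauss v \<theta> z" for \<theta>
          using mult_right_mono[OF inner_le_one_norm_sq(1)[OF e, of "z - \<theta>"], of "gauss v \<theta> z"]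
          by (simp add: abs_mult distrib_right)
      qed (auto intro!: integrable_mix Bochner_Integration.integrable_add vp integrable_abs e)
      also have "\<dots> = mix v z + mix2 v z"
        unfolding mix_def mix2_def by (intro Bochner_Integration.integral_add integrable_mix vp)
      finally have "\<bar>mix1 v z e / mix v z\<bar> \<le> 1 + mix2 v z / mix v z"
        using m by (simp add: abs_divide divide_le_eq distrib_right)
      also have "\<dots> \<le> s + 2 * v2 * C0 * s" using m2 s by simp
      finally show "\<bar>mix1 v z e / mix v z\<bar> \<le> C * (1 + (norm z)\<^sup>2)" using le1(3) by (simp add: s_def)
      show "0 \<le> mix11 v z e" unfolding mix11_def by (intro Bochner_Integration.integral_nonneg) auto
      have "mix11 v z e \<le> mix2 v z"
        unfolding mix11_def mix2_def using inner_le_one_norm_sq(2)[OF e]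
        by (intro integral_mono integrable_mix vp e mult_right_mono) auto
      then have "mix11 v z e / mix v z \<le> mix2 v z / mix v z" using m by (simp add: divide_right_mono)
      then show "mix11 v z e / mix v z \<le> C * (1 + (norm z)\<^sup>2)" using m2 le1 by (simp add: s_def)
    qed
  qed
qed

section \<open>The heat equation and the mean logarithm of the marginal density\<close>

lemma has_derivative_gauss_line:
  fixes z e :: 'a assumes v: "v > 0" and e: "norm e = 1"
  shows "((\<lambda>t. gauss v \<theta> (z + t *\<^sub>R e)) has_real_derivative
    - ((z + t *\<^sub>R e - \<theta>) \<bullet> e) / v * gauss v \<theta> (z + t *\<^sub>R e)) (at t within S)"
proof -
  have sq: "(norm (z + t *\<^sub>R e - \<theta>))\<^sup>2 = (norm (z - \<theta>))\<^sup>2 + 2 * t * ((z - \<theta>) \<bullet> e) + t\<^sup>2" for t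
    using e unfolding power2_norm_eq_inner norm_eq_1
    by (simp add: inner_simps algebra_simps power2_eq_square inner_commute)
  have i: "(z + t *\<^sub>R e - \<theta>) \<bullet> e = (z - \<theta>) \<bullet> e + t"
    using e by (simp add: inner_simps norm_eq_1)
  show ?thesis
    unfolding gauss_def sq i
    using v by (auto intro!: derivative_eq_intros simp: field_simps)
qed

lemma mix_deriv:
  assumes v: "v > 0" and e: "norm e = 1"
  shows "((\<lambda>t. mix v (z + t *\<^sub>R e)) has_real_derivative - mix1 v z e / v) (at 0)"
    and "((\<lambda>t. mix1 v (z + t *\<^sub>R e) e) has_real_derivative mix v z - mix11 v z e / v) (at 0)"
proof -
  obtain K where K: "K \<ge> 0" "\<And>\<theta> z::'a. (1 + (norm (z - \<theta>))\<^sup>2) * gauss v \<theta> z \<le> K"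
    using second_moment_gauss_bounded[of v v] v by auto
  have K1: "\<bar>x\<bar> * gauss v \<theta> z \<le> c * K" if "\<bar>x\<bar> \<le> c * (1 + (norm (z - \<theta>))\<^sup>2)" "c \<ge> 0" for x c and z \<theta> :: 'a
  proof -
    have "\<bar>x\<bar> * gauss v \<theta> z \<le> c * ((1 + (norm (z - \<theta>))\<^sup>2) * gauss v \<theta> z)"
      using mult_right_mono[OF that(1), of "gauss v \<theta> z"] by (simp add: mult.assoc)
    also have "\<dots> \<le> c * K" using that K by (intro mult_left_mono) auto
    finally show ?thesis .
  qed
  note il = inner_le_one_norm_sq[OF e]
  have "((\<lambda>t. mix v (z + t *\<^sub>R e)) has_real_derivative
      (\<integral>\<theta>. - ((z + 0 *\<^sub>R e - \<theta>) \<bullet> e) / v * gauss v \<theta> (z + 0 *\<^sub>R e) \<partial>M)) (at 0 within UNIV)"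
    unfolding mix_def
  proof (rule has_real_derivative_integral[where W = "\<lambda>_. 1 / v * K"])
    fix t \<theta>
    have "\<bar>- ((z + t *\<^sub>R e - \<theta>) \<bullet> e) / v\<bar> \<le> 1 / v * (1 + (norm (z + t *\<^sub>R e - \<theta>))\<^sup>2)"
      using il(1)[of "z + t *\<^sub>R e - \<theta>"] v by (simp add: divide_right_mono)
    from K1[OF this] v
    show "\<bar>- ((z + t *\<^sub>R e - \<theta>) \<bullet> e) / v * gauss v \<theta> (z + t *\<^sub>R e)\<bar> \<le> 1 / v * K"
      by (simp add: abs_mult)
    show "((\<lambda>t. gauss v \<theta> (z + t *\<^sub>R e)) has_real_derivative
        - ((z + t *\<^sub>R e - \<theta>) \<bullet> e) / v * gauss v \<theta> (z + t *\<^sub>R e)) (at t within UNIV)"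
      by (rule has_derivative_gauss_line[OF v e])
  qed (auto intro: integrable_mix v e)
  moreover have "(\<integral>\<theta>. - ((z + 0 *\<^sub>R e - \<theta>) \<bullet> e) / v * gauss v \<theta> (z + 0 *\<^sub>R e) \<partial>M) = - mix1 v z e / v"
    unfolding mix1_def by simp
  ultimately show "((\<lambda>t. mix v (z + t *\<^sub>R e)) has_real_derivative - mix1 v z e / v) (at 0)" by (simp only:)
  have "((\<lambda>t. mix1 v (z + t *\<^sub>R e) e) has_real_derivative
      (\<integral>\<theta>. (1 - ((z + 0 *\<^sub>R e - \<theta>) \<bullet> e)\<^sup>2 / v) * gauss v \<theta> (z + 0 *\<^sub>R e) \<partial>M)) (at 0 within UNIV)"
    unfolding mix1_def
  proof (rule has_real_derivative_integral[where W = "\<lambda>_. (1 + 1 / v) * K"])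
    fix t \<theta>
    have ee: "(z + t *\<^sub>R e - \<theta>) \<bullet> e = (z - \<theta>) \<bullet> e + t" for t
      using e by (simp add: inner_simps norm_eq_1)
    have "((\<lambda>t. (z + t *\<^sub>R e - \<theta>) \<bullet> e) has_real_derivative 1) (at t)"
      unfolding ee by (auto intro!: derivative_eq_intros)
    from DERIV_mult[OF this has_derivative_gauss_line[OF v e, of \<theta> z t UNIV]]
    show "((\<lambda>t. (z + t *\<^sub>R e - \<theta>) \<bullet> e * gauss v \<theta> (z + t *\<^sub>R e)) has_real_derivative
        (1 - ((z + t *\<^sub>R e - \<theta>) \<bullet> e)\<^sup>2 / v) * gauss v \<theta> (z + t *\<^sub>R e)) (at t)"
      by (rule DERIV_cong) (simp add: field_simps power2_eq_square v less_imp_neq[OF v, symmetric])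
    define p where "p = (norm (z + t *\<^sub>R e - \<theta>))\<^sup>2"
    have "((z + t *\<^sub>R e - \<theta>) \<bullet> e)\<^sup>2 / v \<le> p / v"
      using il(2)[of "z + t *\<^sub>R e - \<theta>"] v by (simp add: divide_right_mono p_def)
    moreover have "0 \<le> ((z + t *\<^sub>R e - \<theta>) \<bullet> e)\<^sup>2 / v" "p \<ge> 0" "p / v \<ge> 0" "1 / v \<ge> 0" using v by (auto simp: p_def)
    moreover have "(1 + 1 / v) * (1 + p) = 1 + p + 1 / v + p / v" by (simp add: algebra_simps add_divide_distrib)
    ultimately have "\<bar>1 - ((z + t *\<^sub>R e - \<theta>) \<bullet> e)\<^sup>2 / v\<bar> \<le> (1 + 1 / v) * (1 + p)"
      by linarith
    from K1[OF this[unfolded p_def]] v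
    show "\<bar>(1 - ((z + t *\<^sub>R e - \<theta>) \<bullet> e)\<^sup>2 / v) * gauss v \<theta> (z + t *\<^sub>R e)\<bar> \<le> (1 + 1 / v) * K"
      by (simp add: abs_mult)
  qed (auto intro: integrable_mix v e)
  moreover have "(\<integral>\<theta>. (1 - ((z + 0 *\<^sub>R e - \<theta>) \<bullet> e)\<^sup>2 / v) * gauss v \<theta> (z + 0 *\<^sub>R e) \<partial>M)
      = (\<integral>\<theta>. gauss v \<theta> z - (1 / v) * (((z - \<theta>) \<bullet> e)\<^sup>2 * gauss v \<theta> z) \<partial>M)"
    by (intro Bochner_Integration.integral_cong) (auto simp: algebra_simps)
  moreover have "\<dots> = mix v z - (1 / v) * mix11 v z e"
    unfolding mix_def mix11_def
    by (subst Bochner_Integration.integral_diff) (auto intro!: integrable_mix v e)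
  ultimately show "((\<lambda>t. mix1 v (z + t *\<^sub>R e) e) has_real_derivative mix v z - mix11 v z e / v) (at 0)"
    by simp
qed

text \<open>The heat equation: the right-hand side is half the Laplacian in
  \<open>z\<close>.\<close>

lemma has_derivative_gauss_variance:
  fixes z \<theta> :: 'a assumes v: "v > 0"
  shows "((\<lambda>v. gauss v \<theta> z) has_real_derivative
    ((norm (z - \<theta>))\<^sup>2 / v\<^sup>2 - real DIM('a) / v) / 2 * gauss v \<theta> z) (at v within S)"
proof -
  have "((\<lambda>v. (2 * pi * v) powr c) has_real_derivative c / v * (2 * pi * v) powr c) (at v within S)" for c
    using v by (auto intro!: derivative_eq_intros simp: powr_diff)
  note 1 = this[of "- (real DIM('a) / 2)"]
  have 2: "((\<lambda>v. exp (- (norm (z - \<theta>))\<^sup>2 / (2 * v))) has_real_derivative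
     (norm (z - \<theta>))\<^sup>2 / v\<^sup>2 / 2 * exp (- (norm (z - \<theta>))\<^sup>2 / (2 * v))) (at v within S)"
    using v by (auto intro!: derivative_eq_intros simp: field_simps power2_eq_square)
  show ?thesis
    unfolding gauss_def
    using DERIV_mult[OF 1 2] by (simp add: algebra_simps diff_divide_distrib)
qed

lemma mix_deriv_variance:
  assumes v1: "0 < v1" and v: "v \<in> {v1..v2}"
  shows "((\<lambda>v. mix v z) has_real_derivative (mix2 v z / v\<^sup>2 - real DIM('a) / v * mix v z) / 2)
    (at v within {v1..v2})"
proof -
  have v12: "v1 \<le> v2" "v > 0" using v v1 by auto
  obtain K where K: "K \<ge> 0" "\<And>v \<theta> z::'a. v \<in> {v1..v2} \<Longrightarrow> (1 + (norm (z - \<theta>))\<^sup>2) * gauss v \<theta> z \<le> K"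
    using second_moment_gauss_bounded[of v1 v2] v1 v12 by auto
  define c where "c = (1 / v1\<^sup>2 + real DIM('a) / v1) / 2"
  have c: "c \<ge> 0" using v1 by (simp add: c_def)
  have "((\<lambda>v. mix v z) has_real_derivative
      (\<integral>\<theta>. ((norm (z - \<theta>))\<^sup>2 / v\<^sup>2 - real DIM('a) / v) / 2 * gauss v \<theta> z \<partial>M)) (at v within {v1..v2})"
    unfolding mix_def
  proof (rule has_real_derivative_integral[where W = "\<lambda>_. c * K"])
    fix w \<theta> assume w: "w \<in> {v1..v2}"
    then have wp: "w > 0" using v1 by simp
    then show "((\<lambda>v. gauss v \<theta> z) has_real_derivative
        ((norm (z - \<theta>))\<^sup>2 / w\<^sup>2 - real DIM('a) / w) / 2 * gauss w \<theta> z) (at w within {v1..v2})"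
      by (rule has_derivative_gauss_variance)
    define p where "p = (norm (z - \<theta>))\<^sup>2"
    have p: "p \<ge> 0" by (simp add: p_def)
    have "p / w\<^sup>2 \<le> p / v1\<^sup>2" "real DIM('a) / w \<le> real DIM('a) / v1"
      using w v1 p by (auto intro!: frac_le power_mono)
    moreover have "0 \<le> p / w\<^sup>2" "0 \<le> real DIM('a) / w" "0 \<le> real DIM('a) / v1 * p" "0 \<le> 1 / v1\<^sup>2"
      using p wp v1 by auto
    moreover have "c * (1 + p) = (1 / v1\<^sup>2 + real DIM('a) / v1 + p / v1\<^sup>2 + real DIM('a) / v1 * p) / 2"
      by (simp add: c_def algebra_simps add_divide_distrib)
    moreover have "\<bar>(x - y) / 2\<bar> \<le> (i + y1 + x1 + j) / 2"
      if "x \<le> x1" "y \<le> y1" "0 \<le> x" "0 \<le> y" "0 \<le> j" "0 \<le> i" for x x1 y y1 i j :: real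
      using that by (simp add: abs_le_iff)
    ultimately have "\<bar>(p / w\<^sup>2 - real DIM('a) / w) / 2\<bar> \<le> c * (1 + p)"
      by metis
    then have "\<bar>(p / w\<^sup>2 - real DIM('a) / w) / 2\<bar> * gauss w \<theta> z \<le> c * (1 + p) * gauss w \<theta> z"
      by (rule mult_right_mono) simp
    also have "\<dots> \<le> c * K"
      using K(2)[OF w, of z \<theta>] c by (simp add: mult.assoc mult_left_mono p_def)
    finally show "\<bar>((norm (z - \<theta>))\<^sup>2 / w\<^sup>2 - real DIM('a) / w) / 2 * gauss w \<theta> z\<bar> \<le> c * K"
      by (simp add: abs_mult p_def)
  qed (use v v1 in \<open>auto intro: integrable_mix\<close>)
  also have "(\<integral>\<theta>. ((norm (z - \<theta>))\<^sup>2 / v\<^sup>2 - real DIM('a) / v) / 2 * gauss v \<theta> z \<partial>M) =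
     (\<integral>\<theta>. (1 / v\<^sup>2 / 2) * ((norm (z - \<theta>))\<^sup>2 * gauss v \<theta> z) - (real DIM('a) / v / 2) * gauss v \<theta> z \<partial>M)"
    by (intro Bochner_Integration.integral_cong) (auto simp: algebra_simps diff_divide_distrib)
  also have "\<dots> = (1 / v\<^sup>2 / 2) * mix2 v z - (real DIM('a) / v / 2) * mix v z"
    unfolding mix_def mix2_def
    by (subst Bochner_Integration.integral_diff) (auto intro!: integrable_mix v12)
  finally show ?thesis by (simp add: diff_divide_distrib)
qed

definition mean_ln_mix :: "'a \<Rightarrow> real \<Rightarrow> real" where
  "mean_ln_mix \<theta> v = (\<integral>z. gauss v \<theta> z * ln (mix v z) \<partial>lborel)"

lemma integrable_gauss_ln_mix:
  assumes v: "v > 0"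
  shows "integrable lborel (\<lambda>z. gauss v \<theta> z * ln (mix v z))"
proof -
  obtain C where C: "C \<ge> 0" "\<And>z. \<bar>ln (mix v z)\<bar> \<le> C * (1 + (norm z)\<^sup>2)"
    using ratio_bounds[of v v] v by auto
  show ?thesis
  proof (rule integrable_poly_gauss[OF v, of _ C 1 \<theta>])
    show "\<bar>gauss v \<theta> z * ln (mix v z)\<bar> \<le> C * (1 + (norm z)\<^sup>2) ^ 1 * gauss v \<theta> z" for z
      using mult_right_mono[OF C(2)[of z], of "gauss v \<theta> z"] by (simp add: abs_mult mult.commute)
  qed measurable
qed

text \<open>Integrate by parts the field with components \<open>\<partial>\<^sub>eG \<cdot> ln m - G \<cdot> \<partial>\<^sub>e(ln m)\<close>.\<close>

lemma gauss_laplacian_ln_mix: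
  assumes v: "v > 0" and e: "norm e = 1"
  shows "integrable lborel (\<lambda>z. gauss v \<theta> z * ((((z - \<theta>) \<bullet> e)\<^sup>2 / v\<^sup>2 - 1 / v) * ln (mix v z)
      - (mix11 v z e / mix v z / v\<^sup>2 - 1 / v - (mix1 v z e / mix v z)\<^sup>2 / v\<^sup>2)))" (is "integrable _ ?g'")
    and "(\<integral>z. gauss v \<theta> z * ((((z - \<theta>) \<bullet> e)\<^sup>2 / v\<^sup>2 - 1 / v) * ln (mix v z)
      - (mix11 v z e / mix v z / v\<^sup>2 - 1 / v - (mix1 v z e / mix v z)\<^sup>2 / v\<^sup>2)) \<partial>lborel) = 0"
proof -
  obtain C where C: "C \<ge> 0" "\<And>z. \<bar>ln (mix v z)\<bar> \<le> C * (1 + (norm z)\<^sup>2)"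
     "\<And>z. \<bar>mix1 v z e / mix v z\<bar> \<le> C * (1 + (norm z)\<^sup>2)"
     "\<And>z. 0 \<le> mix11 v z e" "\<And>z. mix11 v z e / mix v z \<le> C * (1 + (norm z)\<^sup>2)"
    using ratio_bounds[of v v] v e by auto
  define g where "g z = gauss v \<theta> z * (- ((z - \<theta>) \<bullet> e) / v * ln (mix v z) + mix1 v z e / mix v z / v)" for z
  define D where "D = 2 + 2 * (norm \<theta>)\<^sup>2"
  have il: "\<bar>(z - \<theta>) \<bullet> e\<bar> \<le> D * (1 + (norm z)\<^sup>2) \<and> ((z - \<theta>) \<bullet> e)\<^sup>2 \<le> D * (1 + (norm z)\<^sup>2)" for z
  proof -
    have "1 + (norm (z - \<theta>))\<^sup>2 \<le> D * (1 + (norm z)\<^sup>2)"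
      using norm_diff_sq_le[of z \<theta>] by (simp add: D_def algebra_simps) (smt (verit) mult_nonneg_nonneg zero_le_power2)
    then show ?thesis using inner_le_one_norm_sq[OF e, of "z - \<theta>"] by linarith
  qed
  have D: "D \<ge> 1" by (simp add: D_def)
  have G: "\<And>z. gauss v \<theta> z \<ge> 0" by simp
  have mp: "mix v z > 0" for z by (rule mix_pos[OF v])
  have int_g: "integrable lborel g"
  proof (rule integrable_poly_gauss[OF v, of _ "D / v * C + C / v" 2 \<theta>])
    fix z :: 'a
    define s where "s = 1 + (norm z)\<^sup>2"
    have s: "s \<ge> 1" by (simp add: s_def)
    have "\<bar>- ((z - \<theta>) \<bullet> e) / v * ln (mix v z)\<bar> \<le> (D * s / v) * (C * s)"
      unfolding abs_mult using il[of z] C(2)[of z] v D s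
      by (intro mult_mono) (auto simp: s_def abs_divide divide_right_mono)
    moreover have "\<bar>mix1 v z e / mix v z / v\<bar> \<le> C * s / v"
      using divide_right_mono[OF C(3)[of z], of v] v by (simp only: abs_divide[of _ v] abs_of_pos s_def)
    moreover have "C * s / v \<le> C * s\<^sup>2 / v"
      using s C(1) v by (intro divide_right_mono mult_left_mono) (auto simp: power2_eq_square)
    ultimately have "\<bar>- ((z - \<theta>) \<bullet> e) / v * ln (mix v z) + mix1 v z e / mix v z / v\<bar> \<le> (D * s / v) * (C * s) + C * s\<^sup>2 / v"
      by linarith
    also have "\<dots> = (D / v * C + C / v) * s\<^sup>2" by (simp add: power2_eq_square algebra_simps)
    finally show "\<bar>g z\<bar> \<le> (D / v * C + C / v) * (1 + (norm z)\<^sup>2) ^ 2 * gauss v \<theta> z"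
      unfolding g_def abs_mult s_def by (subst mult.commute) (simp add: mult_right_mono)
  next
    show "g \<in> borel_measurable borel" unfolding g_def by measurable
  qed
  show int_g': "integrable lborel ?g'"
  proof (rule integrable_poly_gauss[OF v, of _ "(D / v\<^sup>2 + 1 / v) * C + C / v\<^sup>2 + 1 / v + C\<^sup>2 / v\<^sup>2" 2 \<theta>])
    fix z :: 'a
    define s where "s = 1 + (norm z)\<^sup>2"
    have s: "s \<ge> 1" "s \<le> s\<^sup>2" "1 \<le> s\<^sup>2" by (auto simp: s_def self_le_power one_le_power)
    define X where "X = (((z - \<theta>) \<bullet> e)\<^sup>2 / v\<^sup>2 - 1 / v) * ln (mix v z)"
    define Y where "Y = mix11 v z e / mix v z / v\<^sup>2"
    define Z where "Z = (mix1 v z e / mix v z)\<^sup>2 / v\<^sup>2"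
    have "((z - \<theta>) \<bullet> e)\<^sup>2 / v\<^sup>2 \<le> D * s / v\<^sup>2" "0 \<le> ((z - \<theta>) \<bullet> e)\<^sup>2 / v\<^sup>2" "1 / v \<le> s / v" "0 \<le> 1 / v" "0 \<le> D * s / v\<^sup>2"
      using il[of z] v s D by (auto simp: s_def divide_right_mono)
    then have "\<bar>((z - \<theta>) \<bullet> e)\<^sup>2 / v\<^sup>2 - 1 / v\<bar> \<le> D * s / v\<^sup>2 + s / v" by linarith
    then have "\<bar>X\<bar> \<le> (D * s / v\<^sup>2 + s / v) * (C * s)"
      unfolding X_def abs_mult using C(2)[of z] v D s
      by (intro mult_mono) (auto simp: s_def)
    also have "\<dots> = (D / v\<^sup>2 + 1 / v) * C * s\<^sup>2" by (simp add: algebra_simps power2_eq_square)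
    finally have X: "\<bar>X\<bar> \<le> (D / v\<^sup>2 + 1 / v) * C * s\<^sup>2" .
    have "Y \<le> C * s / v\<^sup>2"
      unfolding Y_def s_def by (intro divide_right_mono C) simp
    moreover have "0 \<le> Y" using C(4)[of z] v mp[of z] by (auto simp: Y_def)
    moreover have "C * s / v\<^sup>2 \<le> C * s\<^sup>2 / v\<^sup>2" using s C(1) v by (intro divide_right_mono mult_left_mono) auto
    ultimately have Y: "\<bar>Y\<bar> \<le> C / v\<^sup>2 * s\<^sup>2" by simp
    have "(mix1 v z e / mix v z)\<^sup>2 \<le> (C * s)\<^sup>2" using C(3)[of z] by (metis abs_ge_zero power2_abs power_mono s_def)
    then have "Z \<le> (C * s)\<^sup>2 / v\<^sup>2" "0 \<le> Z" by (auto simp: Z_def divide_right_mono)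
    then have Z: "\<bar>Z\<bar> \<le> C\<^sup>2 / v\<^sup>2 * s\<^sup>2" by (simp add: power_mult_distrib)
    have O: "1 / v \<le> 1 / v * s\<^sup>2" "0 \<le> 1 / v" using v s by (auto simp: divide_right_mono)
    have "\<bar>X - (Y - 1 / v - Z)\<bar> \<le> (D / v\<^sup>2 + 1 / v) * C * s\<^sup>2 + C / v\<^sup>2 * s\<^sup>2 + 1 / v * s\<^sup>2 + C\<^sup>2 / v\<^sup>2 * s\<^sup>2"
      using X Y Z O by linarith
    also have "\<dots> = ((D / v\<^sup>2 + 1 / v) * C + C / v\<^sup>2 + 1 / v + C\<^sup>2 / v\<^sup>2) * s\<^sup>2" by (simp only: distrib_right)
    finally show "\<bar>?g' z\<bar> \<le> ((D / v\<^sup>2 + 1 / v) * C + C / v\<^sup>2 + 1 / v + C\<^sup>2 / v\<^sup>2) * (1 + (norm z)\<^sup>2) ^ 2 * gauss v \<theta> z"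
      unfolding X_def[symmetric] Y_def[symmetric] Z_def[symmetric] abs_mult s_def
      by (subst mult.commute) (simp add: mult_right_mono)
  qed measurable
  show "(\<integral>z. ?g' z \<partial>lborel) = 0"
  proof (rule integral_directional_derivative_lborel[OF int_g int_g'])
    fix z
    have ee: "(z + t *\<^sub>R e - \<theta>) \<bullet> e = (z - \<theta>) \<bullet> e + t" for t
      using e by (simp add: inner_simps norm_eq_1)
    have d0: "((\<lambda>t. (z + t *\<^sub>R e - \<theta>) \<bullet> e) has_real_derivative 1) (at 0)"
      unfolding ee by (auto intro!: derivative_eq_intros)
    have d1: "((\<lambda>t. gauss v \<theta> (z + t *\<^sub>R e)) has_real_derivative - ((z - \<theta>) \<bullet> e) / v * gauss v \<theta> z) (at 0)"
      using has_derivative_gauss_line[OF v e, of \<theta> z 0 UNIV] by simp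
    have d2: "((\<lambda>t. ln (mix v (z + t *\<^sub>R e))) has_real_derivative (- mix1 v z e / v) / mix v z) (at 0)"
      using mix_deriv(1)[OF v e, of z] mp[of z] by (auto intro!: derivative_eq_intros simp: divide_inverse)
    have d3: "((\<lambda>t. mix1 v (z + t *\<^sub>R e) e / mix v (z + t *\<^sub>R e)) has_real_derivative
       ((mix v z - mix11 v z e / v) * mix v z - mix1 v z e * (- mix1 v z e / v)) / (mix v z * mix v z)) (at 0)"
      using DERIV_divide[OF mix_deriv(2)[OF v e, of z] mix_deriv(1)[OF v e, of z]] mp[of z] by simp
    show "((\<lambda>t. g (z + t *\<^sub>R e)) has_real_derivative ?g' z) (at 0)"
      unfolding g_def
      apply (rule DERIV_cong)
       apply (rule DERIV_mult[OF d1 DERIV_add[OF DERIV_mult[OF DERIV_cdivide[OF DERIV_minus[OF d0]] d2] DERIV_cdivide[OF d3]]])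
      using mp[of z] v
      by (simp add: field_simps power2_eq_square)
  qed
qed

text \<open>The Gaussian density and the mixture m both solve the heat equation. Subtracting half of
  the vanishing integrals of \<open>gauss_laplacian_ln_mix\<close>, summed over the basis, moves the
  Laplacian from the Gaussian density to ln m. The integrand then becomes the Gaussian density times
  (2 m \<Delta>m - |\<nabla>m|^2) / (2 m^2), which is pointwise nonpositive under the stated
  condition.\<close>

lemma mean_ln_mix_deriv:
  assumes v1: "0 < v1" and v: "v \<in> {v1..v2}"
  shows "\<exists>d. (mean_ln_mix \<theta> has_real_derivative d) (at v within {v1..v2}) \<and>
    ((\<forall>z. 2 * mix v z * (mix2 v z - real DIM('a) * v * mix v z) \<le> (\<Sum>e\<in>Basis. (mix1 v z e)\<^sup>2)) \<longrightarrow> d \<le> 0)"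
proof -
  have v12: "v1 \<le> v2" "v > 0" using v v1 by auto
  obtain C where C: "C \<ge> 0" "\<And>v z. v \<in> {v1..v2} \<Longrightarrow> \<bar>ln (mix v z)\<bar> \<le> C * (1 + (norm z)\<^sup>2)"
     "\<And>v z. v \<in> {v1..v2} \<Longrightarrow> mix2 v z / mix v z \<le> C * (1 + (norm z)\<^sup>2)"
    using ratio_bounds[of v1 v2] v1 v12 by auto
  define n where "n = real DIM('a)"
  define f' where "f' v z = gauss v \<theta> z * (((norm (z - \<theta>))\<^sup>2 / v\<^sup>2 - n / v) / 2 * ln (mix v z)
     + (mix2 v z / mix v z / v\<^sup>2 - n / v) / 2)" for v z
  define K where "K = (2 * pi * v1) powr (- (n / 2)) * exp ((norm \<theta>)\<^sup>2 / (2 * v2))"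
  define D where "D = 2 + 2 * (norm \<theta>)\<^sup>2"
  define E where "E = ((D / v1\<^sup>2 + n / v1) * C + (C / v1\<^sup>2 + n / v1))"
  have n: "n \<ge> 0" and D: "D \<ge> 0" and E: "E \<ge> 0" using C(1) v1 by (auto simp: n_def D_def E_def)
  have f'b: "\<bar>f' v z\<bar> \<le> E * (1 + (norm z)\<^sup>2)\<^sup>2 * gauss v \<theta> z" if v: "v \<in> {v1..v2}" for v and z :: 'a
  proof -
    define s where "s = 1 + (norm z)\<^sup>2"
    have s: "s \<ge> 1" "s \<le> s\<^sup>2" "1 \<le> s\<^sup>2" by (auto simp: s_def self_le_power one_le_power)
    have vp: "v > 0" "v1 \<le> v" using v v1 by auto
    have "(norm (z - \<theta>))\<^sup>2 \<le> D * s"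
      using norm_diff_sq_le[of z \<theta>] by (simp add: D_def s_def algebra_simps) (smt (verit) mult_nonneg_nonneg zero_le_power2)
    then have "(norm (z - \<theta>))\<^sup>2 / v\<^sup>2 \<le> D * s / v1\<^sup>2"
      using vp v1 D s by (intro frac_le power_mono) auto
    moreover have "n / v \<le> n / v1" using n vp v1 by (intro frac_le) auto
    moreover have "n / v1 \<le> n / v1 * s" using n v1 s by (simp add: mult_left_mono[of 1 s "n / v1", simplified])
    moreover have "0 \<le> (norm (z - \<theta>))\<^sup>2 / v\<^sup>2" "0 \<le> n / v" using n vp by auto
    moreover have abs_half_le: "\<bar>(x - y) / 2\<bar> \<le> x1 + y1" if "x \<le> x1" "y \<le> y1" "0 \<le> x" "0 \<le> y" for x x1 y y1 :: real
      using that by (simp add: abs_le_iff)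
    ultimately have 0: "n / v \<le> n / v1 * s" "0 \<le> n / v" by auto
    have 1: "\<bar>((norm (z - \<theta>))\<^sup>2 / v\<^sup>2 - n / v) / 2\<bar> \<le> (D / v1\<^sup>2 + n / v1) * s"
      using abs_half_le[OF \<open>(norm (z - \<theta>))\<^sup>2 / v\<^sup>2 \<le> D * s / v1\<^sup>2\<close> 0(1) _ 0(2)]
      by (simp add: distrib_right)
    have "\<bar>((norm (z - \<theta>))\<^sup>2 / v\<^sup>2 - n / v) / 2 * ln (mix v z)\<bar> \<le> ((D / v1\<^sup>2 + n / v1) * s) * (C * s)"
      unfolding abs_mult using 1 C(2)[OF v, of z] n D v1 s by (intro mult_mono) (auto simp: s_def)
    also have "\<dots> = ((D / v1\<^sup>2 + n / v1) * C) * s\<^sup>2" by (simp add: power2_eq_square)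
    finally have X: "\<bar>((norm (z - \<theta>))\<^sup>2 / v\<^sup>2 - n / v) / 2 * ln (mix v z)\<bar> \<le> ((D / v1\<^sup>2 + n / v1) * C) * s\<^sup>2" .
    have "mix2 v z / mix v z \<ge> 0"
      unfolding mix2_def using mix_pos[OF vp(1), of z] by (intro divide_nonneg_pos Bochner_Integration.integral_nonneg) auto
    then have mix2_nn: "0 \<le> mix2 v z / mix v z / v\<^sup>2" by (rule divide_nonneg_nonneg) simp
    have mix2_le: "mix2 v z / mix v z / v\<^sup>2 \<le> C * s / v1\<^sup>2"
      using C(3)[OF v, of z] C(1) vp v1 s by (intro frac_le power_mono) (auto simp: s_def)
    have "\<bar>(mix2 v z / mix v z / v\<^sup>2 - n / v) / 2\<bar> \<le> (C / v1\<^sup>2 + n / v1) * s"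
      using abs_half_le[OF mix2_le 0(1) mix2_nn 0(2)] by (simp add: distrib_right)
    also have "\<dots> \<le> (C / v1\<^sup>2 + n / v1) * s\<^sup>2"
      using C(1) n v1 s by (intro mult_left_mono) auto
    finally have "\<bar>((norm (z - \<theta>))\<^sup>2 / v\<^sup>2 - n / v) / 2 * ln (mix v z) + (mix2 v z / mix v z / v\<^sup>2 - n / v) / 2\<bar> \<le> E * s\<^sup>2"
      using X unfolding E_def distrib_right[of _ _ "s\<^sup>2"] by linarith
    from mult_left_mono[OF this, of "gauss v \<theta> z"] show ?thesis
      by (simp add: f'_def abs_mult s_def mult_ac)
  qed
  have der: "(mean_ln_mix \<theta> has_real_derivative (\<integral>z. f' v z \<partial>lborel)) (at v within {v1..v2})"
    unfolding mean_ln_mix_def[abs_def]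
  proof (rule has_real_derivative_integral[where W = "\<lambda>z. E * K * ((1 + (norm z)\<^sup>2) ^ 2 * exp (- (1 / (4 * v2)) * (norm z)\<^sup>2))"])
    show "integrable lborel (\<lambda>z::'a. E * K * ((1 + (norm z)\<^sup>2) ^ 2 * exp (- (1 / (4 * v2)) * (norm z)\<^sup>2)))"
      using v1 v12 by (intro integrable_mult_right integrable_power_exp_neg_norm) auto
    show "f' v \<in> borel_measurable lborel" unfolding f'_def by measurable
    fix w z assume w: "w \<in> {v1..v2}"
    then have wp: "w > 0" using v1 by simp
    show "((\<lambda>v. gauss v \<theta> z * ln (mix v z)) has_real_derivative f' w z) (at w within {v1..v2})"
      unfolding f'_def n_def
      apply (rule DERIV_cong)
       apply (rule DERIV_mult[OF has_derivative_gauss_variance[OF wp] DERIV_ln_divide[THEN DERIV_chain2, OF mix_pos[OF wp] mix_deriv_variance[OF v1 w]]])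
      using mix_pos[OF wp, of z] by (simp add: field_simps)
    have "\<bar>f' w z\<bar> \<le> E * (1 + (norm z)\<^sup>2)\<^sup>2 * gauss w \<theta> z" by (rule f'b[OF w])
    also have "\<dots> \<le> E * (1 + (norm z)\<^sup>2)\<^sup>2 * (K * exp (- (1 / (4 * v2)) * (norm z)\<^sup>2))"
      using gauss_le_exp[of v1 w v2 \<theta> z] v1 w E by (intro mult_left_mono) (auto simp: K_def n_def)
    finally show "\<bar>f' w z\<bar> \<le> E * K * ((1 + (norm z)\<^sup>2) ^ 2 * exp (- (1 / (4 * v2)) * (norm z)\<^sup>2))"
      by (simp add: mult_ac)
  qed (use v v1 in \<open>auto intro: integrable_gauss_ln_mix\<close>)
  have d_le: "(\<integral>z. f' v z \<partial>lborel) \<le> 0"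
    if cond: "\<And>z. 2 * mix v z * (mix2 v z - n * v * mix v z) \<le> (\<Sum>e\<in>Basis. (mix1 v z e)\<^sup>2)"
  proof -
    let ?h = "\<lambda>e z. gauss v \<theta> z * ((((z - \<theta>) \<bullet> e)\<^sup>2 / v\<^sup>2 - 1 / v) * ln (mix v z)
      - (mix11 v z e / mix v z / v\<^sup>2 - 1 / v - (mix1 v z e / mix v z)\<^sup>2 / v\<^sup>2))"
    have [measurable]: "f' v \<in> borel_measurable borel" unfolding f'_def by measurable
    have int_f': "integrable lborel (f' v)"
      by (rule integrable_poly_gauss[OF v12(2) _ f'b[OF v]]) measurable
    have int_h: "integrable lborel (\<lambda>z. \<Sum>e\<in>Basis. ?h e z)"
      using gauss_laplacian_ln_mix(1)[OF v12(2)] by (intro Bochner_Integration.integrable_sum) auto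
    have h0: "(\<integral>z. (\<Sum>e\<in>Basis. ?h e z) \<partial>lborel) = 0"
      using gauss_laplacian_ln_mix[OF v12(2)] by (subst Bochner_Integration.integral_sum) auto
    have "f' v z - (1 / 2) * (\<Sum>e\<in>Basis. ?h e z) \<le> 0" for z
    proof -
      have m: "mix v z > 0" by (rule mix_pos[OF v12(2)])
      have "(norm (z - \<theta>))\<^sup>2 = (\<Sum>e\<in>Basis. ((z - \<theta>) \<bullet> e)\<^sup>2)"
        by (rule norm_sq_eq_sum_Basis)
      moreover have "(\<Sum>e\<in>Basis. mix11 v z e / mix v z / v\<^sup>2) = mix2 v z / mix v z / v\<^sup>2"
        by (simp add: sum_divide_distrib[symmetric] sum_mix11[OF v12(2)])
      ultimately have "(\<Sum>e\<in>Basis. ?h e z) = gauss v \<theta> z * (((norm (z - \<theta>))\<^sup>2 / v\<^sup>2 - n / v) * ln (mix v z)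
         - (mix2 v z / mix v z / v\<^sup>2 - n / v - (\<Sum>e\<in>Basis. (mix1 v z e)\<^sup>2) / (mix v z)\<^sup>2 / v\<^sup>2))"
        by (simp add: sum_distrib_left[symmetric] sum_subtractf sum_distrib_right[symmetric] n_def
          sum_divide_distrib power_divide)
      then have "f' v z - (1 / 2) * (\<Sum>e\<in>Basis. ?h e z) = (gauss v \<theta> z / (2 * v\<^sup>2 * (mix v z)\<^sup>2)) *
          (2 * mix v z * (mix2 v z - n * v * mix v z) - (\<Sum>e\<in>Basis. (mix1 v z e)\<^sup>2))"
        using m v12 unfolding f'_def by (simp add: field_simps power2_eq_square)
      also have "\<dots> \<le> 0" using cond[of z] by (intro mult_nonneg_nonpos) auto
      finally show ?thesis .
    qed
    then have "(\<integral>z. f' v z - (1 / 2) * (\<Sum>e\<in>Basis. ?h e z) \<partial>lborel) \<le> (\<integral>z. 0 * norm (z::'a) \<partial>lborel)"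
      by (intro Bochner_Integration.integral_mono Bochner_Integration.integrable_diff
        integrable_mult_right int_f' int_h) auto
    then show ?thesis
      using Bochner_Integration.integral_diff[OF int_f' integrable_mult_right[OF int_h, of "1/2"]] h0 by simp
  qed
  show ?thesis using der d_le unfolding n_def by blast
qed

lemma mean_ln_mix_antimono:
  assumes v1: "0 < v1" "v1 \<le> v2"
    and cond: "\<And>v z. v1 \<le> v \<Longrightarrow> v \<le> v2 \<Longrightarrow>
      2 * mix v z * (mix2 v z - real DIM('a) * v * mix v z) \<le> (\<Sum>e\<in>Basis. (mix1 v z e)\<^sup>2)"
  shows "mean_ln_mix \<theta> v2 \<le> mean_ln_mix \<theta> v1"
proof (rule DERIV_nonpos_imp_decreasing_open[OF v1(2)])
  fix v assume v: "v1 < v" "v < v2"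
  then obtain d where "(mean_ln_mix \<theta> has_real_derivative d) (at v within {v1..v2})" "d \<le> 0"
    using mean_ln_mix_deriv[of v1 v v2 \<theta>] v1 cond[of v] by auto
  then show "\<exists>y. (mean_ln_mix \<theta> has_real_derivative y) (at v) \<and> y \<le> 0"
    using v at_within_interior[of v "{v1..v2}"] by (auto simp: interior_atLeastAtMost_real)
next
  show "continuous_on {v1..v2} (mean_ln_mix \<theta>)"
    using mean_ln_mix_deriv[OF v1(1)] DERIV_continuous
    by (auto simp: continuous_on_eq_continuous_within) blast
qed

end

section \<open>Kullback-Leibler risk of Bayesian predictive densities\<close>

lemma kl_nonneg:
  fixes p h :: real assumes "p > 0" "h > 0"
  shows "0 \<le> p * ln (p / h) - p + h" and "p * ln (p / h) - p + h = 0 \<Longrightarrow> p = h"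
proof -
  have e: "p * ln (p / h) - p + h = p * (h / p - 1 - ln (h / p))"
    using assms by (simp add: ln_div right_diff_distrib)
  show "0 \<le> p * ln (p / h) - p + h"
    unfolding e using assms ln_le_minus_one[of "h / p"] by simp
  assume "p * ln (p / h) - p + h = 0"
  then have "ln (h / p) = h / p - 1" unfolding e using assms by simp
  then have "h / p = 1" using assms by (intro ln_eq_minus_one) auto
  then show "p = h" using assms by simp
qed

text \<open>The integrand of the divergence with \<open>h - p\<close> added. Between densities this
  addition integrates to 0, so the loss is unchanged, but every value becomes nonnegative and risks
  can be manipulated by Tonelli's theorem even when they are infinite.\<close>

definition kl_term :: "real \<Rightarrow> real \<Rightarrow> ennreal" where
  "kl_term p h = (if h = 0 then \<top> else ennreal (p * ln (p / h) - p + h))"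

lemma measurable_kl_term [measurable]:
  assumes [measurable]: "f \<in> borel_measurable M" "g \<in> borel_measurable M"
  shows "(\<lambda>x. kl_term (f x) (g x)) \<in> borel_measurable M"
  unfolding kl_term_def by measurable

definition risk :: "real \<Rightarrow> real \<Rightarrow> 'a::euclidean_space \<Rightarrow> ('a \<Rightarrow> 'a \<Rightarrow> real) \<Rightarrow> ennreal" where
  "risk vx vy \<theta> ph = (\<integral>\<^sup>+X. \<integral>\<^sup>+Y. ennreal (gauss vx \<theta> X) * kl_term (gauss vy \<theta> Y) (ph X Y) \<partial>lborel \<partial>lborel)"

text \<open>The mean of \<open>X\<close> and \<open>Y\<close> weighted by their precisions, which is
  the posterior mean of \<theta> under a flat prior.\<close>

definition barycenter :: "real \<Rightarrow> real \<Rightarrow> 'a::euclidean_space \<Rightarrow> 'a \<Rightarrow> 'a" where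
  "barycenter vx vy X Y = (vy / (vx + vy)) *\<^sub>R X + (vx / (vx + vy)) *\<^sub>R Y"

lemma measurable_barycenter [measurable]:
  assumes [measurable]: "f \<in> borel_measurable M" "g \<in> borel_measurable M"
  shows "(\<lambda>x. barycenter vx vy (f x) (g x) :: 'a::euclidean_space) \<in> borel_measurable M"
  unfolding barycenter_def by measurable

text \<open>Completing the square in \<theta>. The pair enters the likelihood only through its
  barycenter, which acts as one observation of \<theta> with variance vx vy / (vx + vy); this is the
  origin of that variance in the risk formula.\<close>

lemma gauss_mult:
  fixes X Y \<theta> :: "'a::euclidean_space"
  assumes "vx > 0" "vy > 0"
  shows "gauss vx \<theta> X * gauss vy \<theta> Y =
    gauss (vx + vy) X Y * gauss (vx * vy / (vx + vy)) \<theta> (barycenter vx vy X Y)"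
proof -
  define u v where "u = X - \<theta>" and "v = Y - \<theta>"
  define w where "w = vx + vy"
  have w: "w > 0" using assms by (simp add: w_def)
  have 1: "barycenter vx vy X Y - \<theta> = (vy / w) *\<^sub>R u + (vx / w) *\<^sub>R v"
  proof -
    have "(vy / w) *\<^sub>R \<theta> + (vx / w) *\<^sub>R \<theta> = \<theta>"
      unfolding scaleR_add_left[symmetric] using w by (simp add: w_def add_divide_distrib[symmetric] add.commute)
    then show ?thesis by (simp add: barycenter_def u_def v_def w_def algebra_simps)
  qed
  have 2: "Y - X = v - u" by (simp add: u_def v_def)
  have n1: "(norm (v - u))\<^sup>2 = v \<bullet> v - 2 * (u \<bullet> v) + u \<bullet> u"
    unfolding power2_norm_eq_inner by (simp add: inner_simps inner_commute)
  have n2: "(norm ((vy / w) *\<^sub>R u + (vx / w) *\<^sub>R v))\<^sup>2 = (vy / w)\<^sup>2 * (u \<bullet> u) + 2 * (vy / w) * (vx / w) * (u \<bullet> v) + (vx / w)\<^sup>2 * (v \<bullet> v)"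
    unfolding power2_norm_eq_inner by (simp add: inner_simps inner_commute power2_eq_square algebra_simps)
  have "u \<bullet> u / vx + v \<bullet> v / vy = (v \<bullet> v - 2 * (u \<bullet> v) + u \<bullet> u) / w +
     ((vy / w)\<^sup>2 * (u \<bullet> u) + 2 * (vy / w) * (vx / w) * (u \<bullet> v) + (vx / w)\<^sup>2 * (v \<bullet> v)) / (vx * vy / w)"
  proof -
    have a: "1 / vx = 1 / w + (vy / w)\<^sup>2 / (vx * vy / w)" "1 / vy = 1 / w + (vx / w)\<^sup>2 / (vx * vy / w)"
      using assms w by (auto simp: w_def divide_simps power2_eq_square)
    have b: "- 2 / w + (2 * (vy / w) * (vx / w)) / (vx * vy / w) = 0"
      using assms w by (simp add: divide_simps power2_eq_square)
    have "u \<bullet> u / vx + v \<bullet> v / vy = (1 / vx) * (u \<bullet> u) + (1 / vy) * (v \<bullet> v) + (- 2 / w + (2 * (vy / w) * (vx / w)) / (vx * vy / w)) * (u \<bullet> v)"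
      unfolding b by simp
    also have "\<dots> = (v \<bullet> v - 2 * (u \<bullet> v) + u \<bullet> u) / w +
     ((vy / w)\<^sup>2 * (u \<bullet> u) + 2 * (vy / w) * (vx / w) * (u \<bullet> v) + (vx / w)\<^sup>2 * (v \<bullet> v)) / (vx * vy / w)"
      unfolding a by (simp add: add_divide_distrib diff_divide_distrib algebra_simps)
    finally show ?thesis .
  qed
  note K = this
  have halves: "- a / 2 + - b / 2 = - c / 2 + - d / 2" if "a + b = c + d" for a b c d :: real
    using that by linarith
  have half: "- x / (2 * y) = - (x / y) / 2" for x y :: real by simp
  have e: "- (norm (X - \<theta>))\<^sup>2 / (2 * vx) + - (norm (Y - \<theta>))\<^sup>2 / (2 * vy) =
      - (norm (Y - X))\<^sup>2 / (2 * (vx + vy)) + - (norm (barycenter vx vy X Y - \<theta>))\<^sup>2 / (2 * (vx * vy / (vx + vy)))"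
    unfolding 1 2 n1 n2 w_def[symmetric] unfolding u_def[symmetric] v_def[symmetric] power2_norm_eq_inner half
    by (rule halves[OF K])
  have "(2 * pi * vx) * (2 * pi * vy) = (2 * pi * (vx + vy)) * (2 * pi * (vx * vy / (vx + vy)))"
    using assms by (simp add: field_simps)
  note K = this
  have p: "(2 * pi * vx) powr c * (2 * pi * vy) powr c = (2 * pi * (vx + vy)) powr c * (2 * pi * (vx * vy / (vx + vy))) powr c" for c
  proof -
    have "(2 * pi * vx) powr c * (2 * pi * vy) powr c = ((2 * pi * vx) * (2 * pi * vy)) powr c"
      using assms by (subst powr_mult) auto
    also have "\<dots> = (2 * pi * (vx + vy)) powr c * (2 * pi * (vx * vy / (vx + vy))) powr c"
      unfolding K using assms by (subst powr_mult) auto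
    finally show ?thesis .
  qed
  have "gauss vx \<theta> X * gauss vy \<theta> Y = ((2 * pi * vx) powr (- (real DIM('a) / 2)) * (2 * pi * vy) powr (- (real DIM('a) / 2))) *
     exp (- (norm (X - \<theta>))\<^sup>2 / (2 * vx) + - (norm (Y - \<theta>))\<^sup>2 / (2 * vy))"
    unfolding gauss_def exp_add by (simp only: mult_ac)
  also have "\<dots> = gauss (vx + vy) X Y * gauss (vx * vy / (vx + vy)) \<theta> (barycenter vx vy X Y)"
    unfolding p e exp_add gauss_def by (simp only: mult_ac)
  finally show ?thesis .
qed

lemma gauss_conv:
  fixes X Y :: "'a::euclidean_space"
  assumes "vx > 0" "vy > 0"
  shows "(\<integral>\<^sup>+\<theta>. ennreal (gauss vx \<theta> X * gauss vy \<theta> Y) \<partial>lborel) = ennreal (gauss (vx + vy) X Y)"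
  using assms by (simp add: gauss_mult ennreal_mult nn_integral_cmult nn_integral_gauss')

text \<open>Stein's identities: the integrals of the derivatives along \<open>e\<close> of the
  density, and of the density times its centred coordinate, vanish.\<close>

lemma integral_gauss_first_moment:
  fixes \<theta> e :: "'a::euclidean_space"
  assumes v: "v > 0" and e: "norm e = 1"
  shows "integrable lborel (\<lambda>x. ((x - \<theta>) \<bullet> e) * gauss v \<theta> x)" "(\<integral>x. ((x - \<theta>) \<bullet> e) * gauss v \<theta> x \<partial>lborel) = 0"
    and "integrable lborel (\<lambda>x. ((x - \<theta>) \<bullet> e)\<^sup>2 * gauss v \<theta> x)" "(\<integral>x. ((x - \<theta>) \<bullet> e)\<^sup>2 * gauss v \<theta> x \<partial>lborel) = v"
proof -
  have b: "\<bar>(x - \<theta>) \<bullet> e\<bar> \<le> (3 + 2 * (norm \<theta>)\<^sup>2) * (1 + (norm x)\<^sup>2)" "((x - \<theta>) \<bullet> e)\<^sup>2 \<le> (3 + 2 * (norm \<theta>)\<^sup>2) * (1 + (norm x)\<^sup>2)" for x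
  proof -
    have "0 \<le> (norm \<theta>)\<^sup>2 * (norm x)\<^sup>2" "0 \<le> (norm x)\<^sup>2" by simp_all
    have 1: "1 + (norm (x - \<theta>))\<^sup>2 \<le> (3 + 2 * (norm \<theta>)\<^sup>2) * (1 + (norm x)\<^sup>2)"
    proof -
      have "(3 + 2 * (norm \<theta>)\<^sup>2) * (1 + (norm x)\<^sup>2) =
          3 + 3 * (norm x)\<^sup>2 + 2 * (norm \<theta>)\<^sup>2 + 2 * ((norm \<theta>)\<^sup>2 * (norm x)\<^sup>2)"
        by (simp add: algebra_simps)
      then show ?thesis
        using norm_diff_sq_le[of x \<theta>] \<open>0 \<le> (norm \<theta>)\<^sup>2 * (norm x)\<^sup>2\<close> \<open>0 \<le> (norm x)\<^sup>2\<close> by linarith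
    qed
    have ab: "\<bar>(x - \<theta>) \<bullet> e\<bar> \<le> norm (x - \<theta>)" using Cauchy_Schwarz_ineq2[of "x - \<theta>" e] e by simp
    then have sq: "((x - \<theta>) \<bullet> e)\<^sup>2 \<le> (norm (x - \<theta>))\<^sup>2" by (metis abs_le_square_iff abs_norm_cancel)
    then show "((x - \<theta>) \<bullet> e)\<^sup>2 \<le> (3 + 2 * (norm \<theta>)\<^sup>2) * (1 + (norm x)\<^sup>2)" using 1 by linarith
    have "norm (x - \<theta>) \<le> 1 + (norm (x - \<theta>))\<^sup>2"
      using sum_squares_bound[of 1 "norm (x - \<theta>)"] by (simp add: power2_eq_square)
        (smt (verit) zero_le_square)
    then show "\<bar>(x - \<theta>) \<bullet> e\<bar> \<le> (3 + 2 * (norm \<theta>)\<^sup>2) * (1 + (norm x)\<^sup>2)" using 1 ab by linarith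
  qed
  have ee: "(x + t *\<^sub>R e - \<theta>) \<bullet> e = (x - \<theta>) \<bullet> e + t" for x t
    using e by (simp add: inner_simps norm_eq_1)
  have sq: "(norm (x + t *\<^sub>R e - \<theta>))\<^sup>2 = (norm (x - \<theta>))\<^sup>2 + 2 * t * ((x - \<theta>) \<bullet> e) + t\<^sup>2" for x t
    using e unfolding power2_norm_eq_inner norm_eq_1
    by (simp add: inner_simps algebra_simps power2_eq_square inner_commute)
  have dg: "((\<lambda>t. gauss v \<theta> (x + t *\<^sub>R e)) has_real_derivative - ((x - \<theta>) \<bullet> e) / v * gauss v \<theta> x) (at 0)" for x
    unfolding gauss_def sq
    using v by (auto intro!: derivative_eq_intros simp: field_simps)
  show i1: "integrable lborel (\<lambda>x. ((x - \<theta>) \<bullet> e) * gauss v \<theta> x)"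
    using b(1) by (intro integrable_poly_gauss[OF v, of _ "3 + 2 * (norm \<theta>)\<^sup>2" 1 \<theta>]) (auto simp: abs_mult mult_right_mono)
  show i2: "integrable lborel (\<lambda>x. ((x - \<theta>) \<bullet> e)\<^sup>2 * gauss v \<theta> x)"
    using b(2) by (intro integrable_poly_gauss[OF v, of _ "3 + 2 * (norm \<theta>)\<^sup>2" 1 \<theta>]) (auto simp: abs_mult mult_right_mono)
  have "(\<integral>x. (- 1 / v) * (((x - \<theta>) \<bullet> e) * gauss v \<theta> x) \<partial>lborel) = 0"
    by (rule integral_directional_derivative_lborel[OF integrable_gauss[OF v] integrable_mult_right[OF i1]])
      (use dg in simp)
  then show "(\<integral>x. ((x - \<theta>) \<bullet> e) * gauss v \<theta> x \<partial>lborel) = 0" using v by simp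
  have "(\<integral>x. gauss v \<theta> x - (1 / v) * (((x - \<theta>) \<bullet> e)\<^sup>2 * gauss v \<theta> x) \<partial>lborel) = 0"
  proof (rule integral_directional_derivative_lborel[OF i1])
    show "integrable lborel (\<lambda>x. gauss v \<theta> x - 1 / v * (((x - \<theta>) \<bullet> e)\<^sup>2 * gauss v \<theta> x))"
      by (intro Bochner_Integration.integrable_diff integrable_mult_right i2 integrable_gauss v)
    fix x
    have "((\<lambda>t. (x + t *\<^sub>R e - \<theta>) \<bullet> e) has_real_derivative 1) (at 0)"
      unfolding ee by (auto intro!: derivative_eq_intros)
    from DERIV_mult[OF this dg]
    show "((\<lambda>t. (x + t *\<^sub>R e - \<theta>) \<bullet> e * gauss v \<theta> (x + t *\<^sub>R e)) has_real_derivative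
        gauss v \<theta> x - 1 / v * (((x - \<theta>) \<bullet> e)\<^sup>2 * gauss v \<theta> x)) (at 0)"
      by (rule DERIV_cong) (simp add: power2_eq_square)
  qed
  then have "1 - (1 / v) * (\<integral>x. ((x - \<theta>) \<bullet> e)\<^sup>2 * gauss v \<theta> x \<partial>lborel) = 0"
    by (subst (asm) Bochner_Integration.integral_diff)
      (auto simp: integral_gauss v intro!: integrable_gauss i2)
  then show "(\<integral>x. ((x - \<theta>) \<bullet> e)\<^sup>2 * gauss v \<theta> x \<partial>lborel) = v" using v by (simp add: field_simps)
qed

lemma integral_gauss_second_moment:
  fixes \<theta> :: "'a::euclidean_space"
  assumes v: "v > 0"
  shows "integrable lborel (\<lambda>x. gauss v \<theta> x * (norm (x - \<theta>))\<^sup>2)"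
    and "(\<integral>x. gauss v \<theta> x * (norm (x - \<theta>))\<^sup>2 \<partial>lborel) = real DIM('a) * v"
    and "integrable lborel (\<lambda>x. gauss v \<theta> x * (norm x)\<^sup>2)"
    and "(\<integral>x. gauss v \<theta> x * (norm x)\<^sup>2 \<partial>lborel) = (norm \<theta>)\<^sup>2 + real DIM('a) * v"
proof -
  note m = integral_gauss_first_moment[OF v, of _ \<theta>]
  have s: "gauss v \<theta> x * (norm (x - \<theta>))\<^sup>2 = (\<Sum>e\<in>Basis. ((x - \<theta>) \<bullet> e)\<^sup>2 * gauss v \<theta> x)" for x
    by (simp add: norm_sq_eq_sum_Basis sum_distrib_left mult.commute)
  show i: "integrable lborel (\<lambda>x. gauss v \<theta> x * (norm (x - \<theta>))\<^sup>2)"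
    unfolding s by (intro Bochner_Integration.integrable_sum m) auto
  show I: "(\<integral>x. gauss v \<theta> x * (norm (x - \<theta>))\<^sup>2 \<partial>lborel) = real DIM('a) * v"
    unfolding s by (subst Bochner_Integration.integral_sum) (auto simp: m)
  have s1: "gauss v \<theta> x * ((x - \<theta>) \<bullet> \<theta>) = (\<Sum>e\<in>Basis. (\<theta> \<bullet> e) * (((x - \<theta>) \<bullet> e) * gauss v \<theta> x))" for x
    by (subst euclidean_inner) (simp add: sum_distrib_left mult_ac)
  have i1: "integrable lborel (\<lambda>x. gauss v \<theta> x * ((x - \<theta>) \<bullet> \<theta>))"
    unfolding s1 by (intro Bochner_Integration.integrable_sum integrable_mult_right m) auto
  have I1: "(\<integral>x. gauss v \<theta> x * ((x - \<theta>) \<bullet> \<theta>) \<partial>lborel) = 0"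
    unfolding s1 by (subst Bochner_Integration.integral_sum) (auto simp: m)
  have n: "gauss v \<theta> x * (norm x)\<^sup>2 = gauss v \<theta> x * (norm (x - \<theta>))\<^sup>2 + 2 * (gauss v \<theta> x * ((x - \<theta>) \<bullet> \<theta>)) + (norm \<theta>)\<^sup>2 * gauss v \<theta> x" for x
    unfolding power2_norm_eq_inner by (simp add: inner_simps inner_commute algebra_simps)
  show "integrable lborel (\<lambda>x. gauss v \<theta> x * (norm x)\<^sup>2)"
    unfolding n using i i1 integrable_gauss[OF v]
    by (intro Bochner_Integration.integrable_add integrable_mult_right)
  show "(\<integral>x. gauss v \<theta> x * (norm x)\<^sup>2 \<partial>lborel) = (norm \<theta>)\<^sup>2 + real DIM('a) * v"
    unfolding n
    by (simp add: Bochner_Integration.integral_add[OF Bochner_Integration.integrable_add[OF i integrable_mult_right[OF i1]]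
        integrable_mult_right[OF integrable_gauss[OF v]]]
      Bochner_Integration.integral_add[OF i integrable_mult_right[OF i1]] I I1 integral_gauss[OF v])
qed

definition gauss_measure :: "real \<Rightarrow> 'a::euclidean_space \<Rightarrow> 'a measure" where
  "gauss_measure v \<theta> = density lborel (\<lambda>x. ennreal (gauss v \<theta> x))"

lemma sets_gauss_measure [measurable_cong, simp]: "sets (gauss_measure v \<theta>) = sets borel"
  by (simp add: gauss_measure_def)

lemma space_gauss_measure [simp]: "space (gauss_measure v \<theta>) = UNIV"
  by (simp add: gauss_measure_def)

lemma prob_space_gauss_measure: "v > 0 \<Longrightarrow> prob_space (gauss_measure v \<theta>)"
  by (rule prob_spaceI) (simp add: gauss_measure_def emeasure_density nn_integral_gauss)

lemma nn_integral_gauss_measure: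
  "f \<in> borel_measurable borel \<Longrightarrow> (\<integral>\<^sup>+x. f x \<partial>gauss_measure v \<theta>) = (\<integral>\<^sup>+x. ennreal (gauss v \<theta> x) * f x \<partial>lborel)"
  unfolding gauss_measure_def by (rule nn_integral_density) auto

lemma nn_integral_lborel_shift:
  fixes f :: "'a::euclidean_space \<Rightarrow> ennreal"
  assumes [measurable]: "f \<in> borel_measurable borel"
  shows "(\<integral>\<^sup>+x. f (x + c) \<partial>lborel) = (\<integral>\<^sup>+x. f x \<partial>lborel)"
proof -
  have "(\<integral>\<^sup>+x. f x \<partial>lborel) = (\<integral>\<^sup>+x. f x \<partial>distr lborel borel (\<lambda>x. x + c))"
    by (simp add: lborel_distr_plus_right)
  also have "\<dots> = (\<integral>\<^sup>+x. f (x + c) \<partial>lborel)"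
    by (rule nn_integral_distr) measurable
  finally show ?thesis by simp
qed

text \<open>The map from (X, Y) to the difference and the barycenter is a composition of two shears,
  so translation invariance and Fubini replace a Jacobian.\<close>

lemma gauss_pair_substitution:
  fixes \<theta> :: "'a::euclidean_space" and f :: "'a \<Rightarrow> 'a \<Rightarrow> ennreal"
  assumes v: "vx > 0" "vy > 0" and [measurable]: "case_prod f \<in> borel_measurable (borel \<Otimes>\<^sub>M borel)"
  defines "vw \<equiv> vx * vy / (vx + vy)"
  shows "(\<integral>\<^sup>+X. \<integral>\<^sup>+Y. ennreal (gauss vx \<theta> X * gauss vy \<theta> Y) * f (Y - X) (barycenter vx vy X Y) \<partial>lborel \<partial>lborel) =
    (\<integral>\<^sup>+D. \<integral>\<^sup>+W. ennreal (gauss (vx + vy) 0 D * gauss vw \<theta> W) * f D W \<partial>lborel \<partial>lborel)"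
proof -
  have [measurable]: "(\<lambda>x. f (g x) (h x)) \<in> borel_measurable M"
    if [measurable]: "g \<in> borel_measurable M" "h \<in> borel_measurable M" for g h and M :: "'b measure"
    using measurable_compose[of "\<lambda>x. (g x, h x)" M "borel \<Otimes>\<^sub>M borel" "case_prod f"] assms(3) that by simp
  define c where "c = vx / (vx + vy)"
  have bc: "barycenter vx vy X (Y + X) = X + c *\<^sub>R Y" for X Y :: 'a
  proof -
    have "(vy / (vx + vy)) *\<^sub>R X + (vx / (vx + vy)) *\<^sub>R X = X"
      unfolding scaleR_add_left[symmetric] using v by (simp add: add_divide_distrib[symmetric] add.commute)
    then show ?thesis by (simp add: barycenter_def c_def algebra_simps)
  qed
  let ?F = "\<lambda>X Y. ennreal (gauss (vx + vy) X Y * gauss vw \<theta> (barycenter vx vy X Y)) * f (Y - X) (barycenter vx vy X Y)"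
  have "(\<integral>\<^sup>+X. \<integral>\<^sup>+Y. ennreal (gauss vx \<theta> X * gauss vy \<theta> Y) * f (Y - X) (barycenter vx vy X Y) \<partial>lborel \<partial>lborel) =
     (\<integral>\<^sup>+X. \<integral>\<^sup>+Y. ?F X Y \<partial>lborel \<partial>lborel)"
    by (simp add: gauss_mult[OF v] vw_def)
  also have "\<dots> = (\<integral>\<^sup>+X. \<integral>\<^sup>+Y. ?F X (Y + X) \<partial>lborel \<partial>lborel)"
    by (intro nn_integral_cong nn_integral_lborel_shift[symmetric]) measurable
  also have "\<dots> = (\<integral>\<^sup>+X. \<integral>\<^sup>+D. ennreal (gauss (vx + vy) 0 D * gauss vw \<theta> (X + c *\<^sub>R D)) * f D (X + c *\<^sub>R D) \<partial>lborel \<partial>lborel)"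
    by (simp add: bc gauss_def)
  also have "\<dots> = (\<integral>\<^sup>+D. \<integral>\<^sup>+X. ennreal (gauss (vx + vy) 0 D * gauss vw \<theta> (X + c *\<^sub>R D)) * f D (X + c *\<^sub>R D) \<partial>lborel \<partial>lborel)"
    by (rule lborel_pair.Fubini') measurable
  also have "\<dots> = (\<integral>\<^sup>+D. \<integral>\<^sup>+W. ennreal (gauss (vx + vy) 0 D * gauss vw \<theta> W) * f D W \<partial>lborel \<partial>lborel)"
    by (intro nn_integral_cong nn_integral_lborel_shift[where f = "\<lambda>W. ennreal (gauss (vx + vy) 0 _ * gauss vw \<theta> W) * f _ W"]) measurable
  finally show ?thesis .
qed

definition gauss_pair :: "real \<Rightarrow> real \<Rightarrow> 'a::euclidean_space \<Rightarrow> ('a \<times> 'a) measure" where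
  "gauss_pair vx vy \<theta> = density (lborel \<Otimes>\<^sub>M lborel) (\<lambda>(X, Y). ennreal (gauss vx \<theta> X * gauss vy \<theta> Y))"

lemma sets_gauss_pair [measurable_cong, simp]: "sets (gauss_pair vx vy \<theta>) = sets (borel \<Otimes>\<^sub>M borel)"
  by (simp add: gauss_pair_def)

lemma nn_integral_gauss_pair:
  assumes [measurable]: "f \<in> borel_measurable (borel \<Otimes>\<^sub>M borel)"
  shows "(\<integral>\<^sup>+z. f z \<partial>gauss_pair vx vy \<theta>) =
    (\<integral>\<^sup>+X. \<integral>\<^sup>+Y. ennreal (gauss vx \<theta> X * gauss vy \<theta> Y) * f (X, Y) \<partial>lborel \<partial>lborel)"
  unfolding gauss_pair_def
  by (subst nn_integral_density) (auto simp: lborel.nn_integral_fst[symmetric])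

text \<open>The log ratio of true to predictive density is a sum of four terms, each of which
  depends on the pair through one of these four variables.\<close>

lemma distr_gauss_pair:
  fixes \<theta> :: "'a::euclidean_space"
  assumes v: "vx > 0" "vy > 0"
  shows "distr (gauss_pair vx vy \<theta>) borel fst = gauss_measure vx \<theta>" (is ?A)
    and "distr (gauss_pair vx vy \<theta>) borel snd = gauss_measure vy \<theta>" (is ?B)
    and "distr (gauss_pair vx vy \<theta>) borel (\<lambda>(X, Y). Y - X) = gauss_measure (vx + vy) 0" (is ?C)
    and "distr (gauss_pair vx vy \<theta>) borel (\<lambda>(X, Y). barycenter vx vy X Y) = gauss_measure (vx * vy / (vx + vy)) \<theta>" (is ?D)
proof -
  have vw: "vx + vy > 0" "vx * vy / (vx + vy) > 0" using v by auto
  have *: "distr (gauss_pair vx vy \<theta>) borel h = gauss_measure w \<eta>"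
    if [measurable]: "h \<in> borel_measurable (borel \<Otimes>\<^sub>M borel)"
    and eq: "\<And>f. f \<in> borel_measurable borel \<Longrightarrow>
      (\<integral>\<^sup>+X. \<integral>\<^sup>+Y. ennreal (gauss vx \<theta> X * gauss vy \<theta> Y) * f (h (X, Y)) \<partial>lborel \<partial>lborel) = (\<integral>\<^sup>+x. ennreal (gauss w \<eta> x) * f x \<partial>lborel)"
    for h :: "'a \<times> 'a \<Rightarrow> 'a" and w \<eta>
  proof (rule measure_eqI)
    fix A assume "A \<in> sets (distr (gauss_pair vx vy \<theta>) borel h)"
    then have [measurable]: "A \<in> sets borel" by simp
    have "emeasure (distr (gauss_pair vx vy \<theta>) borel h) A = (\<integral>\<^sup>+x. indicator A x \<partial>distr (gauss_pair vx vy \<theta>) borel h)"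
      by simp
    also have "\<dots> = (\<integral>\<^sup>+z. indicator A (h z) \<partial>gauss_pair vx vy \<theta>)"
      by (rule nn_integral_distr) auto
    also have "\<dots> = (\<integral>\<^sup>+x. ennreal (gauss w \<eta> x) * indicator A x \<partial>lborel)"
      by (simp add: nn_integral_gauss_pair eq)
    also have "\<dots> = emeasure (gauss_measure w \<eta>) A"
      by (simp add: gauss_measure_def emeasure_density)
    finally show "emeasure (distr (gauss_pair vx vy \<theta>) borel h) A = emeasure (gauss_measure w \<eta>) A" .
  qed simp
  show ?A
    by (rule *) (auto simp: ennreal_mult mult.assoc nn_integral_cmult nn_integral_multc nn_integral_gauss[OF v(2)])
  show ?B
    by (rule *) (auto simp: ennreal_mult mult.assoc nn_integral_cmult nn_integral_multc nn_integral_gauss[OF v(1)])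
  show ?C
  proof (rule *)
    fix f :: "'a \<Rightarrow> ennreal" assume [measurable]: "f \<in> borel_measurable borel"
    show "(\<integral>\<^sup>+X. \<integral>\<^sup>+Y. ennreal (gauss vx \<theta> X * gauss vy \<theta> Y) * f (case (X, Y) of (X, Y) \<Rightarrow> Y - X) \<partial>lborel \<partial>lborel) =
        (\<integral>\<^sup>+x. ennreal (gauss (vx + vy) 0 x) * f x \<partial>lborel)"
      unfolding prod.case
      by (subst gauss_pair_substitution[OF v, where f = "\<lambda>D W. f D"])
        (simp_all add: ennreal_mult nn_integral_cmult nn_integral_multc nn_integral_gauss[OF vw(2)])
  qed measurable
  show ?D
  proof (rule *)
    fix f :: "'a \<Rightarrow> ennreal" assume [measurable]: "f \<in> borel_measurable borel"
    show "(\<integral>\<^sup>+X. \<integral>\<^sup>+Y. ennreal (gauss vx \<theta> X * gauss vy \<theta> Y) * f (case (X, Y) of (X, Y) \<Rightarrow> barycenter vx vy X Y) \<partial>lborel \<partial>lborel) =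
        (\<integral>\<^sup>+x. ennreal (gauss (vx * vy / (vx + vy)) \<theta> x) * f x \<partial>lborel)"
      unfolding prod.case
      by (subst gauss_pair_substitution[OF v, where f = "\<lambda>D W. f W"])
        (simp_all add: ennreal_mult mult.assoc nn_integral_cmult nn_integral_multc nn_integral_gauss[OF vw(1)])
  qed measurable
qed

lemma ln_gauss:
  assumes "v > 0"
  shows "ln (gauss v \<theta> (x::'a::euclidean_space)) = - (real DIM('a) / 2) * ln (2 * pi * v) - (norm (x - \<theta>))\<^sup>2 / (2 * v)"
  using assms by (simp add: gauss_def ln_mult ln_powr)

lemma mult_ln_bounded:
  fixes p P :: real assumes "0 < p" "p \<le> P"
  shows "\<bar>p * ln p\<bar> \<le> 1 + P * \<bar>ln P\<bar>"
proof -
  have "ln p \<le> \<bar>ln P\<bar>" using ln_mono[of p P] assms by linarith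
  then have "p * ln p \<le> p * \<bar>ln P\<bar>" using assms by (intro mult_left_mono) auto
  also have "\<dots> \<le> P * \<bar>ln P\<bar>" using assms by (intro mult_right_mono) auto
  finally have 1: "p * ln p \<le> P * \<bar>ln P\<bar>" .
  have "- ln p \<le> 1 / p - 1" using ln_le_minus_one[of "1 / p"] assms by (simp add: ln_div)
  then have "p * (- ln p) \<le> p * (1 / p - 1)" using assms by (intro mult_left_mono) auto
  also have "\<dots> \<le> 1" using assms by (simp add: right_diff_distrib)
  finally have "- (p * ln p) \<le> 1" by simp
  moreover have "0 \<le> P * \<bar>ln P\<bar>" using assms by simp
  ultimately show ?thesis using 1 by linarith
qed

lemma integrable_gauss_measure_iff:
  fixes f :: "'a::euclidean_space \<Rightarrow> real"
  assumes [measurable]: "f \<in> borel_measurable borel"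
  shows "integrable (gauss_measure v \<theta>) f \<longleftrightarrow> integrable lborel (\<lambda>x. gauss v \<theta> x * f x)"
  unfolding gauss_measure_def by (subst integrable_density) auto

lemma integral_gauss_measure:
  fixes f :: "'a::euclidean_space \<Rightarrow> real"
  assumes [measurable]: "f \<in> borel_measurable borel"
  shows "(\<integral>x. f x \<partial>gauss_measure v \<theta>) = (\<integral>x. gauss v \<theta> x * f x \<partial>lborel)"
  unfolding gauss_measure_def by (subst integral_density) auto

lemma gauss_entropy:
  fixes \<theta> :: "'a::euclidean_space"
  assumes v: "v > 0"
  shows "integrable lborel (\<lambda>x. gauss v \<theta> x * ln (gauss v \<theta> x))"
    and "(\<integral>x. gauss v \<theta> x * ln (gauss v \<theta> x) \<partial>lborel) = - (real DIM('a) / 2) * ln (2 * pi * v) - real DIM('a) / 2"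
proof -
  have eq: "gauss v \<theta> x * ln (gauss v \<theta> x) =
      (- (real DIM('a) / 2) * ln (2 * pi * v)) * gauss v \<theta> x - (1 / (2 * v)) * (gauss v \<theta> x * (norm (x - \<theta>))\<^sup>2)" for x
    by (simp add: ln_gauss[OF v] algebra_simps)
  note i = integrable_mult_right[OF integrable_gauss[OF v, of \<theta>]]
    integrable_mult_right[OF integral_gauss_second_moment(1)[OF v, of \<theta>]]
  show "integrable lborel (\<lambda>x. gauss v \<theta> x * ln (gauss v \<theta> x))"
    unfolding eq by (intro Bochner_Integration.integrable_diff i)
  show "(\<integral>x. gauss v \<theta> x * ln (gauss v \<theta> x) \<partial>lborel) = - (real DIM('a) / 2) * ln (2 * pi * v) - real DIM('a) / 2"
    unfolding eq Bochner_Integration.integral_diff[OF i] using v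
    by (simp add: integral_gauss integral_gauss_second_moment(2)[OF v])
qed

section \<open>Bayes risk and its excess for other predictive densities\<close>

context gauss_mixture
begin

definition pred :: "real \<Rightarrow> real \<Rightarrow> 'a \<Rightarrow> 'a \<Rightarrow> real" where
  "pred vx vy X Y = (\<integral>\<theta>. gauss vx \<theta> X * gauss vy \<theta> Y \<partial>M) / mix vx X"

lemma measurable_pred [measurable]:
  assumes [measurable]: "f \<in> borel_measurable N" "g \<in> borel_measurable N"
  shows "(\<lambda>x. pred vx vy (f x) (g x)) \<in> borel_measurable N"
  unfolding pred_def by measurable

lemma measurable_pred_prod: "(\<lambda>(X, Y). pred vx vy X Y) \<in> borel_measurable borel"
  unfolding borel_prod[symmetric] by measurable

lemma pred_eq:
  assumes v: "vx > 0" "vy > 0"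
  shows "pred vx vy X Y =
    gauss (vx + vy) X Y * mix (vx * vy / (vx + vy)) (barycenter vx vy X Y) / mix vx X"
    and "pred vx vy X Y > 0"
proof -
  show 1: "pred vx vy X Y =
    gauss (vx + vy) X Y * mix (vx * vy / (vx + vy)) (barycenter vx vy X Y) / mix vx X"
    unfolding pred_def by (simp add: gauss_mult[OF v] mix_def)
  show "pred vx vy X Y > 0"
    unfolding 1 using v by (intro divide_pos_pos mult_pos_pos mix_pos gauss_pos) auto
qed

lemma nn_integral_pred:
  assumes v: "vx > 0" "vy > 0"
  shows "(\<integral>\<^sup>+Y. ennreal (pred vx vy X Y) \<partial>lborel) = 1"
proof -
  interpret pair_sigma_finite M "lborel :: 'a measure" ..
  have m: "mix vx X > 0" by (rule mix_pos[OF v(1)])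
  have eq: "ennreal (pred vx vy X Y) = (\<integral>\<^sup>+\<theta>. ennreal (gauss vx \<theta> X * gauss vy \<theta> Y) \<partial>M) / ennreal (mix vx X)" for Y
  proof -
    have "integrable M (\<lambda>\<theta>. gauss vx \<theta> X * gauss vy \<theta> Y)"
      unfolding gauss_mult[OF v] using v by (intro integrable_mult_right integrable_mix) auto
    then show ?thesis
      using m by (subst nn_integral_eq_integral) (auto simp: pred_def divide_ennreal)
  qed
  have "(\<integral>\<^sup>+Y. ennreal (pred vx vy X Y) \<partial>lborel) =
      (\<integral>\<^sup>+Y. \<integral>\<^sup>+\<theta>. ennreal (gauss vx \<theta> X * gauss vy \<theta> Y) \<partial>M \<partial>lborel) / ennreal (mix vx X)"
    unfolding eq by (rule nn_integral_divide) measurable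
  also have "(\<integral>\<^sup>+Y. \<integral>\<^sup>+\<theta>. ennreal (gauss vx \<theta> X * gauss vy \<theta> Y) \<partial>M \<partial>lborel) =
      (\<integral>\<^sup>+\<theta>. \<integral>\<^sup>+Y. ennreal (gauss vx \<theta> X * gauss vy \<theta> Y) \<partial>lborel \<partial>M)"
    by (rule Fubini') measurable
  also have "\<dots> = (\<integral>\<^sup>+\<theta>. ennreal (gauss vx \<theta> X) \<partial>M)"
    by (simp add: ennreal_mult nn_integral_cmult nn_integral_gauss[OF v(2)])
  also have "\<dots> = ennreal (mix vx X)"
    unfolding mix_def using integrable_mix(1)[OF v(1)] by (subst nn_integral_eq_integral) auto
  finally show ?thesis using m by (simp add: ennreal_divide_self)
qed

text \<open>The compensation identity of the Bregman divergence \<^const>\<open>kl_term\<close> around the posterior mean.\<close>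

lemma kl_term_compensation:
  assumes v: "vx > 0" "vy > 0" and h: "h \<ge> 0"
  shows "(\<integral>\<^sup>+\<theta>. ennreal (gauss vx \<theta> X) * kl_term (gauss vy \<theta> Y) h \<partial>M) =
    (\<integral>\<^sup>+\<theta>. ennreal (gauss vx \<theta> X) * kl_term (gauss vy \<theta> Y) (pred vx vy X Y) \<partial>M) +
    ennreal (mix vx X) * kl_term (pred vx vy X Y) h"
proof (cases "h = 0")
  case True
  have "(\<integral>\<^sup>+\<theta>. ennreal (gauss vx \<theta> X) * \<top> \<partial>M) = (\<integral>\<^sup>+\<theta>. ennreal (gauss vx \<theta> X) \<partial>M) * \<top>"
    by (rule nn_integral_multc) measurable
  also have "(\<integral>\<^sup>+\<theta>. ennreal (gauss vx \<theta> X) \<partial>M) = ennreal (mix vx X)"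
    unfolding mix_def using integrable_mix(1)[OF v(1)] by (subst nn_integral_eq_integral) auto
  finally show ?thesis
    using True mix_pos[OF v(1), of X] by (simp add: kl_term_def ennreal_mult_top)
next
  case False
  with h have h: "h > 0" by simp
  define g where "g = pred vx vy X Y"
  have g: "g > 0" using pred_eq(2)[OF v] by (simp add: g_def)
  define m where "m = mix vx X"
  have m: "m > 0" using mix_pos[OF v(1)] by (simp add: m_def)
  define P where "P = (2 * pi * vy) powr (- (real DIM('a) / 2))"
  have P: "0 < gauss vy \<theta> Y" "gauss vy \<theta> Y \<le> P" for \<theta>
    using gauss_pos[OF v(2)] gauss_le[OF v(2)] by (auto simp: P_def)
  have i0: "integrable M (\<lambda>\<theta>. gauss vx \<theta> X)" by (rule integrable_mix(1)[OF v(1)])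
  have i1: "integrable M (\<lambda>\<theta>. gauss vx \<theta> X * gauss vy \<theta> Y)"
    unfolding gauss_mult[OF v] using v by (intro integrable_mult_right integrable_mix) auto
  have i2: "integrable M (\<lambda>\<theta>. gauss vx \<theta> X * (gauss vy \<theta> Y * ln (gauss vy \<theta> Y)))"
  proof (rule Bochner_Integration.integrable_bound)
    show "integrable M (\<lambda>\<theta>. (1 + P * \<bar>ln P\<bar>) * gauss vx \<theta> X)" using i0 by (rule integrable_mult_right)
    have P0: "P > 0" using P[of 0] by linarith
    show "AE \<theta> in M. norm (gauss vx \<theta> X * (gauss vy \<theta> Y * ln (gauss vy \<theta> Y))) \<le> norm ((1 + P * \<bar>ln P\<bar>) * gauss vx \<theta> X)"
      using mult_right_mono[OF mult_ln_bounded[OF P], of "gauss vx _ X"] P0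
      by (intro AE_I2) (simp add: abs_mult mult.commute)
  qed measurable
  define I where "I = (\<integral>\<theta>. gauss vx \<theta> X * (gauss vy \<theta> Y * ln (gauss vy \<theta> Y)) \<partial>M)"
  have I1: "(\<integral>\<theta>. gauss vx \<theta> X * gauss vy \<theta> Y \<partial>M) = m * g"
    using m by (simp add: g_def pred_def m_def)
  have I0: "(\<integral>\<theta>. gauss vx \<theta> X \<partial>M) = m" by (simp add: m_def mix_def)
  \<comment> \<open>For a candidate value \<open>k\<close> the posterior integral depends on
    \<open>k\<close> only through \<open>ln k\<close> and \<open>k\<close>. Comparing
    \<open>k = h\<close> with \<open>k = g\<close>, the posterior mean, therefore leaves exactly
    \<open>m\<close> times the divergence term of \<open>g\<close> and \<open>h\<close>.\<close>
  have *: "(\<integral>\<^sup>+\<theta>. ennreal (gauss vx \<theta> X) * kl_term (gauss vy \<theta> Y) k \<partial>M) = ennreal (I - ln k * (m * g) - m * g + k * m)"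
    and **: "0 \<le> I - ln k * (m * g) - m * g + k * m" if k: "k > 0" for k
  proof -
    have eq: "gauss vx \<theta> X * (gauss vy \<theta> Y * ln (gauss vy \<theta> Y / k) - gauss vy \<theta> Y + k) =
       gauss vx \<theta> X * (gauss vy \<theta> Y * ln (gauss vy \<theta> Y)) - ln k * (gauss vx \<theta> X * gauss vy \<theta> Y) - gauss vx \<theta> X * gauss vy \<theta> Y
       + k * gauss vx \<theta> X" for \<theta>
      using P(1)[of \<theta>] k by (simp add: ln_div algebra_simps)
    have i: "integrable M (\<lambda>\<theta>. gauss vx \<theta> X * (gauss vy \<theta> Y * ln (gauss vy \<theta> Y / k) - gauss vy \<theta> Y + k))"
      unfolding eq by (intro Bochner_Integration.integrable_add Bochner_Integration.integrable_diff integrable_mult_right i0 i1 i2)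
    have nn: "0 \<le> gauss vx \<theta> X * (gauss vy \<theta> Y * ln (gauss vy \<theta> Y / k) - gauss vy \<theta> Y + k)" for \<theta>
      by (intro mult_nonneg_nonneg kl_nonneg P k) auto
    have I: "(\<integral>\<theta>. gauss vx \<theta> X * (gauss vy \<theta> Y * ln (gauss vy \<theta> Y / k) - gauss vy \<theta> Y + k) \<partial>M) = I - ln k * (m * g) - m * g + k * m"
      unfolding eq
      by (simp add: Bochner_Integration.integral_add Bochner_Integration.integral_diff
          Bochner_Integration.integrable_add Bochner_Integration.integrable_diff i0 i1 i2 I0 I1 I_def)
    show "0 \<le> I - ln k * (m * g) - m * g + k * m"
      unfolding I[symmetric] using nn by (intro Bochner_Integration.integral_nonneg) auto
    have "(\<integral>\<^sup>+\<theta>. ennreal (gauss vx \<theta> X) * kl_term (gauss vy \<theta> Y) k \<partial>M) =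
       (\<integral>\<^sup>+\<theta>. ennreal (gauss vx \<theta> X * (gauss vy \<theta> Y * ln (gauss vy \<theta> Y / k) - gauss vy \<theta> Y + k)) \<partial>M)"
      using k by (intro nn_integral_cong) (simp add: kl_term_def ennreal_mult kl_nonneg P)
    also have "\<dots> = ennreal (I - ln k * (m * g) - m * g + k * m)"
      unfolding I[symmetric] by (rule nn_integral_eq_integral[OF i]) (use nn in auto)
    finally show "(\<integral>\<^sup>+\<theta>. ennreal (gauss vx \<theta> X) * kl_term (gauss vy \<theta> Y) k \<partial>M) = ennreal (I - ln k * (m * g) - m * g + k * m)" .
  qed
  have "(\<integral>\<^sup>+\<theta>. ennreal (gauss vx \<theta> X) * kl_term (gauss vy \<theta> Y) h \<partial>M) = ennreal (I - ln h * (m * g) - m * g + h * m)"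
    by (rule *[OF h])
  also have "I - ln h * (m * g) - m * g + h * m = (I - ln g * (m * g) - m * g + g * m) + m * (g * ln (g / h) - g + h)"
    using g h by (simp add: ln_div algebra_simps)
  also have "ennreal \<dots> = ennreal (I - ln g * (m * g) - m * g + g * m) + ennreal m * ennreal (g * ln (g / h) - g + h)"
    using **[OF g] m kl_nonneg(1)[OF g h] by (simp add: ennreal_plus ennreal_mult)
  also have "\<dots> = (\<integral>\<^sup>+\<theta>. ennreal (gauss vx \<theta> X) * kl_term (gauss vy \<theta> Y) g \<partial>M) + ennreal m * kl_term g h"
    unfolding *[OF g] using h by (simp add: kl_term_def)
  finally show ?thesis by (simp add: g_def m_def)
qed

lemma measurable_curried:
  assumes "(\<lambda>(X, Y). ph X Y) \<in> borel_measurable (borel :: ('a \<times> 'a) measure)"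
    and [measurable]: "f \<in> borel_measurable N" "g \<in> borel_measurable N"
  shows "(\<lambda>x. ph (f x) (g x) :: real) \<in> borel_measurable N"
  using measurable_compose[of "\<lambda>x. (f x, g x)" N borel "\<lambda>(X, Y). ph X Y"] assms by simp

text \<open>Tonelli and the compensation identity. The second summand is the excess of the Bayes
  risk over its minimum; all terms being nonnegative, the identity holds also with infinite
  risks.\<close>

lemma integral_risk:
  assumes v: "vx > 0" "vy > 0" and ph: "(\<lambda>(X, Y). ph X Y) \<in> borel_measurable borel" "\<And>X Y. ph X Y \<ge> 0"
  shows "(\<integral>\<^sup>+\<theta>. risk vx vy \<theta> ph \<partial>M) = (\<integral>\<^sup>+\<theta>. risk vx vy \<theta> (pred vx vy) \<partial>M) +
    (\<integral>\<^sup>+X. \<integral>\<^sup>+Y. ennreal (mix vx X) * kl_term (pred vx vy X Y) (ph X Y) \<partial>lborel \<partial>lborel)"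
proof -
  interpret pair_sigma_finite M "lborel :: 'a measure" ..
  note [measurable (raw)] = measurable_curried[OF ph(1)]
  have ex: "(\<integral>\<^sup>+\<theta>. risk vx vy \<theta> k \<partial>M) = (\<integral>\<^sup>+X. \<integral>\<^sup>+Y. \<integral>\<^sup>+\<theta>. ennreal (gauss vx \<theta> X) * kl_term (gauss vy \<theta> Y) (k X Y) \<partial>M \<partial>lborel \<partial>lborel)"
    if k: "(\<lambda>(X, Y). k X Y) \<in> borel_measurable (borel :: ('a \<times> 'a) measure)" for k
  proof -
    note [measurable (raw)] = measurable_curried[OF k]
    have "(\<integral>\<^sup>+\<theta>. risk vx vy \<theta> k \<partial>M) = (\<integral>\<^sup>+X. \<integral>\<^sup>+\<theta>. \<integral>\<^sup>+Y. ennreal (gauss vx \<theta> X) * kl_term (gauss vy \<theta> Y) (k X Y) \<partial>lborel \<partial>M \<partial>lborel)"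
      unfolding risk_def by (rule Fubini'[symmetric]) measurable
    also have "\<dots> = (\<integral>\<^sup>+X. \<integral>\<^sup>+Y. \<integral>\<^sup>+\<theta>. ennreal (gauss vx \<theta> X) * kl_term (gauss vy \<theta> Y) (k X Y) \<partial>M \<partial>lborel \<partial>lborel)"
      by (intro nn_integral_cong Fubini'[symmetric]) measurable
    finally show ?thesis .
  qed
  have "(\<integral>\<^sup>+\<theta>. risk vx vy \<theta> ph \<partial>M) = (\<integral>\<^sup>+X. \<integral>\<^sup>+Y. (\<integral>\<^sup>+\<theta>. ennreal (gauss vx \<theta> X) * kl_term (gauss vy \<theta> Y) (pred vx vy X Y) \<partial>M) +
    ennreal (mix vx X) * kl_term (pred vx vy X Y) (ph X Y) \<partial>lborel \<partial>lborel)"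
    unfolding ex[OF ph(1)] by (simp add: kl_term_compensation[OF v ph(2)])
  also have "\<dots> = (\<integral>\<^sup>+X. \<integral>\<^sup>+Y. (\<integral>\<^sup>+\<theta>. ennreal (gauss vx \<theta> X) * kl_term (gauss vy \<theta> Y) (pred vx vy X Y) \<partial>M) \<partial>lborel \<partial>lborel) +
    (\<integral>\<^sup>+X. \<integral>\<^sup>+Y. ennreal (mix vx X) * kl_term (pred vx vy X Y) (ph X Y) \<partial>lborel \<partial>lborel)"
    by (simp add: nn_integral_add)
  finally show ?thesis unfolding ex[OF measurable_pred_prod] .
qed

text \<open>The risk of the Bayesian predictive density under a flat prior, which is normal with
  mean \<open>X\<close> and variance \<open>vx + vy\<close>.\<close>

definition constant_risk :: "real \<Rightarrow> real \<Rightarrow> real" where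
  "constant_risk vx vy = real DIM('a) / 2 * ln ((vx + vy) / vy)"

text \<open>By \<open>pred_eq\<close> the log ratio splits into four logarithms, and
  \<open>distr_gauss_pair\<close> reduces each mean to a single Gaussian integral. The two Gaussian
  entropies combine to the constant; the marginal densities at the barycenter and at
  \<open>X\<close> give the other two terms.\<close>

lemma risk_pred:
  assumes v: "vx > 0" "vy > 0"
  defines "vw \<equiv> vx * vy / (vx + vy)"
  shows "risk vx vy \<theta> (pred vx vy) = ennreal (constant_risk vx vy - mean_ln_mix \<theta> vw + mean_ln_mix \<theta> vx)"
    and "0 \<le> constant_risk vx vy - mean_ln_mix \<theta> vw + mean_ln_mix \<theta> vx"
proof -
  have vw: "vw > 0" "vx + vy > 0" using v by (auto simp: vw_def)
  define P where "P = gauss_pair vx vy \<theta>"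
  have [measurable_cong]: "sets P = sets (borel \<Otimes>\<^sub>M borel)" by (simp add: P_def)
  have i: "integrable P (\<lambda>z. f (h z))" and I: "(\<integral>z. f (h z) \<partial>P) = (\<integral>x. gauss w \<eta> x * f x \<partial>lborel)"
    if d: "distr P borel h = gauss_measure w \<eta>" and [measurable]: "h \<in> borel_measurable (borel \<Otimes>\<^sub>M borel)" "f \<in> borel_measurable borel"
      and f: "integrable lborel (\<lambda>x. gauss w \<eta> x * f x)" for h :: "'a \<times> 'a \<Rightarrow> 'a" and f w \<eta>
  proof -
    have "integrable (distr P borel h) f" unfolding d using f by (subst integrable_gauss_measure_iff) auto
    then show "integrable P (\<lambda>z. f (h z))" by (subst (asm) integrable_distr_eq) auto
    have "(\<integral>z. f (h z) \<partial>P) = (\<integral>x. f x \<partial>distr P borel h)" by (rule integral_distr[symmetric]) auto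
    then show "(\<integral>z. f (h z) \<partial>P) = (\<integral>x. gauss w \<eta> x * f x \<partial>lborel)"
      unfolding d by (simp add: integral_gauss_measure)
  qed
  note d = distr_gauss_pair[OF v, of \<theta>, folded P_def vw_def]
  note h1 = i[OF d(2) _ _ gauss_entropy(1)[OF v(2)], simplified] I[OF d(2) _ _ gauss_entropy(1)[OF v(2)], simplified]
  note h2 = i[OF d(3) _ _ gauss_entropy(1)[OF vw(2)], simplified] I[OF d(3) _ _ gauss_entropy(1)[OF vw(2)], simplified]
  note h3 = i[OF d(4) _ _ integrable_gauss_ln_mix[OF vw(1)], simplified] I[OF d(4) _ _ integrable_gauss_ln_mix[OF vw(1)], simplified]
  note h4 = i[OF d(1) _ _ integrable_gauss_ln_mix[OF v(1)], simplified] I[OF d(1) _ _ integrable_gauss_ln_mix[OF v(1)], simplified]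
  define L where "L = (\<lambda>z. ln (gauss vy \<theta> (snd z)) - ln (gauss (vx + vy) 0 (case z of (X, Y) \<Rightarrow> Y - X))
     - ln (mix vw (case z of (X, Y) \<Rightarrow> barycenter vx vy X Y)) + ln (mix vx (fst z)))"
  have iL: "integrable P L" unfolding L_def
    by (intro Bochner_Integration.integrable_add Bochner_Integration.integrable_diff h1 h2 h3 h4)
  have "(\<integral>z. L z \<partial>P) = (\<integral>x. gauss vy \<theta> x * ln (gauss vy \<theta> x) \<partial>lborel) - (\<integral>x. gauss (vx + vy) 0 x * ln (gauss (vx + vy) 0 x) \<partial>(lborel :: 'a measure))
     - mean_ln_mix \<theta> vw + mean_ln_mix \<theta> vx"
    unfolding L_def mean_ln_mix_def
    by (simp add: Bochner_Integration.integral_add Bochner_Integration.integral_diff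
          Bochner_Integration.integrable_add Bochner_Integration.integrable_diff h1 h2 h3 h4)
  also have "\<dots> = constant_risk vx vy - mean_ln_mix \<theta> vw + mean_ln_mix \<theta> vx"
  proof -
    have "ln ((vx + vy) / vy) = ln (2 * pi * (vx + vy)) - ln (2 * pi * vy)"
      using v by (simp add: ln_div ln_mult)
    moreover have "- h * A - h - (- h * B - h) - x + y = h * (B - A) - x + y" for h A B x y :: real
      by (simp add: algebra_simps)
    ultimately show ?thesis unfolding gauss_entropy(2)[OF v(2)] gauss_entropy(2)[OF vw(2)] constant_risk_def by simp
  qed
  finally have EL: "(\<integral>z. L z \<partial>P) = constant_risk vx vy - mean_ln_mix \<theta> vw + mean_ln_mix \<theta> vx" .
  \<comment> \<open>\<open>q\<close> and \<open>r\<close> are the joint densities with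
    \<open>Y\<close> drawn from the truth and from the prediction. Both have mass 1, so
    \<open>- q + r\<close> contributes nothing to the integral while making the integrand
    nonnegative.\<close>
  define q where "q = (\<lambda>(X, Y). gauss vx \<theta> X * gauss vy \<theta> Y)"
  define r where "r = (\<lambda>(X, Y). gauss vx \<theta> X * pred vx vy X Y)"
  have [measurable]: "q \<in> borel_measurable (borel \<Otimes>\<^sub>M borel)" "r \<in> borel_measurable (borel \<Otimes>\<^sub>M borel)" "L \<in> borel_measurable (borel \<Otimes>\<^sub>M borel)"
    unfolding q_def r_def L_def by measurable
  have P_eq: "P = density (lborel \<Otimes>\<^sub>M lborel) (\<lambda>z. ennreal (q z))"
    unfolding P_def gauss_pair_def q_def by (intro arg_cong2[where f = density]) (auto simp: fun_eq_iff)
  have q0: "q z \<ge> 0" "r z \<ge> 0" for z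
    using less_imp_le[OF pred_eq(2)[OF v]] by (auto simp: q_def r_def split: prod.split)
  have iqL: "integrable (lborel \<Otimes>\<^sub>M lborel) (\<lambda>z. q z * L z)" and IqL: "(\<integral>z. q z * L z \<partial>(lborel \<Otimes>\<^sub>M lborel)) = (\<integral>z. L z \<partial>P)"
    using iL q0 unfolding P_eq by (auto simp: integrable_density integral_density)
  have nq: "(\<integral>\<^sup>+z. ennreal (q z) \<partial>(lborel \<Otimes>\<^sub>M lborel)) = 1"
    by (subst lborel.nn_integral_fst[symmetric])
      (simp_all add: q_def ennreal_mult nn_integral_cmult nn_integral_gauss v)
  have nr: "(\<integral>\<^sup>+z. ennreal (r z) \<partial>(lborel \<Otimes>\<^sub>M lborel)) = 1"
    using pred_eq(2)[OF v] by (subst lborel.nn_integral_fst[symmetric])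
      (simp_all add: r_def ennreal_mult less_imp_le nn_integral_cmult nn_integral_gauss v nn_integral_pred)
  have iq: "integrable (lborel \<Otimes>\<^sub>M lborel) q" "integrable (lborel \<Otimes>\<^sub>M lborel) r"
    by (intro integrableI_nonneg; simp add: nq nr q0)+
  have Iq: "(\<integral>z. q z \<partial>(lborel \<Otimes>\<^sub>M lborel)) = 1" "(\<integral>z. r z \<partial>(lborel \<Otimes>\<^sub>M lborel)) = 1"
    by (subst integral_eq_nn_integral; simp add: nq nr q0)+
  have F: "ennreal (gauss vx \<theta> X) * kl_term (gauss vy \<theta> Y) (pred vx vy X Y) = ennreal (q (X, Y) * L (X, Y) - q (X, Y) + r (X, Y))"
    "0 \<le> q (X, Y) * L (X, Y) - q (X, Y) + r (X, Y)" for X Y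
  proof -
    have pos: "gauss vx \<theta> X > 0" "gauss vy \<theta> Y > 0" "pred vx vy X Y > 0" "mix vx X > 0" "mix vw (barycenter vx vy X Y) > 0" "gauss (vx + vy) X Y > 0"
      using v vw by (auto intro!: gauss_pos pred_eq(2) mix_pos)
    have "gauss (vx + vy) X Y = gauss (vx + vy) 0 (Y - X)" by (simp add: gauss_def)
    then have "L (X, Y) = ln (gauss vy \<theta> Y / pred vx vy X Y)"
      unfolding pred_eq(1)[OF v] using pos by (simp add: L_def ln_div ln_mult vw_def)
    then have eq: "q (X, Y) * L (X, Y) - q (X, Y) + r (X, Y) = gauss vx \<theta> X * (gauss vy \<theta> Y * ln (gauss vy \<theta> Y / pred vx vy X Y) - gauss vy \<theta> Y + pred vx vy X Y)"
      by (simp add: q_def r_def algebra_simps)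
    show "0 \<le> q (X, Y) * L (X, Y) - q (X, Y) + r (X, Y)"
      unfolding eq using pos by (intro mult_nonneg_nonneg kl_nonneg) auto
    show "ennreal (gauss vx \<theta> X) * kl_term (gauss vy \<theta> Y) (pred vx vy X Y) = ennreal (q (X, Y) * L (X, Y) - q (X, Y) + r (X, Y))"
      unfolding eq using pos by (simp add: kl_term_def ennreal_mult kl_nonneg)
  qed
  have iF: "integrable (lborel \<Otimes>\<^sub>M lborel) (\<lambda>z. q z * L z - q z + r z)"
    by (intro Bochner_Integration.integrable_add Bochner_Integration.integrable_diff iqL iq)
  have IF: "(\<integral>z. q z * L z - q z + r z \<partial>(lborel \<Otimes>\<^sub>M lborel)) = (\<integral>z. L z \<partial>P)"
    by (simp add: iqL iq IqL Iq)
  have "risk vx vy \<theta> (pred vx vy) = (\<integral>\<^sup>+z. ennreal (q z * L z - q z + r z) \<partial>(lborel \<Otimes>\<^sub>M lborel))"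
    unfolding risk_def F by (subst lborel.nn_integral_fst[symmetric]) auto
  also have "\<dots> = ennreal (\<integral>z. q z * L z - q z + r z \<partial>(lborel \<Otimes>\<^sub>M lborel))"
    using F(2) by (intro nn_integral_eq_integral[OF iF] AE_I2) auto
  finally show "risk vx vy \<theta> (pred vx vy) = ennreal (constant_risk vx vy - mean_ln_mix \<theta> vw + mean_ln_mix \<theta> vx)"
    unfolding IF EL .
  have "0 \<le> (\<integral>z. q z * L z - q z + r z \<partial>(lborel \<Otimes>\<^sub>M lborel))"
    using F(2) by (intro Bochner_Integration.integral_nonneg) auto
  then show "0 \<le> constant_risk vx vy - mean_ln_mix \<theta> vw + mean_ln_mix \<theta> vx" unfolding IF EL .
qed

text \<open>Risk that is nowhere larger gives Bayes risk that is not larger, so the excess term of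
  \<open>integral_risk\<close> vanishes; finiteness of the Bayes risk is what permits the
  cancellation. Then the two predictive densities agree almost everywhere, and the risk does not
  distinguish them.\<close>

lemma risk_eqI:
  assumes v: "vx > 0" "vy > 0" and ph: "(\<lambda>(X, Y). ph X Y) \<in> borel_measurable borel" "\<And>X Y. ph X Y \<ge> 0"
    and fin: "(\<integral>\<^sup>+\<theta>. risk vx vy \<theta> (pred vx vy) \<partial>M) < \<infinity>"
    and le: "\<And>\<theta>. risk vx vy \<theta> ph \<le> risk vx vy \<theta> (pred vx vy)"
  shows "risk vx vy \<theta> ph = risk vx vy \<theta> (pred vx vy)"
proof -
  note [measurable (raw)] = measurable_curried[OF ph(1)]
  let ?R = "(\<integral>\<^sup>+X. \<integral>\<^sup>+Y. ennreal (mix vx X) * kl_term (pred vx vy X Y) (ph X Y) \<partial>lborel \<partial>lborel)"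
  have "(\<integral>\<^sup>+\<theta>. risk vx vy \<theta> (pred vx vy) \<partial>M) + ?R \<le> (\<integral>\<^sup>+\<theta>. risk vx vy \<theta> (pred vx vy) \<partial>M)"
    unfolding integral_risk[OF v ph, symmetric] by (intro nn_integral_mono le)
  then have "(\<integral>\<^sup>+\<theta>. risk vx vy \<theta> (pred vx vy) \<partial>M) + ?R \<le> (\<integral>\<^sup>+\<theta>. risk vx vy \<theta> (pred vx vy) \<partial>M) + 0"
    by simp
  then have "?R = 0"
    using fin by (subst (asm) ennreal_add_left_cancel_le) auto
  then have "AE X in lborel. (\<integral>\<^sup>+Y. ennreal (mix vx X) * kl_term (pred vx vy X Y) (ph X Y) \<partial>lborel) = 0"
    by (subst (asm) nn_integral_0_iff_AE) auto
  then have AE: "AE X in lborel. AE Y in lborel. ph X Y = pred vx vy X Y"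
  proof eventually_elim
    case (elim X)
    then have "AE Y in lborel. ennreal (mix vx X) * kl_term (pred vx vy X Y) (ph X Y) = 0"
      by (subst (asm) nn_integral_0_iff_AE) auto
    then show ?case
    proof eventually_elim
      case (elim Y)
      have p: "pred vx vy X Y > 0" "mix vx X > 0" using pred_eq(2)[OF v] mix_pos[OF v(1)] by auto
      with elim have "kl_term (pred vx vy X Y) (ph X Y) = 0" by simp
      then have n: "ph X Y \<noteq> 0" and le0: "pred vx vy X Y * ln (pred vx vy X Y / ph X Y) - pred vx vy X Y + ph X Y \<le> 0"
        by (auto simp: kl_term_def ennreal_eq_0_iff split: if_splits)
      have h: "ph X Y > 0" using n ph(2)[of X Y] by simp
      show ?case using kl_nonneg(2)[OF p(1) h antisym[OF le0 kl_nonneg(1)[OF p(1) h]]] by (rule sym)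
    qed
  qed
  show ?thesis
    unfolding risk_def
  proof (rule nn_integral_cong_AE)
    show "AE X in lborel. (\<integral>\<^sup>+Y. ennreal (gauss vx \<theta> X) * kl_term (gauss vy \<theta> Y) (ph X Y) \<partial>lborel) =
        (\<integral>\<^sup>+Y. ennreal (gauss vx \<theta> X) * kl_term (gauss vy \<theta> Y) (pred vx vy X Y) \<partial>lborel)"
      using AE
    proof eventually_elim
      case (elim X)
      then have "AE Y in lborel. ennreal (gauss vx \<theta> X) * kl_term (gauss vy \<theta> Y) (ph X Y) =
          ennreal (gauss vx \<theta> X) * kl_term (gauss vy \<theta> Y) (pred vx vy X Y)"
        by eventually_elim simp
      then show ?case by (rule nn_integral_cong_AE)
    qed
  qed
qed

end

text \<open>Any bound on the risk at all parameters bounds the Bayes risk under the normal prior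
  with variance \<open>s\<close>. That Bayes risk is explicit, and it falls short of the constant by
  n / 2 times ln ((s + vx) / (s + vw)), which tends to 0 as \<open>s\<close> grows.\<close>

lemma risk_lower_bound:
  fixes ph :: "'a::euclidean_space \<Rightarrow> 'a \<Rightarrow> real"
  assumes v: "vx > 0" "vy > 0" and ph: "(\<lambda>(X, Y). ph X Y) \<in> borel_measurable borel" "\<And>X Y. ph X Y \<ge> 0"
    and le: "\<And>\<theta>. risk vx vy \<theta> ph \<le> c"
  shows "ennreal (real DIM('a) / 2 * ln ((vx + vy) / vy)) \<le> c"
proof (rule tendsto_upperbound)
  define vw where "vw = vx * vy / (vx + vy)"
  have vw: "vw > 0" "vx + vy > 0" using v by (auto simp: vw_def)
  define n where "n = real DIM('a)"
  let ?b = "\<lambda>s. n / 2 * ln ((vx + vy) / vy) - n / 2 * ln ((s + vx) / (s + vw))"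
  have "((\<lambda>s. (s + vx) / (s + vw)) \<longlongrightarrow> 1) at_top"
  proof -
    have "((\<lambda>s. 1 + (vx - vw) / (s + vw)) \<longlongrightarrow> 1 + 0) at_top"
    proof (intro tendsto_add tendsto_const tendsto_divide_0[OF tendsto_const] filterlim_at_top_imp_at_infinity)
      show "LIM s at_top. s + vw :> at_top"
        by (rule filterlim_at_top_mono[OF filterlim_ident]) (use vw in simp)
    qed
    moreover have "eventually (\<lambda>s. 1 + (vx - vw) / (s + vw) = (s + vx) / (s + vw)) at_top"
      using eventually_gt_at_top[of 0] by eventually_elim (use vw in \<open>simp add: field_simps\<close>)
    ultimately show ?thesis by (simp add: tendsto_cong)
  qed
  then have "(?b \<longlongrightarrow> n / 2 * ln ((vx + vy) / vy) - n / 2 * ln 1) at_top"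
    by (intro tendsto_intros) auto
  then show "((\<lambda>s. ennreal (?b s)) \<longlongrightarrow> ennreal (real DIM('a) / 2 * ln ((vx + vy) / vy))) at_top"
    by (intro tendsto_ennrealI) (simp add: n_def)
  show "eventually (\<lambda>s. ennreal (?b s) \<le> c) at_top"
    using eventually_gt_at_top[of 0]
  proof eventually_elim
    case (elim s)
    then have s: "s > 0" .
    have ps: "prob_space (gauss_measure s (0::'a))" by (rule prob_space_gauss_measure[OF s])
    have em1: "emeasure (gauss_measure s (0::'a)) UNIV = 1" and m1: "measure (gauss_measure s (0::'a)) UNIV = 1"
      using prob_space.emeasure_space_1[OF ps] prob_space.prob_space[OF ps] by simp_all
    interpret gm: gauss_mixture "gauss_measure s (0::'a)"
      by (intro gauss_mixture.intro gauss_mixture_axioms.intro prob_space.finite_measure[OF ps]) (simp_all add: m1)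
    have mix: "gm.mix w z = gauss (s + w) 0 z" if w: "w > 0" for w z
    proof -
      have "ennreal (gm.mix w z) = (\<integral>\<^sup>+\<theta>. ennreal (gauss w \<theta> z) \<partial>gauss_measure s 0)"
        unfolding gm.mix_def using gm.integrable_mix(1)[OF w] by (subst nn_integral_eq_integral) auto
      also have "\<dots> = (\<integral>\<^sup>+\<theta>. ennreal (gauss s \<theta> 0 * gauss w \<theta> z) \<partial>lborel)"
        by (subst nn_integral_gauss_measure) (simp_all add: ennreal_mult gauss_def)
      also have "\<dots> = ennreal (gauss (s + w) 0 z)" by (rule gauss_conv[OF s w])
      finally show ?thesis using gm.mix_pos[OF w, of z] by (simp add: less_imp_le)
    qed
    have mlm: "gm.mean_ln_mix \<theta> w = - (n / 2) * ln (2 * pi * (s + w)) - ((norm \<theta>)\<^sup>2 + n * w) / (2 * (s + w))" if w: "w > 0" for w \<theta>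
    proof -
      have sw: "s + w > 0" using s w by simp
      have eq: "gauss w \<theta> z * ln (gm.mix w z) = (- (n / 2) * ln (2 * pi * (s + w))) * gauss w \<theta> z - (1 / (2 * (s + w))) * (gauss w \<theta> z * (norm z)\<^sup>2)" for z
        by (simp add: mix[OF w] ln_gauss[OF sw] n_def algebra_simps)
      note i = integrable_mult_right[OF integrable_gauss[OF w, of \<theta>]]
        integrable_mult_right[OF integral_gauss_second_moment(3)[OF w, of \<theta>]]
      show ?thesis
        unfolding gm.mean_ln_mix_def eq Bochner_Integration.integral_diff[OF i]
        by (simp add: integral_gauss[OF w] integral_gauss_second_moment(4)[OF w] n_def)
    qed
    let ?r = "\<lambda>\<theta>::'a. gm.constant_risk vx vy - gm.mean_ln_mix \<theta> vw + gm.mean_ln_mix \<theta> vx"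
    define A where "A = n / 2 * ln ((vx + vy) / vy) - n / 2 * ln ((s + vx) / (s + vw)) + n * vw / (2 * (s + vw)) - n * vx / (2 * (s + vx))"
    define B where "B = 1 / (2 * (s + vw)) - 1 / (2 * (s + vx))"
    have r_eq: "?r \<theta> = A + B * (norm \<theta>)\<^sup>2" for \<theta>
    proof -
      have "ln ((s + vx) / (s + vw)) = ln (2 * pi * (s + vx)) - ln (2 * pi * (s + vw))"
        using v vw s by (simp add: ln_div ln_mult)
      note L = this
      have "h * R - (- h * a' - (p + a) / c') + (- h * b' - (p + b) / d) =
          h * R - h * (b' - a') + a / c' - b / d + (1 / c' - 1 / d) * p" for h R a' b' p a b c' d :: real
        by (simp add: algebra_simps add_divide_distrib diff_divide_distrib)
      then show ?thesis unfolding mlm[OF vw(1)] mlm[OF v(1)] A_def B_def gm.constant_risk_def L n_def .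
    qed
    have i: "integrable (gauss_measure s 0) ?r" and I: "(\<integral>\<theta>. ?r \<theta> \<partial>gauss_measure s 0) = ?b s"
    proof -
      have n2: "integrable (gauss_measure s (0::'a)) (\<lambda>\<theta>. (norm \<theta>)\<^sup>2)" "(\<integral>\<theta>. (norm \<theta>)\<^sup>2 \<partial>gauss_measure s (0::'a)) = n * s"
        using integral_gauss_second_moment(3,4)[OF s, of "0::'a"]
        by (auto simp: integrable_gauss_measure_iff integral_gauss_measure n_def)
      show "integrable (gauss_measure s 0) ?r" unfolding r_eq using n2(1) by simp
      have "(\<integral>\<theta>. ?r \<theta> \<partial>gauss_measure s 0) = A + B * (n * s)"
        unfolding r_eq using n2 by (simp add: m1)
      also have "\<dots> = ?b s"
      proof -
        \<comment> \<open>Under the prior the mean of |\<theta>|^2 is \<open>n * s\<close>. The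
          quadratic parts at the two variances then both equal n / 2 and cancel.\<close>
        have "(1 / c' - 1 / d) * (n * s) + n * p / c' - n * r / d = n * ((s + p) / c') - n * ((s + r) / d)" for c' d p r
          by (simp add: algebra_simps add_divide_distrib diff_divide_distrib)
        then have "B * (n * s) + n * vw / (2 * (s + vw)) - n * vx / (2 * (s + vx)) =
            n * ((s + vw) / (2 * (s + vw))) - n * ((s + vx) / (2 * (s + vx)))"
          unfolding B_def .
        also have "\<dots> = 0" using s v vw by (simp del: distrib_left_numeral)
        finally show ?thesis unfolding A_def by linarith
      qed
      finally show "(\<integral>\<theta>. ?r \<theta> \<partial>gauss_measure s 0) = ?b s" .
    qed
    have "ennreal (?b s) = (\<integral>\<^sup>+\<theta>. ennreal (?r \<theta>) \<partial>gauss_measure s 0)"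
      unfolding I[symmetric] using gm.risk_pred(2)[OF v, folded vw_def]
      by (intro nn_integral_eq_integral[OF i, symmetric]) auto
    also have "\<dots> = (\<integral>\<^sup>+\<theta>. risk vx vy \<theta> (gm.pred vx vy) \<partial>gauss_measure s 0)"
      by (simp add: gm.risk_pred(1)[OF v] vw_def)
    also have "\<dots> \<le> (\<integral>\<^sup>+\<theta>. risk vx vy \<theta> ph \<partial>gauss_measure s 0)"
      unfolding gm.integral_risk[OF v ph] by simp
    also have "\<dots> \<le> (\<integral>\<^sup>+\<theta>. c \<partial>gauss_measure s (0::'a))" by (intro nn_integral_mono le)
    also have "\<dots> = c" by (simp add: em1)
    finally show ?case .
  qed
qed simp

section \<open>The extended-real loss and risk as integrals of nonnegative terms\<close>

lemma sq_norm_eq: "sq_norm A = (norm A)\<^sup>2" for A :: "real ^ 'q ^ 'r"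
  unfolding sq_norm_def trace_def power2_norm_eq_inner inner_vec_def
  by (simp add: matrix_matrix_mult_def transpose_def)

lemma normal_dens_eq_gauss: "normal_dens v \<Theta> X = gauss v \<Theta> X" for X :: "real ^ 'q ^ 'r"
  by (simp add: normal_dens_def gauss_def sq_norm_eq mult.commute)

text \<open>\<open>e2ennreal\<close> extracts positive and negative parts, so the identity is
  rearranged to avoid subtraction. The second claim shows that the negative part of the loss has
  integral at most 1, hence can be cancelled.\<close>

lemma kl_integrand_kl_term:
  assumes "p > 0" "h \<ge> 0"
  shows "e2ennreal (kl_integrand p h) + ennreal h = kl_term p h + e2ennreal (- kl_integrand p h) + ennreal p"
    and "e2ennreal (- kl_integrand p h) \<le> ennreal h"
proof -
  have "e2ennreal (kl_integrand p h) + ennreal h = kl_term p h + e2ennreal (- kl_integrand p h) + ennreal p \<and>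
    e2ennreal (- kl_integrand p h) \<le> ennreal h"
  proof (cases "h = 0")
    case True
    then show ?thesis
      by (simp add: kl_integrand_def kl_term_def e2ennreal_neg)
  next
    case False
    then have h: "h > 0" using assms by simp
    note k = kl_nonneg(1)[OF assms(1) h]
    define x where "x = p * ln (p / h)"
    have x: "kl_integrand p h = ereal x" using h by (simp add: kl_integrand_def x_def)
    have kx: "0 \<le> x - p + h" using k by (simp add: x_def)
    have e: "e2ennreal (ereal y) = ennreal y" for y by (simp add: ennreal.abs_eq[symmetric] ennreal_def e2ennreal_def max_def)
    have "ennreal x + ennreal h = ennreal (x - p + h) + ennreal (- x) + ennreal p"
    proof (cases "x \<ge> 0")
      case True
      then show ?thesis using kx h assms by (simp add: ennreal_plus[symmetric] ennreal_neg del: ennreal_plus)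
    next
      case False
      then show ?thesis using kx h assms by (simp add: ennreal_plus[symmetric] ennreal_neg del: ennreal_plus)
    qed
    moreover have "ennreal (- x) \<le> ennreal h" using kx assms by (intro ennreal_leI) simp
    ultimately show ?thesis using h by (simp add: x e kl_term_def x_def)
  qed
  then show "e2ennreal (kl_integrand p h) + ennreal h = kl_term p h + e2ennreal (- kl_integrand p h) + ennreal p"
    and "e2ennreal (- kl_integrand p h) \<le> ennreal h" by auto
qed

lemma KL_loss_eq:
  fixes ph :: "real ^ 'q ^ 'r \<Rightarrow> real"
  assumes v: "v > 0" and [measurable]: "ph \<in> borel_measurable borel" and nn: "\<And>Y. ph Y \<ge> 0"
    and one: "(\<integral>\<^sup>+Y. ennreal (ph Y) \<partial>lborel) = 1"
  shows "KL_loss v \<Theta> ph = enn2ereal (\<integral>\<^sup>+Y. kl_term (gauss v \<Theta> Y) (ph Y) \<partial>lborel)"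
proof -
  define k where "k Y = kl_integrand (gauss v \<Theta> Y) (ph Y)" for Y
  have [measurable]: "k \<in> borel_measurable borel"
    unfolding k_def kl_integrand_def by measurable
  define P N I where "P = (\<integral>\<^sup>+Y. e2ennreal (k Y) \<partial>lborel)" and "N = (\<integral>\<^sup>+Y. e2ennreal (- k Y) \<partial>lborel)"
    and "I = (\<integral>\<^sup>+Y. kl_term (gauss v \<Theta> Y) (ph Y) \<partial>lborel)"
  have g: "e2ennreal (k Y) + ennreal (ph Y) = kl_term (gauss v \<Theta> Y) (ph Y) + e2ennreal (- k Y) + ennreal (gauss v \<Theta> Y)"
    "e2ennreal (- k Y) \<le> ennreal (ph Y)" for Y
    unfolding k_def by (rule kl_integrand_kl_term[OF gauss_pos[OF v] nn])+
  have "N \<le> (\<integral>\<^sup>+Y. ennreal (ph Y) \<partial>lborel)" unfolding N_def by (intro nn_integral_mono g(2))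
  then have N: "N < \<top>" using one by (metis ennreal_one_less_top order_le_less_trans)
  have "P + 1 = (\<integral>\<^sup>+Y. e2ennreal (k Y) + ennreal (ph Y) \<partial>lborel)"
    unfolding P_def one[symmetric] by (rule nn_integral_add[symmetric]) measurable
  also have "\<dots> = (\<integral>\<^sup>+Y. (kl_term (gauss v \<Theta> Y) (ph Y) + e2ennreal (- k Y)) + ennreal (gauss v \<Theta> Y) \<partial>lborel)"
    by (intro nn_integral_cong g(1))
  also have "\<dots> = (I + N) + 1"
    unfolding I_def N_def nn_integral_gauss[OF v, of \<Theta>, symmetric]
    by (subst nn_integral_add, measurable)+
  finally have "1 + P = 1 + (I + N)" by (simp only: add.commute)
  then have PIN: "P = I + N" by (simp add: ennreal_add_left_cancel)
  have "KL_loss v \<Theta> ph = enn2ereal P - enn2ereal N"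
    by (simp add: KL_loss_def ext_integral_def normal_dens_eq_gauss k_def P_def N_def)
  also have "\<dots> = enn2ereal I"
    unfolding PIN using N by (cases I; cases N) (auto simp: plus_ennreal.rep_eq)
  finally show ?thesis by (simp add: I_def)
qed

lemma KL_risk_eq:
  fixes ph :: "real ^ 'q ^ 'r \<Rightarrow> real ^ 'q ^ 'r \<Rightarrow> real"
  assumes v: "vx > 0" "vy > 0" and ph: "predictive_density ph"
  shows "KL_risk vx vy \<Theta> ph = enn2ereal (risk vx vy \<Theta> ph)"
proof -
  have m: "(\<lambda>(X, Y). ph X Y) \<in> borel_measurable borel" and nn: "\<And>X Y. 0 \<le> ph X Y"
    and one: "\<And>X. (\<integral>\<^sup>+ Y. ennreal (ph X Y) \<partial>lborel) = 1"
    using ph by (auto simp: predictive_density_def)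
  have m1: "(\<lambda>x. ph (f x) (g x)) \<in> borel_measurable N"
    if "f \<in> borel_measurable N" "g \<in> borel_measurable N" for f g and N :: "'c measure"
    using measurable_compose[of "\<lambda>x. (f x, g x)" N borel "\<lambda>(X, Y). ph X Y"] m that
    unfolding borel_prod[symmetric] by simp
  have m2: "ph X \<in> borel_measurable borel" for X
    using measurable_compose[of "\<lambda>Y. (X, Y)" borel borel "\<lambda>(X, Y). ph X Y"] m
    unfolding borel_prod[symmetric] by simp
  let ?I = "\<lambda>X. \<integral>\<^sup>+Y. kl_term (gauss vy \<Theta> Y) (ph X Y) \<partial>lborel"
  have eq: "ereal (normal_dens vx \<Theta> X) * KL_loss vy \<Theta> (ph X) = enn2ereal (ennreal (gauss vx \<Theta> X) * ?I X)" for X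
    using m2 by (simp add: KL_loss_eq v nn one normal_dens_eq_gauss times_ennreal.rep_eq)
  have "e2ennreal (- enn2ereal x) = 0" for x by (simp add: e2ennreal_neg)
  then have "KL_risk vx vy \<Theta> ph = enn2ereal (\<integral>\<^sup>+X. ennreal (gauss vx \<Theta> X) * ?I X \<partial>lborel)"
    unfolding KL_risk_def ext_integral_def eq by (simp add: zero_ennreal.rep_eq)
  also have "(\<integral>\<^sup>+X. ennreal (gauss vx \<Theta> X) * ?I X \<partial>lborel) = risk vx vy \<Theta> ph"
    unfolding risk_def
    by (intro nn_integral_cong nn_integral_cmult[symmetric] measurable_kl_term measurable_gauss)
      (simp_all add: m2)
  finally show ?thesis .
qed

lemma admissible_minimax_pred:
  fixes M :: "(real ^ 'q ^ 'r) measure"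
  assumes M: "gauss_mixture M" and v: "vx > 0" "vy > 0"
    and phat: "\<And>X Y. phat X Y = gauss_mixture.pred M vx vy X Y"
    and cond: "\<And>v z. 0 < v \<Longrightarrow> v \<le> vx \<Longrightarrow>
      2 * gauss_mixture.mix M v z * (gauss_mixture.mix2 M v z - real DIM(real ^ 'q ^ 'r) * v * gauss_mixture.mix M v z)
        \<le> (\<Sum>e\<in>Basis. (gauss_mixture.mix1 M v z e)\<^sup>2)"
  shows "admissible vx vy phat \<and> minimax vx vy phat"
proof -
  interpret gauss_mixture M by (rule M)
  have phat_eq: "phat = pred vx vy" using phat by (simp add: fun_eq_iff)
  have pd: "predictive_density phat"
    unfolding predictive_density_def phat_eq
    using measurable_pred_prod less_imp_le[OF pred_eq(2)[OF v]] nn_integral_pred[OF v] by auto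
  have R: "KL_risk vx vy \<Theta> pt = enn2ereal (risk vx vy \<Theta> pt)" if "predictive_density pt" for \<Theta> and pt :: "real ^ 'q ^ 'r \<Rightarrow> real ^ 'q ^ 'r \<Rightarrow> real"
    by (rule KL_risk_eq[OF v that])
  have vw: "0 < vx * vy / (vx + vy)" "vx * vy / (vx + vy) \<le> vx"
    using v by (auto simp: pos_divide_le_eq)
  \<comment> \<open>In \<open>risk_pred\<close> the two logarithmic means have the ordered variances
    vw \<le> vx, so their antitonicity in the variance leaves at most the constant.\<close>
  have le: "risk vx vy \<Theta> (pred vx vy) \<le> ennreal (constant_risk vx vy)" for \<Theta>
    unfolding risk_pred(1)[OF v]
    using mean_ln_mix_antimono[OF vw, of \<Theta>] cond vw(1) by (intro ennreal_leI) (simp add: order_less_le_trans)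
  have fin: "(\<integral>\<^sup>+\<theta>. risk vx vy \<theta> (pred vx vy) \<partial>M) < \<infinity>"
  proof -
    have "(\<integral>\<^sup>+\<theta>. risk vx vy \<theta> (pred vx vy) \<partial>M) \<le> (\<integral>\<^sup>+\<theta>. ennreal (constant_risk vx vy) \<partial>M)"
      by (intro nn_integral_mono le)
    also have "\<dots> < \<infinity>" by (simp add: ennreal_mult_less_top emeasure_eq_measure)
    finally show ?thesis .
  qed
  have "admissible vx vy phat"
    unfolding admissible_def
  proof (intro conjI pd notI, elim exE conjE)
    fix pt :: "real ^ 'q ^ 'r \<Rightarrow> real ^ 'q ^ 'r \<Rightarrow> real" and \<Theta>
    assume pt: "predictive_density pt" and le: "\<forall>\<Theta>. KL_risk vx vy \<Theta> pt \<le> KL_risk vx vy \<Theta> phat"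
      and less: "KL_risk vx vy \<Theta> pt < KL_risk vx vy \<Theta> phat"
    have "risk vx vy \<Theta> pt = risk vx vy \<Theta> (pred vx vy)"
    proof (rule risk_eqI[OF v _ _ fin])
      show "risk vx vy \<theta> pt \<le> risk vx vy \<theta> (pred vx vy)" for \<theta>
        using le R[OF pt] R[OF pd] by (simp add: phat_eq less_eq_ennreal.rep_eq)
    qed (use pt in \<open>auto simp: predictive_density_def\<close>)
    then show False using less R[OF pt] R[OF pd] by (simp add: phat_eq)
  qed
  moreover have "minimax vx vy phat"
    unfolding minimax_def
  proof (intro conjI pd antisym)
    show "(INF pt\<in>{pt :: real ^ 'q ^ 'r \<Rightarrow> real ^ 'q ^ 'r \<Rightarrow> real. predictive_density pt}. SUP \<Theta>. KL_risk vx vy \<Theta> pt)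
        \<le> (SUP \<Theta>. KL_risk vx vy \<Theta> phat)"
      using pd by (intro INF_lower) auto
    have "(SUP \<Theta>. KL_risk vx vy \<Theta> phat) \<le> enn2ereal (ennreal (constant_risk vx vy))"
      using le by (intro SUP_least) (simp add: R[OF pd] less_eq_ennreal.rep_eq[symmetric], simp add: phat_eq)
    also have "\<dots> \<le> (INF pt\<in>{pt :: real ^ 'q ^ 'r \<Rightarrow> real ^ 'q ^ 'r \<Rightarrow> real. predictive_density pt}. SUP \<Theta>. KL_risk vx vy \<Theta> pt)"
    proof (intro INF_greatest)
      fix pt :: "real ^ 'q ^ 'r \<Rightarrow> real ^ 'q ^ 'r \<Rightarrow> real" assume "pt \<in> {pt. predictive_density pt}"
      then have pt: "predictive_density pt" by simp
      define S where "S = (SUP \<Theta>. KL_risk vx vy \<Theta> pt)"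
      have S: "enn2ereal (risk vx vy \<Theta> pt) \<le> S" for \<Theta>
        unfolding S_def R[OF pt, symmetric] by (rule SUP_upper) simp
      then have S0: "0 \<le> S" using enn2ereal_nonneg order_trans by blast
      have "ennreal (constant_risk vx vy) \<le> e2ennreal S"
        unfolding constant_risk_def
      proof (rule risk_lower_bound[OF v])
        show "risk vx vy \<Theta> pt \<le> e2ennreal S" for \<Theta>
          using e2ennreal_mono[OF S[of \<Theta>]] by simp
      qed (use pt in \<open>auto simp: predictive_density_def\<close>)
      then show "enn2ereal (ennreal (constant_risk vx vy)) \<le> (SUP \<Theta>. KL_risk vx vy \<Theta> pt)"
        unfolding S_def[symmetric] less_eq_ennreal.rep_eq using S0 by (simp add: enn2ereal_e2ennreal)
    qed
    finally show "(SUP \<Theta>. KL_risk vx vy \<Theta> phat) \<le> (INF pt\<in>{pt :: real ^ 'q ^ 'r \<Rightarrow> real ^ 'q ^ 'r \<Rightarrow> real. predictive_density pt}. SUP \<Theta>. KL_risk vx vy \<Theta> pt)" .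
  qed
  ultimately show ?thesis by simp
qed

section \<open>Positive definite matrices and determinants\<close>

lemma matrix_sub_ldistrib: "A ** (B - C) = A ** B - A ** (C :: real ^ 'p ^ 'm)" for A :: "real ^ 'm ^ 'n"
  by (vector matrix_matrix_mult_def sum_subtractf right_diff_distrib)

lemma matrix_sub_rdistrib: "(A - B) ** C = A ** C - B ** (C :: real ^ 'p ^ 'm)" for A :: "real ^ 'm ^ 'n"
  by (vector matrix_matrix_mult_def sum_subtractf left_diff_distrib)

lemma matrix_add_rdistrib: "(A + B) ** C = A ** C + B ** (C :: real ^ 'p ^ 'm)" for A :: "real ^ 'm ^ 'n"
  by (vector matrix_matrix_mult_def sum.distrib distrib_right)

lemma matrix_minus_mult: "A ** (- B) = - (A ** (B :: real ^ 'p ^ 'm))" "(- A) ** B = - (A ** B)" for A :: "real ^ 'm ^ 'n"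
  by (vector matrix_matrix_mult_def sum_negf)+

lemma matrix_scaleR_mult: "(c *\<^sub>R A) ** B = c *\<^sub>R (A ** (B :: real ^ 'p ^ 'm))" "A ** (c *\<^sub>R B) = c *\<^sub>R (A ** B)"
  for A :: "real ^ 'm ^ 'n"
  by (simp_all add: vec_eq_iff matrix_matrix_mult_def sum_distrib_left mult_ac)

lemmas matrix_ring = matrix_add_ldistrib matrix_add_rdistrib matrix_sub_ldistrib matrix_sub_rdistrib
  matrix_minus_mult matrix_scaleR_mult matrix_mul_assoc scaleR_add_right scaleR_diff_right

lemma transpose_linear:
  "transpose (A + B) = transpose A + transpose (B :: real ^ 'm ^ 'n)"
  "transpose (A - B) = transpose A - transpose B"
  by (simp_all add: transpose_def vec_eq_iff)

lemma trace_scaleR: "trace (c *\<^sub>R A) = c * trace (A :: real ^ 'n ^ 'n)"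
  by (simp add: trace_def sum_distrib_left)

lemma matrix_inner_left: "(A ** X) \<bullet> Y = X \<bullet> (transpose A ** Y)" for A :: "real ^ 'm ^ 'n" and X :: "real ^ 'p ^ 'm"
proof -
  have "(A ** X) \<bullet> Y = (\<Sum>i\<in>UNIV. \<Sum>j\<in>UNIV. \<Sum>k\<in>UNIV. A$i$k * X$k$j * Y$i$j)"
    by (simp add: inner_vec_def matrix_matrix_mult_def sum_distrib_right)
  also have "\<dots> = (\<Sum>i\<in>UNIV. \<Sum>k\<in>UNIV. \<Sum>j\<in>UNIV. A$i$k * X$k$j * Y$i$j)"
    by (intro sum.cong refl, subst sum.swap) simp
  also have "\<dots> = (\<Sum>k\<in>UNIV. \<Sum>i\<in>UNIV. \<Sum>j\<in>UNIV. A$i$k * X$k$j * Y$i$j)"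
    by (rule sum.swap)
  also have "\<dots> = (\<Sum>k\<in>UNIV. \<Sum>j\<in>UNIV. \<Sum>i\<in>UNIV. A$i$k * X$k$j * Y$i$j)"
    by (intro sum.cong refl, subst sum.swap) simp
  also have "\<dots> = X \<bullet> (transpose A ** Y)"
    by (simp add: inner_vec_def matrix_matrix_mult_def sum_distrib_left transpose_def mult_ac)
  finally show ?thesis .
qed

lemma trace_mult_inner: "trace (A ** B) = A \<bullet> transpose (B :: real ^ 'n ^ 'm)" for A :: "real ^ 'm ^ 'n"
  by (simp add: trace_def inner_vec_def matrix_matrix_mult_def transpose_def)

lemma trace_mult_transpose: "trace (A ** (X ** transpose Y)) = (A ** X) \<bullet> Y" for A :: "real ^ 'n ^ 'n" and X :: "real ^ 'q ^ 'n"
  by (simp add: matrix_mul_assoc trace_mult_inner)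

lemma trace_transpose: "trace (transpose A) = trace (A :: real ^ 'n ^ 'n)"
  by (simp add: trace_def transpose_def)

lemma column_matrix_mult: "column j (A ** X) = A *v column j X" for A :: "real ^ 'm ^ 'n" and X :: "real ^ 'p ^ 'm"
  by (simp add: column_def vec_eq_iff matrix_matrix_mult_def matrix_vector_mult_def)

lemma inner_columns: "X \<bullet> Y = (\<Sum>j\<in>UNIV. column j X \<bullet> column j (Y :: real ^ 'q ^ 'r))"
  by (simp add: inner_vec_def column_def) (rule sum.swap)

lemma matrix_inv_mult:
  fixes A :: "real ^ 'n ^ 'n" assumes "det A \<noteq> 0"
  shows "A ** matrix_inv A = mat 1" "matrix_inv A ** A = mat 1"
proof -
  have "\<exists>A'. A ** A' = mat 1 \<and> A' ** A = mat 1"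
    using assms invertible_det_nz[of A] by (simp add: invertible_def)
  from someI_ex[OF this] show "A ** matrix_inv A = mat 1" "matrix_inv A ** A = mat 1"
    by (simp_all add: matrix_inv_def)
qed

lemma matrix_inv_unique:
  fixes A :: "real ^ 'n ^ 'n" assumes "A ** B = mat 1"
  shows "matrix_inv A = B" "det A \<noteq> 0"
proof -
  have "det A * det B = 1" using assms by (metis det_I det_mul)
  then show d: "det A \<noteq> 0" by auto
  show "matrix_inv A = B"
    by (metis matrix_inv_mult(2)[OF d] assms matrix_mul_assoc matrix_mul_lid matrix_mul_rid)
qed

lemma det_matrix_inv: "det A \<noteq> 0 \<Longrightarrow> det (matrix_inv A) = 1 / det (A :: real ^ 'n ^ 'n)"
  by (metis det_I det_mul matrix_inv_mult(1) nonzero_mult_div_cancel_left)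

lemma det_scaleR: "det (c *\<^sub>R A) = c ^ CARD('n) * det (A :: real ^ 'n ^ 'n)"
proof -
  have "det (c *\<^sub>R A) = det (\<chi> i. c *s (A $ i))"
    by (intro arg_cong[where f = det]) (simp add: vec_eq_iff)
  also have "\<dots> = (\<Prod>i\<in>(UNIV :: 'n set). c) * det (\<chi> i. A $ i)" by (rule det_rows_mul)
  finally show ?thesis by simp
qed

lemma transpose_matrix_inv:
  fixes A :: "real ^ 'n ^ 'n" assumes "det A \<noteq> 0"
  shows "transpose (matrix_inv A) = matrix_inv (transpose A)"
  using assms by (intro matrix_inv_unique(1)[symmetric])
    (simp add: matrix_transpose_mul[symmetric] matrix_inv_mult)

text \<open>Cramer's rule exhibits the entries as quotients of polynomials, from which continuity,
  measurability and the boundedness of \<open>det A * matrix_inv A\<close> are drawn.\<close>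

lemma matrix_inv_entry:
  fixes A :: "real ^ 'n ^ 'n" assumes "det A \<noteq> 0"
  shows "matrix_inv A $ i $ j = det (\<chi> k l. if l = i then (axis j 1 :: real ^ 'n) $ k else A $ k $ l) / det A"
proof -
  have "A *v (matrix_inv A *v axis j 1) = axis j 1"
    using assms by (simp add: matrix_vector_mul_assoc matrix_inv_mult)
  then have "matrix_inv A *v axis j 1 = (\<chi> k. det (\<chi> k' l. if l = k then (axis j 1 :: real ^ 'n) $ k' else A $ k' $ l) / det A)"
    by (simp add: cramer[OF assms])
  then have "(matrix_inv A *v axis j 1) $ i = det (\<chi> k l. if l = i then (axis j 1 :: real ^ 'n) $ k else A $ k $ l) / det A"
    by simp
  then show ?thesis by (simp add: matrix_vector_mult_basis column_def)
qed

section \<open>Continuity and derivatives of determinants and inverses\<close>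

lemma tendsto_det:
  fixes f :: "'a \<Rightarrow> real ^ 'n ^ 'n" assumes "(f \<longlongrightarrow> A) F"
  shows "((\<lambda>x. det (f x)) \<longlongrightarrow> det A) F"
  unfolding det_def by (intro tendsto_intros tendsto_vec_nth assms)

lemma continuous_on_det [continuous_intros]:
  fixes f :: "'a::topological_space \<Rightarrow> real ^ 'n ^ 'n"
  shows "continuous_on S f \<Longrightarrow> continuous_on S (\<lambda>x. det (f x))"
  unfolding continuous_on_def by (auto intro: tendsto_det)

lemma continuous_on_transpose [continuous_intros]:
  fixes f :: "'a::topological_space \<Rightarrow> real ^ 'm ^ 'n"
  shows "continuous_on S f \<Longrightarrow> continuous_on S (\<lambda>x. transpose (f x))"
  unfolding transpose_def by (intro continuous_intros)

lemma tendsto_matrix_mult: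
  fixes f :: "'a \<Rightarrow> real ^ 'm ^ 'n" and g :: "'a \<Rightarrow> real ^ 'p ^ 'm"
  assumes "(f \<longlongrightarrow> A) F" "(g \<longlongrightarrow> B) F"
  shows "((\<lambda>x. f x ** g x) \<longlongrightarrow> A ** B) F"
  unfolding matrix_matrix_mult_def by (intro tendsto_intros tendsto_vec_nth assms)

lemma continuous_on_matrix_mult [continuous_intros]:
  fixes f :: "'a::topological_space \<Rightarrow> real ^ 'm ^ 'n" and g :: "'a \<Rightarrow> real ^ 'p ^ 'm"
  shows "continuous_on S f \<Longrightarrow> continuous_on S g \<Longrightarrow> continuous_on S (\<lambda>x. f x ** g x)"
  unfolding continuous_on_def by (auto intro: tendsto_matrix_mult)

lemma tendsto_matrix_inv:
  fixes f :: "'a \<Rightarrow> real ^ 'n ^ 'n"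
  assumes f: "(f \<longlongrightarrow> A) F" and d: "det A \<noteq> 0"
  shows "((\<lambda>x. matrix_inv (f x)) \<longlongrightarrow> matrix_inv A) F"
proof -
  have ev: "eventually (\<lambda>x. det (f x) \<noteq> 0) F"
    using tendsto_imp_eventually_ne[OF tendsto_det[OF f] d] .
  define g where "g B = (\<chi> i j. det (\<chi> k l. if l = i then (axis j 1 :: real ^ 'n) $ k else B $ k $ l) / det B)" for B :: "real ^ 'n ^ 'n"
  have g: "det B \<noteq> 0 \<Longrightarrow> matrix_inv B = g B" for B by (simp add: vec_eq_iff g_def matrix_inv_entry)
  have "((\<lambda>x. g (f x)) \<longlongrightarrow> g A) F"
    unfolding g_def
  proof (intro tendsto_intros tendsto_det tendsto_vec_lambda f d)
    show "((\<lambda>x. if l = i then (axis j 1 :: real ^ 'n) $ k else f x $ k $ l) \<longlongrightarrow> (if l = i then axis j 1 $ k else A $ k $ l)) F" for i j k l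
      by (auto intro!: tendsto_intros tendsto_vec_nth f)
  qed
  moreover have "eventually (\<lambda>x. g (f x) = matrix_inv (f x)) F"
    using ev by eventually_elim (simp add: g)
  ultimately show ?thesis unfolding g[OF d] by (rule Lim_transform_eventually)
qed

lemma continuous_on_matrix_inv [continuous_intros]:
  fixes f :: "'a::topological_space \<Rightarrow> real ^ 'n ^ 'n"
  shows "continuous_on S f \<Longrightarrow> (\<And>x. x \<in> S \<Longrightarrow> det (f x) \<noteq> 0) \<Longrightarrow> continuous_on S (\<lambda>x. matrix_inv (f x))"
  unfolding continuous_on_def by (auto intro: tendsto_matrix_inv)

text \<open>In the Leibniz expansion, the derivative of a product at 0 keeps one factor and
  evaluates the others at the identity matrix. They vanish unless the permutation fixes every other
  index, and then it fixes the remaining one too.\<close>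

lemma deriv_det_id:
  fixes B :: "real ^ 'n ^ 'n"
  shows "((\<lambda>t. det (mat 1 + t *\<^sub>R B)) has_real_derivative trace B) (at 0)"
proof -
  let ?P = "{p. p permutes (UNIV :: 'n set)}"
  let ?e = "\<lambda>i j. (mat 1 :: real ^ 'n ^ 'n) $ i $ j"
  have d: "((\<lambda>t. det (mat 1 + t *\<^sub>R B)) has_real_derivative
     (\<Sum>p\<in>?P. of_int (sign p) * (\<Sum>i\<in>UNIV. B $ i $ p i * (\<Prod>j\<in>UNIV - {i}. ?e j (p j) + 0 * B $ j $ p j)))) (at 0)"
    unfolding det_def
  proof (intro DERIV_sum DERIV_cmult)
    fix p assume "p \<in> ?P"
    have "((\<lambda>t. \<Prod>i\<in>UNIV. ?e i (p i) + t * B $ i $ p i) has_real_derivative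
        (\<Sum>i\<in>UNIV. B $ i $ p i * (\<Prod>j\<in>UNIV - {i}. ?e j (p j) + 0 * B $ j $ p j))) (at 0)"
      by (rule has_field_derivative_prod) (auto intro!: derivative_eq_intros)
    then show "((\<lambda>t. \<Prod>i\<in>UNIV. (mat 1 + t *\<^sub>R B) $ i $ p i) has_real_derivative
        (\<Sum>i\<in>UNIV. B $ i $ p i * (\<Prod>j\<in>UNIV - {i}. ?e j (p j) + 0 * B $ j $ p j))) (at 0)"
      by simp
  qed
  have zero: "(\<Prod>j\<in>UNIV - {i}. ?e j (p j) + 0 * B $ j $ p j) = 0" if "p \<in> ?P - {id}" for p i
  proof -
    have p: "p permutes UNIV" "p \<noteq> id" using that by auto
    have "\<exists>j. j \<noteq> i \<and> p j \<noteq> j"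
    proof (rule ccontr)
      assume "\<not> ?thesis"
      then have fx: "\<And>j. j \<noteq> i \<Longrightarrow> p j = j" by auto
      have "p i = i"
      proof (rule ccontr)
        assume "p i \<noteq> i"
        then have "p (p i) = p i" by (rule fx)
        then show False using permutes_inj[OF p(1)] \<open>p i \<noteq> i\<close> by (simp add: inj_eq)
      qed
      then show False using fx p(2) by (metis eq_id_iff)
    qed
    then obtain j where "j \<noteq> i" "p j \<noteq> j" by blast
    then show ?thesis by (intro prod_zero bexI[of _ j]) (auto simp: mat_def)
  qed
  have "(\<Sum>p\<in>?P. of_int (sign p) * (\<Sum>i\<in>UNIV. B $ i $ p i * (\<Prod>j\<in>UNIV - {i}. ?e j (p j) + 0 * B $ j $ p j))) =
     (\<Sum>p\<in>{id}. of_int (sign p) * (\<Sum>i\<in>UNIV. B $ i $ p i * (\<Prod>j\<in>UNIV - {i}. ?e j (p j) + 0 * B $ j $ p j)))"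
  proof (rule sum.mono_neutral_right)
    show "\<forall>p\<in>?P - {id}. of_int (sign p) * (\<Sum>i\<in>UNIV. B $ i $ p i * (\<Prod>j\<in>UNIV - {i}. ?e j (p j) + 0 * B $ j $ p j)) = 0"
      by (intro ballI) (simp only: zero mult_zero_right sum.neutral_const)
  qed (auto simp: finite_permutations permutes_id)
  also have "\<dots> = trace B" by (simp add: trace_def mat_def sign_id)
  finally show ?thesis using d by simp
qed

text \<open>Jacobi's formula, obtained at the identity after factoring out \<open>A\<close>.\<close>

lemma deriv_det:
  fixes A H :: "real ^ 'n ^ 'n"
  assumes d: "det A \<noteq> 0"
  shows "((\<lambda>t. det (A + t *\<^sub>R H)) has_real_derivative det A * trace (matrix_inv A ** H)) (at 0)"
proof -
  have "det (A + t *\<^sub>R H) = det A * det (mat 1 + t *\<^sub>R (matrix_inv A ** H))" for t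
  proof -
    have "A + t *\<^sub>R H = A ** (mat 1 + t *\<^sub>R (matrix_inv A ** H))"
      by (simp add: matrix_ring matrix_inv_mult[OF d])
    then show ?thesis by (simp add: det_mul)
  qed
  then show ?thesis using DERIV_cmult[OF deriv_det_id, of "det A" "matrix_inv A ** H"] by simp
qed

section \<open>Positive definite and semidefinite matrices\<close>

definition psd :: "real ^ 'n ^ 'n \<Rightarrow> bool" where
  "psd A \<longleftrightarrow> transpose A = A \<and> (\<forall>x. 0 \<le> x \<bullet> (A *v x))"

lemma pos_def_psd: "pos_def A \<Longrightarrow> psd A"
  unfolding pos_def_def psd_def by (metis inner_zero_left less_le order_refl)

lemma psd_trace_nonneg: assumes "psd A" shows "0 \<le> trace A"
proof -
  have "A $ i $ i = axis i 1 \<bullet> (A *v axis i 1)" for i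
    by (simp add: matrix_vector_mult_basis column_def inner_axis')
  then show ?thesis using assms unfolding trace_def psd_def by (metis (no_types, lifting) sum_nonneg)
qed

lemma pos_def_det_nonzero:
  assumes "pos_def A" shows "det A \<noteq> 0"
proof -
  have "\<forall>x. A *v x = 0 \<longrightarrow> x = 0" using assms by (metis inner_zero_right less_irrefl pos_def_def)
  then obtain B where "B ** A = mat 1" using matrix_left_invertible_ker[of A] by auto
  then show ?thesis by (metis det_I det_mul mult_zero_right zero_neq_one)
qed

text \<open>Suppose the form vanishes at \<open>x\<close> and put \<open>y = A *v x\<close>. At
  \<open>x + t *\<^sub>R y\<close> the form equals 2 t |y|^2 + t^2 c, which is negative for small
  negative \<open>t\<close> unless \<open>y\<close> is 0, and \<open>y = 0\<close> contradicts
  invertibility.\<close>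

lemma psd_det_nonzero_pos_def:
  assumes A: "psd A" and d: "det A \<noteq> 0" shows "pos_def A"
  unfolding pos_def_def
proof (intro conjI allI impI)
  show sym: "transpose A = A" using A by (simp add: psd_def)
  fix x :: "real ^ 'a" assume x: "x \<noteq> 0"
  have nn: "0 \<le> y \<bullet> (A *v y)" for y using A by (simp add: psd_def)
  have "x \<bullet> (A *v x) \<noteq> 0"
  proof
    assume 0: "x \<bullet> (A *v x) = 0"
    define y where "y = A *v x"
    define c where "c = y \<bullet> (A *v y)"
    have c: "c \<ge> 0" using nn by (simp add: c_def)
    define t where "t = - 1 / (c + 1)"
    have sw: "x \<bullet> (A *v y) = y \<bullet> y"
      unfolding y_def by (metis dot_lmul_matrix inner_commute sym transpose_matrix_vector y_def)
    have "(x + t *\<^sub>R y) \<bullet> (A *v (x + t *\<^sub>R y)) = x \<bullet> (A *v x) + t * (x \<bullet> (A *v y)) + t * (y \<bullet> (A *v x)) + t * t * c"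
      by (simp add: matrix_vector_right_distrib matrix_vector_mult_scaleR inner_simps c_def algebra_simps)
    also have "\<dots> = 2 * t * (y \<bullet> y) + t * t * c"
      unfolding 0 sw by (simp add: y_def)
    finally have "0 \<le> 2 * t * (y \<bullet> y) + t * t * c" using nn by metis
    moreover have "c = y \<bullet> (A *v y)" by (rule c_def)
    moreover have "\<exists>t. 2 * t * (y \<bullet> y) + t * t * c < 0" if "y \<noteq> 0"
    \<comment> \<open>The summand 1 covers the case \<open>c = 0\<close>.\<close>
    proof (intro exI[of _ "- (y \<bullet> y) / (c + 1)"])
      have yy: "y \<bullet> y > 0" using that by simp
      let ?s = "(y \<bullet> y) / (c + 1)"
      have s: "?s > 0" using yy c by simp
      have "?s * c < 2 * (y \<bullet> y)" using yy c by (simp add: pos_divide_less_eq algebra_simps add_nonneg_pos)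
      then have "?s * (?s * c) < ?s * (2 * (y \<bullet> y))" using s by (simp only: mult_strict_left_mono)
      then show "2 * (- (y \<bullet> y) / (c + 1)) * (y \<bullet> y) + (- (y \<bullet> y) / (c + 1)) * (- (y \<bullet> y) / (c + 1)) * c < 0"
        by (simp add: algebra_simps)
    qed
    moreover have "0 \<le> 2 * t * (y \<bullet> y) + t * t * c" for t
    proof -
      have "(x + t *\<^sub>R y) \<bullet> (A *v (x + t *\<^sub>R y)) = x \<bullet> (A *v x) + t * (x \<bullet> (A *v y)) + t * (y \<bullet> (A *v x)) + t * t * c"
        by (simp add: matrix_vector_right_distrib matrix_vector_mult_scaleR inner_simps c_def algebra_simps)
      also have "\<dots> = 2 * t * (y \<bullet> y) + t * t * c"
        unfolding 0 sw by (simp add: y_def)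
      finally show ?thesis using nn by metis
    qed
    ultimately have "y = 0" by (metis not_less)
    then have "matrix_inv A *v (A *v x) = 0" by (simp add: y_def)
    then show False using x d by (simp add: matrix_vector_mul_assoc matrix_inv_mult)
  qed
  then show "0 < x \<bullet> (A *v x)" using nn[of x] by simp
qed

lemma pos_def_id [simp]: "pos_def (mat 1)"
  by (simp add: pos_def_def)

lemma pos_def_add: "pos_def A \<Longrightarrow> psd B \<Longrightarrow> pos_def (A + B)"
  unfolding pos_def_def psd_def
  by (auto simp: transpose_linear matrix_vector_mult_add_rdistrib inner_add_right intro: add_pos_nonneg)

lemma pos_def_scaleR: "pos_def A \<Longrightarrow> c > 0 \<Longrightarrow> pos_def (c *\<^sub>R A)"
  unfolding pos_def_def by (auto simp: transpose_scalar scaleR_matrix_vector_assoc[symmetric])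

lemma psd_scaleR: "psd A \<Longrightarrow> c \<ge> 0 \<Longrightarrow> psd (c *\<^sub>R A)"
  unfolding psd_def by (auto simp: transpose_scalar scaleR_matrix_vector_assoc[symmetric])

lemma psd_congruence: "psd A \<Longrightarrow> psd (transpose B ** A ** B)"
proof -
  assume A: "psd A"
  have "x \<bullet> ((transpose B ** A ** B) *v x) = (B *v x) \<bullet> (A *v (B *v x))" for x
    by (simp only: matrix_vector_mul_assoc[symmetric] transpose_matrix_vector)
      (metis dot_lmul_matrix inner_commute)
  then show ?thesis using A by (auto simp: psd_def matrix_transpose_mul matrix_mul_assoc)
qed

lemma pos_def_matrix_inv:
  assumes "pos_def A" shows "pos_def (matrix_inv A)"
  unfolding pos_def_def
proof (intro conjI allI impI)
  have d: "det A \<noteq> 0" by (rule pos_def_det_nonzero[OF assms])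
  show "transpose (matrix_inv A) = matrix_inv A"
    using assms d by (simp add: transpose_matrix_inv pos_def_def)
  fix x :: "real ^ 'a" assume x: "x \<noteq> 0"
  define y where "y = matrix_inv A *v x"
  have xy: "x = A *v y" using d by (simp add: y_def matrix_vector_mul_assoc matrix_inv_mult)
  then have "y \<noteq> 0" using x by auto
  then have "0 < y \<bullet> (A *v y)" using assms by (simp add: pos_def_def)
  then show "0 < x \<bullet> (matrix_inv A *v x)"
    unfolding y_def[symmetric] by (metis xy inner_commute)
qed

lemma pos_def_segment:
  assumes "pos_def A" "pos_def B" "0 \<le> t" "t \<le> 1"
  shows "pos_def ((1 - t) *\<^sub>R A + t *\<^sub>R B)"
proof (cases "t = 1")
  case False
  then show ?thesis using assms by (intro pos_def_add pos_def_scaleR psd_scaleR pos_def_psd) auto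
qed (use assms in simp)

text \<open>The determinant cannot vanish on the segment from the identity to \<open>A\<close>, so
  by the intermediate value theorem it keeps its sign.\<close>

lemma pos_def_det_pos: assumes A: "pos_def A" shows "det A > 0"
proof (rule ccontr)
  assume "\<not> det A > 0"
  define f where "f t = det ((1 - t) *\<^sub>R mat 1 + t *\<^sub>R A)" for t
  have "continuous_on {0..1} f" unfolding f_def by (intro continuous_intros)
  moreover have "f 1 \<le> 0" "0 \<le> f 0" using \<open>\<not> det A > 0\<close> by (simp_all add: f_def)
  ultimately obtain t where t: "0 \<le> t" "t \<le> 1" "f t = 0" using IVT2'[of f 1 0 0] by auto
  then show False using pos_def_det_nonzero[OF pos_def_segment[OF pos_def_id A t(1,2)]] by (simp add: f_def)
qed

lemma pos_def_lower_bound: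
  assumes A: "pos_def (A :: real ^ 'n ^ 'n)"
  shows "\<exists>c>0. \<forall>x. c * (norm x)\<^sup>2 \<le> x \<bullet> (A *v x)"
proof -
  have "continuous_on (sphere 0 1) (\<lambda>x::real ^ 'n. x \<bullet> (A *v x))"
    by (intro continuous_intros linear_continuous_on_compose[OF continuous_on_id]) (auto simp: matrix_vector_mul_linear)
  then obtain y where y: "y \<in> sphere 0 1" "\<And>x. x \<in> sphere 0 1 \<Longrightarrow> y \<bullet> (A *v y) \<le> x \<bullet> (A *v x)"
  proof -
    have "(axis undefined 1 :: real ^ 'n) \<in> sphere 0 1" by simp
    then have "sphere 0 1 \<noteq> ({} :: (real ^ 'n) set)" by blast
    from continuous_attains_inf[OF compact_sphere this \<open>continuous_on _ _\<close>] that show thesis by auto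
  qed
  have "y \<noteq> 0" using y(1) by auto
  then have "0 < y \<bullet> (A *v y)" using A by (simp add: pos_def_def)
  moreover have "(y \<bullet> (A *v y)) * (norm x)\<^sup>2 \<le> x \<bullet> (A *v x)" for x
  proof (cases "x = 0")
    case False
    define u where "u = (1 / norm x) *\<^sub>R x"
    have "y \<bullet> (A *v y) \<le> u \<bullet> (A *v u)" using False by (intro y(2)) (simp add: u_def)
    also have "u \<bullet> (A *v u) = (x \<bullet> (A *v x)) / (norm x)\<^sup>2"
      using False by (simp add: u_def matrix_vector_mult_scaleR power2_eq_square)
    finally show ?thesis using False by (simp add: pos_le_divide_eq)
  qed simp
  ultimately show ?thesis by blast
qed

lemma pos_def_lower_bound_matrix:
  assumes A: "pos_def (A :: real ^ 'n ^ 'n)"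
  shows "\<exists>c>0. \<forall>X :: real ^ 'q ^ 'n. c * (norm X)\<^sup>2 \<le> (A ** X) \<bullet> X"
proof -
  obtain c where c: "c > 0" "\<And>x. c * (norm x)\<^sup>2 \<le> x \<bullet> (A *v x)" using pos_def_lower_bound[OF A] by auto
  have "c * (norm X)\<^sup>2 \<le> (A ** X) \<bullet> X" for X :: "real ^ 'q ^ 'n"
    unfolding power2_norm_eq_inner inner_columns[of X] inner_columns[of "A ** X"] column_matrix_mult sum_distrib_left
    using c(2) by (intro sum_mono) (simp add: power2_norm_eq_inner inner_commute)
  with c show ?thesis by blast
qed

lemma psd_inner_matrix: "psd A \<Longrightarrow> 0 \<le> (A ** X) \<bullet> X" for X :: "real ^ 'q ^ 'n"
  unfolding inner_columns[of "A ** X"] column_matrix_mult psd_def by (intro sum_nonneg) (simp add: inner_commute)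

section \<open>Matrix Gaussian integrals and the hierarchical prior\<close>

text \<open>The unnormalised centred matrix normal density with independent columns, each with
  precision matrix \<open>P\<close>.\<close>

definition egauss :: "real ^ 'n ^ 'n \<Rightarrow> real ^ 'q ^ 'n \<Rightarrow> real" where
  "egauss P X = exp (- ((P ** X) \<bullet> X) / 2)"

lemma continuous_on_matrix_mult_left: "continuous_on UNIV (\<lambda>X :: real ^ 'q ^ 'n. A ** X)" for A :: "real ^ 'n ^ 'm"
  by (intro continuous_intros)

lemma measurable_matrix_mult_left [measurable]:
  "(\<lambda>X :: real ^ 'q ^ 'n. A ** X) \<in> borel_measurable borel" for A :: "real ^ 'n ^ 'm"
  by (intro borel_measurable_continuous_onI continuous_on_matrix_mult_left)

lemma measurable_egauss [measurable]: "(egauss P :: real ^ 'q ^ 'n \<Rightarrow> real) \<in> borel_measurable borel"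
  unfolding egauss_def[abs_def] by measurable

lemma matrix_mult_bounded: "\<exists>K\<ge>0. \<forall>X :: real ^ 'q ^ 'n. norm (A ** X) \<le> K * norm X" for A :: "real ^ 'n ^ 'm"
proof -
  have "linear (\<lambda>X :: real ^ 'q ^ 'n. A ** X)"
    by (rule linearI) (simp_all add: matrix_ring)
  then obtain B where B: "\<And>X :: real ^ 'q ^ 'n. norm (A ** X) \<le> B * norm X" using linear_bounded by blast
  then have "norm (A ** X) \<le> \<bar>B\<bar> * norm X" for X :: "real ^ 'q ^ 'n"
    by (rule order_trans) (intro mult_right_mono, auto)
  then show ?thesis by (intro exI[of _ "\<bar>B\<bar>"]) auto
qed

lemma integrable_egauss_poly:
  fixes f :: "real ^ 'q ^ 'n \<Rightarrow> real"
  assumes P: "pos_def P" and [measurable]: "f \<in> borel_measurable borel"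
    and b: "\<And>X. \<bar>f X\<bar> \<le> C * (1 + (norm X)\<^sup>2) ^ k"
  shows "integrable lborel (\<lambda>X. f X * egauss P X)"
proof -
  obtain c where c: "c > 0" "\<And>X :: real ^ 'q ^ 'n. c * (norm X)\<^sup>2 \<le> (P ** X) \<bullet> X"
    using pos_def_lower_bound_matrix[OF P] by auto
  show ?thesis
  proof (rule Bochner_Integration.integrable_bound)
    show "integrable lborel (\<lambda>X :: real ^ 'q ^ 'n. \<bar>C\<bar> * ((1 + (norm X)\<^sup>2) ^ k * exp (- (c / 2) * (norm X)\<^sup>2)))"
      using c by (intro integrable_mult_right integrable_power_exp_neg_norm) auto
    show "AE X in lborel. norm (f X * egauss P X) \<le> norm (\<bar>C\<bar> * ((1 + (norm X)\<^sup>2) ^ k * exp (- (c / 2) * (norm X)\<^sup>2)))"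
    proof (rule AE_I2)
      fix X :: "real ^ 'q ^ 'n"
      have "\<bar>f X\<bar> \<le> \<bar>C\<bar> * (1 + (norm X)\<^sup>2) ^ k"
        using b[of X] by (rule order_trans) (intro mult_right_mono, auto)
      moreover have "egauss P X \<le> exp (- (c / 2) * (norm X)\<^sup>2)"
        using c(2)[of X] by (simp add: egauss_def)
      ultimately have "\<bar>f X\<bar> * egauss P X \<le> (\<bar>C\<bar> * (1 + (norm X)\<^sup>2) ^ k) * exp (- (c / 2) * (norm X)\<^sup>2)"
        by (intro mult_mono) (auto simp: egauss_def)
      then show "norm (f X * egauss P X) \<le> norm (\<bar>C\<bar> * ((1 + (norm X)\<^sup>2) ^ k * exp (- (c / 2) * (norm X)\<^sup>2)))"
        by (simp add: abs_mult mult.assoc egauss_def)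
    qed
  qed auto
qed

lemma norm_le_poly: "norm x \<le> 1 + (norm x)\<^sup>2" "(norm x)\<^sup>2 \<le> 1 + (norm x)\<^sup>2" for x :: "'a::real_normed_vector"
proof -
  have "0 \<le> (norm x - 1 / 2)\<^sup>2" by simp
  then show "norm x \<le> 1 + (norm x)\<^sup>2" by (simp add: power2_eq_square algebra_simps)
qed simp

lemma integrable_egauss:
  fixes P :: "real ^ 'n ^ 'n"
  assumes P: "pos_def P"
  shows "integrable lborel (egauss P :: real ^ 'q ^ 'n \<Rightarrow> real)"
    and "integrable lborel (\<lambda>X :: real ^ 'q ^ 'n. (X \<bullet> Y) * egauss P X)"
    and "integrable lborel (\<lambda>X :: real ^ 'q ^ 'n. ((H ** X) \<bullet> X) * egauss P X)"
    and "integrable lborel (\<lambda>X :: real ^ 'q ^ 'n. (H ** X) $ i $ j * egauss P X)"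
    and "integrable lborel (\<lambda>X :: real ^ 'q ^ 'n. ((H ** X) $ i $ j * (K ** X) $ i $ j) * egauss P X)"
proof -
  obtain h where h: "h \<ge> 0" "\<And>X :: real ^ 'q ^ 'n. norm (H ** X) \<le> h * norm X" using matrix_mult_bounded[of H] by blast
  obtain k where k: "k \<ge> 0" "\<And>X :: real ^ 'q ^ 'n. norm (K ** X) \<le> k * norm X" using matrix_mult_bounded[of K] by blast
  have n: "\<bar>X $ i $ j\<bar> \<le> norm X" for X :: "real ^ 'q ^ 'n" 
  proof -
    have "norm (X $ i $ j) \<le> norm (X $ i)" by (rule Finite_Cartesian_Product.norm_nth_le)
    also have "norm (X $ i) \<le> norm X" by (rule Finite_Cartesian_Product.norm_nth_le)
    finally show ?thesis by simp
  qed
  show "integrable lborel (egauss P :: real ^ 'q ^ 'n \<Rightarrow> real)"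
    using integrable_egauss_poly[OF P, of "\<lambda>_. 1" 1 0] by simp
  show "integrable lborel (\<lambda>X :: real ^ 'q ^ 'n. (X \<bullet> Y) * egauss P X)"
  proof (rule integrable_egauss_poly[OF P])
    fix X :: "real ^ 'q ^ 'n"
    have "\<bar>X \<bullet> Y\<bar> \<le> norm Y * norm X" using Cauchy_Schwarz_ineq2[of X Y] by (simp add: mult.commute)
    also have "\<dots> \<le> norm Y * (1 + (norm X)\<^sup>2) ^ 1" using norm_le_poly(1)[of X] by (intro mult_left_mono) auto
    finally show "\<bar>X \<bullet> Y\<bar> \<le> norm Y * (1 + (norm X)\<^sup>2) ^ 1" .
  qed measurable
  show "integrable lborel (\<lambda>X :: real ^ 'q ^ 'n. ((H ** X) \<bullet> X) * egauss P X)"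
  proof (rule integrable_egauss_poly[OF P])
    fix X :: "real ^ 'q ^ 'n"
    have "\<bar>(H ** X) \<bullet> X\<bar> \<le> norm (H ** X) * norm X" by (rule Cauchy_Schwarz_ineq2)
    also have "\<dots> \<le> h * norm X * norm X" by (intro mult_right_mono h) auto
    also have "\<dots> \<le> h * (1 + (norm X)\<^sup>2) ^ 1" using h(1) by (simp add: mult_left_mono power2_eq_square distrib_left mult.assoc)
    finally show "\<bar>(H ** X) \<bullet> X\<bar> \<le> h * (1 + (norm X)\<^sup>2) ^ 1" .
  qed measurable
  show "integrable lborel (\<lambda>X :: real ^ 'q ^ 'n. (H ** X) $ i $ j * egauss P X)"
  proof (rule integrable_egauss_poly[OF P])
    fix X :: "real ^ 'q ^ 'n"
    have "\<bar>(H ** X) $ i $ j\<bar> \<le> h * norm X" using n[of "H ** X"] h(2)[of X] by linarith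
    also have "\<dots> \<le> h * (1 + (norm X)\<^sup>2) ^ 1" using norm_le_poly(1)[of X] h(1) by (intro mult_left_mono) auto
    finally show "\<bar>(H ** X) $ i $ j\<bar> \<le> h * (1 + (norm X)\<^sup>2) ^ 1" .
  qed (measurable; intro borel_measurable_continuous_onI continuous_intros)
  show "integrable lborel (\<lambda>X :: real ^ 'q ^ 'n. ((H ** X) $ i $ j * (K ** X) $ i $ j) * egauss P X)"
  proof (rule integrable_egauss_poly[OF P])
    fix X :: "real ^ 'q ^ 'n"
    have "\<bar>(H ** X) $ i $ j * (K ** X) $ i $ j\<bar> \<le> (h * norm X) * (k * norm X)"
      unfolding abs_mult using n[of "H ** X"] h n[of "K ** X"] k by (intro mult_mono) (auto intro: order_trans)
    also have "\<dots> = h * k * (norm X)\<^sup>2" by (simp add: power2_eq_square)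
    also have "\<dots> \<le> h * k * (1 + (norm X)\<^sup>2) ^ 1" using h(1) k(1) by (intro mult_left_mono) auto
    finally show "\<bar>(H ** X) $ i $ j * (K ** X) $ i $ j\<bar> \<le> h * k * (1 + (norm X)\<^sup>2) ^ 1" .
  qed (intro borel_measurable_continuous_onI continuous_intros)
qed

lemma deriv_egauss:
  fixes P :: "real ^ 'n ^ 'n" and X :: "real ^ 'q ^ 'n"
  assumes P: "transpose P = P"
  shows "((\<lambda>t. egauss P (X + t *\<^sub>R E)) has_real_derivative - ((P ** X) \<bullet> E) * egauss P X) (at 0)"
proof -
  have eq: "(P ** (X + t *\<^sub>R E)) \<bullet> (X + t *\<^sub>R E) = (P ** X) \<bullet> X + 2 * t * ((P ** X) \<bullet> E) + t\<^sup>2 * ((P ** E) \<bullet> E)" for t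
  proof -
    have "(P ** E) \<bullet> X = (P ** X) \<bullet> E" using matrix_inner_left[of P E X] P by (simp add: inner_commute)
    then show ?thesis by (simp add: matrix_ring inner_simps algebra_simps power2_eq_square)
  qed
  show ?thesis
    unfolding egauss_def eq by (auto intro!: derivative_eq_intros)
qed

lemma inner_axis_axis_right: "X \<bullet> axis i (axis j 1) = X $ i $ j" for X :: "real ^ 'q ^ 'n"
  by (simp add: inner_axis)

lemma integral_egauss_first:
  fixes P :: "real ^ 'n ^ 'n" and Y :: "real ^ 'q ^ 'n"
  assumes P: "pos_def P"
  shows "(\<integral>X. (X \<bullet> Y) * egauss P X \<partial>(lborel :: (real ^ 'q ^ 'n) measure)) = 0"
proof -
  have d: "det P \<noteq> 0" and s: "transpose P = P" using P pos_def_det_nonzero[OF P] by (auto simp: pos_def_def)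
  let ?E = "matrix_inv P ** Y"
  have eq: "(P ** X) \<bullet> ?E = X \<bullet> Y" for X :: "real ^ 'q ^ 'n"
    by (simp add: matrix_inner_left s matrix_mul_assoc matrix_inv_mult[OF d])
  have "(\<integral>X. - ((X \<bullet> Y) * egauss P X) \<partial>(lborel :: (real ^ 'q ^ 'n) measure)) = 0"
    by (rule integral_directional_derivative_lborel[OF integrable_egauss(1)[OF P], where e = ?E])
      (use deriv_egauss[OF s, where E = ?E] integrable_egauss(2)[OF P] in \<open>simp_all add: eq\<close>)
  then show ?thesis by simp
qed

text \<open>Stein's identity, entry by entry, for the field \<open>K ** X\<close> with
  \<open>K = matrix_inv P ** H\<close>: the negative logarithmic gradient of the density is
  \<open>P ** X\<close>, and its inner product with \<open>K ** X\<close> is the form of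
  \<open>H\<close>. Each of the q columns contributes the trace of \<open>K\<close> once.\<close>

lemma integral_egauss_second:
  fixes P H :: "real ^ 'n ^ 'n"
  assumes P: "pos_def P"
  shows "(\<integral>X. ((H ** X) \<bullet> X) * egauss P X \<partial>(lborel :: (real ^ 'q ^ 'n) measure)) =
    real CARD('q) * trace (matrix_inv P ** H) * (\<integral>X. egauss P X \<partial>(lborel :: (real ^ 'q ^ 'n) measure))"
proof -
  have d: "det P \<noteq> 0" and s: "transpose P = P" using P pos_def_det_nonzero[OF P] by (auto simp: pos_def_def)
  define K where "K = matrix_inv P ** H"
  define I where "I = (\<integral>X. egauss P X \<partial>(lborel :: (real ^ 'q ^ 'n) measure))"
  have ij: "(\<integral>X. ((K ** X) $ i $ j * (P ** X) $ i $ j) * egauss P X \<partial>(lborel :: (real ^ 'q ^ 'n) measure)) = K $ i $ i * I" for i j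
  proof -
    let ?E = "axis i (axis j 1) :: real ^ 'q ^ 'n"
    have i4: "integrable lborel (\<lambda>X :: real ^ 'q ^ 'n. (K ** X) $ i $ j * egauss P X)"
      and i5: "integrable lborel (\<lambda>X :: real ^ 'q ^ 'n. ((K ** X) $ i $ j * (P ** X) $ i $ j) * egauss P X)"
      by (rule integrable_egauss[OF P])+
    have KE: "(K ** ?E) $ i $ j = K $ i $ i"
    proof -
      have "?E $ k $ j = (if k = i then 1 else 0)" for k by (simp add: axis_def)
      then show ?thesis by (simp add: matrix_matrix_mult_def if_distrib[of "(*) _"] cong: if_cong)
    qed
    have "(\<integral>X. K $ i $ i * egauss P X - ((K ** X) $ i $ j * (P ** X) $ i $ j) * egauss P X \<partial>(lborel :: (real ^ 'q ^ 'n) measure)) = 0"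
    proof (rule integral_directional_derivative_lborel[OF i4, where e = ?E])
      show "integrable lborel (\<lambda>X :: real ^ 'q ^ 'n. K $ i $ i * egauss P X - ((K ** X) $ i $ j * (P ** X) $ i $ j) * egauss P X)"
        by (intro Bochner_Integration.integrable_diff integrable_mult_right i5 integrable_egauss(1)[OF P])
      fix X :: "real ^ 'q ^ 'n"
      have "(K ** (X + t *\<^sub>R ?E)) $ i $ j = (K ** X) $ i $ j + t * K $ i $ i" for t
        by (simp add: matrix_ring KE)
      then have "((\<lambda>t. (K ** (X + t *\<^sub>R ?E)) $ i $ j) has_real_derivative K $ i $ i) (at 0)"
        by (auto intro!: derivative_eq_intros)
      from DERIV_mult[OF this deriv_egauss[OF s, of X ?E]]
      show "((\<lambda>t. (K ** (X + t *\<^sub>R ?E)) $ i $ j * egauss P (X + t *\<^sub>R ?E)) has_real_derivative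
          K $ i $ i * egauss P X - ((K ** X) $ i $ j * (P ** X) $ i $ j) * egauss P X) (at 0)"
        by (simp add: inner_axis_axis_right algebra_simps)
    qed
    then show ?thesis
      by (subst (asm) Bochner_Integration.integral_diff)
        (auto simp: I_def intro!: integrable_mult_right i5 integrable_egauss(1)[OF P])
  qed
  have "(H ** X) \<bullet> X = (\<Sum>i\<in>UNIV. \<Sum>j\<in>UNIV. (K ** X) $ i $ j * (P ** X) $ i $ j)" for X :: "real ^ 'q ^ 'n"
  proof -
    have "(H ** X) \<bullet> X = (P ** (K ** X)) \<bullet> X"
      by (simp add: K_def matrix_mul_assoc matrix_inv_mult[OF d])
    also have "\<dots> = (K ** X) \<bullet> (P ** X)" by (simp add: matrix_inner_left[of P] s)
    finally show ?thesis by (simp add: inner_vec_def)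
  qed
  then have "(\<integral>X. ((H ** X) \<bullet> X) * egauss P X \<partial>(lborel :: (real ^ 'q ^ 'n) measure)) =
      (\<integral>X. (\<Sum>i\<in>UNIV. \<Sum>j\<in>UNIV. ((K ** X) $ i $ j * (P ** X) $ i $ j) * egauss P X) \<partial>(lborel :: (real ^ 'q ^ 'n) measure))"
    by (simp add: sum_distrib_right)
  also have "\<dots> = (\<Sum>i\<in>UNIV. \<Sum>j\<in>(UNIV :: 'q set). K $ i $ i * I)"
    by (simp add: Bochner_Integration.integral_sum Bochner_Integration.integrable_sum integrable_egauss(5)[OF P] ij)
  also have "\<dots> = real CARD('q) * trace K * I"
    by (simp add: trace_def sum_distrib_left sum_distrib_right mult_ac)
  finally show ?thesis by (simp add: K_def I_def)
qed

text \<open>Up to a positive factor the trace is the mean of the nonnegative form of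
  \<open>A\<close> under the Gaussian with covariance \<open>B\<close>. This argument takes the
  place of a square root of \<open>B\<close>.\<close>

lemma trace_mult_nonneg:
  fixes A B :: "real ^ 'n ^ 'n"
  assumes A: "psd A" and B: "pos_def B"
  shows "0 \<le> trace (A ** B)"
proof -
  define P where "P = matrix_inv B"
  have P: "pos_def P" using pos_def_matrix_inv[OF B] by (simp add: P_def)
  have iP: "matrix_inv P = B"
    unfolding P_def by (intro matrix_inv_unique matrix_inv_mult pos_def_det_nonzero[OF B])
  have "0 \<le> (\<integral>X. ((A ** X) \<bullet> X) * egauss P X \<partial>(lborel :: (real ^ 'n ^ 'n) measure))"
    by (intro Bochner_Integration.integral_nonneg mult_nonneg_nonneg psd_inner_matrix[OF A]) (simp add: egauss_def)
  then have "0 \<le> real CARD('n) * trace (B ** A) * (\<integral>X. egauss P X \<partial>(lborel :: (real ^ 'n ^ 'n) measure))"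
    unfolding integral_egauss_second[OF P] iP .
  moreover have "0 < (\<integral>X. egauss P X \<partial>(lborel :: (real ^ 'n ^ 'n) measure))"
  proof (rule ccontr)
    assume "\<not> ?thesis"
    moreover have "0 \<le> (\<integral>X. egauss P X \<partial>(lborel :: (real ^ 'n ^ 'n) measure))"
      by (intro Bochner_Integration.integral_nonneg) (simp add: egauss_def)
    ultimately have "(\<integral>X. egauss P X \<partial>(lborel :: (real ^ 'n ^ 'n) measure)) = 0" by simp
    then have "AE X in (lborel :: (real ^ 'n ^ 'n) measure). egauss P X = 0"
      by (subst (asm) integral_nonneg_eq_0_iff_AE[OF integrable_egauss(1)[OF P]]) (simp_all add: egauss_def)
    then have "AE X in (lborel :: (real ^ 'n ^ 'n) measure). False"
      unfolding egauss_def by (simp only: exp_not_eq_zero)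
    then have "emeasure (lborel :: (real ^ 'n ^ 'n) measure) (space lborel) = 0"
      by (simp only: eventually_False ae_filter_eq_bot_iff)
    then show False by (simp only: space_lborel space_borel emeasure_lborel_UNIV infinity_ennreal_def ennreal_top_neq_zero)
  qed
  ultimately have "0 \<le> trace (B ** A)" by (simp add: zero_le_mult_iff)
  then show ?thesis by (subst trace_mul_sym)
qed

lemma integral_egauss_id:
  "(\<integral>X. egauss (mat 1) X \<partial>(lborel :: (real ^ 'q ^ 'n) measure)) = (2 * pi) powr (real CARD('q) * real CARD('n) / 2)"
proof -
  have eq: "egauss (mat 1) X = (2 * pi) powr (real CARD('q) * real CARD('n) / 2) * gauss 1 0 X" for X :: "real ^ 'q ^ 'n"
  proof -
    have "(2 * pi) powr (real CARD('q) * real CARD('n) / 2) * (2 * pi) powr (- (real DIM(real ^ 'q ^ 'n) / 2)) = 1"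
      by (simp add: powr_add[symmetric] mult.commute)
    then show ?thesis unfolding gauss_def egauss_def
      by (simp only: mult.assoc[symmetric]) (simp add: power2_norm_eq_inner)
  qed
  show ?thesis unfolding eq by (simp add: integral_gauss)
qed

text \<open>
  Along the segment \<open>P\<^sub>t = (1 - t) I + t P\<close> the logarithmic derivative of the integral is
  \<open>- (q / 2) tr (P\<^sub>t\<inverse> (P - I))\<close>, by the second moment formula, and that of the determinant is
  \<open>tr (P\<^sub>t\<inverse> (P - I))\<close>.
\<close>

lemma integral_egauss:
  fixes P :: "real ^ 'n ^ 'n"
  assumes P: "pos_def P"
  shows "(\<integral>X. egauss P X \<partial>(lborel :: (real ^ 'q ^ 'n) measure)) =
    (2 * pi) powr (real CARD('q) * real CARD('n) / 2) * det P powr (- (real CARD('q) / 2))"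
proof -
  define H where "H = P - mat 1"
  define Q where "Q t = mat 1 + t *\<^sub>R H" for t
  have Q: "pos_def (Q t)" if "t \<in> {0..1}" for t
    using pos_def_segment[OF pos_def_id P, of t] that by (simp add: Q_def H_def algebra_simps)
  define L where "L t = (\<integral>X. egauss (Q t) X \<partial>(lborel :: (real ^ 'q ^ 'n) measure))" for t
  define q where "q = real CARD('q)"
  obtain c where c: "c > 0" "\<And>X :: real ^ 'q ^ 'n. c * (norm X)\<^sup>2 \<le> (P ** X) \<bullet> X"
    using pos_def_lower_bound_matrix[OF P] by auto
  obtain h where h: "h \<ge> 0" "\<And>X :: real ^ 'q ^ 'n. norm (H ** X) \<le> h * norm X" using matrix_mult_bounded[of H] by blast
  \<comment> \<open>The form of the identity has lower bound 1 and that of \<open>P\<close> has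
    lower bound \<open>c\<close>, so their minimum serves along the whole segment and yields one
    dominating function.\<close>
  define d where "d = min 1 c"
  have d: "d > 0" using c by (simp add: d_def)
  have Qd: "d * (norm X)\<^sup>2 \<le> (Q t ** X) \<bullet> X" if "t \<in> {0..1}" for t and X :: "real ^ 'q ^ 'n"
  proof -
    have "(Q t ** X) \<bullet> X = (1 - t) * (norm X)\<^sup>2 + t * ((P ** X) \<bullet> X)"
      by (simp add: Q_def H_def matrix_ring inner_simps algebra_simps power2_norm_eq_inner)
    moreover have "(1 - t) * (d * (norm X)\<^sup>2) \<le> (1 - t) * (norm X)\<^sup>2"
      using that by (intro mult_left_mono) (auto simp: d_def intro: mult_left_le_one_le order_trans[OF mult_right_mono[of "min 1 c" 1]])
    moreover have "t * (d * (norm X)\<^sup>2) \<le> t * ((P ** X) \<bullet> X)"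
    proof -
      have "d * (norm X)\<^sup>2 \<le> c * (norm X)\<^sup>2" by (intro mult_right_mono) (auto simp: d_def)
      then show ?thesis using that c(2)[of X] by (intro mult_left_mono) auto
    qed
    ultimately show ?thesis by (simp add: algebra_simps)
  qed
  have L': "(L has_real_derivative - (q / 2) * trace (matrix_inv (Q t) ** H) * L t) (at t within {0..1})"
    if t: "t \<in> {0..1}" for t
  proof -
    have "(L has_real_derivative (\<integral>X. - (1 / 2) * (((H ** X) \<bullet> X) * egauss (Q t) X) \<partial>(lborel :: (real ^ 'q ^ 'n) measure))) (at t within {0..1})"
      unfolding L_def[abs_def]
    proof (rule has_real_derivative_integral[where W = "\<lambda>X. h * ((1 + (norm X)\<^sup>2) ^ 1 * exp (- (d / 2) * (norm X)\<^sup>2))"])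
      show "integrable lborel (\<lambda>X :: real ^ 'q ^ 'n. h * ((1 + (norm X)\<^sup>2) ^ 1 * exp (- (d / 2) * (norm X)\<^sup>2)))"
        using d by (intro integrable_mult_right integrable_power_exp_neg_norm) auto
      fix u :: real and X :: "real ^ 'q ^ 'n" assume u: "u \<in> {0..1}"
      have "(Q u ** X) \<bullet> X = X \<bullet> X + u * ((H ** X) \<bullet> X)" for u
        by (simp add: Q_def matrix_ring inner_simps)
      then show "((\<lambda>u. egauss (Q u) X) has_real_derivative - (1 / 2) * (((H ** X) \<bullet> X) * egauss (Q u) X)) (at u within {0..1})"
        unfolding egauss_def by (auto intro!: derivative_eq_intros)
      have "\<bar>(H ** X) \<bullet> X\<bar> \<le> norm (H ** X) * norm X" by (rule Cauchy_Schwarz_ineq2)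
      also have "\<dots> \<le> h * norm X * norm X" by (intro mult_right_mono h) auto
      also have "\<dots> \<le> h * (1 + (norm X)\<^sup>2)" using h(1) by (simp add: mult_left_mono power2_eq_square distrib_left mult.assoc)
      finally have "\<bar>(H ** X) \<bullet> X\<bar> * egauss (Q u) X \<le> (h * (1 + (norm X)\<^sup>2)) * exp (- (d / 2) * (norm X)\<^sup>2)"
        using Qd[OF u, of X] h(1) by (intro mult_mono) (auto simp: egauss_def)
      moreover have "\<bar>- (1 / 2) * (((H ** X) \<bullet> X) * egauss (Q u) X)\<bar> = (1 / 2) * (\<bar>(H ** X) \<bullet> X\<bar> * egauss (Q u) X)"
        by (simp add: abs_mult egauss_def)
      moreover have "0 \<le> \<bar>(H ** X) \<bullet> X\<bar> * egauss (Q u) X" by (simp add: egauss_def)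
      ultimately show "\<bar>- (1 / 2) * (((H ** X) \<bullet> X) * egauss (Q u) X)\<bar> \<le> h * ((1 + (norm X)\<^sup>2) ^ 1 * exp (- (d / 2) * (norm X)\<^sup>2))"
        unfolding power_one_right mult.assoc by linarith
    next
      show "(\<lambda>X :: real ^ 'q ^ 'n. - (1 / 2) * (((H ** X) \<bullet> X) * egauss (Q t) X)) \<in> borel_measurable lborel"
        by measurable
    qed (use t integrable_egauss(1)[OF Q] in auto)
    also have "(\<integral>X. - (1 / 2) * (((H ** X) \<bullet> X) * egauss (Q t) X) \<partial>(lborel :: (real ^ 'q ^ 'n) measure)) =
        - (1 / 2) * (q * trace (matrix_inv (Q t) ** H) * L t)"
      unfolding q_def L_def integral_egauss_second[OF Q[OF t], symmetric] by simp
    finally show ?thesis by simp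
  qed
  have D': "((\<lambda>t. det (Q t)) has_real_derivative det (Q t) * trace (matrix_inv (Q t) ** H)) (at t within {0..1})"
    if t: "t \<in> {0..1}" for t
  proof -
    have "((\<lambda>u. det (Q t + (u - t) *\<^sub>R H)) has_real_derivative det (Q t) * trace (matrix_inv (Q t) ** H) * 1) (at t)"
      by (rule DERIV_chain2[where f = "\<lambda>u. det (Q t + u *\<^sub>R H)"])
        (auto intro!: derivative_eq_intros deriv_det pos_def_det_nonzero Q t)
    moreover have "Q t + (u - t) *\<^sub>R H = Q u" for u by (simp add: Q_def algebra_simps)
    ultimately show ?thesis by (simp add: has_field_derivative_at_within)
  qed
  have "((\<lambda>t. L t * det (Q t) powr (q / 2)) has_real_derivative 0) (at t within {0..1})" if t: "t \<in> {0..1}" for t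
  proof -
    have p: "det (Q t) > 0" by (rule pos_def_det_pos[OF Q[OF t]])
    have "((\<lambda>t. det (Q t) powr (q / 2)) has_real_derivative (q / 2) * det (Q t) powr (q / 2) * trace (matrix_inv (Q t) ** H)) (at t within {0..1})"
      using D'[OF t] p by (auto intro!: derivative_eq_intros simp: powr_diff)
    from DERIV_mult[OF L'[OF t] this] show ?thesis by (simp add: algebra_simps)
  qed
  then have "L 1 * det (Q 1) powr (q / 2) = L 0 * det (Q 0) powr (q / 2)"
    using has_field_derivative_zero_constant[of "{0..1::real}" "\<lambda>t. L t * det (Q t) powr (q / 2)"] by force
  moreover have "Q 1 = P" "Q 0 = mat 1" by (simp_all add: Q_def H_def)
  ultimately have "L 1 * det P powr (q / 2) = (2 * pi) powr (real CARD('q) * real CARD('n) / 2)"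
    by (simp add: L_def integral_egauss_id)
  then show ?thesis
    using pos_def_det_pos[OF P] \<open>Q 1 = P\<close> by (simp add: L_def q_def powr_minus field_simps)
qed

section \<open>Conditional law of the parameter given \<Omega> and the observation\<close>

definition res :: "real \<Rightarrow> real ^ 'n ^ 'n \<Rightarrow> real ^ 'n ^ 'n" where
  "res s \<Omega> = matrix_inv (mat 1 - s *\<^sub>R \<Omega>)"

text \<open>The matrix \<Lambda> of the overview. Given \<Omega>, the posterior mean of the
  parameter is \<open>z - lam s \<Omega> ** z\<close>, so this matrix describes how far the
  observation is shrunk to 0.\<close>

definition lam :: "real \<Rightarrow> real ^ 'n ^ 'n \<Rightarrow> real ^ 'n ^ 'n" where
  "lam s \<Omega> = (1 - s) *\<^sub>R (\<Omega> ** res s \<Omega>)"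

lemma R_set_iff: "\<Omega> \<in> R_set \<longleftrightarrow> pos_def \<Omega> \<and> pos_def (mat 1 - \<Omega>)"
  by (simp add: R_set_def)

lemma R_set_pos_def:
  assumes \<Omega>: "\<Omega> \<in> R_set" and s: "0 \<le> s" "s \<le> 1"
  shows "pos_def (mat 1 - s *\<^sub>R \<Omega>)"
proof -
  have "mat 1 - s *\<^sub>R \<Omega> = (1 - s) *\<^sub>R mat 1 + s *\<^sub>R (mat 1 - \<Omega>)" by (simp add: algebra_simps)
  then show ?thesis using pos_def_segment[OF pos_def_id, of "mat 1 - \<Omega>" s] \<Omega> s by (simp add: R_set_iff)
qed

lemma res_mult:
  fixes \<Omega> :: "real ^ 'n ^ 'n"
  assumes "det (mat 1 - s *\<^sub>R \<Omega>) \<noteq> 0"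
  shows "\<Omega> ** res s \<Omega> = res s \<Omega> ** \<Omega>" and "res s \<Omega> = mat 1 + s *\<^sub>R (\<Omega> ** res s \<Omega>)"
proof -
  define T where "T = mat 1 - s *\<^sub>R \<Omega>"
  have T: "T ** res s \<Omega> = mat 1" "res s \<Omega> ** T = mat 1"
    using matrix_inv_mult[OF assms] by (simp_all add: T_def res_def)
  have c: "T ** \<Omega> = \<Omega> ** T" by (simp add: T_def matrix_ring)
  have "res s \<Omega> ** \<Omega> = res s \<Omega> ** (\<Omega> ** T) ** res s \<Omega>"
    by (simp add: matrix_mul_assoc[symmetric] T)
  also have "\<dots> = (res s \<Omega> ** T) ** \<Omega> ** res s \<Omega>" by (simp add: c[symmetric] matrix_mul_assoc)
  finally show "\<Omega> ** res s \<Omega> = res s \<Omega> ** \<Omega>" by (simp add: T)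
  have "mat 1 = res s \<Omega> - s *\<^sub>R (\<Omega> ** res s \<Omega>)"
    using T(1) by (simp add: T_def matrix_ring)
  then show "res s \<Omega> = mat 1 + s *\<^sub>R (\<Omega> ** res s \<Omega>)" by simp
qed

context
  fixes \<Omega> :: "real ^ 'n ^ 'n" and s :: real
  assumes \<Omega>: "\<Omega> \<in> R_set" and s: "0 \<le> s" "s \<le> 1"
begin

lemma res_pos_def: "pos_def (res s \<Omega>)"
  unfolding res_def by (intro pos_def_matrix_inv R_set_pos_def \<Omega> s)

lemma R_set_sym: "transpose \<Omega> = \<Omega>"
  using \<Omega> by (simp add: R_set_iff pos_def_def)

lemma res_sym: "transpose (res s \<Omega>) = res s \<Omega>"
  using res_pos_def by (simp add: pos_def_def)

lemma res_facts:
  "\<Omega> ** res s \<Omega> = res s \<Omega> ** \<Omega>" "res s \<Omega> = mat 1 + s *\<^sub>R (\<Omega> ** res s \<Omega>)"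
  by (rule res_mult[OF pos_def_det_nonzero[OF R_set_pos_def[OF \<Omega> s]]])+

text \<open>The difference is \<open>s\<close> times the congruence of \<open>res s \<Omega>\<close>
  by \<Omega>.\<close>

lemma mult_res_psd: "psd (\<Omega> ** res s \<Omega> - \<Omega>)"
proof -
  have "\<Omega> ** res s \<Omega> - \<Omega> = s *\<^sub>R (\<Omega> ** res s \<Omega> ** \<Omega>)"
  proof -
    have "\<Omega> ** res s \<Omega> = \<Omega> ** (mat 1 + s *\<^sub>R (\<Omega> ** res s \<Omega>))"
      by (rule arg_cong[OF res_facts(2)])
    also have "\<dots> = \<Omega> + s *\<^sub>R (\<Omega> ** (\<Omega> ** res s \<Omega>))"
      by (simp add: matrix_add_ldistrib matrix_scaleR_mult)
    also have "\<Omega> ** (\<Omega> ** res s \<Omega>) = \<Omega> ** res s \<Omega> ** \<Omega>"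
      by (subst res_facts(1)) (rule matrix_mul_assoc)
    finally show ?thesis by (metis add_diff_cancel_left')
  qed
  moreover have "psd (transpose \<Omega> ** res s \<Omega> ** \<Omega>)" by (intro psd_congruence pos_def_psd res_pos_def)
  ultimately show ?thesis using s by (simp add: psd_scaleR R_set_sym)
qed

lemma mult_res_pos_def: "pos_def (\<Omega> ** res s \<Omega>)"
  using pos_def_add[of \<Omega> "\<Omega> ** res s \<Omega> - \<Omega>"] mult_res_psd \<Omega> by (simp add: R_set_iff)

lemma lam_psd: "psd (lam s \<Omega>)" "psd (lam s \<Omega> - (1 - s) *\<^sub>R \<Omega>)"
  unfolding lam_def using s psd_scaleR[OF mult_res_psd, of "1 - s"] psd_scaleR[OF pos_def_psd[OF mult_res_pos_def], of "1 - s"]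
  by (simp_all add: scaleR_diff_right)

lemma id_minus_lam: "mat 1 - lam s \<Omega> = (mat 1 - \<Omega>) ** res s \<Omega>"
proof -
  have "mat 1 = res s \<Omega> - s *\<^sub>R (\<Omega> ** res s \<Omega>)" using res_facts(2) by (metis add_diff_cancel_right')
  then have "mat 1 - lam s \<Omega> = res s \<Omega> - s *\<^sub>R (\<Omega> ** res s \<Omega>) - lam s \<Omega>" by simp
  then show ?thesis by (simp add: lam_def matrix_ring algebra_simps)
qed

end

text \<open>
  The conditional precision of \<open>\<Theta>\<close> given \<open>X\<close> and \<open>\<Omega>\<close>; its inverse is \<open>v (I - \<Lambda>)\<close> for
  \<open>\<Lambda> = lam (1 - v / v\<^sub>0) \<Omega>\<close>.
\<close>

definition prec :: "real \<Rightarrow> real \<Rightarrow> real ^ 'n ^ 'n \<Rightarrow> real ^ 'n ^ 'n" where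
  "prec v v0 \<Omega> = (1 / v) *\<^sub>R mat 1 + (1 / v0) *\<^sub>R (\<Omega> ** matrix_inv (mat 1 - \<Omega>))"

context
  fixes \<Omega> :: "real ^ 'n ^ 'n" and v v0 s :: real
  assumes \<Omega>: "\<Omega> \<in> R_set" and v: "0 < v" "v \<le> v0" and s: "s = 1 - v / v0"
begin

lemma s_bounds: "0 \<le> s" "s < 1" "s \<le> 1"
  using v by (auto simp: s pos_divide_le_eq)

lemma prec_eq: "prec v v0 \<Omega> = (1 / v) *\<^sub>R ((mat 1 - s *\<^sub>R \<Omega>) ** res 1 \<Omega>)"
proof -
  note G = res_facts(2)[OF \<Omega>, of 1, simplified]
  have "(mat 1 - s *\<^sub>R \<Omega>) ** res 1 \<Omega> = mat 1 + (1 - s) *\<^sub>R (\<Omega> ** res 1 \<Omega>)"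
    using G by (simp add: matrix_ring scaleR_diff_left)
  moreover have "(1 / v) * (1 - s) = 1 / v0" using v by (simp add: s)
  ultimately show ?thesis
    by (simp add: prec_def res_def scaleR_add_right)
qed

lemma prec_pos_def: "pos_def (prec v v0 \<Omega>)"
  unfolding prec_def using v pos_def_psd[OF mult_res_pos_def[OF \<Omega>, of 1]]
  by (intro pos_def_add pos_def_scaleR psd_scaleR) (auto simp: res_def)

lemma prec_inv: "matrix_inv (prec v v0 \<Omega>) = v *\<^sub>R (mat 1 - lam s \<Omega>)"
proof (rule matrix_inv_unique)
  have "det (mat 1 - 1 *\<^sub>R \<Omega>) \<noteq> 0" "det (mat 1 - s *\<^sub>R \<Omega>) \<noteq> 0"
    by (intro pos_def_det_nonzero R_set_pos_def \<Omega> s_bounds; simp)+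
  then have a: "res 1 \<Omega> ** (mat 1 - \<Omega>) = mat 1" and b: "(mat 1 - s *\<^sub>R \<Omega>) ** res s \<Omega> = mat 1"
    using matrix_inv_mult by (simp_all add: res_def)
  have "((mat 1 - s *\<^sub>R \<Omega>) ** res 1 \<Omega>) ** ((mat 1 - \<Omega>) ** res s \<Omega>) = (mat 1 - s *\<^sub>R \<Omega>) ** (res 1 \<Omega> ** (mat 1 - \<Omega>)) ** res s \<Omega>"
    by (simp only: matrix_mul_assoc)
  also have "\<dots> = mat 1" by (simp add: a b)
  finally show "prec v v0 \<Omega> ** (v *\<^sub>R (mat 1 - lam s \<Omega>)) = mat 1"
    using v by (simp add: prec_eq id_minus_lam[OF \<Omega> s_bounds(1,3)] matrix_scaleR_mult)
qed

lemma prec_det: "det (prec v v0 \<Omega>) = (1 / v) ^ CARD('n) * (det (mat 1 - s *\<^sub>R \<Omega>) / det (mat 1 - \<Omega>))"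
proof -
  have "det (res 1 \<Omega>) = 1 / det (mat 1 - \<Omega>)"
    using pos_def_det_nonzero \<Omega> unfolding res_def by (subst det_matrix_inv) (auto simp: R_set_iff)
  then show ?thesis by (simp add: prec_eq det_scaleR det_mul)
qed

text \<open>The density of the observation at \<open>z\<close> given \<Omega>, with the parameter
  integrated out; \<open>prior1_moments\<close> confirms this.\<close>

definition phi :: "real ^ 'q ^ 'n \<Rightarrow> real" where
  "phi z = (2 * pi * v0) powr (- (real CARD('q) * real CARD('n) / 2)) *
    (det \<Omega> powr (real CARD('q) / 2) * det (mat 1 - s *\<^sub>R \<Omega>) powr (- (real CARD('q) / 2)) *
    exp (- ((lam s \<Omega> ** z) \<bullet> z) / (2 * v)))"

text \<open>Completing the square in \<Theta>. The centre \<open>y\<close> of the posterior is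
  determined by \<open>P ** y = (1 / v) *\<^sub>R z\<close>, and what does not depend on \<Theta>
  collects into \<open>phi\<close>.\<close>

lemma gauss_prior1:
  fixes z \<Theta> :: "real ^ 'q ^ 'n"
  shows "gauss v \<Theta> z * prior1 v0 \<Omega> \<Theta> =
    phi z / ((2 * pi) powr (real CARD('q) * real CARD('n) / 2) * det (prec v v0 \<Omega>) powr (- (real CARD('q) / 2))) *
    egauss (prec v v0 \<Omega>) (\<Theta> - (z - lam s \<Omega> ** z))"
proof -
  define P where "P = prec v v0 \<Omega>"
  define Q where "Q = \<Omega> ** matrix_inv (mat 1 - \<Omega>)"
  define y where "y = z - lam s \<Omega> ** z"
  define n where "n = real CARD('q) * real CARD('n) / 2"
  define q where "q = real CARD('q) / 2"
  have v0: "v0 > 0" using v by simp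
  have P: "P = (1 / v) *\<^sub>R mat 1 + (1 / v0) *\<^sub>R Q" by (simp add: P_def prec_def Q_def)
  have Psym: "transpose P = P" using prec_pos_def by (simp add: P_def pos_def_def)
  have y: "y = (1 / v) *\<^sub>R (matrix_inv P ** z)"
    using v by (simp add: P_def prec_inv y_def matrix_ring)
  have Py: "P ** y = (1 / v) *\<^sub>R z"
    unfolding y using pos_def_det_nonzero[OF prec_pos_def]
    by (simp add: matrix_ring P_def matrix_inv_mult)
  have QT: "(Q ** \<Theta>) \<bullet> \<Theta> / v0 = (P ** \<Theta>) \<bullet> \<Theta> - \<Theta> \<bullet> \<Theta> / v"
    by (simp add: P matrix_ring inner_simps)
  have PT: "(P ** (\<Theta> - y)) \<bullet> (\<Theta> - y) = (P ** \<Theta>) \<bullet> \<Theta> - 2 * (z \<bullet> \<Theta> / v) + z \<bullet> y / v"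
  proof -
    have "(P ** \<Theta>) \<bullet> y = z \<bullet> \<Theta> / v"
      using matrix_inner_left[of P \<Theta> y] by (simp add: Psym Py inner_commute)
    then show ?thesis by (simp add: matrix_ring Py inner_simps)
  qed
  have zy: "z \<bullet> y = z \<bullet> z - (lam s \<Omega> ** z) \<bullet> z" by (simp add: y_def inner_simps inner_commute)
  have ex: "(norm (z - \<Theta>))\<^sup>2 / v + (Q ** \<Theta>) \<bullet> \<Theta> / v0 = (P ** (\<Theta> - y)) \<bullet> (\<Theta> - y) + (lam s \<Omega> ** z) \<bullet> z / v"
    unfolding QT PT zy power2_norm_eq_inner
    by (simp add: inner_simps inner_commute add_divide_distrib diff_divide_distrib)
  have dO: "det \<Omega> > 0" "det (mat 1 - \<Omega>) > 0" "det (mat 1 - s *\<^sub>R \<Omega>) > 0"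
    using \<Omega> R_set_pos_def[OF \<Omega> s_bounds(1,3)] by (auto simp: R_set_iff intro: pos_def_det_pos)
  have dQ: "det Q = det \<Omega> / det (mat 1 - \<Omega>)"
    using dO by (simp add: Q_def det_mul det_matrix_inv)
  have c: "(2 * pi * v) powr (- n) * ((2 * pi * v0) powr (- n) * det Q powr q) =
     (2 * pi * v0) powr (- n) * (det \<Omega> powr q * det (mat 1 - s *\<^sub>R \<Omega>) powr (- q)) / ((2 * pi) powr n * det P powr (- q))"
  proof -
    have vn: "((1 / v) ^ CARD('n)) powr (- q) = v powr n"
      using v by (simp add: powr_realpow[symmetric] powr_powr powr_divide n_def q_def powr_minus mult.commute field_simps)
    have "det P powr (- q) = v powr n * (det (mat 1 - s *\<^sub>R \<Omega>) powr (- q) / det (mat 1 - \<Omega>) powr (- q))"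
      unfolding P_def prec_det using v dO by (subst powr_mult) (auto simp: vn powr_divide)
    moreover have "(2 * pi * v) powr (- n) = 1 / ((2 * pi) powr n * v powr n)"
      using v by (simp add: powr_minus powr_mult field_simps)
    moreover have "det Q powr q = det \<Omega> powr q * det (mat 1 - \<Omega>) powr (- q)"
      using dO by (simp add: dQ powr_divide powr_minus field_simps)
    ultimately show ?thesis using dO v by simp
  qed
  have "gauss v \<Theta> z * prior1 v0 \<Omega> \<Theta> = ((2 * pi * v) powr (- n) * ((2 * pi * v0) powr (- n) * det Q powr q)) *
     exp (- ((norm (z - \<Theta>))\<^sup>2 / v + (Q ** \<Theta>) \<bullet> \<Theta> / v0) / 2)"
    by (simp add: gauss_def prior1_def Q_def n_def q_def trace_mult_transpose mult.commute[of "real CARD('q)"] exp_add[symmetric]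
        add_divide_distrib diff_divide_distrib)
  also have "\<dots> = phi z / ((2 * pi) powr n * det P powr (- q)) * egauss P (\<Theta> - y)"
  proof -
    have "exp (- ((P ** (\<Theta> - y)) \<bullet> (\<Theta> - y) + (lam s \<Omega> ** z) \<bullet> z / v) / 2) =
        exp (- ((P ** (\<Theta> - y)) \<bullet> (\<Theta> - y)) / 2) * exp (- ((lam s \<Omega> ** z) \<bullet> z) / (2 * v))"
      by (simp add: exp_add[symmetric] add_divide_distrib diff_divide_distrib)
    then show ?thesis
      unfolding c ex unfolding phi_def egauss_def n_def[symmetric] q_def[symmetric] by (simp add: mult_ac)
  qed
  finally show ?thesis by (simp add: P_def y_def n_def q_def)
qed

text \<open>Integrals against the Gaussian of \<open>gauss_prior1\<close>. The residual
  \<open>z - \<Theta>\<close> has mean \<Lambda> z, and each of the q columns has covariance v (I -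
  \<Lambda>), whose trace v (r - tr \<Lambda>) appears in the second moment.\<close>

lemma prior1_moments:
  fixes z :: "real ^ 'q ^ 'n"
  shows "integrable lborel (\<lambda>\<Theta>. gauss v \<Theta> z * prior1 v0 \<Omega> \<Theta>)"
    and "(\<integral>\<Theta>. gauss v \<Theta> z * prior1 v0 \<Omega> \<Theta> \<partial>lborel) = phi z"
    and "integrable lborel (\<lambda>\<Theta>. ((z - \<Theta>) \<bullet> e) * (gauss v \<Theta> z * prior1 v0 \<Omega> \<Theta>))"
    and "(\<integral>\<Theta>. ((z - \<Theta>) \<bullet> e) * (gauss v \<Theta> z * prior1 v0 \<Omega> \<Theta>) \<partial>lborel) = phi z * ((lam s \<Omega> ** z) \<bullet> e)"
    and "integrable lborel (\<lambda>\<Theta>. (norm (z - \<Theta>))\<^sup>2 * (gauss v \<Theta> z * prior1 v0 \<Omega> \<Theta>))"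
    and "(\<integral>\<Theta>. (norm (z - \<Theta>))\<^sup>2 * (gauss v \<Theta> z * prior1 v0 \<Omega> \<Theta>) \<partial>lborel) =
      phi z * ((norm (lam s \<Omega> ** z))\<^sup>2 + real CARD('q) * v * (real CARD('n) - trace (lam s \<Omega>)))"
proof -
  define P where "P = prec v v0 \<Omega>"
  define y where "y = z - lam s \<Omega> ** z"
  define D where "D = (2 * pi) powr (real CARD('q) * real CARD('n) / 2) * det P powr (- (real CARD('q) / 2))"
  have P: "pos_def P" using prec_pos_def by (simp add: P_def)
  have D: "D > 0" using pos_def_det_pos[OF P] by (simp add: D_def)
  have I0: "(\<integral>X. egauss P X \<partial>(lborel :: (real ^ 'q ^ 'n) measure)) = D" by (simp add: D_def integral_egauss[OF P])
  have g: "gauss v \<Theta> z * prior1 v0 \<Omega> \<Theta> = phi z / D * egauss P (\<Theta> - y)" for \<Theta>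
    using gauss_prior1[of \<Theta> z] by (simp add: D_def P_def y_def)
  have shift: "integrable lborel (\<lambda>\<Theta>. h (\<Theta> - y))" "(\<integral>\<Theta>. h (\<Theta> - y) \<partial>lborel) = (\<integral>\<Theta>. h \<Theta> \<partial>lborel)"
    if h: "integrable lborel h" for h :: "real ^ 'q ^ 'n \<Rightarrow> real"
  proof -
    have [measurable]: "h \<in> borel_measurable borel" using borel_measurable_integrable[OF h] by simp
    have e: "lborel = distr lborel borel (\<lambda>x. x + (- y))" by (simp only: lborel_distr_plus_right)
    have "integrable (distr lborel borel (\<lambda>x. x + (- y))) h" using h e by simp
    then show "integrable lborel (\<lambda>\<Theta>. h (\<Theta> - y))" by (subst (asm) integrable_distr_eq) auto
    have "(\<integral>\<Theta>. h \<Theta> \<partial>lborel) = (\<integral>\<Theta>. h \<Theta> \<partial>distr lborel borel (\<lambda>x. x + (- y)))" using e by simp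
    also have "\<dots> = (\<integral>\<Theta>. h (\<Theta> + (- y)) \<partial>lborel)" by (rule integral_distr) auto
    finally show "(\<integral>\<Theta>. h (\<Theta> - y) \<partial>lborel) = (\<integral>\<Theta>. h \<Theta> \<partial>lborel)" by simp
  qed
  note i0 = integrable_egauss(1)[OF P] and i1 = integrable_egauss(2)[OF P] and i2 = integrable_egauss(3)[OF P]
  let ?c = "phi z / D"
  let ?m = "lam s \<Omega> ** z"
  have "integrable lborel (\<lambda>\<Theta>. ?c * egauss P (\<Theta> - y))" "(\<integral>\<Theta>. ?c * egauss P (\<Theta> - y) \<partial>lborel) = ?c * D"
    using shift[OF i0] by (auto simp: I0)
  then show "integrable lborel (\<lambda>\<Theta>. gauss v \<Theta> z * prior1 v0 \<Omega> \<Theta>)"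
    and "(\<integral>\<Theta>. gauss v \<Theta> z * prior1 v0 \<Omega> \<Theta> \<partial>lborel) = phi z"
    using D by (simp_all add: g)
  have e1: "((z - \<Theta>) \<bullet> e) * (gauss v \<Theta> z * prior1 v0 \<Omega> \<Theta>) =
     (\<lambda>X. ?c * (?m \<bullet> e) * egauss P X - ?c * ((X \<bullet> e) * egauss P X)) (\<Theta> - y)" for \<Theta>
  proof -
    have "z - \<Theta> = ?m - (\<Theta> - y)" by (simp add: y_def)
    then have "(z - \<Theta>) \<bullet> e = ?m \<bullet> e - (\<Theta> - y) \<bullet> e" by (simp only: inner_diff_left[of ?m])
    then show ?thesis unfolding g by (simp add: algebra_simps add_divide_distrib)
  qed
  have j1: "integrable lborel (\<lambda>X. ?c * (?m \<bullet> e) * egauss P X - ?c * ((X \<bullet> e) * egauss P X))"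
    by (intro Bochner_Integration.integrable_diff integrable_mult_right i0 i1)
  show "integrable lborel (\<lambda>\<Theta>. ((z - \<Theta>) \<bullet> e) * (gauss v \<Theta> z * prior1 v0 \<Omega> \<Theta>))"
    unfolding e1 by (rule shift[OF j1])
  show "(\<integral>\<Theta>. ((z - \<Theta>) \<bullet> e) * (gauss v \<Theta> z * prior1 v0 \<Omega> \<Theta>) \<partial>lborel) = phi z * (?m \<bullet> e)"
    unfolding e1 shift(2)[OF j1]
    using D by (subst Bochner_Integration.integral_diff)
      (auto simp: I0 integral_egauss_first[OF P] intro!: integrable_mult_right i0 i1)
  have e2: "(norm (z - \<Theta>))\<^sup>2 * (gauss v \<Theta> z * prior1 v0 \<Omega> \<Theta>) =
     (\<lambda>X. (?c * (norm ?m)\<^sup>2 * egauss P X - ?c * 2 * ((X \<bullet> ?m) * egauss P X)) + ?c * (((mat 1 ** X) \<bullet> X) * egauss P X)) (\<Theta> - y)" for \<Theta>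
  proof -
    have "z - \<Theta> = ?m - (\<Theta> - y)" by (simp add: y_def)
    then have e: "(norm (z - \<Theta>))\<^sup>2 = (norm ?m)\<^sup>2 - 2 * ((\<Theta> - y) \<bullet> ?m) + (\<Theta> - y) \<bullet> (\<Theta> - y)"
      by (simp only: power2_norm_eq_inner inner_diff_left[of ?m] inner_diff_right[of _ ?m]) (simp add: inner_commute)
    have "(a - 2 * b + d) * (k * E) = (k * a * E - k * 2 * (b * E)) + k * (d * E)" for a b d k E :: real
      by (simp add: algebra_simps)
    then show ?thesis unfolding g e by (simp only: matrix_mul_lid)
  qed
  have j2: "integrable lborel (\<lambda>X. (?c * (norm ?m)\<^sup>2 * egauss P X - ?c * 2 * ((X \<bullet> ?m) * egauss P X)) + ?c * (((mat 1 ** X) \<bullet> X) * egauss P X))"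
    by (intro Bochner_Integration.integrable_add Bochner_Integration.integrable_diff integrable_mult_right i0 i1 i2)
  show "integrable lborel (\<lambda>\<Theta>. (norm (z - \<Theta>))\<^sup>2 * (gauss v \<Theta> z * prior1 v0 \<Omega> \<Theta>))"
    unfolding e2 by (rule shift[OF j2])
  note A = integrable_mult_right[OF i0, of "?c * (norm ?m)\<^sup>2"] and B = integrable_mult_right[OF i1[of ?m], of "?c * 2"]
    and C = integrable_mult_right[OF i2[of "mat 1"], of ?c]
  have tr: "trace (matrix_inv P ** mat 1) = v * (real CARD('n) - trace (lam s \<Omega>))"
    by (simp add: P_def prec_inv trace_scaleR trace_sub trace_I)
  have "(\<integral>\<Theta>. (norm (z - \<Theta>))\<^sup>2 * (gauss v \<Theta> z * prior1 v0 \<Omega> \<Theta>) \<partial>lborel) =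
     ?c * (norm ?m)\<^sup>2 * D - ?c * 2 * 0 + ?c * (real CARD('q) * trace (matrix_inv P ** mat 1) * D)"
    unfolding e2 shift(2)[OF j2] Bochner_Integration.integral_add[OF Bochner_Integration.integrable_diff[OF A B] C]
      Bochner_Integration.integral_diff[OF A B]
    by (simp only: integral_mult_right_zero I0 integral_egauss_first[OF P] integral_egauss_second[OF P])
  then show "(\<integral>\<Theta>. (norm (z - \<Theta>))\<^sup>2 * (gauss v \<Theta> z * prior1 v0 \<Omega> \<Theta>) \<partial>lborel) =
      phi z * ((norm ?m)\<^sup>2 + real CARD('q) * v * (real CARD('n) - trace (lam s \<Omega>)))"
    using D by (simp only: tr) (simp add: field_simps)
qed

end

section \<open>Lebesgue measure on symmetric matrices\<close>

abbreviation pairs :: "'r set set" where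
  "pairs \<equiv> {{i, j} |i j. True}"

abbreviation pairs_lborel :: "('r::finite set \<Rightarrow> real) measure" where
  "pairs_lborel \<equiv> \<Pi>\<^sub>M s \<in> pairs. lborel"

interpretation pairs: product_sigma_finite "\<lambda>_ :: 'r::finite set. lborel :: real measure" ..

lemma finite_pairs [simp]: "finite (pairs :: 'r::finite set set)"
  by (rule finite_subset[of _ "Pow UNIV"]) auto

lemma sets_sym_lborel [measurable_cong, simp]: "sets sym_lborel = sets borel"
  by (simp add: sym_lborel_def)

lemma space_sym_lborel [simp]: "space sym_lborel = UNIV"
  by (simp add: sym_lborel_def)

declare measurable_sym_mat [measurable]

lemma sym_mat_nth: "sym_mat \<omega> $ i $ j = \<omega> {i, j}"
  by (simp add: sym_mat_def)

lemma measurable_pairs_component: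
  "s \<in> pairs \<Longrightarrow> (\<lambda>\<omega>. \<omega> s) \<in> borel_measurable (pairs_lborel :: ('r::finite set \<Rightarrow> real) measure)"
  using measurable_component_singleton[of s pairs "\<lambda>_. lborel :: real measure"] by simp

lemma emeasure_pairs_box:
  "emeasure pairs_lborel (\<Pi>\<^sub>E s\<in>(pairs :: 'r::finite set set). {- c..c}) < \<infinity>"
  by (subst pairs.emeasure_PiM) (auto simp: power_less_top_ennreal emeasure_lborel_Icc_eq)

lemma nn_integral_sym_lborel:
  "f \<in> borel_measurable borel \<Longrightarrow> (\<integral>\<^sup>+A. f A \<partial>sym_lborel) = (\<integral>\<^sup>+\<omega>. f (sym_mat \<omega>) \<partial>pairs_lborel)"
  unfolding sym_lborel_def by (rule nn_integral_distr[OF measurable_sym_mat]) simp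

lemma sigma_finite_sym_lborel: "sigma_finite_measure (sym_lborel :: (real ^ 'r ^ 'r) measure)"
proof
  define B where "B n = {A :: real ^ 'r ^ 'r. \<forall>i j. \<bar>A $ i $ j\<bar> \<le> real n}" for n
  have B: "B n \<in> sets borel" for n
  proof -
    have "closed (B n)" unfolding B_def
      by (intro closed_Collect_all closed_Collect_le continuous_intros)
    then show ?thesis by simp
  qed
  have fin: "emeasure sym_lborel (B n) \<noteq> \<infinity>" for n
  proof -
    have "emeasure sym_lborel (B n) = emeasure pairs_lborel (sym_mat -` B n \<inter> space pairs_lborel)"
      unfolding sym_lborel_def using B by (subst emeasure_distr[OF measurable_sym_mat]) auto
    also have "\<dots> \<le> emeasure pairs_lborel (\<Pi>\<^sub>E s\<in>(pairs :: 'r set set). {- real n..real n})"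
    proof (rule emeasure_mono)
      show "sym_mat -` B n \<inter> space pairs_lborel \<subseteq> (\<Pi>\<^sub>E s\<in>(pairs :: 'r set set). {- real n..real n})"
        by (auto simp: B_def sym_mat_nth space_PiM PiE_iff abs_le_iff) (metis minus_le_iff)
    qed (auto intro!: sets_PiM_I_finite)
    also have "\<dots> < \<infinity>" by (rule emeasure_pairs_box)
    finally show ?thesis by simp
  qed
  show "\<exists>F::(real ^ 'r ^ 'r) set set. countable F \<and> F \<subseteq> sets sym_lborel \<and> \<Union> F = space sym_lborel \<and> (\<forall>a\<in>F. emeasure sym_lborel a \<noteq> \<infinity>)"
  proof (intro exI[of _ "range B"] conjI)
    show "\<Union> (range B) = space sym_lborel"
    proof (intro equalityI subsetI)
      fix A :: "real ^ 'r ^ 'r"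
      obtain n where n: "norm A \<le> real n" using real_arch_simple by blast
      have "\<bar>A $ i $ j\<bar> \<le> norm A" for i j
      proof -
        have "norm (A $ i $ j) \<le> norm (A $ i)" by (rule Finite_Cartesian_Product.norm_nth_le)
        also have "norm (A $ i) \<le> norm A" by (rule Finite_Cartesian_Product.norm_nth_le)
        finally show ?thesis by simp
      qed
      then show "A \<in> \<Union> (range B)" using n unfolding B_def by (blast intro: order_trans)
    qed simp
  qed (use B fin in auto)
qed

lemma distr_lborel_isometry:
  fixes t c :: real assumes "\<bar>c\<bar> = 1"
  shows "distr lborel borel (\<lambda>x. t + c * x) = lborel"
proof -
  have "c \<noteq> 0" using assms by auto
  from lborel_real_affine[OF this, of t] assms show ?thesis by (simp add: density_1)
qed

text \<open>In the free coordinates the map is a product of one-dimensional isometries. With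
  \<open>c = 1\<close> it gives translation invariance for integration by parts, and with
  \<open>c = - 1\<close> and \<open>H = mat 1\<close> the symmetry between \<Omega> and I -
  \<Omega>.\<close>

lemma sym_lborel_isometry:
  fixes H :: "real ^ 'r ^ 'r"
  assumes H: "transpose H = H" and c: "\<bar>c\<bar> = 1"
  shows "distr sym_lborel borel (\<lambda>A. H + c *\<^sub>R A) = sym_lborel"
proof -
  \<comment> \<open>By symmetry an entry of \<open>H\<close> depends only on the unordered pair of
    its indices, so the choice is harmless.\<close>
  define h where "h s = (SOME x. \<exists>i j. s = {i, j} \<and> x = H $ i $ j)" for s
  have sym: "H $ j $ i = H $ i $ j" for i j using H by (metis transpose_def vec_lambda_beta)
  have h: "h {i, j} = H $ i $ j" for i j
  proof -
    have "\<exists>i' j'. {i, j} = {i', j'} \<and> h {i, j} = H $ i' $ j'"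
      unfolding h_def by (rule someI_ex) blast
    then show ?thesis using sym by (auto simp: doubleton_eq_iff)
  qed
  define g where "g = (\<lambda>\<omega>. \<lambda>s\<in>(pairs :: 'r set set). h s + c * \<omega> s)"
  have g: "g \<in> measurable pairs_lborel pairs_lborel"
    unfolding g_def
    by (rule measurable_restrict) (auto intro!: borel_measurable_add borel_measurable_times measurable_pairs_component)
  have P: "distr pairs_lborel pairs_lborel g = pairs_lborel"
  proof (rule pairs.PiM_eqI)
    fix A :: "'r set \<Rightarrow> real set" assume A: "\<And>s. s \<in> pairs \<Longrightarrow> A s \<in> sets lborel"
    have "emeasure (distr pairs_lborel pairs_lborel g) (Pi\<^sub>E pairs A) = emeasure pairs_lborel (g -` Pi\<^sub>E pairs A \<inter> space pairs_lborel)"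
      using A by (intro emeasure_distr[OF g]) (auto intro!: sets_PiM_I_finite)
    also have "g -` Pi\<^sub>E pairs A \<inter> space pairs_lborel = (\<Pi>\<^sub>E s\<in>pairs. (\<lambda>x. h s + c * x) -` A s)"
    proof -
      have "(\<lambda>\<omega>. \<lambda>s\<in>I. h s + c * \<omega> s) -` Pi\<^sub>E I A \<inter> Pi\<^sub>E I (\<lambda>_. UNIV) = (\<Pi>\<^sub>E s\<in>I. (\<lambda>x. h s + c * x) -` A s)" for I
        by (auto simp: PiE_iff extensional_def)
      then show ?thesis unfolding g_def space_PiM by simp
    qed
    also have "emeasure pairs_lborel \<dots> = (\<Prod>s\<in>pairs. emeasure lborel ((\<lambda>x. h s + c * x) -` A s))"
    proof (rule pairs.emeasure_PiM)
      fix s :: "'r set" assume "s \<in> pairs"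
      then have "A s \<in> sets borel" using A by simp
      then have "(\<lambda>x. h s + c * x) -` A s \<inter> space borel \<in> sets borel" by (intro measurable_sets[OF _ \<open>A s \<in> sets borel\<close>]) measurable
      then show "(\<lambda>x. h s + c * x) -` A s \<in> sets lborel" by simp
    qed simp
    also have "\<dots> = (\<Prod>s\<in>pairs. emeasure lborel (A s))"
    proof (rule prod.cong[OF refl])
      fix s :: "'r set" assume "s \<in> pairs"
      then have s: "A s \<in> sets borel" using A by simp
      have "emeasure lborel (A s) = emeasure (distr lborel borel (\<lambda>x. h s + c * x)) (A s)"
        by (simp add: distr_lborel_isometry[OF c])
      also have "\<dots> = emeasure lborel ((\<lambda>x. h s + c * x) -` A s)"
        using s by (subst emeasure_distr) auto
      finally show "emeasure lborel ((\<lambda>x. h s + c * x) -` A s) = emeasure lborel (A s)" ..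
    qed
    finally show "emeasure (distr pairs_lborel pairs_lborel g) (Pi\<^sub>E pairs A) = (\<Prod>s\<in>pairs. emeasure lborel (A s))" .
  qed simp_all
  have gm: "H + c *\<^sub>R sym_mat \<omega> = sym_mat (g \<omega>)" for \<omega>
  proof -
    have "{i, j} \<in> pairs" for i j :: 'r by blast
    then show ?thesis by (simp add: vec_eq_iff sym_mat_nth g_def h)
  qed
  have "distr sym_lborel borel (\<lambda>A. H + c *\<^sub>R A) = distr pairs_lborel borel (\<lambda>\<omega>. sym_mat (g \<omega>))"
    unfolding sym_lborel_def
    by (subst distr_distr[OF _ measurable_sym_mat]) (measurable, simp add: comp_def gm)
  also have "\<dots> = distr (distr pairs_lborel pairs_lborel g) borel sym_mat"
    by (subst distr_distr[OF measurable_sym_mat g]) (simp only: comp_def)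
  finally show ?thesis unfolding P sym_lborel_def .
qed

lemma pos_def_iff_psd: "pos_def A \<longleftrightarrow> psd A \<and> det A \<noteq> 0"
  using pos_def_psd psd_det_nonzero_pos_def pos_def_det_nonzero by blast

lemma closed_psd: "closed {A :: real ^ 'n ^ 'n. psd A}"
proof -
  have "closed {A :: real ^ 'n ^ 'n. transpose A = A \<and> (\<forall>x. 0 \<le> x \<bullet> (A *v x))}"
    unfolding matrix_vector_mult_def
    by (intro closed_Collect_conj closed_Collect_eq closed_Collect_all closed_Collect_le continuous_intros)
  then show ?thesis by (simp add: psd_def)
qed

lemma measurable_det [measurable]: "det \<in> borel_measurable (borel :: (real ^ 'n ^ 'n) measure)"
  by (intro borel_measurable_continuous_onI continuous_on_det continuous_on_id)

lemma sets_pos_def: "{A :: real ^ 'n ^ 'n. pos_def A} \<in> sets borel"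
proof -
  have "{A :: real ^ 'n ^ 'n. pos_def A} = {A. psd A} - (det -` {0} \<inter> space borel)"
    by (auto simp: pos_def_iff_psd)
  also have "\<dots> \<in> sets borel" by (intro sets.Diff borel_closed closed_psd measurable_sets[OF measurable_det]) auto
  finally show ?thesis .
qed

lemma measurable_pos_def [measurable]: "Measurable.pred borel (pos_def :: real ^ 'n ^ 'n \<Rightarrow> bool)"
  using sets_pos_def by (simp add: pred_def)

section \<open>Integrability of powers of the determinant\<close>

lemma nn_integral_powr_unit:
  fixes \<alpha> :: real assumes "- 1 < \<alpha>"
  shows "(\<integral>\<^sup>+u. ennreal (u powr \<alpha>) * indicator {0..1} u \<partial>lborel) = ennreal (1 / (\<alpha> + 1))"
proof -
  have "((\<lambda>x. x powr \<alpha>) has_integral (1 powr (\<alpha> + 1) / (\<alpha> + 1))) {0..1}"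
    by (rule has_integral_powr_from_0) (use assms in auto)
  then have "((\<lambda>x. if x \<in> {0..1} then x powr \<alpha> else 0) has_integral (1 / (\<alpha> + 1))) UNIV"
    unfolding has_integral_restrict_UNIV by simp
  then have "(\<integral>\<^sup>+u. ennreal (if u \<in> {0..1} then u powr \<alpha> else 0) \<partial>lborel) = ennreal (1 / (\<alpha> + 1))"
    by (intro nn_integral_has_integral_lborel) auto
  moreover have "ennreal (u powr \<alpha>) * indicator {0..1} u = ennreal (if u \<in> {0..1} then u powr \<alpha> else 0)" for u :: real
    by (simp add: indicator_def)
  ultimately show ?thesis by (simp only:)
qed

text \<open>The bound has to be uniform in \<open>x0\<close>, which will be a quotient of
  determinants in the other coordinates. After translation the power is integrable on the unit
  interval, and beyond it the power is at most 1 over a set inside an interval of length 2.\<close>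

lemma nn_integral_shifted_powr_le:
  fixes \<alpha> x0 :: real assumes \<alpha>: "- 1 < \<alpha>" "\<alpha> \<le> 0"
  shows "(\<integral>\<^sup>+y. (if \<bar>y\<bar> \<le> 1 \<and> y + x0 > 0 then ennreal ((y + x0) powr \<alpha>) else 0) \<partial>lborel) \<le> ennreal (1 / (\<alpha> + 1) + 2)"
proof -
  have "(\<integral>\<^sup>+y. (if \<bar>y\<bar> \<le> 1 \<and> y + x0 > 0 then ennreal ((y + x0) powr \<alpha>) else 0) \<partial>lborel) =
     (\<integral>\<^sup>+y. (\<lambda>u. if \<bar>u - x0\<bar> \<le> 1 \<and> u > 0 then ennreal (u powr \<alpha>) else 0) (y + x0) \<partial>lborel)"
    by simp
  also have "\<dots> = (\<integral>\<^sup>+u. (if \<bar>u - x0\<bar> \<le> 1 \<and> u > 0 then ennreal (u powr \<alpha>) else 0) \<partial>lborel)"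
    by (rule nn_integral_lborel_shift) measurable
  also have "\<dots> \<le> (\<integral>\<^sup>+u. ennreal (u powr \<alpha>) * indicator {0..1} u + indicator {x0 - 1..x0 + 1} u \<partial>lborel)"
  proof (rule nn_integral_mono)
    fix u :: real
    have "ennreal (u powr \<alpha>) \<le> 1" if "u > 1" using that \<alpha> powr_mono[of \<alpha> 0 u] by (simp add: ennreal_le_1)
    then show "(if \<bar>u - x0\<bar> \<le> 1 \<and> u > 0 then ennreal (u powr \<alpha>) else 0) \<le> ennreal (u powr \<alpha>) * indicator {0..1} u + indicator {x0 - 1..x0 + 1} u"
      by (auto simp: indicator_def abs_le_iff not_le)
  qed
  also have "\<dots> = ennreal (1 / (\<alpha> + 1)) + ennreal 2"
    by (subst nn_integral_add) (auto simp: nn_integral_powr_unit[OF \<alpha>(1)])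
  also have "\<dots> = ennreal (1 / (\<alpha> + 1) + 2)" using \<alpha> by (simp add: ennreal_plus)
  finally show ?thesis .
qed

text \<open>The block on \<open>J\<close> is completed by the identity. Its determinant is then the
  principal minor, its positive definiteness concerns the block alone, and blocks of all sizes share
  one type.\<close>

definition blk :: "'r set \<Rightarrow> ('r set \<Rightarrow> real) \<Rightarrow> real ^ 'r ^ 'r" where
  "blk J \<omega> = (\<chi> i j. if i \<in> J \<and> j \<in> J then \<omega> {i, j} else if i = j then 1 else 0)"

lemma measurable_blk [measurable]: "blk J \<in> borel_measurable (pairs_lborel :: ('r::finite set \<Rightarrow> real) measure)"
proof -
  have "(\<lambda>\<omega>. blk J \<omega> \<bullet> axis i (axis j 1)) \<in> borel_measurable (pairs_lborel :: ('r set \<Rightarrow> real) measure)" for i j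
  proof -
    have "{i, j} \<in> pairs" by blast
    then show ?thesis by (auto simp: inner_axis blk_def intro: measurable_pairs_component)
  qed
  then show ?thesis by (auto simp: borel_measurable_euclidean_space[of "blk J"] Basis_vec_def)
qed

text \<open>
  Affine dependence on a diagonal entry lets the diagonal coordinates be integrated out one at a time;
  this is where \<open>\<gamma> > -1\<close> makes powers \<open>det powr \<gamma>\<close> integrable.
\<close>

lemma det_blk_insert:
  fixes k :: "'r::finite"
  assumes k: "k \<notin> J"
  shows "det (blk (insert k J) (fun_upd \<omega> {k} y)) = y * det (blk J \<omega>) + det (blk (insert k J) (fun_upd \<omega> {k} 0))"
proof -
  let ?P = "{p. p permutes (UNIV :: 'r set)}"
  let ?B = "\<lambda>y. blk (insert k J) (fun_upd \<omega> {k} y)"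
  have other: "?B y $ i $ j = ?B 0 $ i $ j" if "(i, j) \<noteq> (k, k)" for i j y
    using that by (auto simp: blk_def)
  have "(\<Prod>i\<in>UNIV. ?B y $ i $ p i) = y * (\<Prod>i\<in>UNIV. blk J \<omega> $ i $ p i) + (\<Prod>i\<in>UNIV. ?B 0 $ i $ p i)"
    if p: "p \<in> ?P" for p
  proof (cases "p k = k")
    case True
    have e: "p i \<noteq> k" if "i \<noteq> k" for i using p that True permutes_inj[of p UNIV] by (metis injD mem_Collect_eq)
    have split: "(\<Prod>i\<in>UNIV. f i) = f k * (\<Prod>i\<in>UNIV - {k}. f i)" for f :: "'r \<Rightarrow> real"
      by (rule prod.remove) auto
    have eq: "?B y $ i $ p i = blk J \<omega> $ i $ p i" if "i \<noteq> k" for i y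
      using that e[OF that] by (auto simp: blk_def)
    have kk: "?B y $ k $ p k = y" "blk J \<omega> $ k $ p k = 1" for y using k True by (auto simp: blk_def)
    have "(\<Prod>i\<in>UNIV - {k}. ?B y $ i $ p i) = (\<Prod>i\<in>UNIV - {k}. blk J \<omega> $ i $ p i)" for y
      by (intro prod.cong) (auto simp: eq)
    then show ?thesis by (simp add: split kk)
  next
    case False
    have "(\<Prod>i\<in>UNIV. ?B y $ i $ p i) = (\<Prod>i\<in>UNIV. ?B 0 $ i $ p i)"
      by (intro prod.cong refl other) (use False in auto)
    moreover have "(\<Prod>i\<in>UNIV. blk J \<omega> $ i $ p i) = 0"
      by (rule prod_zero) (use False k in \<open>auto simp: blk_def intro!: bexI[of _ k]\<close>)
    ultimately show ?thesis by simp
  qed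
  then have "det (?B y) = (\<Sum>p\<in>?P. of_int (sign p) * (y * (\<Prod>i\<in>UNIV. blk J \<omega> $ i $ p i) + (\<Prod>i\<in>UNIV. ?B 0 $ i $ p i)))"
    unfolding det_def by (intro sum.cong) auto
  also have "\<dots> = y * det (blk J \<omega>) + det (?B 0)"
    by (simp add: det_def sum.distrib sum_distrib_left algebra_simps)
  finally show ?thesis .
qed

lemma blk_update: "k \<notin> J \<Longrightarrow> blk J (fun_upd \<omega> {k} y) = blk J \<omega>"
  by (auto simp: blk_def vec_eq_iff)

lemma blk_quadratic: "x \<bullet> (blk J \<omega> *v x) = (\<Sum>i\<in>J. \<Sum>j\<in>J. \<omega> {i, j} * x $ i * x $ j) + (\<Sum>i\<in>- J. (x $ i)\<^sup>2)"
proof -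
  have "x \<bullet> (blk J \<omega> *v x) = (\<Sum>i\<in>UNIV. \<Sum>j\<in>UNIV. blk J \<omega> $ i $ j * x $ i * x $ j)"
    by (simp add: inner_vec_def matrix_vector_mult_def sum_distrib_left mult_ac)
  also have "\<dots> = (\<Sum>i\<in>J. \<Sum>j\<in>UNIV. blk J \<omega> $ i $ j * x $ i * x $ j) + (\<Sum>i\<in>- J. \<Sum>j\<in>UNIV. blk J \<omega> $ i $ j * x $ i * x $ j)"
    by (subst sum.union_disjoint[symmetric]) (auto intro: sum.cong)
  also have "(\<Sum>i\<in>J. \<Sum>j\<in>UNIV. blk J \<omega> $ i $ j * x $ i * x $ j) = (\<Sum>i\<in>J. \<Sum>j\<in>J. \<omega> {i, j} * x $ i * x $ j)"
    by (intro sum.cong refl sum.mono_neutral_cong_right) (auto simp: blk_def)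
  also have "(\<Sum>i\<in>- J. \<Sum>j\<in>UNIV. blk J \<omega> $ i $ j * x $ i * x $ j) = (\<Sum>i\<in>- J. \<Sum>j\<in>{i}. (x $ i)\<^sup>2)"
    by (intro sum.cong refl sum.mono_neutral_cong_right) (auto simp: blk_def power2_eq_square)
  finally show ?thesis by simp
qed

lemma pos_def_blk_subset:
  assumes "pos_def (blk K \<omega>)" "J \<subseteq> K"
  shows "pos_def (blk J \<omega>)"
  unfolding pos_def_def
proof (intro conjI allI impI)
  show "transpose (blk J \<omega>) = blk J \<omega>"
    by (simp add: blk_def transpose_def vec_eq_iff insert_commute conj_commute)
  fix x :: "real ^ 'a" assume x: "x \<noteq> 0"
  define y where "y = (\<chi> i. if i \<in> J then x $ i else 0)"
  have y: "x \<bullet> (blk J \<omega> *v x) = y \<bullet> (blk K \<omega> *v y) + (\<Sum>i\<in>- J. (x $ i)\<^sup>2)"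
  proof -
    have "(\<Sum>i\<in>K. \<Sum>j\<in>K. \<omega> {i, j} * y $ i * y $ j) = (\<Sum>i\<in>J. \<Sum>j\<in>K. \<omega> {i, j} * y $ i * y $ j)"
      using assms(2) by (intro sum.mono_neutral_right) (auto simp: y_def)
    also have "\<dots> = (\<Sum>i\<in>J. \<Sum>j\<in>J. \<omega> {i, j} * x $ i * x $ j)"
      using assms(2) by (intro sum.cong refl sum.mono_neutral_cong_right) (auto simp: y_def)
    moreover have "(\<Sum>i\<in>- K. (y $ i)\<^sup>2) = 0" using assms(2) by (intro sum.neutral) (auto simp: y_def)
    ultimately show ?thesis by (simp add: blk_quadratic)
  qed
  have nn: "0 \<le> (\<Sum>i\<in>- J. (x $ i)\<^sup>2)" by (intro sum_nonneg) auto
  show "0 < x \<bullet> (blk J \<omega> *v x)"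
  proof (cases "y = 0")
    case False
    then show ?thesis using assms(1) nn y by (simp add: pos_def_def add_pos_nonneg)
  next
    case True
    obtain i where i: "x $ i \<noteq> 0" using x by (auto simp: vec_eq_iff)
    then have "i \<in> - J" using True by (auto simp: y_def vec_eq_iff split: if_splits)
    then have "0 < (\<Sum>i\<in>- J. (x $ i)\<^sup>2)" using i by (intro sum_pos2[of _ i]) auto
    then show ?thesis using y True by simp
  qed
qed

text \<open>Induction on \<open>J\<close>. With the other coordinates fixed, the determinant of the
  larger block is d (y + e / d), where \<open>d\<close> is that of the smaller one and
  \<open>y\<close> the new diagonal entry. Integrating out \<open>y\<close> therefore turns the
  power for the larger block into at most a constant times the power for the smaller.\<close>

lemma nn_integral_blk_finite:
  fixes \<alpha> :: real and J :: "'r::finite set"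
  assumes \<alpha>: "- 1 < \<alpha>" "\<alpha> \<le> 0"
  shows "(\<integral>\<^sup>+\<omega>. (if (\<forall>s\<in>pairs. \<bar>\<omega> s\<bar> \<le> 1) \<and> pos_def (blk J \<omega>) then ennreal (det (blk J \<omega>) powr \<alpha>) else 0) \<partial>pairs_lborel) < \<infinity>"
    (is "(\<integral>\<^sup>+\<omega>. ?F J \<omega> \<partial>_) < _")
proof -
  have box: "Measurable.pred pairs_lborel (\<lambda>\<omega>. \<forall>s\<in>(pairs :: 'r set set). \<bar>\<omega> s\<bar> \<le> 1)"
  proof (intro pred_intros_finite finite_pairs)
    fix s :: "'r set" assume "s \<in> pairs"
    then have [measurable]: "(\<lambda>\<omega>. \<omega> s) \<in> borel_measurable (pairs_lborel :: ('r set \<Rightarrow> real) measure)"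
      by (rule measurable_pairs_component)
    show "Measurable.pred pairs_lborel (\<lambda>\<omega> :: 'r set \<Rightarrow> real. \<bar>\<omega> s\<bar> \<le> 1)" by measurable
  qed
  note [measurable] = box
  have meas: "?F J \<in> borel_measurable pairs_lborel" for J :: "'r set" by measurable
  define c where "c = 1 / (\<alpha> + 1) + 2"
  have "finite J" by simp
  then show ?thesis
  proof (induction J rule: finite_induct)
    case empty
    have "blk {} \<omega> = mat 1" for \<omega> :: "'r set \<Rightarrow> real" by (simp add: blk_def vec_eq_iff mat_def)
    then have "(\<integral>\<^sup>+\<omega>. ?F {} \<omega> \<partial>pairs_lborel) \<le> (\<integral>\<^sup>+\<omega>. indicator (\<Pi>\<^sub>E s\<in>(pairs :: 'r set set). {- 1..1}) \<omega> \<partial>pairs_lborel)"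
      by (intro nn_integral_mono) (auto simp: indicator_def space_PiM PiE_iff abs_le_iff)
    also have "\<dots> = emeasure pairs_lborel (\<Pi>\<^sub>E s\<in>(pairs :: 'r set set). {- 1..1})"
      by (intro nn_integral_indicator sets_PiM_I_finite) auto
    also have "\<dots> < \<infinity>" by (rule emeasure_pairs_box)
    finally show ?case .
  next
    case (insert k J)
    define S where "S = (pairs :: 'r set set) - {{k}}"
    have kp: "{k} \<in> pairs" by blast
    have S: "finite S" "{k} \<notin> S" and ins: "insert {k} S = pairs"
      using kp by (auto simp: S_def)
    have fold: "(\<integral>\<^sup>+\<omega>. f \<omega> \<partial>pairs_lborel) = (\<integral>\<^sup>+\<omega>. (\<integral>\<^sup>+y. f (fun_upd \<omega> {k} y) \<partial>lborel) \<partial>(\<Pi>\<^sub>M s\<in>S. lborel))"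
      if "f \<in> borel_measurable pairs_lborel" for f
      using pairs.product_nn_integral_insert[OF S, of f] that unfolding ins .
    have "(\<integral>\<^sup>+\<omega>. ?F (insert k J) \<omega> \<partial>pairs_lborel) = (\<integral>\<^sup>+\<omega>. (\<integral>\<^sup>+y. ?F (insert k J) (fun_upd \<omega> {k} y) \<partial>lborel) \<partial>(\<Pi>\<^sub>M s\<in>S. lborel))"
      by (rule fold[OF meas])
    also have "\<dots> \<le> (\<integral>\<^sup>+\<omega>. ennreal c * (\<integral>\<^sup>+y. ?F J (fun_upd \<omega> {k} y) \<partial>lborel) \<partial>(\<Pi>\<^sub>M s\<in>S. lborel))"
    proof (rule nn_integral_mono)
      fix \<omega> :: "'r set \<Rightarrow> real"
      show "(\<integral>\<^sup>+y. ?F (insert k J) (fun_upd \<omega> {k} y) \<partial>lborel) \<le> ennreal c * (\<integral>\<^sup>+y. ?F J (fun_upd \<omega> {k} y) \<partial>lborel)"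
      proof (cases "(\<forall>s\<in>S. \<bar>\<omega> s\<bar> \<le> 1) \<and> pos_def (blk J \<omega>)")
        case False
        have "?F (insert k J) (fun_upd \<omega> {k} y) = 0" for y
        proof -
          have "\<not> ((\<forall>s\<in>pairs. \<bar>(fun_upd \<omega> {k} y) s\<bar> \<le> 1) \<and> pos_def (blk (insert k J) (fun_upd \<omega> {k} y)))"
          proof
            assume a: "(\<forall>s\<in>pairs. \<bar>(fun_upd \<omega> {k} y) s\<bar> \<le> 1) \<and> pos_def (blk (insert k J) (fun_upd \<omega> {k} y))"
            have "\<forall>s\<in>S. \<bar>\<omega> s\<bar> \<le> 1"
            proof
              fix s assume "s \<in> S"
              then have "s \<in> pairs" "s \<noteq> {k}" unfolding S_def by blast+
              have "\<bar>(fun_upd \<omega> {k} y) s\<bar> \<le> 1" by (rule bspec[OF conjunct1[OF a] \<open>s \<in> pairs\<close>])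
              then show "\<bar>\<omega> s\<bar> \<le> 1" using \<open>s \<noteq> {k}\<close> by simp
            qed
            moreover have "pos_def (blk J \<omega>)"
              using a pos_def_blk_subset[of "insert k J" "fun_upd \<omega> {k} y" J] blk_update[OF insert.hyps(2)] by auto
            ultimately show False using False by simp
          qed
          then show ?thesis by (simp only: if_False)
        qed
        then show ?thesis by simp
      next
        case True
        define d where "d = det (blk J \<omega>)"
        have d: "d > 0" unfolding d_def by (rule pos_def_det_pos[OF conjunct2[OF True]])
        define e where "e = det (blk (insert k J) (fun_upd \<omega> {k} 0))"
        have det: "det (blk (insert k J) (fun_upd \<omega> {k} y)) = d * (y + e / d)" for y
          using d det_blk_insert[OF insert.hyps(2), of \<omega> y] by (simp add: d_def[symmetric] e_def[symmetric] algebra_simps)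
        have "(\<integral>\<^sup>+y. ?F (insert k J) (fun_upd \<omega> {k} y) \<partial>lborel) \<le>
            (\<integral>\<^sup>+y. ennreal (d powr \<alpha>) * (if \<bar>y\<bar> \<le> 1 \<and> y + e / d > 0 then ennreal ((y + e / d) powr \<alpha>) else 0) \<partial>lborel)"
        proof (rule nn_integral_mono)
          fix y :: real
          show "?F (insert k J) (fun_upd \<omega> {k} y) \<le> ennreal (d powr \<alpha>) * (if \<bar>y\<bar> \<le> 1 \<and> y + e / d > 0 then ennreal ((y + e / d) powr \<alpha>) else 0)"
          proof (cases "(\<forall>s\<in>pairs. \<bar>(fun_upd \<omega> {k} y) s\<bar> \<le> 1) \<and> pos_def (blk (insert k J) (fun_upd \<omega> {k} y))")
            case c: True
            then have "\<bar>y\<bar> \<le> 1" using kp by (metis fun_upd_same)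
            moreover have "0 < d * (y + e / d)" using pos_def_det_pos c det by metis
            then have "y + e / d > 0" using d by (simp add: zero_less_mult_iff)
            moreover have "(d * (y + e / d)) powr \<alpha> = d powr \<alpha> * (y + e / d) powr \<alpha>"
              by (rule powr_mult)
            ultimately show ?thesis using c by (simp add: det ennreal_mult del: fun_upd_apply)
          qed (simp only: if_False zero_le)
        qed
        also have "\<dots> = ennreal (d powr \<alpha>) * (\<integral>\<^sup>+y. (if \<bar>y\<bar> \<le> 1 \<and> y + e / d > 0 then ennreal ((y + e / d) powr \<alpha>) else 0) \<partial>lborel)"
          by (rule nn_integral_cmult) measurable
        also have "\<dots> \<le> ennreal (d powr \<alpha>) * ennreal c"
          unfolding c_def by (intro mult_left_mono nn_integral_shifted_powr_le \<alpha>) auto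
        \<comment> \<open>The coordinate \<open>y\<close> has been integrated out, but the induction
          hypothesis integrates over all coordinates. A factor of measure 2 \<ge> 1 brings an
          integral over \<open>y\<close> back.\<close>
        also have "\<dots> \<le> ennreal c * (ennreal (d powr \<alpha>) * emeasure lborel {- 1..1::real})"
        proof -
          have "ennreal (d powr \<alpha>) * 1 \<le> ennreal (d powr \<alpha>) * emeasure lborel {- 1..1::real}"
            by (intro mult_left_mono) auto
          then show ?thesis by (subst mult.commute) (intro mult_left_mono, auto)
        qed
        also have "ennreal (d powr \<alpha>) * emeasure lborel {- 1..1::real} = (\<integral>\<^sup>+y. ennreal (d powr \<alpha>) * indicator {- 1..1::real} y \<partial>lborel)"
          by (rule nn_integral_cmult_indicator[symmetric]) auto
        also have "\<dots> \<le> (\<integral>\<^sup>+y. ?F J (fun_upd \<omega> {k} y) \<partial>lborel)"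
        proof (rule nn_integral_mono)
          fix y :: real
          have "\<forall>s\<in>pairs. \<bar>(fun_upd \<omega> {k} y) s\<bar> \<le> 1" if "y \<in> {- 1..1}"
            using that True by (auto simp: S_def abs_le_iff)
          then show "ennreal (d powr \<alpha>) * indicator {- 1..1} y \<le> ?F J (fun_upd \<omega> {k} y)"
            using True unfolding blk_update[OF insert.hyps(2)] d_def[symmetric] by (cases "y \<in> {- 1..1}") auto
        qed
        finally show ?thesis by (simp add: mult_left_mono)
      qed
    qed
    also have "\<dots> = ennreal c * (\<integral>\<^sup>+\<omega>. (\<integral>\<^sup>+y. ?F J (fun_upd \<omega> {k} y) \<partial>lborel) \<partial>(\<Pi>\<^sub>M s\<in>S. lborel))"
    proof (rule nn_integral_cmult)
      have "(\<lambda>(\<omega>, y). (fun_upd \<omega> {k} y)) \<in> measurable ((\<Pi>\<^sub>M s\<in>S. lborel) \<Otimes>\<^sub>M lborel) pairs_lborel"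
        using measurable_add_dim[of "{k}" S "\<lambda>_. lborel :: real measure"] unfolding ins .
      then have "(\<lambda>(\<omega>, y). f (fun_upd \<omega> {k} y)) \<in> borel_measurable ((\<Pi>\<^sub>M s\<in>S. lborel) \<Otimes>\<^sub>M lborel)"
        if "f \<in> borel_measurable pairs_lborel" for f :: "('r set \<Rightarrow> real) \<Rightarrow> ennreal"
        using measurable_compose[OF _ that] by (simp only: case_prod_unfold)
      note this[OF meas[of J]]
      then show "(\<lambda>\<omega>. \<integral>\<^sup>+y. ?F J (fun_upd \<omega> {k} y) \<partial>lborel) \<in> borel_measurable (\<Pi>\<^sub>M s\<in>S. lborel)"
        by (rule lborel.borel_measurable_nn_integral)
    qed
    also have "\<dots> = ennreal c * (\<integral>\<^sup>+\<omega>. ?F J \<omega> \<partial>pairs_lborel)"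
      by (subst fold[OF meas]) simp
    also have "\<dots> < \<infinity>" using insert.IH by (simp add: ennreal_mult_less_top)
    finally show ?case .
  qed
qed

section \<open>The compact set of matrices between 0 and I\<close>

lemma R_set_reflect: "\<Omega> \<in> R_set \<Longrightarrow> mat 1 - \<Omega> \<in> R_set"
  by (simp add: R_set_iff)

text \<open>The compact set on which continuous factors are bounded. Its points outside
  \<open>R_set\<close> are those where \<Omega> or I - \<Omega> has determinant 0.\<close>

definition R_closed :: "(real ^ 'n ^ 'n) set" where
  "R_closed = {\<Omega>. psd \<Omega> \<and> psd (mat 1 - \<Omega>)}"

lemma R_set_subset_closed: "R_set \<subseteq> R_closed"
  by (auto simp: R_set_iff R_closed_def pos_def_psd)

lemma R_set_iff_closed: "\<Omega> \<in> R_set \<longleftrightarrow> \<Omega> \<in> R_closed \<and> det \<Omega> \<noteq> 0 \<and> det (mat 1 - \<Omega>) \<noteq> 0"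
  by (auto simp: R_set_iff R_closed_def pos_def_iff_psd)

lemma psd_diag_nonneg: "psd A \<Longrightarrow> 0 \<le> A $ i $ i"
proof -
  have "A $ i $ i = axis i 1 \<bullet> (A *v axis i 1)"
    by (simp add: matrix_vector_mult_basis column_def inner_axis')
  then show "psd A \<Longrightarrow> 0 \<le> A $ i $ i" by (simp add: psd_def)
qed

text \<open>Evaluate the form at the sum and the difference of two basis vectors.\<close>

lemma psd_entry_bound:
  assumes "psd A"
  shows "2 * \<bar>A $ i $ j\<bar> \<le> A $ i $ i + A $ j $ j"
proof -
  have sym: "A $ j $ i = A $ i $ j" using assms unfolding psd_def by (metis transpose_def vec_lambda_beta)
  have q: "(axis i 1 + c *\<^sub>R axis j 1) \<bullet> (A *v (axis i 1 + c *\<^sub>R axis j 1)) = A $ i $ i + 2 * c * A $ i $ j + c * c * A $ j $ j" for c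
    by (simp add: matrix_vector_right_distrib matrix_vector_mult_scaleR matrix_vector_mult_basis column_def inner_axis' inner_add_left inner_add_right sym algebra_simps)
  have "0 \<le> A $ i $ i + 2 * A $ i $ j + A $ j $ j" "0 \<le> A $ i $ i - 2 * A $ i $ j + A $ j $ j"
    using q[of 1] q[of "- 1"] assms unfolding psd_def by (metis mult_1 mult.right_neutral, metis (no_types, opaque_lifting) q add_uminus_conv_diff mult.right_neutral mult_minus1 mult_minus_left mult_minus_right minus_minus mult_1)
  then show ?thesis by linarith
qed

lemma R_closed_entry_bound:
  assumes "\<Omega> \<in> R_closed" shows "\<bar>\<Omega> $ i $ j\<bar> \<le> 1"
proof -
  have "0 \<le> (mat 1 - \<Omega>) $ i $ i" "0 \<le> (mat 1 - \<Omega>) $ j $ j"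
    using assms psd_diag_nonneg[of "mat 1 - \<Omega>"] unfolding R_closed_def by blast+
  then have "\<Omega> $ i $ i \<le> 1" "\<Omega> $ j $ j \<le> 1" by (simp_all add: mat_def)
  then show ?thesis using psd_entry_bound[of \<Omega> i j] assms by (simp add: R_closed_def)
qed

lemma compact_R_closed: "compact (R_closed :: (real ^ 'n ^ 'n) set)"
  unfolding compact_eq_bounded_closed
proof
  have "continuous_on UNIV (\<lambda>\<Omega> :: real ^ 'n ^ 'n. mat 1 - \<Omega>)" by (intro continuous_intros)
  from closed_vimage[OF closed_psd this]
  have "closed {\<Omega> :: real ^ 'n ^ 'n. psd (mat 1 - \<Omega>)}" by (simp add: vimage_def)
  then show "closed (R_closed :: (real ^ 'n ^ 'n) set)"
    unfolding R_closed_def by (intro closed_Collect_conj closed_psd)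
  have "norm \<Omega> \<le> real CARD('n) * real CARD('n)" if "\<Omega> \<in> R_closed" for \<Omega> :: "real ^ 'n ^ 'n"
  proof -
    have "norm \<Omega> \<le> (\<Sum>i\<in>UNIV. norm (\<Omega> $ i))" by (simp add: norm_vec_def L2_set_le_sum)
    also have "\<dots> \<le> (\<Sum>i\<in>UNIV. \<Sum>j\<in>UNIV. norm (\<Omega> $ i $ j))"
      by (intro sum_mono) (simp add: norm_vec_def L2_set_le_sum)
    also have "\<dots> \<le> (\<Sum>i\<in>(UNIV :: 'n set). \<Sum>j\<in>(UNIV :: 'n set). 1)"
      using R_closed_entry_bound[OF that] by (intro sum_mono) simp
    finally show ?thesis by simp
  qed
  then show "bounded (R_closed :: (real ^ 'n ^ 'n) set)" unfolding bounded_iff by blast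
qed

lemma det_entry_bound:
  fixes A :: "real ^ 'n ^ 'n"
  assumes "\<And>i j. \<bar>A $ i $ j\<bar> \<le> 1"
  shows "\<bar>det A\<bar> \<le> fact CARD('n)"
proof -
  have "\<bar>det A\<bar> \<le> (\<Sum>p\<in>{p. p permutes (UNIV :: 'n set)}. \<bar>of_int (sign p) * (\<Prod>i\<in>UNIV. A $ i $ p i)\<bar>)"
    unfolding det_def by (rule sum_abs)
  also have "\<dots> \<le> (\<Sum>p\<in>{p. p permutes (UNIV :: 'n set)}. 1)"
  proof (rule sum_mono)
    fix p :: "'n \<Rightarrow> 'n"
    have "\<bar>\<Prod>i\<in>UNIV. A $ i $ p i\<bar> \<le> 1"
      unfolding abs_prod using assms by (intro prod_le_1) auto
    then show "\<bar>of_int (sign p) * (\<Prod>i\<in>UNIV. A $ i $ p i)\<bar> \<le> 1"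
      by (simp add: abs_mult sign_def)
  qed
  also have "\<dots> = fact CARD('n)" by (simp add: card_permutations)
  finally show ?thesis .
qed

text \<open>The product is the adjugate matrix, which stays bounded where the inverse blows
  up.\<close>

lemma matrix_inv_det_bound:
  fixes A :: "real ^ 'n ^ 'n"
  assumes d: "det A \<noteq> 0" and A: "\<And>i j. \<bar>A $ i $ j\<bar> \<le> 1"
  shows "\<bar>det A * matrix_inv A $ i $ j\<bar> \<le> fact CARD('n)"
proof -
  have "det A * matrix_inv A $ i $ j = det (\<chi> k l. if l = i then (axis j 1 :: real ^ 'n) $ k else A $ k $ l)"
    using d by (simp add: matrix_inv_entry)
  also have "\<bar>\<dots>\<bar> \<le> fact CARD('n)"
    by (rule det_entry_bound) (auto simp: A axis_def)
  finally show ?thesis .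
qed

lemma measurable_matrix_inv [measurable]:
  "matrix_inv \<in> borel_measurable (borel :: (real ^ 'n ^ 'n) measure)"
proof -
  text \<open>On singular matrices the choice in \<^const>\<open>matrix_inv\<close> ranges over an empty predicate, hence it is constant there.\<close>
  define c :: "real ^ 'n ^ 'n" where "c = (SOME A. False)"
  have sing: "matrix_inv A = c" if "det A = 0" for A :: "real ^ 'n ^ 'n"
  proof -
    have "\<not> (A ** A' = mat 1 \<and> A' ** A = mat 1)" for A'
      using matrix_inv_unique(2)[of A A'] that by auto
    then have "(\<lambda>A'. A ** A' = mat 1 \<and> A' ** A = mat 1) = (\<lambda>_. False)" by blast
    then show ?thesis unfolding matrix_inv_def c_def by (simp only:)
  qed
  have "(\<lambda>A :: real ^ 'n ^ 'n. matrix_inv A \<bullet> axis i (axis j 1)) \<in> borel_measurable borel" for i j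
  proof -
    have e: "matrix_inv A \<bullet> axis i (axis j 1) = (if det A = 0 then c $ i $ j else
        det (\<chi> k l. if l = i then (axis j 1 :: real ^ 'n) $ k else A $ k $ l) / det A)" for A :: "real ^ 'n ^ 'n"
      by (simp add: inner_axis matrix_inv_entry sing)
    have "continuous_on UNIV (\<lambda>A :: real ^ 'n ^ 'n. det (\<chi> k l. if l = i then (axis j 1 :: real ^ 'n) $ k else A $ k $ l))"
    proof (intro continuous_intros)
      show "continuous_on UNIV (\<lambda>A :: real ^ 'n ^ 'n. if l = i then (axis j 1 :: real ^ 'n) $ k else A $ k $ l)" for k l
        by (cases "l = i") (auto intro!: continuous_intros)
    qed
    then have [measurable]: "(\<lambda>A :: real ^ 'n ^ 'n. det (\<chi> k l. if l = i then (axis j 1 :: real ^ 'n) $ k else A $ k $ l)) \<in> borel_measurable borel"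
      by (rule borel_measurable_continuous_onI)
    show ?thesis unfolding e by measurable
  qed
  then show ?thesis by (auto simp: borel_measurable_euclidean_space[of matrix_inv] Basis_vec_def)
qed

lemma measurable_matrix_mult [measurable (raw)]:
  fixes f :: "'a \<Rightarrow> real ^ 'm ^ 'n" and g :: "'a \<Rightarrow> real ^ 'p ^ 'm"
  assumes [measurable]: "f \<in> borel_measurable N" "g \<in> borel_measurable N"
  shows "(\<lambda>x. f x ** g x) \<in> borel_measurable N"
  by (rule borel_measurable_continuous_Pair[of f N g "\<lambda>A B. A ** B"]) (measurable, intro continuous_intros)

lemma measurable_nth [measurable (raw)]:
  fixes f :: "'a \<Rightarrow> ('b::euclidean_space) ^ 'n"
  assumes "f \<in> borel_measurable N"
  shows "(\<lambda>x. f x $ i) \<in> borel_measurable N"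
  by (rule borel_measurable_continuous_on[OF _ assms]) (intro continuous_intros)

lemma measurable_trace [measurable (raw)]:
  fixes f :: "'a \<Rightarrow> real ^ 'n ^ 'n"
  assumes [measurable]: "f \<in> borel_measurable N"
  shows "(\<lambda>x. trace (f x)) \<in> borel_measurable N"
  unfolding trace_def by measurable

lemma measurable_res [measurable]: "res s \<in> borel_measurable borel"
  unfolding res_def[abs_def] by measurable

lemma measurable_lam [measurable]: "lam s \<in> borel_measurable borel"
  unfolding lam_def[abs_def] by measurable

lemma sets_R_set [measurable]: "R_set \<in> sets borel"
  unfolding R_set_def by measurable

lemma nn_integral_R_det:
  fixes \<alpha> :: real assumes \<alpha>: "- 1 < \<alpha>"
  shows "(\<integral>\<^sup>+\<Omega>. indicator R_set \<Omega> * ennreal (det \<Omega> powr \<alpha>) \<partial>(sym_lborel :: (real ^ 'n ^ 'n) measure)) < \<infinity>"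
proof -
  \<comment> \<open>A positive exponent is reduced to 0, since the determinant is bounded on
    \<open>R_set\<close>; only the singular range needs the recursion over blocks.\<close>
  define \<gamma> where "\<gamma> = min \<alpha> 0"
  define C where "C = (fact CARD('n) :: real) powr (\<alpha> - \<gamma>)"
  have \<gamma>: "- 1 < \<gamma>" "\<gamma> \<le> 0" "\<alpha> - \<gamma> \<ge> 0" using \<alpha> by (auto simp: \<gamma>_def)
  have "(\<integral>\<^sup>+\<Omega>. indicator R_set \<Omega> * ennreal (det \<Omega> powr \<alpha>) \<partial>(sym_lborel :: (real ^ 'n ^ 'n) measure)) =
     (\<integral>\<^sup>+\<omega>. indicator R_set (sym_mat \<omega> :: real ^ 'n ^ 'n) * ennreal (det (sym_mat \<omega> :: real ^ 'n ^ 'n) powr \<alpha>) \<partial>pairs_lborel)"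
    by (rule nn_integral_sym_lborel) measurable
  also have "\<dots> \<le> (\<integral>\<^sup>+\<omega>. ennreal C * (if (\<forall>s\<in>pairs. \<bar>\<omega> s\<bar> \<le> 1) \<and> pos_def (blk (UNIV :: 'n set) \<omega>) then ennreal (det (blk UNIV \<omega>) powr \<gamma>) else 0) \<partial>pairs_lborel)"
  proof (rule nn_integral_mono)
    fix \<omega> :: "'n set \<Rightarrow> real"
    have b: "blk UNIV \<omega> = sym_mat \<omega>" by (simp add: blk_def sym_mat_def)
    show "indicator R_set (sym_mat \<omega> :: real ^ 'n ^ 'n) * ennreal (det (sym_mat \<omega> :: real ^ 'n ^ 'n) powr \<alpha>) \<le>
      ennreal C * (if (\<forall>s\<in>pairs. \<bar>\<omega> s\<bar> \<le> 1) \<and> pos_def (blk (UNIV :: 'n set) \<omega>) then ennreal (det (blk UNIV \<omega>) powr \<gamma>) else 0)"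
    proof (cases "sym_mat \<omega> \<in> (R_set :: (real ^ 'n ^ 'n) set)")
      case True
      have e: "\<bar>sym_mat \<omega> $ i $ j\<bar> \<le> 1" for i j :: 'n
        using R_closed_entry_bound True R_set_subset_closed by blast
      then have "\<forall>s\<in>(pairs :: 'n set set). \<bar>\<omega> s\<bar> \<le> 1" by (auto simp: sym_mat_nth)
      moreover have pd: "pos_def (sym_mat \<omega> :: real ^ 'n ^ 'n)" using True by (simp add: R_set_iff)
      moreover have "det (sym_mat \<omega> :: real ^ 'n ^ 'n) powr \<alpha> \<le> C * det (sym_mat \<omega> :: real ^ 'n ^ 'n) powr \<gamma>"
      proof -
        have "det (sym_mat \<omega> :: real ^ 'n ^ 'n) powr \<alpha> = det (sym_mat \<omega> :: real ^ 'n ^ 'n) powr (\<alpha> - \<gamma>) * det (sym_mat \<omega> :: real ^ 'n ^ 'n) powr \<gamma>"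
          by (simp add: powr_add[symmetric])
        also have "\<dots> \<le> C * det (sym_mat \<omega> :: real ^ 'n ^ 'n) powr \<gamma>"
          unfolding C_def using pos_def_det_pos[OF pd] det_entry_bound[OF e] \<gamma>
          by (intro mult_right_mono powr_mono2) auto
        finally show ?thesis .
      qed
      ultimately show ?thesis using True by (simp add: b ennreal_mult[symmetric] C_def ennreal_leI)
    qed simp
  qed
  also have "\<dots> = ennreal C * (\<integral>\<^sup>+\<omega>. (if (\<forall>s\<in>pairs. \<bar>\<omega> s\<bar> \<le> 1) \<and> pos_def (blk (UNIV :: 'n set) \<omega>) then ennreal (det (blk UNIV \<omega>) powr \<gamma>) else 0) \<partial>pairs_lborel)"
  proof (rule nn_integral_cmult)
    have [measurable]: "Measurable.pred pairs_lborel (\<lambda>\<omega>. \<forall>s\<in>(pairs :: 'n set set). \<bar>\<omega> s\<bar> \<le> 1)"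
    proof (intro pred_intros_finite finite_pairs)
      fix s :: "'n set" assume "s \<in> pairs"
      then have [measurable]: "(\<lambda>\<omega>. \<omega> s) \<in> borel_measurable (pairs_lborel :: ('n set \<Rightarrow> real) measure)"
        by (rule measurable_pairs_component)
      show "Measurable.pred pairs_lborel (\<lambda>\<omega> :: 'n set \<Rightarrow> real. \<bar>\<omega> s\<bar> \<le> 1)" by measurable
    qed
    show "(\<lambda>\<omega>. if (\<forall>s\<in>pairs. \<bar>\<omega> s\<bar> \<le> 1) \<and> pos_def (blk (UNIV :: 'n set) \<omega>) then ennreal (det (blk UNIV \<omega>) powr \<gamma>) else 0) \<in> borel_measurable pairs_lborel"
      by measurable
  qed
  also have "\<dots> < \<infinity>" using nn_integral_blk_finite[OF \<gamma>(1,2), where J = "UNIV :: 'n set"] by (simp add: ennreal_mult_less_top)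
  finally show ?thesis .
qed

lemma nn_integral_R_det_reflect:
  fixes \<alpha> :: real assumes \<alpha>: "- 1 < \<alpha>"
  shows "(\<integral>\<^sup>+\<Omega>. indicator R_set \<Omega> * ennreal (det (mat 1 - \<Omega>) powr \<alpha>) \<partial>(sym_lborel :: (real ^ 'n ^ 'n) measure)) < \<infinity>"
proof -
  have d: "distr sym_lborel borel (\<lambda>A. mat 1 + (- 1) *\<^sub>R A) = (sym_lborel :: (real ^ 'n ^ 'n) measure)"
    by (rule sym_lborel_isometry) auto
  have "(\<integral>\<^sup>+\<Omega>. indicator R_set \<Omega> * ennreal (det \<Omega> powr \<alpha>) \<partial>(sym_lborel :: (real ^ 'n ^ 'n) measure)) =
     (\<integral>\<^sup>+\<Omega>. indicator R_set \<Omega> * ennreal (det \<Omega> powr \<alpha>) \<partial>distr sym_lborel borel (\<lambda>A. mat 1 + (- 1) *\<^sub>R (A :: real ^ 'n ^ 'n)))"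
    by (simp only: d)
  also have "\<dots> = (\<integral>\<^sup>+\<Omega>. indicator R_set (mat 1 + (- 1) *\<^sub>R \<Omega>) * ennreal (det (mat 1 + (- 1) *\<^sub>R \<Omega>) powr \<alpha>) \<partial>(sym_lborel :: (real ^ 'n ^ 'n) measure))"
    by (rule nn_integral_distr) measurable
  also have "\<dots> = (\<integral>\<^sup>+\<Omega>. indicator R_set \<Omega> * ennreal (det (mat 1 - \<Omega>) powr \<alpha>) \<partial>(sym_lborel :: (real ^ 'n ^ 'n) measure))"
    by (intro nn_integral_cong) (auto simp: indicator_def R_set_iff)
  finally show ?thesis using nn_integral_R_det[OF \<alpha>] by metis
qed

text \<open>Along a line the set \<open>R_set\<close> is an open interval, so the fundamental
  theorem of calculus has finitely many exceptional points.\<close>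

lemma finite_frontier_real:
  fixes U :: "real set" assumes "open U" "convex U" "bounded U"
  shows "finite (frontier U)"
proof -
  have "connected (closure U)" "compact (closure U)"
    using assms by (auto intro: convex_connected convex_closure)
  then obtain a b where ab: "closure U = {a..b}" using connected_compact_interval_1 by blast
  have "interior U = interior (closure U)" using assms convex_interior_closure by metis
  then have "frontier U = {a..b} - {a<..<b}" by (simp add: frontier_def ab)
  also have "\<dots> \<subseteq> {a, b}" by auto
  finally show ?thesis by (rule finite_subset) simp
qed

section \<open>Integration by parts on the set of matrices between 0 and I\<close>

lemma R_closed_pos_def:
  assumes "\<Omega> \<in> R_closed" "0 \<le> s" "s < 1"
  shows "pos_def (mat 1 - s *\<^sub>R \<Omega>)"
proof -
  have "mat 1 - s *\<^sub>R \<Omega> = (1 - s) *\<^sub>R mat 1 + s *\<^sub>R (mat 1 - \<Omega>)" by (simp add: algebra_simps)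
  then show ?thesis using assms by (auto simp: R_closed_def intro!: pos_def_add pos_def_scaleR psd_scaleR)
qed

lemma det_trace_inv_bound:
  fixes A E :: "real ^ 'n ^ 'n"
  assumes "det A \<noteq> 0" "\<And>i j. \<bar>A $ i $ j\<bar> \<le> 1"
  shows "\<bar>det A * trace (matrix_inv A ** E)\<bar> \<le> fact CARD('n) * (\<Sum>i\<in>UNIV. \<Sum>k\<in>UNIV. \<bar>E $ k $ i\<bar>)"
proof -
  have "det A * trace (matrix_inv A ** E) = (\<Sum>i\<in>UNIV. \<Sum>k\<in>UNIV. (det A * matrix_inv A $ i $ k) * E $ k $ i)"
    by (simp add: trace_def matrix_matrix_mult_def sum_distrib_left mult.assoc)
  also have "\<bar>\<dots>\<bar> \<le> (\<Sum>i\<in>UNIV. \<Sum>k\<in>UNIV. \<bar>(det A * matrix_inv A $ i $ k) * E $ k $ i\<bar>)"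
    by (intro order_trans[OF sum_abs] sum_mono order_refl)
  also have "\<dots> \<le> (\<Sum>i\<in>UNIV. \<Sum>k\<in>UNIV. fact CARD('n) * \<bar>E $ k $ i\<bar>)"
    unfolding abs_mult[of "det A * matrix_inv A $ _ $ _"]
    by (intro sum_mono mult_right_mono matrix_inv_det_bound assms) auto
  finally show ?thesis by (simp add: sum_distrib_left)
qed

lemma trace_minus: "trace (- A) = - trace (A :: real ^ 'n ^ 'n)"
  by (simp add: trace_def sum_negf)

text \<open>The parameters of the conditional density of \<Omega> given the observation. In the
  application \<alpha> is (a + q) / 2 - 1, \<beta> is b / 2 - 1, \<kappa> is q / 2 and
  \<open>s\<close> is 1 - v / v0; the bound on \<beta> is then \<open>b > 2\<close>.\<close>

locale matrix_beta =
  fixes \<alpha> \<beta> s \<kappa> v :: real and z :: "real ^ 'q ^ 'n"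
  assumes \<alpha>: "\<alpha> > 1" and \<beta>: "\<beta> > 0" and s: "0 \<le> s" "s < 1" and v: "v > 0"
begin

text \<open>The factor of the density that is continuous on all of \<open>R_closed\<close>, because
  \<open>s < 1\<close> keeps I - s \<Omega> invertible there.\<close>

definition smooth :: "real ^ 'n ^ 'n \<Rightarrow> real" where
  "smooth \<Omega> = det (mat 1 - s *\<^sub>R \<Omega>) powr (- \<kappa>) * exp (- ((lam s \<Omega> ** z) \<bullet> z) / (2 * v))"

definition weight :: "real ^ 'n ^ 'n \<Rightarrow> real" where
  "weight \<Omega> = det \<Omega> powr \<alpha> * det (mat 1 - \<Omega>) powr \<beta> * smooth \<Omega>"

text \<open>The logarithmic derivative of \<open>smooth\<close> in the direction \<open>E\<close>;
  \<open>score\<close> is that of the whole \<open>weight\<close>.\<close>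

definition rest_score :: "real ^ 'n ^ 'n \<Rightarrow> real ^ 'n ^ 'n \<Rightarrow> real" where
  "rest_score \<Omega> E = \<kappa> * s * trace (res s \<Omega> ** E) - (1 - s) * ((res s \<Omega> ** E ** res s \<Omega> ** z) \<bullet> z) / (2 * v)"

definition score :: "real ^ 'n ^ 'n \<Rightarrow> real ^ 'n ^ 'n \<Rightarrow> real" where
  "score \<Omega> E = \<alpha> * trace (matrix_inv \<Omega> ** E) - \<beta> * trace (res 1 \<Omega> ** E) + rest_score \<Omega> E"

lemma measurable_weights [measurable]:
  "smooth \<in> borel_measurable borel" "weight \<in> borel_measurable borel"
  "(\<lambda>\<Omega>. score \<Omega> E) \<in> borel_measurable borel"
  unfolding smooth_def[abs_def] weight_def[abs_def] score_def rest_score_def by measurable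

lemma det_pos:
  assumes "\<Omega> \<in> R_set"
  shows "det \<Omega> > 0" "det (mat 1 - \<Omega>) > 0" "det (mat 1 - s *\<^sub>R \<Omega>) > 0"
  using assms s R_set_pos_def[OF assms, of s] by (auto simp: R_set_iff intro: pos_def_det_pos)

lemma continuous_on_res: "continuous_on R_closed (res s :: real ^ 'n ^ 'n \<Rightarrow> _)"
  unfolding res_def[abs_def]
  by (intro continuous_intros pos_def_det_nonzero R_closed_pos_def s)

lemma continuous_on_smooth: "continuous_on R_closed smooth"
  unfolding smooth_def[abs_def] lam_def
  by (intro continuous_intros continuous_on_res)
    (auto simp: v less_imp_neq[OF v, symmetric] dest!: R_closed_pos_def[OF _ s] pos_def_det_nonzero)

lemma continuous_on_rest_score: "continuous_on R_closed (\<lambda>\<Omega>. rest_score \<Omega> E)"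
  unfolding rest_score_def trace_def using v
  by (intro continuous_intros continuous_on_res) auto

lemma bounded_on_R_closed:
  fixes f :: "real ^ 'n ^ 'n \<Rightarrow> real"
  assumes "continuous_on R_closed f"
  shows "\<exists>C\<ge>0. \<forall>\<Omega>\<in>R_closed. \<bar>f \<Omega>\<bar> \<le> C"
proof -
  have "bounded (f ` R_closed)" by (intro compact_imp_bounded compact_continuous_image assms compact_R_closed)
  then obtain C where "\<And>\<Omega>. \<Omega> \<in> R_closed \<Longrightarrow> \<bar>f \<Omega>\<bar> \<le> C" unfolding bounded_iff by auto
  then show ?thesis by (intro exI[of _ "\<bar>C\<bar>"]) (auto intro: order_trans[OF _ abs_ge_self])
qed

text \<open>Differentiating \<open>weight\<close> lowers each exponent by one. As \<alpha> > 1, the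
  power of det \<Omega> stays bounded, but \<beta> - 1 may be negative, so the majorant contains a
  singular power; it is integrable because \<beta> - 1 > - 1.\<close>

lemma integrable_dominated:
  assumes [measurable]: "k \<in> borel_measurable borel"
    and b: "\<And>\<Omega>. \<Omega> \<in> R_set \<Longrightarrow> \<bar>k \<Omega>\<bar> \<le> C * (1 + det (mat 1 - \<Omega>) powr (\<beta> - 1))"
  shows "integrable (sym_lborel :: (real ^ 'n ^ 'n) measure) (\<lambda>\<Omega>. indicator R_set \<Omega> * k \<Omega>)"
proof (rule integrableI_bounded)
  show "(\<lambda>\<Omega>. indicator R_set \<Omega> * k \<Omega>) \<in> borel_measurable (sym_lborel :: (real ^ 'n ^ 'n) measure)" by measurable
  have "(\<integral>\<^sup>+\<Omega>. ennreal (norm (indicator R_set \<Omega> * k \<Omega>)) \<partial>(sym_lborel :: (real ^ 'n ^ 'n) measure)) \<le>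
     (\<integral>\<^sup>+\<Omega>. ennreal \<bar>C\<bar> * (indicator R_set \<Omega> * ennreal (det (mat 1 - \<Omega>) powr 0) + indicator R_set \<Omega> * ennreal (det (mat 1 - \<Omega>) powr (\<beta> - 1))) \<partial>(sym_lborel :: (real ^ 'n ^ 'n) measure))"
  proof (rule nn_integral_mono)
    fix \<Omega> :: "real ^ 'n ^ 'n"
    show "ennreal (norm (indicator R_set \<Omega> * k \<Omega>)) \<le>
      ennreal \<bar>C\<bar> * (indicator R_set \<Omega> * ennreal (det (mat 1 - \<Omega>) powr 0) + indicator R_set \<Omega> * ennreal (det (mat 1 - \<Omega>) powr (\<beta> - 1)))"
    proof (cases "\<Omega> \<in> R_set")
      case True
      have "\<bar>k \<Omega>\<bar> \<le> \<bar>C\<bar> * (1 + det (mat 1 - \<Omega>) powr (\<beta> - 1))"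
        using b[OF True] by (rule order_trans) (intro mult_right_mono, auto)
      then have "ennreal \<bar>k \<Omega>\<bar> \<le> ennreal \<bar>C\<bar> * (1 + ennreal (det (mat 1 - \<Omega>) powr (\<beta> - 1)))"
      proof -
        have "ennreal (\<bar>C\<bar> * (1 + det (mat 1 - \<Omega>) powr (\<beta> - 1))) = ennreal \<bar>C\<bar> * (1 + ennreal (det (mat 1 - \<Omega>) powr (\<beta> - 1)))"
          by (simp add: ennreal_mult ennreal_plus)
        then show ?thesis using ennreal_leI[OF \<open>\<bar>k \<Omega>\<bar> \<le> \<bar>C\<bar> * (1 + det (mat 1 - \<Omega>) powr (\<beta> - 1))\<close>] by simp
      qed
      then show ?thesis using True det_pos(2)[OF True] by simp
    qed simp
  qed
  also have "\<dots> < \<infinity>"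
    using nn_integral_R_det_reflect[of 0, where 'n = 'n] nn_integral_R_det_reflect[of "\<beta> - 1", where 'n = 'n] \<beta>
    by (subst nn_integral_cmult, measurable) (simp add: nn_integral_add ennreal_mult_less_top del: powr_zero_eq_one)
  finally show "(\<integral>\<^sup>+\<Omega>. ennreal (norm (indicator R_set \<Omega> * k \<Omega>)) \<partial>(sym_lborel :: (real ^ 'n ^ 'n) measure)) < \<infinity>" .
qed

lemma det_bounds:
  fixes \<Omega> :: "real ^ 'n ^ 'n" assumes "\<Omega> \<in> R_set"
  shows "det \<Omega> \<le> fact CARD('n)" "det (mat 1 - \<Omega>) \<le> fact CARD('n)"
    "\<And>i j. \<bar>\<Omega> $ i $ j\<bar> \<le> 1" "\<And>i j. \<bar>(mat 1 - \<Omega>) $ i $ j\<bar> \<le> 1"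
proof -
  show 1: "\<And>i j. \<bar>\<Omega> $ i $ j\<bar> \<le> 1" using assms R_closed_entry_bound R_set_subset_closed by blast
  show 2: "\<And>i j. \<bar>(mat 1 - \<Omega>) $ i $ j\<bar> \<le> 1" using R_set_reflect[OF assms] R_closed_entry_bound R_set_subset_closed by blast
  show "det \<Omega> \<le> fact CARD('n)" "det (mat 1 - \<Omega>) \<le> fact CARD('n)"
    using det_entry_bound[OF 1] det_entry_bound[OF 2] by auto
qed

lemma weight_bounded: "\<exists>C\<ge>0. \<forall>\<Omega>\<in>R_set. 0 < weight \<Omega> \<and> weight \<Omega> \<le> C"
proof -
  obtain H where H: "H \<ge> 0" "\<And>\<Omega>. \<Omega> \<in> R_closed \<Longrightarrow> \<bar>smooth \<Omega>\<bar> \<le> H"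
    using bounded_on_R_closed[OF continuous_on_smooth] by blast
  define D :: real where "D = fact CARD('n)"
  have "0 < weight \<Omega> \<and> weight \<Omega> \<le> D powr \<alpha> * D powr \<beta> * H" if \<Omega>: "\<Omega> \<in> R_set" for \<Omega>
  proof
    show "0 < weight \<Omega>" using det_pos[OF \<Omega>] by (simp add: weight_def smooth_def)
    have "smooth \<Omega> \<le> H" using H(2)[of \<Omega>] \<Omega> R_set_subset_closed by auto
    moreover have "0 \<le> smooth \<Omega>" by (simp add: smooth_def)
    ultimately show "weight \<Omega> \<le> D powr \<alpha> * D powr \<beta> * H"
      unfolding weight_def using det_pos[OF \<Omega>] det_bounds[OF \<Omega>] \<alpha> \<beta>
      by (intro mult_mono powr_mono2) (auto simp: D_def)
  qed
  then show ?thesis using H(1) by (intro exI[of _ "D powr \<alpha> * D powr \<beta> * H"]) auto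
qed

lemma weight_score_bound:
  "\<exists>C. \<forall>\<Omega>\<in>R_set. \<bar>weight \<Omega> * score \<Omega> E\<bar> \<le> C * (1 + det (mat 1 - \<Omega>) powr (\<beta> - 1))"
proof -
  obtain H where H: "H \<ge> 0" "\<And>\<Omega>. \<Omega> \<in> R_closed \<Longrightarrow> \<bar>smooth \<Omega>\<bar> \<le> H"
    using bounded_on_R_closed[OF continuous_on_smooth] by blast
  obtain S where S: "S \<ge> 0" "\<And>\<Omega>. \<Omega> \<in> R_closed \<Longrightarrow> \<bar>rest_score \<Omega> E\<bar> \<le> S"
    using bounded_on_R_closed[OF continuous_on_rest_score] by blast
  obtain W where W: "W \<ge> 0" "\<And>\<Omega>. \<Omega> \<in> R_set \<Longrightarrow> 0 < weight \<Omega>" "\<And>\<Omega>. \<Omega> \<in> R_set \<Longrightarrow> weight \<Omega> \<le> W"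
    using weight_bounded by blast
  define D :: real where "D = fact CARD('n)"
  define e where "e = D * (\<Sum>i\<in>UNIV. \<Sum>k\<in>UNIV. \<bar>E $ k $ i\<bar>)"
  have D: "D > 0" and e: "e \<ge> 0" by (auto simp: D_def e_def sum_nonneg)
  define C1 where "C1 = \<alpha> * (D powr (\<alpha> - 1) * e * D powr \<beta> * H)"
  define C2 where "C2 = \<beta> * (D powr \<alpha> * e * H)"
  have C: "C1 \<ge> 0" "C2 \<ge> 0" using \<alpha> \<beta> e H by (auto simp: C1_def C2_def)
  have "\<bar>weight \<Omega> * score \<Omega> E\<bar> \<le> (C1 + C2 + W * S) * (1 + det (mat 1 - \<Omega>) powr (\<beta> - 1))" if \<Omega>: "\<Omega> \<in> R_set" for \<Omega>
  proof -
    note dp = det_pos[OF \<Omega>] and db = det_bounds[OF \<Omega>, folded D_def]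
    define P where "P = det (mat 1 - \<Omega>) powr (\<beta> - 1)"
    have P: "P \<ge> 0" by (simp add: P_def)
    have sm: "0 \<le> smooth \<Omega>" "smooth \<Omega> \<le> H" using H(2)[of \<Omega>] \<Omega> R_set_subset_closed by (auto simp: smooth_def)
    have t1: "\<bar>det \<Omega> * trace (matrix_inv \<Omega> ** E)\<bar> \<le> e"
      using det_trace_inv_bound[of \<Omega> E] dp db by (auto simp: e_def D_def)
    have t2: "\<bar>det (mat 1 - \<Omega>) * trace (res 1 \<Omega> ** E)\<bar> \<le> e"
      using det_trace_inv_bound[of "mat 1 - \<Omega>" E] dp db by (auto simp: e_def D_def res_def)
    \<comment> \<open>One power of each determinant is split off to pair with the inverse matrix in
      \<open>score\<close>, so that only the bounded adjugate remains.\<close>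
    have p1: "det \<Omega> powr \<alpha> = det \<Omega> powr (\<alpha> - 1) * det \<Omega>" using dp by (simp add: powr_diff)
    have p2: "det (mat 1 - \<Omega>) powr \<beta> = P * det (mat 1 - \<Omega>)" using dp by (simp add: P_def powr_diff)
    have "\<bar>weight \<Omega> * (\<alpha> * trace (matrix_inv \<Omega> ** E))\<bar> =
        \<alpha> * (det \<Omega> powr (\<alpha> - 1) * \<bar>det \<Omega> * trace (matrix_inv \<Omega> ** E)\<bar> * det (mat 1 - \<Omega>) powr \<beta> * smooth \<Omega>)"
      using \<alpha> dp sm by (simp add: weight_def p1 abs_mult mult_ac)
    also have "\<dots> \<le> C1"
      unfolding C1_def using t1 dp db sm \<alpha> \<beta> e D by (intro mult_left_mono mult_mono powr_mono2) auto
    finally have 1: "\<bar>weight \<Omega> * (\<alpha> * trace (matrix_inv \<Omega> ** E))\<bar> \<le> C1" .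
    have "\<bar>weight \<Omega> * (\<beta> * trace (res 1 \<Omega> ** E))\<bar> =
        \<beta> * (det \<Omega> powr \<alpha> * \<bar>det (mat 1 - \<Omega>) * trace (res 1 \<Omega> ** E)\<bar> * smooth \<Omega>) * P"
      unfolding weight_def p2 using \<beta> dp sm P by (simp add: abs_mult mult_ac)
    also have "\<dots> \<le> C2 * P"
      unfolding C2_def using t2 dp db sm \<alpha> \<beta> e D P by (intro mult_right_mono mult_left_mono mult_mono powr_mono2) auto
    finally have 2: "\<bar>weight \<Omega> * (\<beta> * trace (res 1 \<Omega> ** E))\<bar> \<le> C2 * P" .
    have 3: "\<bar>weight \<Omega> * rest_score \<Omega> E\<bar> \<le> W * S"
      unfolding abs_mult using W(2,3)[OF \<Omega>] S(2)[of \<Omega>] \<Omega> R_set_subset_closed W(1) by (intro mult_mono) auto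
    have "weight \<Omega> * score \<Omega> E = weight \<Omega> * (\<alpha> * trace (matrix_inv \<Omega> ** E)) - weight \<Omega> * (\<beta> * trace (res 1 \<Omega> ** E)) + weight \<Omega> * rest_score \<Omega> E"
      by (simp add: score_def algebra_simps)
    then have "\<bar>weight \<Omega> * score \<Omega> E\<bar> \<le> C1 + C2 * P + W * S" using 1 2 3 by linarith
    also have "\<dots> \<le> (C1 + C2 + W * S) * (1 + P)"
    proof -
      have "0 \<le> C1 * P" "0 \<le> W * S * P" using C P W S by auto
      then show ?thesis using C by (simp add: algebra_simps)
    qed
    finally show ?thesis by (simp add: P_def)
  qed
  then show ?thesis by blast
qed

text \<open>A resolvent identity: \<open>X ** Rt - \<Omega> ** R\<close> is exactly
  \<open>t *\<^sub>R (R ** E ** Rt)\<close>, so the difference quotient converges by continuity of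
  the inverse.\<close>

lemma lam_deriv:
  assumes d: "det (mat 1 - s *\<^sub>R \<Omega>) \<noteq> 0"
  shows "((\<lambda>t. (lam s (\<Omega> + t *\<^sub>R E) ** z) \<bullet> z) has_real_derivative (1 - s) * ((res s \<Omega> ** E ** res s \<Omega> ** z) \<bullet> z)) (at 0)"
proof -
  have t: "((\<lambda>t. mat 1 - s *\<^sub>R (\<Omega> + t *\<^sub>R E)) \<longlongrightarrow> mat 1 - s *\<^sub>R \<Omega>) (at 0)" by (auto intro!: tendsto_eq_intros)
  have ev: "eventually (\<lambda>t. det (mat 1 - s *\<^sub>R (\<Omega> + t *\<^sub>R E)) \<noteq> 0) (at 0)"
    using tendsto_imp_eventually_ne[OF tendsto_det[OF t] d] .
  have "((\<lambda>t. (1 - s) * ((res s \<Omega> ** E ** res s (\<Omega> + t *\<^sub>R E) ** z) \<bullet> z)) \<longlongrightarrow> (1 - s) * ((res s \<Omega> ** E ** res s \<Omega> ** z) \<bullet> z)) (at 0)"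
    unfolding res_def by (intro tendsto_intros tendsto_matrix_mult tendsto_matrix_inv t d)
  moreover have "eventually (\<lambda>t. (1 - s) * ((res s \<Omega> ** E ** res s (\<Omega> + t *\<^sub>R E) ** z) \<bullet> z) =
     ((lam s (\<Omega> + t *\<^sub>R E) ** z) \<bullet> z - (lam s (\<Omega> + 0 *\<^sub>R E) ** z) \<bullet> z) / (t - 0)) (at 0)"
    using ev eventually_neq_at_within[of 0 0 UNIV]
  proof eventually_elim
    case (elim t)
    define X where "X = \<Omega> + t *\<^sub>R E"
    define R where "R = res s \<Omega>"
    define Rt where "Rt = res s X"
    define T where "T = mat 1 - s *\<^sub>R \<Omega>"
    define Tt where "Tt = mat 1 - s *\<^sub>R X"
    have RT: "R ** T = mat 1" and TtRt: "Tt ** Rt = mat 1"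
      using matrix_inv_mult(2)[OF d] matrix_inv_mult(1)[OF elim(1)]
      by (simp_all add: R_def Rt_def T_def Tt_def res_def X_def)
    have "X ** Rt - \<Omega> ** R = X ** Rt - R ** \<Omega>" using res_mult(1)[OF d] by (simp add: R_def)
    also have "\<dots> = (R ** T) ** X ** Rt - R ** \<Omega> ** (Tt ** Rt)" by (simp add: RT TtRt)
    also have "\<dots> = R ** (T ** X - \<Omega> ** Tt) ** Rt"
      by (simp add: matrix_sub_ldistrib matrix_sub_rdistrib matrix_mul_assoc)
    also have "T ** X - \<Omega> ** Tt = t *\<^sub>R E"
      by (simp add: T_def Tt_def matrix_ring X_def)
    finally have "X ** Rt - \<Omega> ** R = t *\<^sub>R (R ** E ** Rt)" by (simp add: matrix_scaleR_mult)
    then have "lam s X - lam s \<Omega> = (1 - s) *\<^sub>R (t *\<^sub>R (R ** E ** Rt))"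
      by (simp add: lam_def R_def Rt_def scaleR_diff_right[symmetric])
    then have "(lam s X ** z) \<bullet> z - (lam s \<Omega> ** z) \<bullet> z = ((1 - s) *\<^sub>R (t *\<^sub>R (R ** E ** Rt)) ** z) \<bullet> z"
      by (simp add: inner_diff_left[symmetric] matrix_sub_rdistrib[symmetric])
    then show ?case using elim(2) by (simp add: X_def[symmetric] matrix_scaleR_mult R_def[symmetric] Rt_def[symmetric])
  qed
  ultimately have "((\<lambda>t. ((lam s (\<Omega> + t *\<^sub>R E) ** z) \<bullet> z - (lam s (\<Omega> + 0 *\<^sub>R E) ** z) \<bullet> z) / (t - 0)) \<longlongrightarrow> (1 - s) * ((res s \<Omega> ** E ** res s \<Omega> ** z) \<bullet> z)) (at 0)"
    by (rule Lim_transform_eventually)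
  then show ?thesis by (simp add: has_field_derivative_iff)
qed

lemma weight_deriv:
  assumes \<Omega>: "\<Omega> \<in> R_set"
  shows "((\<lambda>t. weight (\<Omega> + t *\<^sub>R E)) has_real_derivative weight \<Omega> * score \<Omega> E) (at 0)"
proof -
  note dp = det_pos[OF \<Omega>]
  have d1: "((\<lambda>t. det (\<Omega> + t *\<^sub>R E)) has_real_derivative det \<Omega> * trace (matrix_inv \<Omega> ** E)) (at 0)"
    using dp by (intro deriv_det) auto
  have d2: "((\<lambda>t. det (mat 1 - (\<Omega> + t *\<^sub>R E))) has_real_derivative - (det (mat 1 - \<Omega>) * trace (res 1 \<Omega> ** E))) (at 0)"
  proof -
    have "((\<lambda>t. det ((mat 1 - \<Omega>) + t *\<^sub>R (- E))) has_real_derivative det (mat 1 - \<Omega>) * trace (matrix_inv (mat 1 - \<Omega>) ** (- E))) (at 0)"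
      using dp by (intro deriv_det) auto
    then show ?thesis by (simp add: matrix_minus_mult res_def diff_diff_eq trace_minus)
  qed
  have d3: "((\<lambda>t. det (mat 1 - s *\<^sub>R (\<Omega> + t *\<^sub>R E))) has_real_derivative - (det (mat 1 - s *\<^sub>R \<Omega>) * (s * trace (res s \<Omega> ** E)))) (at 0)"
  proof -
    have "((\<lambda>t. det ((mat 1 - s *\<^sub>R \<Omega>) + t *\<^sub>R (- s *\<^sub>R E))) has_real_derivative det (mat 1 - s *\<^sub>R \<Omega>) * trace (matrix_inv (mat 1 - s *\<^sub>R \<Omega>) ** (- s *\<^sub>R E))) (at 0)"
      using dp by (intro deriv_det) auto
    then show ?thesis by (simp add: matrix_scaleR_mult matrix_minus_mult trace_minus trace_scaleR res_def algebra_simps)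
  qed
  have p: "((\<lambda>t. f t powr c) has_real_derivative c * f 0 powr c * (f' / f 0)) (at 0)"
    if "(f has_real_derivative f') (at 0)" "f 0 > 0" for f f' and c :: real
    using that by (auto intro!: derivative_eq_intros simp: powr_diff)
  note p1 = p[OF d1, of \<alpha>] and p2 = p[OF d2, of \<beta>] and p3 = p[OF d3, of "- \<kappa>"]
  have ex: "((\<lambda>t. exp (- ((lam s (\<Omega> + t *\<^sub>R E) ** z) \<bullet> z) / (2 * v))) has_real_derivative
     exp (- ((lam s \<Omega> ** z) \<bullet> z) / (2 * v)) * (- ((1 - s) * ((res s \<Omega> ** E ** res s \<Omega> ** z) \<bullet> z)) / (2 * v))) (at 0)"
    using DERIV_exp[THEN DERIV_chain2, OF DERIV_cdivide[OF DERIV_minus[OF lam_deriv[of \<Omega> E]], of "2 * v"]] dp by simp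
  have "((\<lambda>t. weight (\<Omega> + t *\<^sub>R E)) has_real_derivative
    (\<alpha> * det \<Omega> powr \<alpha> * trace (matrix_inv \<Omega> ** E) * det (mat 1 - \<Omega>) powr \<beta> + \<beta> * det (mat 1 - \<Omega>) powr \<beta> * (- trace (res 1 \<Omega> ** E)) * det \<Omega> powr \<alpha>) * smooth \<Omega>
    + ((- \<kappa>) * det (mat 1 - s *\<^sub>R \<Omega>) powr (- \<kappa>) * (- (s * trace (res s \<Omega> ** E))) * exp (- ((lam s \<Omega> ** z) \<bullet> z) / (2 * v)) +
      exp (- ((lam s \<Omega> ** z) \<bullet> z) / (2 * v)) * (- ((1 - s) * ((res s \<Omega> ** E ** res s \<Omega> ** z) \<bullet> z)) / (2 * v)) * det (mat 1 - s *\<^sub>R \<Omega>) powr (- \<kappa>))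
      * (det \<Omega> powr \<alpha> * det (mat 1 - \<Omega>) powr \<beta>)) (at 0)"
    unfolding weight_def smooth_def
    using DERIV_mult[OF DERIV_mult[OF p1 p2] DERIV_mult[OF p3 ex]] dp by simp
  moreover have "(\<alpha> * A * ta * B + \<beta> * B * (- tb) * A) * (C * X) + ((- \<kappa>) * C * (- (s * tc)) * X + X * (- L) * C) * (A * B) =
      A * B * (C * X) * (\<alpha> * ta - \<beta> * tb + (\<kappa> * s * tc - L))" for A B C X ta tb tc L
    by (simp add: algebra_simps)
  ultimately show ?thesis
    unfolding score_def rest_score_def weight_def smooth_def minus_divide_left[symmetric] by (simp only:)
qed

end

lemma psd_det_nonneg: "psd A \<Longrightarrow> 0 \<le> det (A :: real ^ 'n ^ 'n)"
  using psd_det_nonzero_pos_def pos_def_det_pos by (metis less_eq_real_def)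

lemma pos_def_line_open:
  fixes A E :: "real ^ 'n ^ 'n"
  assumes A: "pos_def A" and E: "transpose E = E"
  shows "\<exists>\<delta>>0. \<forall>t. \<bar>t\<bar> < \<delta> \<longrightarrow> pos_def (A + t *\<^sub>R E)"
proof -
  obtain c where c: "c > 0" "\<And>x. c * (norm x)\<^sup>2 \<le> x \<bullet> (A *v x)" using pos_def_lower_bound[OF A] by auto
  have "linear (\<lambda>x. E *v x)" by (rule matrix_vector_mul_linear)
  then obtain B where B: "B > 0" "\<And>x. norm (E *v x) \<le> B * norm x" using linear_bounded_pos by blast
  have "pos_def (A + t *\<^sub>R E)" if t: "\<bar>t\<bar> < c / B" for t
    unfolding pos_def_def
  proof (intro conjI allI impI)
    show "transpose (A + t *\<^sub>R E) = A + t *\<^sub>R E"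
      using A E by (simp add: transpose_linear transpose_scalar pos_def_def)
    fix x :: "real ^ 'n" assume x: "x \<noteq> 0"
    have "\<bar>x \<bullet> (E *v x)\<bar> \<le> norm x * norm (E *v x)" by (rule Cauchy_Schwarz_ineq2)
    also have "\<dots> \<le> norm x * (B * norm x)" by (intro mult_left_mono B) auto
    finally have "\<bar>t\<bar> * \<bar>x \<bullet> (E *v x)\<bar> \<le> \<bar>t\<bar> * (B * (norm x)\<^sup>2)"
      by (intro mult_left_mono) (auto simp: power2_eq_square mult_ac)
    also have "\<dots> < c * (norm x)\<^sup>2"
    proof -
      have "\<bar>t\<bar> * B < c" using t B by (simp add: pos_less_divide_eq)
      then have "(\<bar>t\<bar> * B) * (norm x)\<^sup>2 < c * (norm x)\<^sup>2" using x by (intro mult_strict_right_mono) auto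
      then show ?thesis by (simp add: mult.assoc)
    qed
    also have "\<dots> \<le> x \<bullet> (A *v x)" by (rule c)
    finally have "\<bar>t * (x \<bullet> (E *v x))\<bar> < x \<bullet> (A *v x)" by (simp add: abs_mult)
    then show "0 < x \<bullet> ((A + t *\<^sub>R E) *v x)"
      by (simp add: matrix_vector_mult_add_rdistrib scaleR_matrix_vector_assoc[symmetric] inner_add_right)
  qed
  then show ?thesis using c B by (intro exI[of _ "c / B"]) auto
qed

text \<open>\<open>R_set\<close> lies in the subspace of symmetric matrices, so openness is
  formulated along lines with symmetric direction, which is how integration by parts sees
  it.\<close>

lemma R_set_line:
  fixes x E :: "real ^ 'n ^ 'n"
  assumes E: "transpose E = E" "E \<noteq> 0"
  defines "U \<equiv> {t. x + t *\<^sub>R E \<in> R_set}"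
  shows "open U" "convex U" "bounded U"
proof -
  show "open U"
    unfolding open_real
  proof (intro ballI)
    fix t assume "t \<in> U"
    then have R: "pos_def (x + t *\<^sub>R E)" "pos_def (mat 1 - (x + t *\<^sub>R E))" by (auto simp: U_def R_set_iff)
    obtain d1 where d1: "d1 > 0" "\<And>u. \<bar>u\<bar> < d1 \<Longrightarrow> pos_def (x + t *\<^sub>R E + u *\<^sub>R E)"
      using pos_def_line_open[OF R(1) E(1)] by blast
    obtain d2 where d2: "d2 > 0" "\<And>u. \<bar>u\<bar> < d2 \<Longrightarrow> pos_def (mat 1 - (x + t *\<^sub>R E) + u *\<^sub>R E)"
      using pos_def_line_open[OF R(2) E(1)] by blast
    show "\<exists>e>0. \<forall>u. \<bar>u - t\<bar> < e \<longrightarrow> u \<in> U"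
    proof (intro exI[of _ "min d1 d2"] conjI allI impI)
      fix u assume u: "\<bar>u - t\<bar> < min d1 d2"
      have "pos_def (x + u *\<^sub>R E)" using d1(2)[of "u - t"] u by (simp add: algebra_simps)
      moreover have "pos_def (mat 1 - (x + u *\<^sub>R E))" using d2(2)[of "t - u"] u by (simp add: algebra_simps abs_minus_commute)
      ultimately show "u \<in> U" by (simp add: U_def R_set_iff)
    qed (use d1 d2 in simp)
  qed
  show "convex U"
    unfolding convex_alt
  proof (intro ballI allI impI)
    fix t1 t2 u :: real assume t: "t1 \<in> U" "t2 \<in> U" and u: "0 \<le> u \<and> u \<le> 1"
    have "x + ((1 - u) *\<^sub>R t1 + u *\<^sub>R t2) *\<^sub>R E = (1 - u) *\<^sub>R (x + t1 *\<^sub>R E) + u *\<^sub>R (x + t2 *\<^sub>R E)"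
      by (simp add: algebra_simps)
    moreover have "mat 1 - ((1 - u) *\<^sub>R (x + t1 *\<^sub>R E) + u *\<^sub>R (x + t2 *\<^sub>R E)) = (1 - u) *\<^sub>R (mat 1 - (x + t1 *\<^sub>R E)) + u *\<^sub>R (mat 1 - (x + t2 *\<^sub>R E))"
      by (simp add: algebra_simps)
    ultimately show "(1 - u) *\<^sub>R t1 + u *\<^sub>R t2 \<in> U"
      using t u by (auto simp: U_def R_set_iff intro!: pos_def_segment)
  qed
  obtain i j where ij: "E $ i $ j \<noteq> 0" using E(2) by (auto simp: vec_eq_iff)
  show "bounded U"
    unfolding bounded_iff
  proof (intro exI[of _ "(1 + \<bar>x $ i $ j\<bar>) / \<bar>E $ i $ j\<bar>"] ballI)
    fix t assume "t \<in> U"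
    then have "\<bar>(x + t *\<^sub>R E) $ i $ j\<bar> \<le> 1"
      using R_closed_entry_bound R_set_subset_closed unfolding U_def by blast
    then have "\<bar>t * E $ i $ j\<bar> \<le> 1 + \<bar>x $ i $ j\<bar>" by simp
    then show "norm t \<le> (1 + \<bar>x $ i $ j\<bar>) / \<bar>E $ i $ j\<bar>" using ij by (simp add: abs_mult pos_le_divide_eq)
  qed
qed

text \<open>The symmetric part of a matrix unit. With this factor 1 / 2 a symmetric matrix is the
  sum, over all ordered index pairs, of its entries times these directions.\<close>

definition sym_unit :: "'n \<Rightarrow> 'n \<Rightarrow> real ^ 'n ^ 'n" where
  "sym_unit i j = (\<chi> k l. ((if k = i \<and> l = j then 1 else 0) + (if k = j \<and> l = i then 1 else 0)) / 2)"

lemma sym_unit_sym: "transpose (sym_unit i j) = sym_unit i j"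
proof -
  have "transpose (sym_unit i j) $ k $ l = sym_unit i j $ k $ l" for k l
    unfolding sym_unit_def transpose_def by (simp add: conj_commute add.commute)
  then show ?thesis by (simp only: vec_eq_iff) blast
qed

lemma sym_unit_nonzero: "sym_unit i j \<noteq> 0"
proof -
  have "sym_unit i j $ i $ j \<noteq> 0" by (simp add: sym_unit_def)
  then show ?thesis by (metis zero_index)
qed

lemma sum_sym_unit:
  assumes "transpose F = F"
  shows "(\<Sum>i\<in>UNIV. \<Sum>j\<in>UNIV. F $ i $ j *\<^sub>R sym_unit i j) = F"
proof -
  have sym: "F $ j $ i = F $ i $ j" for i j using assms by (metis transpose_def vec_lambda_beta)
  have "(\<Sum>i\<in>UNIV. \<Sum>j\<in>UNIV. F $ i $ j *\<^sub>R sym_unit i j) $ k $ l = F $ k $ l" for k l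
  proof -
    have "(\<Sum>i\<in>UNIV. \<Sum>j\<in>UNIV. F $ i $ j *\<^sub>R sym_unit i j) $ k $ l =
        (\<Sum>i\<in>UNIV. \<Sum>j\<in>UNIV. (if j = l then if i = k then F $ i $ j / 2 else 0 else 0) + (if j = k then if i = l then F $ i $ j / 2 else 0 else 0))"
      by (auto simp: sym_unit_def intro!: sum.cong)
    also have "\<dots> = F $ k $ l / 2 + F $ l $ k / 2" by (simp add: sum.distrib)
    finally show ?thesis by (simp add: sym)
  qed
  then show ?thesis by (simp add: vec_eq_iff)
qed

text \<open>The origin of the dimension terms in both divergences. A diagonal entry of
  \<open>B\<close> is counted with weight 1 / 2 for each of the r values of \<open>j\<close>, and
  with weight 1 / 2 once more for \<open>j = i\<close>.\<close>

lemma sum_mult_sym_unit: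
  fixes B :: "real ^ 'n ^ 'n"
  shows "(\<Sum>i\<in>UNIV. \<Sum>j\<in>UNIV. (B ** sym_unit i j) $ i $ j) = (real CARD('n) + 1) / 2 * trace B"
    and "(\<Sum>i\<in>UNIV. \<Sum>j\<in>UNIV. (sym_unit i j ** B) $ i $ j) = (real CARD('n) + 1) / 2 * trace B"
proof -
  have 1: "(B ** sym_unit i j) $ i $ j = B $ i $ i / 2 + (if j = i then B $ i $ i / 2 else 0)" for B :: "real ^ 'n ^ 'n" and i j
  proof -
    have "(B ** sym_unit i j) $ i $ j = (\<Sum>k\<in>UNIV. (if k = i then B $ i $ k / 2 else 0) + (if k = j then if j = i then B $ i $ k / 2 else 0 else 0))"
      by (auto simp: matrix_matrix_mult_def sym_unit_def intro!: sum.cong)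
    also have "\<dots> = B $ i $ i / 2 + (if j = i then B $ i $ i / 2 else 0)" by (simp add: sum.distrib)
    finally show ?thesis .
  qed
  show r: "(\<Sum>i\<in>UNIV. \<Sum>j\<in>UNIV. (B ** sym_unit i j) $ i $ j) = (real CARD('n) + 1) / 2 * trace B" for B :: "real ^ 'n ^ 'n"
    by (simp add: 1 sum.distrib trace_def sum_distrib_left[symmetric] sum_divide_distrib[symmetric] algebra_simps add_divide_distrib)
  have "(sym_unit i j ** B) $ i $ j = (transpose B ** sym_unit j i) $ j $ i" for i j
  proof -
    have "(sym_unit i j ** B) $ i $ j = transpose (sym_unit i j ** B) $ j $ i" by (simp add: transpose_def)
    also have "transpose (sym_unit i j ** B) = transpose B ** sym_unit j i"
      unfolding matrix_transpose_mul sym_unit_sym by (simp add: sym_unit_def vec_eq_iff add.commute)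
    finally show ?thesis .
  qed
  then have "(\<Sum>i\<in>UNIV. \<Sum>j\<in>UNIV. (sym_unit i j ** B) $ i $ j) = (\<Sum>j\<in>UNIV. \<Sum>i\<in>UNIV. (transpose B ** sym_unit j i) $ j $ i)"
    by (simp only:) (rule sum.swap)
  then show "(\<Sum>i\<in>UNIV. \<Sum>j\<in>UNIV. (sym_unit i j ** B) $ i $ j) = (real CARD('n) + 1) / 2 * trace B"
    by (simp add: r trace_transpose)
qed

context matrix_beta
begin

lemma continuous_on_weight: "continuous_on R_closed weight"
proof -
  have "continuous_on R_closed (\<lambda>\<Omega>. det \<Omega> powr \<alpha>)"
    using \<alpha> by (intro continuous_on_powr' continuous_intros) (auto simp: R_closed_def intro: psd_det_nonneg)
  moreover have "continuous_on R_closed (\<lambda>\<Omega>. det (mat 1 - \<Omega>) powr \<beta>)"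
    using \<beta> by (intro continuous_on_powr' continuous_intros) (auto simp: R_closed_def intro: psd_det_nonneg)
  ultimately show ?thesis
    unfolding weight_def[abs_def] by (intro continuous_on_mult continuous_on_smooth)
qed

text \<open>
  Since \<open>\<alpha> > 1\<close> and \<open>\<beta> > 0\<close>, the weight extends continuously by zero across the boundary of
  \<^const>\<open>R_set\<close>, so no boundary term appears.
\<close>

lemma ibp:
  fixes F F' :: "real ^ 'n ^ 'n \<Rightarrow> real"
  assumes E: "transpose E = E" "E \<noteq> 0"
    and cF: "continuous_on UNIV F" "continuous_on UNIV F'"
    and dF: "\<And>\<Omega>. ((\<lambda>t. F (\<Omega> + t *\<^sub>R E)) has_real_derivative F' \<Omega>) (at 0)"
  shows "integrable sym_lborel (\<lambda>\<Omega>. indicator R_set \<Omega> * (F' \<Omega> * weight \<Omega> + F \<Omega> * (weight \<Omega> * score \<Omega> E)))"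
    and "(\<integral>\<Omega>. indicator R_set \<Omega> * (F' \<Omega> * weight \<Omega> + F \<Omega> * (weight \<Omega> * score \<Omega> E)) \<partial>sym_lborel) = 0"
proof -
  define g where "g = (\<lambda>\<Omega>. indicator R_set \<Omega> * (F \<Omega> * weight \<Omega>))"
  define g' where "g' = (\<lambda>\<Omega>. indicator R_set \<Omega> * (F' \<Omega> * weight \<Omega> + F \<Omega> * (weight \<Omega> * score \<Omega> E)))"
  have [measurable]: "F \<in> borel_measurable borel" "F' \<in> borel_measurable borel"
    by (intro borel_measurable_continuous_onI cF)+
  obtain A where A: "A \<ge> 0" "\<And>\<Omega>. \<Omega> \<in> R_closed \<Longrightarrow> \<bar>F \<Omega>\<bar> \<le> A"
    using bounded_on_R_closed[OF continuous_on_subset[OF cF(1)]] by auto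
  obtain B where B: "B \<ge> 0" "\<And>\<Omega>. \<Omega> \<in> R_closed \<Longrightarrow> \<bar>F' \<Omega>\<bar> \<le> B"
    using bounded_on_R_closed[OF continuous_on_subset[OF cF(2)]] by auto
  obtain W where W: "W \<ge> 0" "\<And>\<Omega>. \<Omega> \<in> R_set \<Longrightarrow> 0 < weight \<Omega>" "\<And>\<Omega>. \<Omega> \<in> R_set \<Longrightarrow> weight \<Omega> \<le> W"
    using weight_bounded by blast
  obtain C where C: "\<And>\<Omega>. \<Omega> \<in> R_set \<Longrightarrow> \<bar>weight \<Omega> * score \<Omega> E\<bar> \<le> C * (1 + det (mat 1 - \<Omega>) powr (\<beta> - 1))"
    using weight_score_bound by blast
  have P1: "X \<le> X * (1 + det (mat 1 - \<Omega>) powr (\<beta> - 1))" if "X \<ge> 0" for X and \<Omega> :: "real ^ 'n ^ 'n"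
    using that by (simp add: distrib_left)
  have ig: "integrable sym_lborel g"
    unfolding g_def
  proof (rule integrable_dominated)
    fix \<Omega> :: "real ^ 'n ^ 'n" assume \<Omega>: "\<Omega> \<in> R_set"
    have "\<bar>F \<Omega> * weight \<Omega>\<bar> \<le> A * W"
      unfolding abs_mult using A W(1) W(2,3)[OF \<Omega>] \<Omega> R_set_subset_closed by (intro mult_mono) auto
    also have "\<dots> \<le> A * W * (1 + det (mat 1 - \<Omega>) powr (\<beta> - 1))" using A W by (intro P1) auto
    finally show "\<bar>F \<Omega> * weight \<Omega>\<bar> \<le> A * W * (1 + det (mat 1 - \<Omega>) powr (\<beta> - 1))" .
  qed measurable
  have ig': "integrable sym_lborel g'"
    unfolding g'_def
  proof (rule integrable_dominated)
    fix \<Omega> :: "real ^ 'n ^ 'n" assume \<Omega>: "\<Omega> \<in> R_set"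
    have 1: "\<bar>F' \<Omega> * weight \<Omega>\<bar> \<le> B * W"
      unfolding abs_mult using B W(1) W(2,3)[OF \<Omega>] \<Omega> R_set_subset_closed by (intro mult_mono) auto
    have 2: "\<bar>F \<Omega> * (weight \<Omega> * score \<Omega> E)\<bar> \<le> A * (C * (1 + det (mat 1 - \<Omega>) powr (\<beta> - 1)))"
      unfolding abs_mult[of "F \<Omega>"] using A C[OF \<Omega>] \<Omega> R_set_subset_closed by (intro mult_mono) auto
    have 3: "B * W \<le> B * W * (1 + det (mat 1 - \<Omega>) powr (\<beta> - 1))" using B W by (intro P1) auto
    have "\<bar>F' \<Omega> * weight \<Omega> + F \<Omega> * (weight \<Omega> * score \<Omega> E)\<bar> \<le> B * W * (1 + det (mat 1 - \<Omega>) powr (\<beta> - 1)) + A * (C * (1 + det (mat 1 - \<Omega>) powr (\<beta> - 1)))"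
      using abs_triangle_ineq[of "F' \<Omega> * weight \<Omega>" "F \<Omega> * (weight \<Omega> * score \<Omega> E)"] 1 2 3 by linarith
    also have "\<dots> = (B * W + A * C) * (1 + det (mat 1 - \<Omega>) powr (\<beta> - 1))" by (simp add: algebra_simps)
    finally show "\<bar>F' \<Omega> * weight \<Omega> + F \<Omega> * (weight \<Omega> * score \<Omega> E)\<bar> \<le> (B * W + A * C) * (1 + det (mat 1 - \<Omega>) powr (\<beta> - 1))" .
  qed measurable
  show "integrable sym_lborel (\<lambda>\<Omega>. indicator R_set \<Omega> * (F' \<Omega> * weight \<Omega> + F \<Omega> * (weight \<Omega> * score \<Omega> E)))"
    using ig' by (simp add: g'_def)
  have "(\<integral>\<Omega>. g' \<Omega> \<partial>sym_lborel) = 0"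
  proof (rule integral_directional_derivative[OF sigma_finite_sym_lborel sets_sym_lborel _ ig ig'])
    show "distr sym_lborel borel (\<lambda>x. x + t *\<^sub>R E) = sym_lborel" for t
      using sym_lborel_isometry[of "t *\<^sub>R E" 1] E(1) by (simp add: transpose_scalar add.commute cong: distr_cong)
    fix x :: "real ^ 'n ^ 'n"
    show "((\<lambda>t. g' (x + t *\<^sub>R E)) has_integral g (x + E) - g x) {0..1}"
    proof (cases "transpose x = x")
      \<comment> \<open>The hypothesis of \<open>integral_directional_derivative\<close> concerns
        every base point. A line through a non-symmetric matrix in a symmetric direction misses
        \<open>R_set\<close>, so both sides are 0.\<close>
      case False
      have "x + t *\<^sub>R E \<notin> R_set" for t
      proof
        assume "x + t *\<^sub>R E \<in> R_set"
        then have "transpose (x + t *\<^sub>R E) = x + t *\<^sub>R E" by (simp add: R_set_iff pos_def_def)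
        then show False using False E(1) by (simp add: transpose_linear transpose_scalar)
      qed
      from this this[of 0] this[of 1] show ?thesis by (simp add: g_def g'_def)
    next
      case sym: True
      define U where "U = {t. x + t *\<^sub>R E \<in> R_set}"
      note U = R_set_line[OF E, of x, folded U_def]
      define q where "q = (\<lambda>t. g (x + t *\<^sub>R E))"
      have cl: "continuous_on S (\<lambda>t. x + t *\<^sub>R E)" for S by (intro continuous_intros)
      \<comment> \<open>Continuity of \<open>q\<close> by pasting over two closed sets: on
        \<open>K\<close> it is the product of \<open>F\<close> and \<open>weight\<close>, off
        \<open>U\<close> it is 0, and where these sets overlap a determinant vanishes and the two
        formulas agree.\<close>
      define K where "K = {t. x + t *\<^sub>R E \<in> R_closed}"
      have clK: "closed K"
        using closed_vimage[OF compact_imp_closed[OF compact_R_closed] cl] by (simp add: K_def vimage_def)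
      have cK: "continuous_on K q"
      proof (rule continuous_on_eq)
        show "continuous_on K (\<lambda>t. F (x + t *\<^sub>R E) * weight (x + t *\<^sub>R E))"
          by (intro continuous_intros continuous_on_compose2[OF cF(1) cl] continuous_on_compose2[OF continuous_on_weight cl])
            (auto simp: K_def)
        fix t assume t: "t \<in> K"
        show "F (x + t *\<^sub>R E) * weight (x + t *\<^sub>R E) = q t"
        proof (cases "t \<in> U")
          case False
          then have "det (x + t *\<^sub>R E) = 0 \<or> det (mat 1 - (x + t *\<^sub>R E)) = 0"
            using t by (auto simp: U_def K_def R_set_iff_closed)
          then show ?thesis using False by (auto simp: q_def g_def weight_def U_def)
        qed (simp add: q_def g_def U_def)
      qed
      have clU: "closed (- U)" using U by auto
      have cU: "continuous_on (- U) q"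
        by (rule continuous_on_eq[of _ "\<lambda>_. 0"]) (auto simp: q_def g_def U_def)
      have cKU: "continuous_on (K \<union> - U) q" using clK clU cK cU by (rule continuous_on_closed_Un)
      have "U \<subseteq> K" using R_set_subset_closed by (auto simp: U_def K_def)
      then have "K \<union> - U = UNIV" by auto
      then have cq: "continuous_on {0..1} q" using continuous_on_subset[OF cKU, of "{0..1}"] by simp
      \<comment> \<open>Differentiability may fail where the line enters or leaves
        \<open>R_set\<close>; these are finitely many points at which \<open>q\<close> is still
        continuous.\<close>
      have "((\<lambda>t. g' (x + t *\<^sub>R E)) has_integral (q 1 - q 0)) {0..1}"
      proof (rule fundamental_theorem_of_calculus_strong[OF finite_frontier_real[OF U] _ _ cq])
        fix t assume t: "t \<in> {0..1} - frontier U"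
        have "(q has_real_derivative g' (x + t *\<^sub>R E)) (at t)"
        proof (cases "t \<in> U")
          case True
          then have R: "x + t *\<^sub>R E \<in> R_set" by (simp add: U_def)
          have "((\<lambda>u. F (x + t *\<^sub>R E + u *\<^sub>R E) * weight (x + t *\<^sub>R E + u *\<^sub>R E)) has_real_derivative g' (x + t *\<^sub>R E)) (at 0)"
            using DERIV_mult[OF dF[of "x + t *\<^sub>R E"] weight_deriv[OF R, of E]] R
            by (simp add: g'_def algebra_simps)
          then have "((\<lambda>u. F (x + t *\<^sub>R E + (u - t) *\<^sub>R E) * weight (x + t *\<^sub>R E + (u - t) *\<^sub>R E)) has_real_derivative g' (x + t *\<^sub>R E) * 1) (at t)"
            by (intro DERIV_chain2[where f = "\<lambda>u. F (x + t *\<^sub>R E + u *\<^sub>R E) * weight (x + t *\<^sub>R E + u *\<^sub>R E)"]) (auto intro!: derivative_eq_intros)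
          then have "((\<lambda>u. F (x + u *\<^sub>R E) * weight (x + u *\<^sub>R E)) has_real_derivative g' (x + t *\<^sub>R E)) (at t)"
            by (simp add: algebra_simps)
          then show ?thesis
            by (rule has_field_derivative_transform_within_open[OF _ U(1) True]) (auto simp: q_def g_def U_def)
        next
          case False
          then have "t \<in> - closure U" using t by (auto simp: frontier_def U interior_open)
          moreover have "((\<lambda>u. 0) has_real_derivative g' (x + t *\<^sub>R E)) (at t)"
            using False by (simp add: g'_def U_def)
          ultimately show ?thesis
            using closure_subset[of U]
            by (elim has_field_derivative_transform_within_open[where S = "- closure U"]) (auto simp: q_def g_def U_def indicator_def)
        qed
        then show "(q has_vector_derivative g' (x + t *\<^sub>R E)) (at t)"
          by (simp add: has_real_derivative_iff_has_vector_derivative)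
      qed simp
      then show ?thesis by (simp add: q_def)
    qed
  qed
  then show "(\<integral>\<Omega>. indicator R_set \<Omega> * (F' \<Omega> * weight \<Omega> + F \<Omega> * (weight \<Omega> * score \<Omega> E)) \<partial>sym_lborel) = 0"
    by (simp add: g'_def)
qed

lemma linear_score: "linear (score \<Omega>)"
proof (rule linearI)
  fix A B :: "real ^ 'n ^ 'n" and c :: real
  have 1: "rest_score \<Omega> (A + B) = rest_score \<Omega> A + rest_score \<Omega> B"
    unfolding rest_score_def matrix_add_ldistrib matrix_add_rdistrib trace_add inner_add_left
    by (simp add: add_divide_distrib distrib_left)
  show "score \<Omega> (A + B) = score \<Omega> A + score \<Omega> B"
    unfolding score_def 1 matrix_add_ldistrib trace_add by (simp add: distrib_left)
  have 2: "rest_score \<Omega> (c *\<^sub>R A) = c * rest_score \<Omega> A"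
    unfolding rest_score_def matrix_scaleR_mult trace_scaleR inner_scaleR_left
    by (simp add: right_diff_distrib)
  show "score \<Omega> (c *\<^sub>R A) = c *\<^sub>R score \<Omega> A"
    unfolding score_def 2 matrix_scaleR_mult trace_scaleR by (simp add: algebra_simps)
qed

text \<open>The identities \<open>ibp\<close> for the entries of \<open>F\<close>, each in its own
  direction \<open>sym_unit i j\<close>, are added up. By linearity the scores sum to the score of
  the field, so \<open>e\<close> is the divergence of \<open>F\<close> relative to
  \<open>weight\<close>.\<close>

lemma ibp_field:
  fixes F :: "real ^ 'n ^ 'n \<Rightarrow> real ^ 'n ^ 'n" and DF :: "real ^ 'n ^ 'n \<Rightarrow> real ^ 'n ^ 'n \<Rightarrow> real ^ 'n ^ 'n"
  assumes sym: "\<And>\<Omega>. transpose \<Omega> = \<Omega> \<Longrightarrow> transpose (F \<Omega>) = F \<Omega>"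
    and cF: "continuous_on UNIV F" "\<And>E. continuous_on UNIV (\<lambda>\<Omega>. DF \<Omega> E)"
    and dF: "\<And>\<Omega> E i j. ((\<lambda>t. F (\<Omega> + t *\<^sub>R E) $ i $ j) has_real_derivative DF \<Omega> E $ i $ j) (at 0)"
  defines "e \<equiv> (\<lambda>\<Omega>. (\<Sum>i\<in>UNIV. \<Sum>j\<in>UNIV. DF \<Omega> (sym_unit i j) $ i $ j) + score \<Omega> (F \<Omega>))"
  shows "integrable sym_lborel (\<lambda>\<Omega>. indicator R_set \<Omega> * (e \<Omega> * weight \<Omega>))"
    and "(\<integral>\<Omega>. indicator R_set \<Omega> * (e \<Omega> * weight \<Omega>) \<partial>sym_lborel) = 0"
proof -
  let ?h = "\<lambda>i j \<Omega>. indicator R_set \<Omega> * (DF \<Omega> (sym_unit i j) $ i $ j * weight \<Omega> + F \<Omega> $ i $ j * (weight \<Omega> * score \<Omega> (sym_unit i j)))"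
  have h: "integrable sym_lborel (?h i j)" "(\<integral>\<Omega>. ?h i j \<Omega> \<partial>sym_lborel) = 0" for i j
    by (intro ibp sym_unit_sym sym_unit_nonzero dF continuous_intros cF)+
  have eq: "indicator R_set \<Omega> * (e \<Omega> * weight \<Omega>) = (\<Sum>i\<in>UNIV. \<Sum>j\<in>UNIV. ?h i j \<Omega>)" for \<Omega>
  proof (cases "\<Omega> \<in> R_set")
    case True
    then have "transpose \<Omega> = \<Omega>" by (simp add: R_set_iff pos_def_def)
    then have "score \<Omega> (F \<Omega>) = score \<Omega> (\<Sum>i\<in>UNIV. \<Sum>j\<in>UNIV. F \<Omega> $ i $ j *\<^sub>R sym_unit i j)"
      by (simp add: sum_sym_unit sym)
    also have "\<dots> = (\<Sum>i\<in>UNIV. \<Sum>j\<in>UNIV. F \<Omega> $ i $ j * score \<Omega> (sym_unit i j))"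
      by (simp add: linear_sum[OF linear_score] linear_cmul[OF linear_score])
    finally show ?thesis
      using True by (simp add: e_def sum.distrib sum_distrib_left distrib_left mult_ac)
  qed simp
  show "integrable sym_lborel (\<lambda>\<Omega>. indicator R_set \<Omega> * (e \<Omega> * weight \<Omega>))"
    unfolding eq by (intro Bochner_Integration.integrable_sum h)
  show "(\<integral>\<Omega>. indicator R_set \<Omega> * (e \<Omega> * weight \<Omega>) \<partial>sym_lborel) = 0"
    unfolding eq by (simp only: Bochner_Integration.integral_sum Bochner_Integration.integrable_sum h sum.neutral_const)
qed

end

lemma quadratic_entry_deriv:
  fixes A B C :: "real ^ 'm ^ 'n"
  assumes "\<And>t. f t = A + t *\<^sub>R B + (t * t) *\<^sub>R C"
  shows "((\<lambda>t. f t $ i $ j) has_real_derivative B $ i $ j) (at 0)"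
  unfolding assms by (auto intro!: derivative_eq_intros)

text \<open>With R the inverse of T = I - s \<Omega>, the matrix I - \<Lambda> is (I - \<Omega>) R.
  Inserting R T = I on the left makes it a congruence by R of (1 - s) (I - \<Omega>) + s (I -
  \<Omega>)^2.\<close>

lemma id_minus_lam_psd:
  assumes \<Omega>: "\<Omega> \<in> R_set" and s: "0 \<le> s" "s \<le> 1"
  shows "psd (mat 1 - lam s \<Omega>)"
proof -
  define R where "R = res s \<Omega>"
  define T where "T = mat 1 - s *\<^sub>R \<Omega>"
  define I where "I = mat 1 - \<Omega>"
  have d: "det T \<noteq> 0" unfolding T_def by (intro pos_def_det_nonzero R_set_pos_def \<Omega> s)
  have RT: "R ** T = mat 1" using matrix_inv_mult(2)[OF d] by (simp add: R_def T_def res_def)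
  have sym: "transpose R = R" "transpose I = I"
    using res_sym[OF \<Omega> s] R_set_sym[OF \<Omega> s] by (simp_all add: R_def I_def transpose_linear)
  have I: "pos_def I" using \<Omega> by (simp add: I_def R_set_iff)
  have "mat 1 - lam s \<Omega> = (R ** T) ** I ** R" by (simp add: id_minus_lam[OF \<Omega> s] I_def R_def RT[unfolded R_def])
  also have "\<dots> = R ** (T ** I) ** R" by (simp add: matrix_mul_assoc)
  also have "T ** I = (1 - s) *\<^sub>R I + s *\<^sub>R (I ** I)" by (simp add: T_def I_def matrix_ring algebra_simps)
  finally have e: "mat 1 - lam s \<Omega> = transpose R ** ((1 - s) *\<^sub>R I + s *\<^sub>R (I ** I)) ** R" by (simp add: sym)
  have p: "psd (mat 1 :: real ^ 'a ^ 'a)" by (intro pos_def_psd pos_def_id)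
  have "psd (transpose I ** mat 1 ** I)" by (rule psd_congruence[OF p])
  then have II: "psd (I ** I)" by (simp add: sym)
  have "psd ((1 - s) *\<^sub>R I + s *\<^sub>R (I ** I))"
    using psd_scaleR[OF pos_def_psd[OF I], of "1 - s"] psd_scaleR[OF II, of s] s
    by (auto simp: psd_def transpose_linear matrix_vector_mult_add_rdistrib inner_add_right)
  then show ?thesis unfolding e by (rule psd_congruence)
qed

context matrix_beta
begin

text \<open>
  The divergence relative to \<^const>\<open>weight\<close> of the field \<open>\<Omega> \<mapsto> (1 - s) \<Omega>\<^sup>2\<close>; below, that of
  \<open>\<Omega> \<mapsto> (M \<Omega> + \<Omega> M) / 2 - s \<Omega> M \<Omega>\<close>.  The fields are chosen so that the exponent contributes
  exactly \<open>|\<Lambda> z|\<^sup>2\<close> and \<open>\<langle>M \<Lambda> z, z\<rangle>\<close>.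
\<close>

definition div_square :: "real ^ 'n ^ 'n \<Rightarrow> real" where
  "div_square \<Omega> = (real CARD('n) + 1 + \<alpha> + \<beta> - \<kappa>) * (1 - s) * trace \<Omega> - \<beta> * (1 - s) * trace (\<Omega> ** res 1 \<Omega>) + \<kappa> * trace (lam s \<Omega>) - (norm (lam s \<Omega> ** z))\<^sup>2 / (2 * v)"

definition div_sandwich :: "real ^ 'n ^ 'n \<Rightarrow> real ^ 'n ^ 'n \<Rightarrow> real" where
  "div_sandwich M \<Omega> = ((real CARD('n) + 1) / 2 + \<alpha>) * trace M - s * (real CARD('n) + 1 + \<alpha> + \<beta> - \<kappa>) * trace (M ** \<Omega>)
     - \<beta> * (1 - s) * trace (\<Omega> ** res 1 \<Omega> ** M) - ((M ** lam s \<Omega> ** z) \<bullet> z) / (2 * v)"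

lemma lam_sym: "\<Omega> \<in> R_set \<Longrightarrow> transpose (lam s \<Omega>) = lam s \<Omega>"
  using lam_psd(1)[of \<Omega> s] s by (simp add: psd_def)

lemma
  shows integrable_div_square: "integrable sym_lborel (\<lambda>\<Omega>. indicator R_set \<Omega> * (div_square \<Omega> * weight \<Omega>))"
    and integral_div_square: "(\<integral>\<Omega>. indicator R_set \<Omega> * (div_square \<Omega> * weight \<Omega>) \<partial>sym_lborel) = 0"
proof -
  define F :: "real ^ 'n ^ 'n \<Rightarrow> real ^ 'n ^ 'n" where "F = (\<lambda>\<Omega>. \<Omega> ** \<Omega>)"
  define DF :: "real ^ 'n ^ 'n \<Rightarrow> real ^ 'n ^ 'n \<Rightarrow> real ^ 'n ^ 'n" where "DF = (\<lambda>\<Omega> E. \<Omega> ** E + E ** \<Omega>)"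
  define e where "e = (\<lambda>\<Omega>. (\<Sum>i\<in>UNIV. \<Sum>j\<in>UNIV. DF \<Omega> (sym_unit i j) $ i $ j) + score \<Omega> (F \<Omega>))"
  have f: "integrable sym_lborel (\<lambda>\<Omega>. indicator R_set \<Omega> * (e \<Omega> * weight \<Omega>))"
    "(\<integral>\<Omega>. indicator R_set \<Omega> * (e \<Omega> * weight \<Omega>) \<partial>sym_lborel) = 0"
    unfolding e_def
  proof -
    have 1: "transpose (F \<Omega>) = F \<Omega>" if "transpose \<Omega> = \<Omega>" for \<Omega>
      using that by (simp add: F_def matrix_transpose_mul)
    have 2: "continuous_on UNIV F" "continuous_on UNIV (\<lambda>\<Omega>. DF \<Omega> E)" for E
      unfolding F_def DF_def by (intro continuous_intros)+
    have 3: "((\<lambda>t. F (\<Omega> + t *\<^sub>R E) $ i $ j) has_real_derivative DF \<Omega> E $ i $ j) (at 0)" for \<Omega> E i j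
    proof (rule quadratic_entry_deriv)
      show "F (\<Omega> + t *\<^sub>R E) = F \<Omega> + t *\<^sub>R DF \<Omega> E + (t * t) *\<^sub>R (E ** E)" for t
        unfolding F_def DF_def matrix_ring by (simp add: algebra_simps)
    qed
    note r = ibp_field[of F DF, OF 1 2 3]
    show "integrable sym_lborel (\<lambda>\<Omega>. indicator R_set \<Omega> * (((\<Sum>i\<in>UNIV. \<Sum>j\<in>UNIV. DF \<Omega> (sym_unit i j) $ i $ j) + score \<Omega> (F \<Omega>)) * weight \<Omega>))"
      "(\<integral>\<Omega>. indicator R_set \<Omega> * (((\<Sum>i\<in>UNIV. \<Sum>j\<in>UNIV. DF \<Omega> (sym_unit i j) $ i $ j) + score \<Omega> (F \<Omega>)) * weight \<Omega>) \<partial>sym_lborel) = 0"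
      by (rule r; assumption)+
  qed
  have eq: "indicator R_set \<Omega> * (div_square \<Omega> * weight \<Omega>) = (1 - s) * (indicator R_set \<Omega> * (e \<Omega> * weight \<Omega>))" for \<Omega>
  proof (cases "\<Omega> \<in> R_set")
    case \<Omega>: True
    have d: "det \<Omega> \<noteq> 0" using det_pos[OF \<Omega>] by simp
    define R where "R = res s \<Omega>"
    define G where "G = res 1 \<Omega>"
    define L where "L = lam s \<Omega>"
    have R: "\<Omega> ** R = R ** \<Omega>" "R = mat 1 + s *\<^sub>R (\<Omega> ** R)" and G: "\<Omega> ** G = G ** \<Omega>" "G = mat 1 + \<Omega> ** G"
      using res_facts[OF \<Omega>, of s] res_facts[OF \<Omega>, of 1] s by (simp_all add: R_def G_def)
    have h1: "(\<Sum>i\<in>UNIV. \<Sum>j\<in>UNIV. DF \<Omega> (sym_unit i j) $ i $ j) = (real CARD('n) + 1) * trace \<Omega>"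
      unfolding DF_def by (simp add: sum.distrib sum_mult_sym_unit)
    have h2: "trace (matrix_inv \<Omega> ** F \<Omega>) = trace \<Omega>"
      unfolding F_def matrix_mul_assoc matrix_inv_mult(2)[OF d] by simp
    \<comment> \<open>The relation \<open>G = mat 1 + \<Omega> ** G\<close> lowers the degree of the
      product, so that the singular matrix \<open>G\<close> survives in one trace only. The
      analogous relation for \<open>R\<close> does the same in \<open>h4\<close>.\<close>
    have h3: "trace (G ** F \<Omega>) = trace (\<Omega> ** G) - trace \<Omega>"
    proof -
      have "\<Omega> ** G = (mat 1 + \<Omega> ** G) ** \<Omega>" using G by metis
      then have "\<Omega> ** G = \<Omega> + G ** \<Omega> ** \<Omega>" by (simp add: matrix_add_rdistrib G(1))
      then show ?thesis by (simp add: F_def matrix_mul_assoc trace_add)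
    qed
    have h4: "s * trace (R ** F \<Omega>) = trace (\<Omega> ** R) - trace \<Omega>"
    proof -
      have "\<Omega> ** R = (mat 1 + s *\<^sub>R (\<Omega> ** R)) ** \<Omega>" using R by metis
      then have "\<Omega> ** R = \<Omega> + s *\<^sub>R (R ** \<Omega> ** \<Omega>)" by (simp add: matrix_add_rdistrib matrix_scaleR_mult R(1))
      then have "trace (\<Omega> ** R) = trace (\<Omega> + s *\<^sub>R (R ** \<Omega> ** \<Omega>))" by simp
      then show ?thesis by (simp add: F_def matrix_mul_assoc trace_add trace_scaleR)
    qed
    \<comment> \<open>Since R and \<Omega> commute, R \<Omega>^2 R is the square of R \<Omega>. One
      factor 1 - s comes from the derivative of the exponent and the other from the field; together
      they turn this square into \<Lambda>^2.\<close>
    have h5: "(1 - s) * ((1 - s) * ((R ** F \<Omega> ** R ** z) \<bullet> z)) = (norm (L ** z))\<^sup>2"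
    proof -
      have L: "L = (1 - s) *\<^sub>R (R ** \<Omega>)" by (simp add: L_def lam_def R_def[symmetric] R(1))
      have "(norm (L ** z))\<^sup>2 = (L ** (L ** z)) \<bullet> z"
        by (simp add: power2_norm_eq_inner matrix_inner_left lam_sym[OF \<Omega>] L_def)
      also have "L ** (L ** z) = ((1 - s) * (1 - s)) *\<^sub>R (R ** \<Omega> ** (R ** \<Omega>) ** z)"
        unfolding L by (simp add: matrix_scaleR_mult matrix_mul_assoc)
      also have "R ** \<Omega> ** (R ** \<Omega>) = R ** F \<Omega> ** R"
        unfolding F_def matrix_mul_assoc[symmetric] R(1) ..
      finally show ?thesis by (simp add: mult.assoc)
    qed
    have h6: "trace L = (1 - s) * trace (\<Omega> ** R)" by (simp add: L_def lam_def R_def trace_scaleR)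
    have "div_square \<Omega> = (1 - s) * e \<Omega>"
    proof -
      have "(1 - s) * e \<Omega> = (1 - s) * ((real CARD('n) + 1) * trace \<Omega> + (\<alpha> * trace \<Omega> - \<beta> * (trace (\<Omega> ** G) - trace \<Omega>) + \<kappa> * (trace (\<Omega> ** R) - trace \<Omega>)))
           - (1 - s) * ((1 - s) * ((R ** F \<Omega> ** R ** z) \<bullet> z)) / (2 * v)"
        unfolding e_def score_def rest_score_def R_def[symmetric] G_def[symmetric] h1 h2 h3 mult.assoc[of \<kappa> s] h4
        by (simp add: algebra_simps diff_divide_distrib add_divide_distrib)
      then show ?thesis
        unfolding h5 div_square_def R_def[symmetric] G_def[symmetric] L_def[symmetric] h6 by (simp add: algebra_simps)
    qed
    then show ?thesis by simp
  qed simp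
  show "integrable sym_lborel (\<lambda>\<Omega>. indicator R_set \<Omega> * (div_square \<Omega> * weight \<Omega>))"
    unfolding eq by (intro integrable_mult_right f)
  show "(\<integral>\<Omega>. indicator R_set \<Omega> * (div_square \<Omega> * weight \<Omega>) \<partial>sym_lborel) = 0"
    unfolding eq by (simp add: f)
qed

lemma
  assumes M: "transpose M = M"
  shows integrable_div_sandwich: "integrable sym_lborel (\<lambda>\<Omega>. indicator R_set \<Omega> * (div_sandwich M \<Omega> * weight \<Omega>))"
    and integral_div_sandwich: "(\<integral>\<Omega>. indicator R_set \<Omega> * (div_sandwich M \<Omega> * weight \<Omega>) \<partial>sym_lborel) = 0"
proof -
  define F :: "real ^ 'n ^ 'n \<Rightarrow> real ^ 'n ^ 'n" where
    "F = (\<lambda>\<Omega>. (1 / 2) *\<^sub>R (M ** \<Omega> + \<Omega> ** M) - s *\<^sub>R (\<Omega> ** M ** \<Omega>))"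
  define DF :: "real ^ 'n ^ 'n \<Rightarrow> real ^ 'n ^ 'n \<Rightarrow> real ^ 'n ^ 'n" where
    "DF = (\<lambda>\<Omega> E. (1 / 2) *\<^sub>R (M ** E + E ** M) - s *\<^sub>R (E ** (M ** \<Omega>) + (\<Omega> ** M) ** E))"
  define e where "e = (\<lambda>\<Omega>. (\<Sum>i\<in>UNIV. \<Sum>j\<in>UNIV. DF \<Omega> (sym_unit i j) $ i $ j) + score \<Omega> (F \<Omega>))"
  have f: "integrable sym_lborel (\<lambda>\<Omega>. indicator R_set \<Omega> * (e \<Omega> * weight \<Omega>))"
    "(\<integral>\<Omega>. indicator R_set \<Omega> * (e \<Omega> * weight \<Omega>) \<partial>sym_lborel) = 0"
    unfolding e_def
  proof -
    have 1: "transpose (F \<Omega>) = F \<Omega>" if "transpose \<Omega> = \<Omega>" for \<Omega>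
      using that M by (simp add: F_def matrix_transpose_mul transpose_linear transpose_scalar matrix_mul_assoc add.commute)
    have 2: "continuous_on UNIV F" "continuous_on UNIV (\<lambda>\<Omega>. DF \<Omega> E)" for E
      unfolding F_def DF_def by (intro continuous_intros)+
    have 3: "((\<lambda>t. F (\<Omega> + t *\<^sub>R E) $ i $ j) has_real_derivative DF \<Omega> E $ i $ j) (at 0)" for \<Omega> E i j
    proof (rule quadratic_entry_deriv)
      show "F (\<Omega> + t *\<^sub>R E) = F \<Omega> + t *\<^sub>R DF \<Omega> E + (t * t) *\<^sub>R (- s *\<^sub>R (E ** M ** E))" for t
        unfolding F_def DF_def matrix_ring by (simp add: algebra_simps)
    qed
    note r = ibp_field[of F DF, OF 1 2 3]
    show "integrable sym_lborel (\<lambda>\<Omega>. indicator R_set \<Omega> * (((\<Sum>i\<in>UNIV. \<Sum>j\<in>UNIV. DF \<Omega> (sym_unit i j) $ i $ j) + score \<Omega> (F \<Omega>)) * weight \<Omega>))"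
      "(\<integral>\<Omega>. indicator R_set \<Omega> * (((\<Sum>i\<in>UNIV. \<Sum>j\<in>UNIV. DF \<Omega> (sym_unit i j) $ i $ j) + score \<Omega> (F \<Omega>)) * weight \<Omega>) \<partial>sym_lborel) = 0"
      by (rule r; assumption)+
  qed
  have eq: "indicator R_set \<Omega> * (div_sandwich M \<Omega> * weight \<Omega>) = indicator R_set \<Omega> * (e \<Omega> * weight \<Omega>)" for \<Omega>
  proof (cases "\<Omega> \<in> R_set")
    case \<Omega>: True
    have d: "det \<Omega> \<noteq> 0" using det_pos[OF \<Omega>] by simp
    define R where "R = res s \<Omega>"
    define G where "G = res 1 \<Omega>"
    define L where "L = lam s \<Omega>"
    define T where "T = mat 1 - s *\<^sub>R \<Omega>"
    have R: "\<Omega> ** R = R ** \<Omega>" "R = mat 1 + s *\<^sub>R (\<Omega> ** R)" and G: "\<Omega> ** G = G ** \<Omega>" "G = mat 1 + \<Omega> ** G"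
      using res_facts[OF \<Omega>, of s] res_facts[OF \<Omega>, of 1] s by (simp_all add: R_def G_def)
    have RT: "R ** T = mat 1" "T ** R = mat 1"
      using matrix_inv_mult[of T] det_pos(3)[OF \<Omega>] by (simp_all add: R_def T_def res_def)
    have symR: "transpose R = R" using res_sym[OF \<Omega>, of s] s by (simp add: R_def)
    have h1: "(\<Sum>i\<in>UNIV. \<Sum>j\<in>UNIV. DF \<Omega> (sym_unit i j) $ i $ j) = (real CARD('n) + 1) / 2 * trace M - s * (real CARD('n) + 1) * trace (M ** \<Omega>)"
    proof -
      have "(\<Sum>i\<in>UNIV. \<Sum>j\<in>UNIV. DF \<Omega> (sym_unit i j) $ i $ j) =
        (1 / 2) * ((\<Sum>i\<in>UNIV. \<Sum>j\<in>UNIV. (M ** sym_unit i j) $ i $ j) + (\<Sum>i\<in>UNIV. \<Sum>j\<in>UNIV. (sym_unit i j ** M) $ i $ j)) -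
        s * ((\<Sum>i\<in>UNIV. \<Sum>j\<in>UNIV. (sym_unit i j ** (M ** \<Omega>)) $ i $ j) + (\<Sum>i\<in>UNIV. \<Sum>j\<in>UNIV. ((\<Omega> ** M) ** sym_unit i j) $ i $ j))"
        unfolding DF_def
        by (simp only: vector_minus_component vector_add_component vector_scaleR_component real_scaleR_def
          sum_subtractf sum.distrib sum_distrib_left[symmetric])
      also have "\<dots> = (1 / 2) * ((real CARD('n) + 1) / 2 * trace M + (real CARD('n) + 1) / 2 * trace M) -
         s * ((real CARD('n) + 1) / 2 * trace (M ** \<Omega>) + (real CARD('n) + 1) / 2 * trace (M ** \<Omega>))"
        unfolding sum_mult_sym_unit trace_mul_sym[of \<Omega> M] ..
      finally show ?thesis by (simp add: field_simps)
    qed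
    have tF: "trace (A ** F \<Omega>) = (1 / 2) * (trace (A ** M ** \<Omega>) + trace (A ** \<Omega> ** M)) - s * trace (A ** \<Omega> ** M ** \<Omega>)" for A
      unfolding F_def by (simp add: matrix_ring trace_add trace_sub trace_scaleR)
    have cyc: "trace (A ** M ** \<Omega>) = trace (\<Omega> ** A ** M)" for A
      by (subst trace_mul_sym) (simp add: matrix_mul_assoc)
    have h2: "trace (matrix_inv \<Omega> ** F \<Omega>) = trace M - s * trace (M ** \<Omega>)"
      unfolding tF cyc matrix_inv_mult[OF d] trace_mul_sym[of M \<Omega>] by simp
    have h3: "trace (G ** F \<Omega>) = (1 - s) * trace (\<Omega> ** G ** M) + s * trace (M ** \<Omega>)"
    proof -
      have "\<Omega> ** G = (mat 1 + \<Omega> ** G) ** \<Omega>" using G by metis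
      then have "\<Omega> ** G = \<Omega> + \<Omega> ** G ** \<Omega>" by (simp add: matrix_add_rdistrib)
      then have "trace (\<Omega> ** G ** M) = trace ((\<Omega> + \<Omega> ** G ** \<Omega>) ** M)" by simp
      then have "trace (\<Omega> ** G ** M) = trace (\<Omega> ** M) + trace (\<Omega> ** (G ** \<Omega>) ** M)"
        by (simp add: matrix_add_rdistrib trace_add matrix_mul_assoc)
      moreover have "trace (G ** \<Omega> ** M ** \<Omega>) = trace (\<Omega> ** (G ** \<Omega>) ** M)" by (rule cyc)
      moreover have "trace (G ** M ** \<Omega>) = trace (\<Omega> ** G ** M)" by (rule cyc)
      moreover have "trace (G ** \<Omega> ** M) = trace (\<Omega> ** G ** M)" by (simp only: G(1))
      ultimately show ?thesis unfolding tF trace_mul_sym[of M \<Omega>] by (simp add: algebra_simps)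
    qed
    have h4: "trace (R ** F \<Omega>) = trace (M ** \<Omega>)"
    proof -
      have "\<Omega> ** R = (mat 1 + s *\<^sub>R (\<Omega> ** R)) ** \<Omega>" using R by metis
      then have "\<Omega> ** R = \<Omega> + s *\<^sub>R (\<Omega> ** R ** \<Omega>)" by (simp add: matrix_add_rdistrib matrix_scaleR_mult)
      then have "trace (\<Omega> ** R ** M) = trace ((\<Omega> + s *\<^sub>R (\<Omega> ** R ** \<Omega>)) ** M)" by simp
      then have "trace (\<Omega> ** R ** M) = trace (\<Omega> ** M) + s * trace (\<Omega> ** (R ** \<Omega>) ** M)"
        by (simp add: matrix_add_rdistrib trace_add matrix_mul_assoc matrix_scaleR_mult trace_scaleR)
      moreover have "trace (R ** \<Omega> ** M ** \<Omega>) = trace (\<Omega> ** (R ** \<Omega>) ** M)" by (rule cyc)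
      moreover have "trace (R ** M ** \<Omega>) = trace (\<Omega> ** R ** M)" by (rule cyc)
      moreover have "trace (R ** \<Omega> ** M) = trace (\<Omega> ** R ** M)" by (simp only: R(1))
      ultimately show ?thesis unfolding tF trace_mul_sym[of M \<Omega>] by (simp add: algebra_simps)
    qed
    \<comment> \<open>The field is the symmetrised product of T, M and \<Omega>. Multiplying by R =
      T^(-1) on both sides cancels each T and leaves the symmetrised product of M and \<Omega> R,
      that is, of M and \<Lambda> up to the factor 1 - s.\<close>
    have h5: "(1 - s) * ((R ** F \<Omega> ** R ** z) \<bullet> z) = (M ** L ** z) \<bullet> z"
    proof -
      have "F \<Omega> = (1 / 2) *\<^sub>R (T ** (M ** \<Omega>) + (\<Omega> ** M) ** T)"
        unfolding F_def T_def by (simp add: matrix_ring) (simp add: vec_eq_iff field_simps)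
      then have "R ** F \<Omega> ** R = (1 / 2) *\<^sub>R ((R ** T) ** (M ** \<Omega>) ** R + R ** (\<Omega> ** M) ** (T ** R))"
        by (simp add: matrix_ring)
      also have "\<dots> = (1 / 2) *\<^sub>R (M ** (\<Omega> ** R) + (\<Omega> ** R) ** M)"
        by (simp add: RT matrix_mul_assoc) (simp add: R(1))
      finally have e: "(1 - s) *\<^sub>R (R ** F \<Omega> ** R) = (1 / 2) *\<^sub>R (M ** L + L ** M)"
        by (simp add: L_def lam_def R_def[symmetric] matrix_scaleR_mult scaleR_add_right mult.commute)
      have "(1 - s) * ((R ** F \<Omega> ** R ** z) \<bullet> z) = ((1 - s) *\<^sub>R (R ** F \<Omega> ** R) ** z) \<bullet> z"
        by (simp add: matrix_scaleR_mult)
      also have "\<dots> = (1 / 2) * ((M ** L ** z) \<bullet> z + (L ** M ** z) \<bullet> z)"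
        unfolding e by (simp add: matrix_ring inner_add_left)
      also have "(L ** M ** z) \<bullet> z = (M ** L ** z) \<bullet> z"
      proof -
        have "(L ** M ** z) \<bullet> z = (L ** (M ** z)) \<bullet> z" by (simp add: matrix_mul_assoc)
        also have "\<dots> = (M ** z) \<bullet> (L ** z)" using lam_sym[OF \<Omega>] by (subst matrix_inner_left) (simp add: L_def)
        also have "\<dots> = z \<bullet> (M ** (L ** z))" by (subst matrix_inner_left) (simp add: M)
        finally show ?thesis by (simp add: matrix_mul_assoc inner_commute)
      qed
      finally show ?thesis by simp
    qed
    have "div_sandwich M \<Omega> = e \<Omega>"
      unfolding e_def score_def rest_score_def R_def[symmetric] G_def[symmetric] h1 h2 h3 h4 h5 div_sandwich_def L_def[symmetric]
      by (simp add: algebra_simps)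
    then show ?thesis by simp
  qed simp
  show "integrable sym_lborel (\<lambda>\<Omega>. indicator R_set \<Omega> * (div_sandwich M \<Omega> * weight \<Omega>))"
    unfolding eq by (rule f)
  show "(\<integral>\<Omega>. indicator R_set \<Omega> * (div_sandwich M \<Omega> * weight \<Omega>) \<partial>sym_lborel) = 0"
    unfolding eq by (rule f)
qed

end

section \<open>Superharmonicity of the square root of the marginal density\<close>

context matrix_beta
begin

text \<open>The multiples 4 and - 2 of the divergences cancel every term quadratic in
  \<open>z\<close> and the term with \<kappa>. Among the remaining traces, M \<le> I gives
  \<open>GM \<le> G\<close>, so the unbounded ones contribute at most - 2 \<beta> (1 - s) G, and
  \<open>G\<close> is at least tr \<Omega>. The rest is estimated by (1 - s) \<Omega> \<le>
  \<Lambda> and \<Omega> \<le> I.\<close>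

lemma pointwise_bound:
  assumes \<Omega>: "\<Omega> \<in> R_set" and M: "psd M" "psd (mat 1 - M)"
    and c: "c = real CARD('n) + 1 + \<alpha> + \<beta> - \<kappa>" "0 \<le> c" "0 \<le> 4 * c - 2 * \<beta>"
  shows "2 * (norm (lam s \<Omega> ** z))\<^sup>2 / v - 4 * \<kappa> * trace (lam s \<Omega>) + 4 * div_square \<Omega> - ((M ** lam s \<Omega> ** z) \<bullet> z) / v - 2 * div_sandwich M \<Omega>
    \<le> (4 * c - 2 * \<beta>) * trace (lam s \<Omega>) + (2 * c - (real CARD('n) + 1 + 2 * \<alpha>)) * trace M"
proof -
  define G where "G = trace (\<Omega> ** res 1 \<Omega>)"
  define GM where "GM = trace (\<Omega> ** res 1 \<Omega> ** M)"
  define N where "N = (norm (lam s \<Omega> ** z))\<^sup>2 / v"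
  have pd: "pos_def (\<Omega> ** res 1 \<Omega>)" using mult_res_pos_def[OF \<Omega>, of 1] by simp
  have 1: "GM \<le> G"
  proof -
    have "0 \<le> trace ((mat 1 - M) ** (\<Omega> ** res 1 \<Omega>))" by (rule trace_mult_nonneg[OF M(2) pd])
    also have "(mat 1 - M) ** (\<Omega> ** res 1 \<Omega>) = \<Omega> ** res 1 \<Omega> - M ** (\<Omega> ** res 1 \<Omega>)" by (simp add: matrix_sub_rdistrib)
    finally show ?thesis unfolding G_def GM_def trace_sub trace_mul_sym[of M] by simp
  qed
  have 2: "trace \<Omega> \<le> G"
    using psd_trace_nonneg[OF mult_res_psd[OF \<Omega>, of 1]] by (simp add: G_def trace_sub)
  have 3: "(1 - s) * trace \<Omega> \<le> trace (lam s \<Omega>)"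
    using psd_trace_nonneg[OF lam_psd(2)[OF \<Omega>, of s]] s by (simp add: trace_sub trace_scaleR)
  have 4: "trace (M ** \<Omega>) \<le> trace M"
  proof -
    have "0 \<le> trace (M ** (mat 1 - \<Omega>))" using \<Omega> by (intro trace_mult_nonneg M) (simp add: R_set_iff)
    then show ?thesis by (simp add: matrix_sub_ldistrib trace_sub)
  qed
  have M0: "0 \<le> trace M" by (rule psd_trace_nonneg[OF M(1)])
  have "s * trace (M ** \<Omega>) \<le> s * trace M" using 4 s by (intro mult_left_mono) auto
  also have "\<dots> \<le> trace M" using s M0 by (simp add: mult_left_le_one_le)
  finally have 5: "c * (s * trace (M ** \<Omega>)) \<le> c * trace M" using c by (intro mult_left_mono) auto
  have 6: "\<beta> * (1 - s) * GM \<le> \<beta> * (1 - s) * G" using 1 \<beta> s by (intro mult_left_mono) auto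
  have 7: "\<beta> * (1 - s) * trace \<Omega> \<le> \<beta> * (1 - s) * G" using 2 \<beta> s by (intro mult_left_mono) auto
  have 8: "(4 * c - 2 * \<beta>) * ((1 - s) * trace \<Omega>) \<le> (4 * c - 2 * \<beta>) * trace (lam s \<Omega>)" using 3 c by (intro mult_left_mono) auto
  have div_square: "div_square \<Omega> = c * ((1 - s) * trace \<Omega>) - \<beta> * (1 - s) * G + \<kappa> * trace (lam s \<Omega>) - N / 2"
    unfolding div_square_def c(1)[symmetric] G_def[symmetric] N_def by simp
  have div_sandwich: "div_sandwich M \<Omega> = ((real CARD('n) + 1) / 2 + \<alpha>) * trace M - c * (s * trace (M ** \<Omega>)) - \<beta> * (1 - s) * GM - ((M ** lam s \<Omega> ** z) \<bullet> z) / v / 2"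
    unfolding div_sandwich_def c(1)[symmetric] GM_def[symmetric] by simp
  have "2 * N - 4 * \<kappa> * trace (lam s \<Omega>) + 4 * div_square \<Omega> - ((M ** lam s \<Omega> ** z) \<bullet> z) / v - 2 * div_sandwich M \<Omega>
     = 4 * (c * ((1 - s) * trace \<Omega>)) - 4 * (\<beta> * (1 - s) * G) + 2 * (c * (s * trace (M ** \<Omega>))) + 2 * (\<beta> * (1 - s) * GM) - (real CARD('n) + 1 + 2 * \<alpha>) * trace M"
    unfolding div_square div_sandwich by (simp add: field_simps)
  also have "\<dots> \<le> 4 * (c * ((1 - s) * trace \<Omega>)) - 2 * (\<beta> * (1 - s) * trace \<Omega>) + 2 * (c * trace M) - (real CARD('n) + 1 + 2 * \<alpha>) * trace M"
    using 5 6 7 by linarith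
  also have "\<dots> = (4 * c - 2 * \<beta>) * ((1 - s) * trace \<Omega>) + (2 * c - (real CARD('n) + 1 + 2 * \<alpha>)) * trace M"
    by (simp add: algebra_simps)
  finally show ?thesis using 8 by (simp add: N_def)
qed

definition weighted :: "(real ^ 'n ^ 'n) measure" where
  "weighted = density sym_lborel (\<lambda>\<Omega>. ennreal (indicator R_set \<Omega> * weight \<Omega>))"

lemma sets_weighted [measurable_cong, simp]: "sets weighted = sets borel"
  by (simp add: weighted_def)

lemma weight_nonneg: "0 \<le> weight \<Omega>"
  by (simp add: weight_def smooth_def)

lemma
  assumes [measurable]: "f \<in> borel_measurable borel"
  shows integral_weighted: "(\<integral>\<Omega>. f \<Omega> \<partial>weighted) = (\<integral>\<Omega>. indicator R_set \<Omega> * (f \<Omega> * weight \<Omega>) \<partial>sym_lborel)"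
    and integrable_weighted_iff: "integrable weighted f \<longleftrightarrow> integrable sym_lborel (\<lambda>\<Omega>. indicator R_set \<Omega> * (f \<Omega> * weight \<Omega>))"
proof -
  have e: "(indicator R_set \<Omega> * weight \<Omega>) * f \<Omega> = indicator R_set \<Omega> * (f \<Omega> * weight \<Omega>)" for \<Omega> by simp
  have *: "AE \<Omega> in sym_lborel. 0 \<le> indicator R_set \<Omega> * weight \<Omega>" using weight_nonneg by simp
  show "(\<integral>\<Omega>. f \<Omega> \<partial>weighted) = (\<integral>\<Omega>. indicator R_set \<Omega> * (f \<Omega> * weight \<Omega>) \<partial>sym_lborel)"
    unfolding weighted_def by (subst integral_real_density[OF _ *]) (measurable, simp only: e)
  show "integrable weighted f \<longleftrightarrow> integrable sym_lborel (\<lambda>\<Omega>. indicator R_set \<Omega> * (f \<Omega> * weight \<Omega>))"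
    unfolding weighted_def by (subst integrable_real_density[OF _ *]) (measurable, simp only: e)
qed

lemma AE_weighted: "AE \<Omega> in weighted. \<Omega> \<in> R_set"
  unfolding weighted_def by (subst AE_density) (auto simp: indicator_def)

lemma finite_measure_weighted: "finite_measure weighted"
proof -
  obtain C where C: "C \<ge> 0" "\<And>\<Omega>. \<Omega> \<in> R_set \<Longrightarrow> weight \<Omega> \<le> C" using weight_bounded by blast
  have "integrable weighted (\<lambda>_. 1 :: real)"
    unfolding integrable_weighted_iff[OF borel_measurable_const]
  proof (rule integrable_dominated)
    show "\<bar>1 * weight \<Omega>\<bar> \<le> C * (1 + det (mat 1 - \<Omega>) powr (\<beta> - 1))" if "\<Omega> \<in> R_set" for \<Omega>
    proof -
      have "0 \<le> C * det (mat 1 - \<Omega>) powr (\<beta> - 1)" using C by simp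
      then have "C \<le> C * (1 + det (mat 1 - \<Omega>) powr (\<beta> - 1))" by (simp add: distrib_left)
      then show ?thesis using order_trans[OF C(2)[OF that]] weight_nonneg[of \<Omega>] by simp
    qed
  qed measurable
  then show ?thesis
    by (auto simp: integrable_iff_bounded intro!: finite_measureI)
qed

sublocale finite_measure weighted by (rule finite_measure_weighted)

lemma integrable_weighted:
  fixes f :: "real ^ 'n ^ 'n \<Rightarrow> 'b :: euclidean_space"
  assumes [measurable]: "f \<in> borel_measurable borel" and c: "continuous_on R_closed f"
  shows "integrable weighted f"
proof -
  have "bounded (f ` R_closed)" by (intro compact_imp_bounded compact_continuous_image c compact_R_closed)
  then obtain B where B: "\<And>\<Omega>. \<Omega> \<in> R_closed \<Longrightarrow> norm (f \<Omega>) \<le> B" unfolding bounded_iff by auto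
  show ?thesis
    by (rule integrable_const_bound[of _ B]) (use AE_weighted in eventually_elim, insert B R_set_subset_closed, auto)
qed

lemma continuous_on_lam: "continuous_on R_closed (lam s :: real ^ 'n ^ 'n \<Rightarrow> _)"
  unfolding lam_def[abs_def] by (intro continuous_intros continuous_on_res)

lemma integrable_lam: "integrable weighted (lam s)"
  by (intro integrable_weighted continuous_on_lam) measurable

text \<open>An integral against the unnormalised weight, hence the factors of the total mass
  \<open>m\<close> in the bounds that follow.\<close>

definition mean_lam :: "real ^ 'n ^ 'n" where
  "mean_lam = (\<integral>\<Omega>. lam s \<Omega> \<partial>weighted)"

lemma linear_mean_lam:
  fixes f :: "real ^ 'n ^ 'n \<Rightarrow> real"
  assumes "linear f"
  shows "integrable weighted (\<lambda>\<Omega>. f (lam s \<Omega>))" "(\<integral>\<Omega>. f (lam s \<Omega>) \<partial>weighted) = f mean_lam"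
proof -
  have "bounded_linear f" using assms linear_conv_bounded_linear by blast
  then show "integrable weighted (\<lambda>\<Omega>. f (lam s \<Omega>))" "(\<integral>\<Omega>. f (lam s \<Omega>) \<partial>weighted) = f mean_lam"
    unfolding mean_lam_def using integrable_lam by (auto intro: integrable_bounded_linear integral_bounded_linear)
qed

lemma linear_mult_inner: "linear (\<lambda>A :: real ^ 'n ^ 'n. (B ** A ** z) \<bullet> y)"
  by (rule linearI) (simp_all add: matrix_add_ldistrib matrix_add_rdistrib matrix_scaleR_mult inner_add_left)

lemma linear_trace: "linear (trace :: real ^ 'n ^ 'n \<Rightarrow> real)"
  by (rule linearI) (simp_all add: trace_add trace_scaleR)

lemma linear_quadratic_form: "linear (\<lambda>A :: real ^ 'n ^ 'n. x \<bullet> (A *v y))"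
  by (rule linearI) (simp_all add: matrix_vector_mult_add_rdistrib inner_add_right scaleR_matrix_vector_assoc[symmetric])

lemma mean_lam_facts:
  defines "m \<equiv> measure weighted (space weighted)"
  shows "psd mean_lam" "psd (m *\<^sub>R mat 1 - mean_lam)"
proof -
  have lin: "linear (\<lambda>A :: real ^ 'n ^ 'n. A $ i $ j)" for i j by (rule linearI) auto
  have "mean_lam $ j $ i = mean_lam $ i $ j" for i j
  proof -
    have "mean_lam $ j $ i = (\<integral>\<Omega>. lam s \<Omega> $ j $ i \<partial>weighted)" by (rule linear_mean_lam(2)[OF lin, symmetric])
    also have "\<dots> = (\<integral>\<Omega>. lam s \<Omega> $ i $ j \<partial>weighted)"
    proof (rule integral_cong_AE)
      show "AE \<Omega> in weighted. lam s \<Omega> $ j $ i = lam s \<Omega> $ i $ j"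
        using AE_weighted
      proof eventually_elim
        case (elim \<Omega>)
        have "lam s \<Omega> $ j $ i = transpose (lam s \<Omega>) $ i $ j" by (simp add: transpose_def)
        then show ?case by (simp add: lam_sym[OF elim])
      qed
    qed measurable
    also have "\<dots> = mean_lam $ i $ j" by (rule linear_mean_lam(2)[OF lin])
    finally show ?thesis .
  qed
  then have sym: "transpose mean_lam = mean_lam" by (simp add: transpose_def vec_eq_iff)
  have q: "(\<integral>\<Omega>. x \<bullet> (lam s \<Omega> *v x) \<partial>weighted) = x \<bullet> (mean_lam *v x)" "integrable weighted (\<lambda>\<Omega>. x \<bullet> (lam s \<Omega> *v x))" for x
    by (rule linear_mean_lam[OF linear_quadratic_form])+
  show "psd mean_lam"
    unfolding psd_def
  proof (intro conjI sym allI)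
    fix x :: "real ^ 'n"
    have "0 \<le> (\<integral>\<Omega>. x \<bullet> (lam s \<Omega> *v x) \<partial>weighted)"
      by (rule integral_nonneg_AE, use AE_weighted in eventually_elim) (use lam_psd(1)[of _ s] s in \<open>auto simp: psd_def\<close>)
    then show "0 \<le> x \<bullet> (mean_lam *v x)" unfolding q .
  qed
  show "psd (m *\<^sub>R mat 1 - mean_lam)"
    unfolding psd_def
  proof (intro conjI allI)
    show "transpose (m *\<^sub>R mat 1 - mean_lam) = m *\<^sub>R mat 1 - mean_lam" by (simp add: transpose_linear transpose_scalar sym)
    fix x :: "real ^ 'n"
    have "0 \<le> (\<integral>\<Omega>. x \<bullet> x - x \<bullet> (lam s \<Omega> *v x) \<partial>weighted)"
    proof (rule integral_nonneg_AE, use AE_weighted in eventually_elim)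
      fix \<Omega> :: "real ^ 'n ^ 'n" assume "\<Omega> \<in> R_set"
      then have "0 \<le> x \<bullet> ((mat 1 - lam s \<Omega>) *v x)" using id_minus_lam_psd[of \<Omega> s] s by (auto simp: psd_def)
      then show "0 \<le> x \<bullet> x - x \<bullet> (lam s \<Omega> *v x)" by (simp add: matrix_vector_mult_diff_rdistrib inner_diff_right)
    qed
    also have "\<dots> = m * (x \<bullet> x) - x \<bullet> (mean_lam *v x)"
      by (subst Bochner_Integration.integral_diff) (simp_all add: q m_def)
    finally show "0 \<le> x \<bullet> ((m *\<^sub>R mat 1 - mean_lam) *v x)"
      by (simp add: matrix_vector_mult_diff_rdistrib inner_diff_right scaleR_matrix_vector_assoc[symmetric])
  qed
qed

lemma integrable_lam_norm: "integrable weighted (\<lambda>\<Omega>. (norm (lam s \<Omega> ** z))\<^sup>2)"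
  by (intro integrable_weighted continuous_intros continuous_on_lam) measurable

text \<open>
  Take for \<open>M\<close> the mean of \<open>\<Lambda>\<close>: then the mean of \<open>\<langle>M \<Lambda> z, z\<rangle>\<close> is \<open>|M z|\<^sup>2\<close>, and the two trace terms of
  the pointwise bound merge into a nonpositive multiple of \<open>tr M\<close>.
\<close>

lemma mean_shrinkage_bound:
  defines "c \<equiv> real CARD('n) + 1 + \<alpha> + \<beta> - \<kappa>" and "m \<equiv> measure weighted (space weighted)"
  assumes c: "0 \<le> c" "0 \<le> 4 * c - 2 * \<beta>" "6 * c - 2 * \<beta> \<le> real CARD('n) + 1 + 2 * \<alpha>"
  shows "2 * m * ((\<integral>\<Omega>. (norm (lam s \<Omega> ** z))\<^sup>2 \<partial>weighted) - 2 * \<kappa> * v * trace mean_lam) \<le> (norm (mean_lam ** z))\<^sup>2"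
proof (cases "m = 0")
  case False
  then have m: "m > 0" using measure_nonneg[of weighted "space weighted"] by (simp add: m_def less_le)
  \<comment> \<open>Dividing by the mass makes \<open>M\<close> an average of \<Lambda>, so it lies
    between 0 and I as \<open>pointwise_bound\<close> demands.\<close>
  define M where "M = (1 / m) *\<^sub>R mean_lam"
  have M1: "psd M" using m psd_scaleR[OF mean_lam_facts(1), of "1 / m"] by (simp add: M_def)
  have M2: "psd (mat 1 - M)"
    using m psd_scaleR[OF mean_lam_facts(2), of "1 / m"] by (simp add: M_def m_def[symmetric] scaleR_diff_right)
  have symM: "transpose M = M" using M1 by (simp add: psd_def)
  define n2 where "n2 = (\<integral>\<Omega>. (norm (lam s \<Omega> ** z))\<^sup>2 \<partial>weighted)"
  have [measurable]: "div_square \<in> borel_measurable borel" "div_sandwich M \<in> borel_measurable borel"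
    unfolding div_square_def[abs_def] div_sandwich_def[abs_def] by measurable
  have i1: "integrable weighted div_square" "(\<integral>\<Omega>. div_square \<Omega> \<partial>weighted) = 0"
    unfolding integrable_weighted_iff[OF \<open>div_square \<in> borel_measurable borel\<close>] integral_weighted[OF \<open>div_square \<in> borel_measurable borel\<close>]
    by (rule integrable_div_square integral_div_square)+
  have i2: "integrable weighted (div_sandwich M)" "(\<integral>\<Omega>. div_sandwich M \<Omega> \<partial>weighted) = 0"
    unfolding integrable_weighted_iff[OF \<open>div_sandwich M \<in> borel_measurable borel\<close>] integral_weighted[OF \<open>div_sandwich M \<in> borel_measurable borel\<close>]
    by (rule integrable_div_sandwich integral_div_sandwich, rule symM)+
  note i3 = linear_mean_lam[OF linear_trace] and i4 = linear_mean_lam[OF linear_mult_inner[of M z]]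
  have "(\<integral>\<Omega>. 2 / v * (norm (lam s \<Omega> ** z))\<^sup>2 - 4 * \<kappa> * trace (lam s \<Omega>) + 4 * div_square \<Omega> - 1 / v * ((M ** lam s \<Omega> ** z) \<bullet> z) - 2 * div_sandwich M \<Omega> \<partial>weighted)
    \<le> (\<integral>\<Omega>. (4 * c - 2 * \<beta>) * trace (lam s \<Omega>) + (2 * c - (real CARD('n) + 1 + 2 * \<alpha>)) * trace M \<partial>weighted)"
  proof (rule integral_mono_AE)
    show "AE \<Omega> in weighted. 2 / v * (norm (lam s \<Omega> ** z))\<^sup>2 - 4 * \<kappa> * trace (lam s \<Omega>) + 4 * div_square \<Omega> - 1 / v * ((M ** lam s \<Omega> ** z) \<bullet> z) - 2 * div_sandwich M \<Omega>
      \<le> (4 * c - 2 * \<beta>) * trace (lam s \<Omega>) + (2 * c - (real CARD('n) + 1 + 2 * \<alpha>)) * trace M"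
      using AE_weighted
    proof eventually_elim
      case (elim \<Omega>)
      then show ?case using pointwise_bound[OF elim M1 M2 c_def[THEN meta_eq_to_obj_eq] c(1,2)] by simp
    qed
  qed (intro integrable_mult_right Bochner_Integration.integrable_add Bochner_Integration.integrable_diff i1 i2 i3 i4 integrable_lam_norm integrable_const)+
  also have "(\<integral>\<Omega>. 2 / v * (norm (lam s \<Omega> ** z))\<^sup>2 - 4 * \<kappa> * trace (lam s \<Omega>) + 4 * div_square \<Omega> - 1 / v * ((M ** lam s \<Omega> ** z) \<bullet> z) - 2 * div_sandwich M \<Omega> \<partial>weighted)
     = 2 / v * n2 - 4 * \<kappa> * trace mean_lam - 1 / v * ((M ** mean_lam ** z) \<bullet> z)"
    using i1 i2 i3 i4 integrable_lam_norm by (simp add: n2_def)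
  also have "(\<integral>\<Omega>. (4 * c - 2 * \<beta>) * trace (lam s \<Omega>) + (2 * c - (real CARD('n) + 1 + 2 * \<alpha>)) * trace M \<partial>weighted)
     = (4 * c - 2 * \<beta>) * trace mean_lam + (2 * c - (real CARD('n) + 1 + 2 * \<alpha>)) * trace M * m"
    using i3 by (simp add: m_def)
  also have "trace M * m = trace mean_lam" if "True" using m by (simp add: M_def trace_scaleR)
  then have "(4 * c - 2 * \<beta>) * trace mean_lam + (2 * c - (real CARD('n) + 1 + 2 * \<alpha>)) * trace M * m =
     (6 * c - 2 * \<beta> - (real CARD('n) + 1 + 2 * \<alpha>)) * trace mean_lam"
    by (simp add: mult.assoc) (simp add: algebra_simps)
  also have "\<dots> \<le> 0" using c(3) psd_trace_nonneg[OF mean_lam_facts(1)] by (intro mult_nonpos_nonneg) auto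
  finally have "2 / v * n2 - 4 * \<kappa> * trace mean_lam \<le> 1 / v * ((M ** mean_lam ** z) \<bullet> z)" by simp
  then have "m * v * (2 / v * n2 - 4 * \<kappa> * trace mean_lam) \<le> m * v * (1 / v * ((M ** mean_lam ** z) \<bullet> z))"
    using m v by (intro mult_left_mono) auto
  moreover have "m * v * (1 / v * ((M ** mean_lam ** z) \<bullet> z)) = (norm (mean_lam ** z))\<^sup>2"
  proof -
    have "transpose mean_lam = mean_lam" using mean_lam_facts(1) by (simp add: psd_def)
    then have "(norm (mean_lam ** z))\<^sup>2 = (mean_lam ** (mean_lam ** z)) \<bullet> z"
      by (simp add: power2_norm_eq_inner matrix_inner_left)
    then show ?thesis using m v by (simp add: M_def matrix_scaleR_mult matrix_mul_assoc)
  qed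
  moreover have "m * v * (2 / v * n2 - 4 * \<kappa> * trace mean_lam) = 2 * m * (n2 - 2 * \<kappa> * v * trace mean_lam)"
    using v by (simp add: field_simps)
  ultimately show ?thesis unfolding n2_def by linarith
qed simp

end

section \<open>The hierarchical prior as a finite nonzero measure\<close>

lemma pos_def_near_half_id:
  fixes A :: "real ^ 'n ^ 'n"
  assumes sym: "transpose A = A" and d: "\<And>i j. \<bar>(A - (1 / 2) *\<^sub>R mat 1) $ i $ j\<bar> \<le> d" and small: "d * (real CARD('n))\<^sup>2 < 1 / 2"
  shows "A \<in> R_set"
proof -
  define B where "B = A - (1 / 2) *\<^sub>R mat 1"
  have q: "\<bar>x \<bullet> (B *v x)\<bar> < (norm x)\<^sup>2 / 2" if x: "x \<noteq> 0" for x
  proof -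
    have "x \<bullet> (B *v x) = (\<Sum>i\<in>UNIV. \<Sum>j\<in>UNIV. x $ i * (B $ i $ j * x $ j))"
      by (simp add: inner_vec_def matrix_vector_mult_def sum_distrib_left)
    also have "\<bar>\<dots>\<bar> \<le> (\<Sum>i\<in>UNIV. \<Sum>j\<in>UNIV. \<bar>x $ i * (B $ i $ j * x $ j)\<bar>)"
      by (intro order_trans[OF sum_abs] sum_mono order_refl)
    also have "\<dots> \<le> (\<Sum>i\<in>(UNIV :: 'n set). \<Sum>j\<in>(UNIV :: 'n set). norm x * (d * norm x))"
      unfolding abs_mult using d[folded B_def] Finite_Cartesian_Product.norm_nth_le[of x]
      by (intro sum_mono mult_mono) (auto intro: order_trans[OF abs_ge_zero])
    also have "\<dots> = d * (real CARD('n))\<^sup>2 * (norm x)\<^sup>2" by (simp add: power2_eq_square)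
    also have "\<dots> < 1 / 2 * (norm x)\<^sup>2" using small x by (intro mult_strict_right_mono) auto
    finally show ?thesis by simp
  qed
  have A: "A = (1 / 2) *\<^sub>R mat 1 + B" "mat 1 - A = (1 / 2) *\<^sub>R mat 1 - B"
    by (simp_all add: B_def vec_eq_iff)
  have "0 < x \<bullet> (A *v x)" "0 < x \<bullet> ((mat 1 - A) *v x)" if "x \<noteq> 0" for x
  proof -
    have 1: "x \<bullet> (A *v x) = (norm x)\<^sup>2 / 2 + x \<bullet> (B *v x)" "x \<bullet> ((mat 1 - A) *v x) = (norm x)\<^sup>2 / 2 - x \<bullet> (B *v x)"
      unfolding A(2) by (subst A(1))
        (simp_all add: matrix_vector_mult_add_rdistrib matrix_vector_mult_diff_rdistrib inner_add_right
          inner_diff_right scaleR_matrix_vector_assoc[symmetric] power2_norm_eq_inner)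
    show "0 < x \<bullet> (A *v x)" "0 < x \<bullet> ((mat 1 - A) *v x)" unfolding 1 using q[OF that] by linarith+
  qed
  then show ?thesis by (simp add: R_set_iff pos_def_def sym transpose_linear)
qed

lemma emeasure_R_set_pos: "0 < emeasure (sym_lborel :: (real ^ 'n ^ 'n) measure) R_set"
proof -
  define d where "d = 1 / (4 * (real CARD('n))\<^sup>2)"
  have d: "d > 0" "d * (real CARD('n))\<^sup>2 < 1 / 2" by (auto simp: d_def)
  \<comment> \<open>A box in the free coordinates around I / 2: singletons index the diagonal, whose
    entries are near 1 / 2, and all other entries are near 0. With this \<open>d\<close>, the
    perturbation of the form is at most a quarter of |x|^2.\<close>
  define I where "I = (\<lambda>s :: 'n set. {of_bool (is_singleton s) / 2 - d .. of_bool (is_singleton s) / 2 + d})"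
  have sub: "Pi\<^sub>E pairs I \<subseteq> sym_mat -` R_set \<inter> space pairs_lborel"
  proof (intro subsetI IntI vimageI2)
    fix \<omega> assume w: "\<omega> \<in> Pi\<^sub>E pairs I"
    then show "\<omega> \<in> space pairs_lborel" by (auto simp: space_PiM)
    show "sym_mat \<omega> \<in> R_set"
    proof (rule pos_def_near_half_id[OF _ _ d(2)])
      show "transpose (sym_mat \<omega>) = (sym_mat \<omega> :: real ^ 'n ^ 'n)"
        by (simp add: sym_mat_def transpose_def insert_commute)
      fix i j :: 'n
      have "{i, j} \<in> pairs" by blast
      then have "\<omega> {i, j} \<in> I {i, j}" using w by (rule PiE_mem[rotated])
      moreover have "is_singleton {i, j} \<longleftrightarrow> i = j" by (auto simp: is_singleton_def doubleton_eq_iff)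
      ultimately show "\<bar>(sym_mat \<omega> - (1 / 2) *\<^sub>R mat 1) $ i $ j\<bar> \<le> d"
        by (auto simp: I_def sym_mat_def mat_def abs_le_iff split: if_splits)
    qed
  qed
  have "emeasure pairs_lborel (Pi\<^sub>E pairs I) = (\<Prod>s\<in>pairs. emeasure lborel (I s))"
    by (rule pairs.emeasure_PiM) (auto simp: I_def)
  also have "\<dots> = (\<Prod>s\<in>(pairs :: 'n set set). ennreal (2 * d))" using d by (intro prod.cong) (auto simp: I_def)
  also have "\<dots> > 0" using d by (simp add: prod_ennreal prod_pos ennreal_power ennreal_zero_less_mult_iff zero_less_iff_neq_zero)
  finally have "0 < emeasure pairs_lborel (Pi\<^sub>E pairs I)" .
  also have "\<dots> \<le> emeasure pairs_lborel (sym_mat -` (R_set :: (real ^ 'n ^ 'n) set) \<inter> space pairs_lborel)"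
    by (intro emeasure_mono sub measurable_sets[OF measurable_sym_mat]) measurable
  also have "\<dots> = emeasure (sym_lborel :: (real ^ 'n ^ 'n) measure) R_set"
    unfolding sym_lborel_def by (rule emeasure_distr[OF measurable_sym_mat, symmetric]) measurable
  finally show ?thesis .
qed

lemma prior1_egauss:
  fixes \<Theta> :: "real ^ 'q ^ 'n"
  assumes v0: "v0 > 0"
  shows "prior1 v0 \<Omega> \<Theta> = (2 * pi * v0) powr (- (real CARD('q) * real CARD('n) / 2)) *
     det (\<Omega> ** res 1 \<Omega>) powr (real CARD('q) / 2) * egauss ((1 / v0) *\<^sub>R (\<Omega> ** res 1 \<Omega>)) \<Theta>"
  unfolding prior1_def egauss_def trace_mult_transpose using v0
  by (simp add: res_def matrix_scaleR_mult)

lemma nn_integral_prior1: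
  assumes v0: "v0 > 0" and \<Omega>: "\<Omega> \<in> R_set"
  shows "(\<integral>\<^sup>+\<Theta>. ennreal (prior1 v0 \<Omega> \<Theta>) \<partial>(lborel :: (real ^ 'q ^ 'n) measure)) = 1"
proof -
  define Q where "Q = \<Omega> ** res 1 \<Omega>"
  define p where "p = real CARD('q) * real CARD('n) / 2"
  have Q: "pos_def Q" using mult_res_pos_def[OF \<Omega>, of 1] by (simp add: Q_def)
  then have P: "pos_def ((1 / v0) *\<^sub>R Q)" using v0 by (intro pos_def_scaleR) auto
  have dQ: "det Q > 0" by (rule pos_def_det_pos[OF Q])
  have 1: "prior1 v0 \<Omega> = (\<lambda>\<Theta> :: real ^ 'q ^ 'n. (2 * pi * v0) powr (- p) * det Q powr (real CARD('q) / 2) * egauss ((1 / v0) *\<^sub>R Q) \<Theta>)"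
    by (rule ext) (simp add: prior1_egauss[OF v0] Q_def p_def)
  have "integrable lborel (prior1 v0 \<Omega> :: real ^ 'q ^ 'n \<Rightarrow> real)"
    unfolding 1 by (intro integrable_mult_right integrable_egauss[OF P])
  then have "(\<integral>\<^sup>+\<Theta>. ennreal (prior1 v0 \<Omega> \<Theta>) \<partial>(lborel :: (real ^ 'q ^ 'n) measure)) = ennreal (\<integral>\<Theta>. prior1 v0 \<Omega> \<Theta> \<partial>(lborel :: (real ^ 'q ^ 'n) measure))"
    by (intro nn_integral_eq_integral AE_I2) (simp_all add: 1 egauss_def)
  also have "(\<integral>\<Theta>. prior1 v0 \<Omega> \<Theta> \<partial>(lborel :: (real ^ 'q ^ 'n) measure)) =
      (2 * pi * v0) powr (- p) * det Q powr (real CARD('q) / 2) * ((2 * pi) powr p * det ((1 / v0) *\<^sub>R Q) powr (- (real CARD('q) / 2)))"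
    unfolding 1 using integral_egauss[OF P, where 'q = 'q] by (simp add: p_def)
  also have "det ((1 / v0) *\<^sub>R Q) powr (- (real CARD('q) / 2)) = v0 powr p * det Q powr (- (real CARD('q) / 2))"
  proof -
    have "(1 / v0) ^ CARD('n) = v0 powr (- real CARD('n))"
      using v0 by (simp add: powr_minus powr_realpow power_one_over divide_inverse power_inverse)
    then show ?thesis
      using v0 dQ by (simp add: det_scaleR powr_mult powr_powr p_def mult.commute)
  qed
  also have "(2 * pi * v0) powr (- p) * det Q powr (real CARD('q) / 2) * ((2 * pi) powr p * (v0 powr p * det Q powr (- (real CARD('q) / 2)))) =
     ((2 * pi * v0) powr (- p) * (2 * pi * v0) powr p) * (det Q powr (real CARD('q) / 2) * det Q powr (- (real CARD('q) / 2)))"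
    using v0 by (simp add: powr_mult mult_ac)
  also have "\<dots> = 1" using v0 dQ by (simp add: powr_add[symmetric])
  finally show ?thesis by simp
qed

lemma measurable_prior1 [measurable (raw)]:
  fixes f :: "'a \<Rightarrow> real ^ 'n ^ 'n" and g :: "'a \<Rightarrow> real ^ 'q ^ 'n"
  assumes [measurable]: "f \<in> borel_measurable N" "g \<in> borel_measurable N"
  shows "(\<lambda>x. prior1 v0 (f x) (g x)) \<in> borel_measurable N"
proof -
  have [measurable]: "(transpose :: real ^ 'q ^ 'n \<Rightarrow> _) \<in> borel_measurable borel"
    by (intro borel_measurable_continuous_onI continuous_intros)
  show ?thesis unfolding prior1_def by measurable
qed

lemma measurable_pi_GB [measurable]: "pi_GB K a b \<in> borel_measurable borel"
  unfolding pi_GB_def[abs_def] by measurable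

locale GB_hierarchy =
  fixes K v0 a b :: real
  assumes K: "K > 0" and v0: "v0 > 0" and a: "a > 0" and b: "b > 2"
begin

definition kernel :: "real ^ 'n ^ 'n \<Rightarrow> real ^ 'q ^ 'n \<Rightarrow> real" where
  "kernel \<Omega> \<Theta> = indicator R_set \<Omega> * (prior1 v0 \<Omega> \<Theta> * pi_GB K a b \<Omega>)"

text \<open>The marginal on \<Theta> of the joint law of (\<Omega>, \<Theta>). As a measure it can
  be integrated in either order, conditionally on \<Omega> or against \<open>prior_GB\<close>, and
  no value has to be assigned where that density is infinite.\<close>

definition prior_measure :: "(real ^ 'q ^ 'n) measure" where
  "prior_measure = distr (density (sym_lborel \<Otimes>\<^sub>M lborel)
     (\<lambda>(\<Omega> :: real ^ 'n ^ 'n, \<Theta>). ennreal (kernel \<Omega> \<Theta>))) borel snd"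

lemma measurable_kernel [measurable (raw)]:
  fixes f :: "'a \<Rightarrow> real ^ 'n ^ 'n" and g :: "'a \<Rightarrow> real ^ 'q ^ 'n"
  assumes [measurable]: "f \<in> borel_measurable N" "g \<in> borel_measurable N"
  shows "(\<lambda>x. kernel (f x) (g x)) \<in> borel_measurable N"
  unfolding kernel_def by measurable

lemma kernel_nonneg: "0 \<le> kernel \<Omega> \<Theta>"
  using K by (simp add: kernel_def prior1_def pi_GB_def)

lemma sets_prior_measure [measurable_cong, simp]: "sets prior_measure = sets borel"
  by (simp add: prior_measure_def)

lemma space_prior_measure [simp]: "space prior_measure = UNIV"
  by (simp add: prior_measure_def)

lemma nn_integral_prior_measure:
  fixes f :: "real ^ 'q ^ 'n \<Rightarrow> ennreal"
  assumes [measurable]: "f \<in> borel_measurable borel"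
  shows "(\<integral>\<^sup>+\<Theta>. f \<Theta> \<partial>prior_measure) = (\<integral>\<^sup>+\<Omega>. \<integral>\<^sup>+\<Theta>. ennreal (kernel \<Omega> \<Theta>) * f \<Theta> \<partial>lborel \<partial>(sym_lborel :: (real ^ 'n ^ 'n) measure))"
    and "(\<integral>\<^sup>+\<Theta>. f \<Theta> \<partial>prior_measure) = (\<integral>\<^sup>+\<Theta>. f \<Theta> * prior_GB K v0 a b \<Theta> \<partial>lborel)"
proof -
  interpret S: sigma_finite_measure "sym_lborel :: (real ^ 'n ^ 'n) measure" by (rule sigma_finite_sym_lborel)
  interpret pair_sigma_finite "sym_lborel :: (real ^ 'n ^ 'n) measure" "lborel :: (real ^ 'q ^ 'n) measure" ..
  have "(\<integral>\<^sup>+\<Theta>. f \<Theta> \<partial>prior_measure) = (\<integral>\<^sup>+x. ennreal (kernel (fst x) (snd x)) * f (snd x) \<partial>((sym_lborel :: (real ^ 'n ^ 'n) measure) \<Otimes>\<^sub>M lborel))"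
    unfolding prior_measure_def case_prod_unfold
    by (subst nn_integral_distr, measurable, subst nn_integral_density, measurable)
  also have "\<dots> = (\<integral>\<^sup>+\<Omega>. \<integral>\<^sup>+\<Theta>. ennreal (kernel \<Omega> \<Theta>) * f \<Theta> \<partial>lborel \<partial>(sym_lborel :: (real ^ 'n ^ 'n) measure))"
  proof -
    have "(\<lambda>x. ennreal (kernel (fst x) (snd x)) * f (snd x)) \<in> borel_measurable ((sym_lborel :: (real ^ 'n ^ 'n) measure) \<Otimes>\<^sub>M (lborel :: (real ^ 'q ^ 'n) measure))"
      by measurable
    from lborel.nn_integral_fst[OF this] show ?thesis by simp
  qed
  finally show 1: "(\<integral>\<^sup>+\<Theta>. f \<Theta> \<partial>prior_measure) = (\<integral>\<^sup>+\<Omega>. \<integral>\<^sup>+\<Theta>. ennreal (kernel \<Omega> \<Theta>) * f \<Theta> \<partial>lborel \<partial>(sym_lborel :: (real ^ 'n ^ 'n) measure))" .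
  also have "\<dots> = (\<integral>\<^sup>+\<Theta>. \<integral>\<^sup>+\<Omega>. ennreal (kernel \<Omega> \<Theta>) * f \<Theta> \<partial>(sym_lborel :: (real ^ 'n ^ 'n) measure) \<partial>lborel)"
    by (rule Fubini'[symmetric]) measurable
  also have "\<dots> = (\<integral>\<^sup>+\<Theta>. f \<Theta> * prior_GB K v0 a b \<Theta> \<partial>lborel)"
  proof (rule nn_integral_cong)
    fix \<Theta> :: "real ^ 'q ^ 'n"
    have "(\<integral>\<^sup>+\<Omega>. ennreal (kernel \<Omega> \<Theta>) * f \<Theta> \<partial>(sym_lborel :: (real ^ 'n ^ 'n) measure)) = (\<integral>\<^sup>+\<Omega>. ennreal (kernel \<Omega> \<Theta>) \<partial>(sym_lborel :: (real ^ 'n ^ 'n) measure)) * f \<Theta>"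
      by (rule nn_integral_multc) measurable
    also have "(\<integral>\<^sup>+\<Omega>. ennreal (kernel \<Omega> \<Theta>) \<partial>(sym_lborel :: (real ^ 'n ^ 'n) measure)) = prior_GB K v0 a b \<Theta>"
      unfolding prior_GB_def kernel_def by (intro nn_integral_cong) (auto simp: indicator_def)
    finally show "(\<integral>\<^sup>+\<Omega>. ennreal (kernel \<Omega> \<Theta>) * f \<Theta> \<partial>(sym_lborel :: (real ^ 'n ^ 'n) measure)) = f \<Theta> * prior_GB K v0 a b \<Theta>"
      by (simp add: mult.commute)
  qed
  finally show "(\<integral>\<^sup>+\<Theta>. f \<Theta> \<partial>prior_measure) = (\<integral>\<^sup>+\<Theta>. f \<Theta> * prior_GB K v0 a b \<Theta> \<partial>lborel)" .
qed

lemma integral_prior_measure: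
  fixes f :: "real ^ 'q ^ 'n \<Rightarrow> real"
  assumes f: "integrable prior_measure f"
  shows "(\<integral>\<Theta>. f \<Theta> \<partial>prior_measure) = (\<integral>\<Omega>. \<integral>\<Theta>. kernel \<Omega> \<Theta> * f \<Theta> \<partial>lborel \<partial>(sym_lborel :: (real ^ 'n ^ 'n) measure))"
proof -
  interpret S: sigma_finite_measure "sym_lborel :: (real ^ 'n ^ 'n) measure" by (rule sigma_finite_sym_lborel)
  interpret pair_sigma_finite "sym_lborel :: (real ^ 'n ^ 'n) measure" "lborel :: (real ^ 'q ^ 'n) measure" ..
  let ?P = "(sym_lborel :: (real ^ 'n ^ 'n) measure) \<Otimes>\<^sub>M (lborel :: (real ^ 'q ^ 'n) measure)"
  have [measurable]: "f \<in> borel_measurable borel" using borel_measurable_integrable[OF f] by simp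
  have d: "prior_measure = distr (density ?P (\<lambda>x. ennreal (kernel (fst x) (snd x)))) borel snd"
    by (simp add: prior_measure_def case_prod_unfold)
  have nn: "AE x in ?P. 0 \<le> kernel (fst x) (snd x)" by (simp add: kernel_nonneg)
  have "integrable (density ?P (\<lambda>x. ennreal (kernel (fst x) (snd x)))) (\<lambda>x. f (snd x))"
    using f unfolding d by (subst (asm) integrable_distr_eq) measurable
  then have i: "integrable ?P (\<lambda>x. kernel (fst x) (snd x) * f (snd x))"
    by (subst (asm) integrable_real_density[OF _ nn]) measurable
  have "(\<integral>\<Theta>. f \<Theta> \<partial>prior_measure) = (\<integral>x. f (snd x) \<partial>density ?P (\<lambda>x. ennreal (kernel (fst x) (snd x))))"
    unfolding d by (rule integral_distr) measurable
  also have "\<dots> = (\<integral>x. kernel (fst x) (snd x) * f (snd x) \<partial>?P)"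
    by (rule integral_real_density[OF _ nn]) measurable
  also have "\<dots> = (\<integral>\<Omega>. \<integral>\<Theta>. kernel \<Omega> \<Theta> * f \<Theta> \<partial>lborel \<partial>(sym_lborel :: (real ^ 'n ^ 'n) measure))"
    using integral_fst'[OF i] by simp
  finally show ?thesis .
qed

lemma emeasure_prior_measure:
  "emeasure (prior_measure :: (real ^ 'q ^ 'n) measure) UNIV =
    (\<integral>\<^sup>+\<Omega>. ennreal (indicator R_set \<Omega> * pi_GB K a b \<Omega>) \<partial>(sym_lborel :: (real ^ 'n ^ 'n) measure))"
proof -
  have "emeasure (prior_measure :: (real ^ 'q ^ 'n) measure) UNIV = (\<integral>\<^sup>+\<Theta>. 1 \<partial>(prior_measure :: (real ^ 'q ^ 'n) measure))"
    by simp
  also have "\<dots> = (\<integral>\<^sup>+\<Omega>. \<integral>\<^sup>+\<Theta>. ennreal (kernel \<Omega> \<Theta>) * 1 \<partial>(lborel :: (real ^ 'q ^ 'n) measure) \<partial>(sym_lborel :: (real ^ 'n ^ 'n) measure))"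
    by (rule nn_integral_prior_measure) measurable
  also have "\<dots> = (\<integral>\<^sup>+\<Omega>. ennreal (indicator R_set \<Omega> * pi_GB K a b \<Omega>) \<partial>(sym_lborel :: (real ^ 'n ^ 'n) measure))"
  proof (rule nn_integral_cong)
    fix \<Omega> :: "real ^ 'n ^ 'n"
    have p: "0 \<le> pi_GB K a b \<Omega>" using K by (simp add: pi_GB_def)
    have "(\<integral>\<^sup>+\<Theta>. ennreal (kernel \<Omega> \<Theta>) * 1 \<partial>(lborel :: (real ^ 'q ^ 'n) measure)) =
       (\<integral>\<^sup>+\<Theta>. ennreal (indicator R_set \<Omega> * pi_GB K a b \<Omega>) * ennreal (prior1 v0 \<Omega> \<Theta>) \<partial>(lborel :: (real ^ 'q ^ 'n) measure))"
      using p by (intro nn_integral_cong) (simp add: kernel_def ennreal_mult[symmetric] prior1_def mult_ac)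
    also have "\<dots> = ennreal (indicator R_set \<Omega> * pi_GB K a b \<Omega>) * (\<integral>\<^sup>+\<Theta>. ennreal (prior1 v0 \<Omega> \<Theta>) \<partial>(lborel :: (real ^ 'q ^ 'n) measure))"
      by (rule nn_integral_cmult) measurable
    also have "\<dots> = ennreal (indicator R_set \<Omega> * pi_GB K a b \<Omega>)"
      by (cases "\<Omega> \<in> R_set") (simp_all add: nn_integral_prior1[OF v0])
    finally show "(\<integral>\<^sup>+\<Theta>. ennreal (kernel \<Omega> \<Theta>) * 1 \<partial>(lborel :: (real ^ 'q ^ 'n) measure)) = ennreal (indicator R_set \<Omega> * pi_GB K a b \<Omega>)" .
  qed
  finally show ?thesis .
qed

text \<open>The conditional densities integrate to 1, so the mass is the integral of
  \<open>pi_GB\<close>. It is finite because \<open>a > 0\<close> makes the power of det \<Omega>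
  integrable while \<open>b > 2\<close> makes the other power bounded, and positive because
  \<open>R_set\<close> has positive volume.\<close>

lemma gauss_mixture_prior: "gauss_mixture (prior_measure :: (real ^ 'q ^ 'n) measure)"
proof -
  let ?S = "sym_lborel :: (real ^ 'n ^ 'n) measure" and ?M = "prior_measure :: (real ^ 'q ^ 'n) measure"
  have sp: "space ?M = UNIV" by simp
  define D :: real where "D = fact CARD('n)"
  have "(\<integral>\<^sup>+\<Omega>. ennreal (indicator R_set \<Omega> * pi_GB K a b \<Omega>) \<partial>?S) \<le>
    (\<integral>\<^sup>+\<Omega>. ennreal (K * D powr (b / 2 - 1)) * (indicator R_set \<Omega> * ennreal (det \<Omega> powr (a / 2 - 1))) \<partial>?S)"
  proof (rule nn_integral_mono)
    fix \<Omega> :: "real ^ 'n ^ 'n"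
    show "ennreal (indicator R_set \<Omega> * pi_GB K a b \<Omega>) \<le> ennreal (K * D powr (b / 2 - 1)) * (indicator R_set \<Omega> * ennreal (det \<Omega> powr (a / 2 - 1)))"
    proof (cases "\<Omega> \<in> R_set")
      case True
      then have "pi_GB K a b \<Omega> \<le> K * det \<Omega> powr (a / 2 - 1) * D powr (b / 2 - 1)"
        \<comment> \<open>The numbers are an arbitrary admissible choice of \<alpha>, \<beta>,
          \<open>s\<close> and \<open>v\<close> for the locale in which the determinant bound was
          proved.\<close>
        unfolding pi_GB_def D_def using K b by (intro mult_left_mono powr_mono2 matrix_beta.det_bounds(2)[of 2 1 0 1])
          (auto simp: R_set_iff matrix_beta_def dest!: pos_def_det_pos)
      then show ?thesis using True K by (simp add: ennreal_mult[symmetric] mult_ac ennreal_leI)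
    qed simp
  qed
  also have "\<dots> = ennreal (K * D powr (b / 2 - 1)) * (\<integral>\<^sup>+\<Omega>. indicator R_set \<Omega> * ennreal (det \<Omega> powr (a / 2 - 1)) \<partial>?S)"
    by (rule nn_integral_cmult) measurable
  also have "\<dots> < \<infinity>" using nn_integral_R_det[of "a / 2 - 1", where 'n = 'n] a by (simp add: ennreal_mult_less_top)
  finally have fin: "emeasure ?M UNIV < \<infinity>" unfolding emeasure_prior_measure .
  have "\<not> (AE \<Omega> in ?S. ennreal (indicator R_set \<Omega> * pi_GB K a b \<Omega>) = 0)"
  proof
    assume "AE \<Omega> in ?S. ennreal (indicator R_set \<Omega> * pi_GB K a b \<Omega>) = 0"
    then have "AE \<Omega> in ?S. \<Omega> \<notin> R_set"
    proof eventually_elim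
      case (elim \<Omega>)
      have "pi_GB K a b \<Omega> > 0" if "\<Omega> \<in> R_set"
        using that K by (auto simp: pi_GB_def R_set_iff dest!: pos_def_det_pos)
      then show ?case using elim by (auto simp: ennreal_eq_0_iff)
    qed
    then have "emeasure ?S R_set = 0" by (subst (asm) AE_iff_measurable[of R_set]) auto
    then show False using emeasure_R_set_pos[where 'n = 'n] by simp
  qed
  then have "emeasure ?M UNIV \<noteq> 0"
    unfolding emeasure_prior_measure by (subst nn_integral_0_iff_AE) measurable
  then have "measure ?M (space ?M) > 0" using fin by (simp add: sp measure_def enn2real_positive_iff zero_less_iff_neq_zero)
  moreover have "finite_measure ?M" using fin by (intro finite_measureI) (simp add: sp)
  ultimately show ?thesis by (simp add: gauss_mixture_def gauss_mixture_axioms_def)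
qed

end

section \<open>Verification of the superharmonicity condition for the hierarchical prior\<close>

context GB_hierarchy
begin

text \<open>Integrating out \<Theta> first turns the mixture moments into integrals over
  \<open>weighted\<close>, by \<open>prior1_moments\<close>. In \<open>mix2\<close> the contribution
  q r v of the identity matrix is exactly what the subtracted multiple of \<open>mix\<close>
  removes, so the claim becomes the square of \<open>C\<close> times
  \<open>mean_shrinkage_bound\<close>.\<close>

lemma mixture_condition:
  fixes z :: "real ^ 'q ^ 'n"
  assumes v: "0 < v" "v \<le> v0" and q: "a + real CARD('q) > 4"
    and ab: "2 * (a + b) \<le> real CARD('q) - 5 * real CARD('n) + 3"
  defines "M \<equiv> prior_measure :: (real ^ 'q ^ 'n) measure"
  shows "2 * gauss_mixture.mix M v z * (gauss_mixture.mix2 M v z - real DIM(real ^ 'q ^ 'n) * v * gauss_mixture.mix M v z)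
    \<le> (\<Sum>e\<in>Basis. (gauss_mixture.mix1 M v z e)\<^sup>2)"
proof -
  interpret M: gauss_mixture M unfolding M_def by (rule gauss_mixture_prior)
  define s where "s = 1 - v / v0"
  define \<alpha> where "\<alpha> = (a + real CARD('q)) / 2 - 1"
  define \<beta> where "\<beta> = b / 2 - 1"
  define \<kappa> where "\<kappa> = real CARD('q) / 2"
  interpret B: matrix_beta \<alpha> \<beta> s \<kappa> v z
    using v q b by unfold_locales (auto simp: \<alpha>_def \<beta>_def s_def)
  define m where "m = measure B.weighted (space B.weighted)"
  define C where "C = K * (2 * pi * v0) powr (- (real CARD('q) * real CARD('n) / 2))"
  \<comment> \<open>The exponent of det \<Omega> collects a / 2 - 1 from the second-stage density
    and q / 2 from the conditional density of the observation.\<close>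
  have w: "pi_GB K a b \<Omega> * phi \<Omega> v v0 s z = C * B.weight \<Omega>" if "\<Omega> \<in> R_set" for \<Omega>
  proof -
    have "\<alpha> = a / 2 - 1 + real CARD('q) / 2" by (simp add: \<alpha>_def add_divide_distrib)
    then have "det \<Omega> powr \<alpha> = det \<Omega> powr (a / 2 - 1) * det \<Omega> powr (real CARD('q) / 2)"
      using B.det_pos(1)[OF that] by (simp only: powr_add)
    then show ?thesis
      unfolding B.weight_def B.smooth_def by (simp add: pi_GB_def phi_def[OF that v s_def] C_def \<beta>_def \<kappa>_def)
  qed
  have red: "(\<integral>\<Theta>. f \<Theta> \<partial>M) = C * (\<integral>\<Omega>. g \<Omega> \<partial>B.weighted)"
    if f: "integrable M f" and [measurable]: "g \<in> borel_measurable borel"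
      and fg: "\<And>\<Omega>. \<Omega> \<in> R_set \<Longrightarrow> (\<integral>\<Theta>. f \<Theta> * prior1 v0 \<Omega> \<Theta> \<partial>lborel) = phi \<Omega> v v0 s z * g \<Omega>" for f g
  proof -
    have "(\<integral>\<Theta>. kernel \<Omega> \<Theta> * f \<Theta> \<partial>lborel) = C * (indicator R_set \<Omega> * (g \<Omega> * B.weight \<Omega>))" for \<Omega>
    proof (cases "\<Omega> \<in> R_set")
      case True
      have "(\<integral>\<Theta>. kernel \<Omega> \<Theta> * f \<Theta> \<partial>lborel) = (\<integral>\<Theta>. pi_GB K a b \<Omega> * (f \<Theta> * prior1 v0 \<Omega> \<Theta>) \<partial>lborel)"
        using True by (intro Bochner_Integration.integral_cong) (auto simp: kernel_def)
      also have "\<dots> = (pi_GB K a b \<Omega> * phi \<Omega> v v0 s z) * g \<Omega>" by (simp add: fg[OF True])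
      finally show ?thesis using True by (simp add: w)
    qed (simp add: kernel_def)
    then have "(\<integral>\<Theta>. f \<Theta> \<partial>M) = C * (\<integral>\<Omega>. indicator R_set \<Omega> * (g \<Omega> * B.weight \<Omega>) \<partial>sym_lborel)"
      using integral_prior_measure[OF f[unfolded M_def]] by (simp add: M_def)
    then show ?thesis by (simp add: B.integral_weighted)
  qed
  note moments = prior1_moments[OF _ v s_def]
  have mix: "M.mix v z = C * m"
  proof -
    have "M.mix v z = C * (\<integral>\<Omega>. 1 \<partial>B.weighted)"
      unfolding M.mix_def
    proof (rule red)
      show "(\<integral>\<Theta>. gauss v \<Theta> z * prior1 v0 \<Omega> \<Theta> \<partial>lborel) = phi \<Omega> v v0 s z * 1" if "\<Omega> \<in> R_set" for \<Omega>
        using moments(2)[OF that] by simp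
    qed (use v in \<open>auto intro: M.integrable_mix\<close>)
    then show ?thesis by (simp add: m_def)
  qed
  have lin: "linear (\<lambda>A :: real ^ 'n ^ 'n. (A ** z) \<bullet> e)" for e
    using B.linear_mult_inner[of "mat 1" e] by simp
  have mix1: "M.mix1 v z e = C * ((B.mean_lam ** z) \<bullet> e)" if e: "e \<in> Basis" for e
  proof -
    have "M.mix1 v z e = C * (\<integral>\<Omega>. (lam s \<Omega> ** z) \<bullet> e \<partial>B.weighted)"
      unfolding M.mix1_def
    proof (rule red)
      show "integrable M (\<lambda>\<Theta>. ((z - \<Theta>) \<bullet> e) * gauss v \<Theta> z)" using e v by (intro M.integrable_mix) auto
      show "(\<integral>\<Theta>. (z - \<Theta>) \<bullet> e * gauss v \<Theta> z * prior1 v0 \<Omega> \<Theta> \<partial>lborel) = phi \<Omega> v v0 s z * ((lam s \<Omega> ** z) \<bullet> e)" if "\<Omega> \<in> R_set" for \<Omega>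
        unfolding mult.assoc by (rule moments(4)[OF that])
    qed measurable
    then show ?thesis by (simp add: B.linear_mean_lam[OF lin])
  qed
  define N where "N = (\<integral>\<Omega>. (norm (lam s \<Omega> ** z))\<^sup>2 \<partial>B.weighted)"
  have mix2: "M.mix2 v z = C * (N + real CARD('q) * v * (real CARD('n) * m - trace B.mean_lam))"
  proof -
    have "M.mix2 v z = C * (\<integral>\<Omega>. (norm (lam s \<Omega> ** z))\<^sup>2 + real CARD('q) * v * (real CARD('n) - trace (lam s \<Omega>)) \<partial>B.weighted)"
      unfolding M.mix2_def
    proof (rule red)
      show "integrable M (\<lambda>\<Theta>. (norm (z - \<Theta>))\<^sup>2 * gauss v \<Theta> z)" using v by (intro M.integrable_mix) auto
      show "(\<integral>\<Theta>. (norm (z - \<Theta>))\<^sup>2 * gauss v \<Theta> z * prior1 v0 \<Omega> \<Theta> \<partial>lborel) =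
          phi \<Omega> v v0 s z * ((norm (lam s \<Omega> ** z))\<^sup>2 + real CARD('q) * v * (real CARD('n) - trace (lam s \<Omega>)))" if "\<Omega> \<in> R_set" for \<Omega>
        unfolding mult.assoc[of _ "gauss v _ z"] by (rule moments(6)[OF that])
    qed measurable
    also have "(\<integral>\<Omega>. (norm (lam s \<Omega> ** z))\<^sup>2 + real CARD('q) * v * (real CARD('n) - trace (lam s \<Omega>)) \<partial>B.weighted) =
       N + real CARD('q) * v * (real CARD('n) * m - trace B.mean_lam)"
      using B.integrable_lam_norm B.linear_mean_lam[OF B.linear_trace] by (simp add: N_def m_def mult.commute)
    finally show ?thesis .
  qed
  have key: "2 * m * (N - 2 * \<kappa> * v * trace B.mean_lam) \<le> (norm (B.mean_lam ** z))\<^sup>2"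
    unfolding m_def N_def
  proof (rule B.mean_shrinkage_bound)
    have n: "real CARD('n) \<ge> 1" using zero_less_card_finite[where 'a = 'n] by linarith
    \<comment> \<open>The common expression is r - 1 + (a + b) / 2. The first two conditions follow
      from r \<ge> 1, \<open>a > 0\<close> and \<open>b > 2\<close>; the third is a rearrangement of
      2 (a + b) \<le> q - 5 r + 3.\<close>
    show "0 \<le> real CARD('n) + 1 + \<alpha> + \<beta> - \<kappa>"
      "0 \<le> 4 * (real CARD('n) + 1 + \<alpha> + \<beta> - \<kappa>) - 2 * \<beta>"
      "6 * (real CARD('n) + 1 + \<alpha> + \<beta> - \<kappa>) - 2 * \<beta> \<le> real CARD('n) + 1 + 2 * \<alpha>"
      using n a b ab unfolding \<alpha>_def \<beta>_def \<kappa>_def by (simp_all add: field_simps)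
  qed
  have "2 * M.mix v z * (M.mix2 v z - real DIM(real ^ 'q ^ 'n) * v * M.mix v z) = C\<^sup>2 * (2 * m * (N - 2 * \<kappa> * v * trace B.mean_lam))"
    unfolding mix mix2 \<kappa>_def by (simp add: algebra_simps power2_eq_square)
  also have "\<dots> \<le> C\<^sup>2 * (norm (B.mean_lam ** z))\<^sup>2" by (intro mult_left_mono key) simp
  also have "\<dots> = (\<Sum>e\<in>Basis. (M.mix1 v z e)\<^sup>2)"
    unfolding norm_sq_eq_sum_Basis[of "B.mean_lam ** z"] sum_distrib_left by (intro sum.cong) (auto simp: mix1 power_mult_distrib)
  finally show ?thesis .
qed

text \<open>Numerator and denominator are finite integrals against the prior measure and the
  denominator is positive, so the conversions between \<open>ennreal\<close> and reals are
  faithful.\<close>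

lemma phat_GB_eq_pred:
  fixes X Y :: "real ^ 'q ^ 'n"
  assumes v: "0 < vx" "0 < vy"
  shows "phat_GB K vx vy v0 a b X Y = gauss_mixture.pred prior_measure vx vy X Y"
proof -
  define M where "M = (prior_measure :: (real ^ 'q ^ 'n) measure)"
  interpret M: gauss_mixture M unfolding M_def by (rule gauss_mixture_prior)
  have nn: "ennreal (\<integral>\<Theta>. f \<Theta> \<partial>M) = (\<integral>\<^sup>+\<Theta>. ennreal (f \<Theta>) * prior_GB K v0 a b \<Theta> \<partial>lborel)"
    if f: "integrable M f" "\<And>\<Theta>. 0 \<le> f \<Theta>" for f
  proof -
    have [measurable]: "f \<in> borel_measurable borel" using borel_measurable_integrable[OF f(1)] by (simp add: M_def)
    have "(\<integral>\<^sup>+\<Theta>. ennreal (f \<Theta>) * prior_GB K v0 a b \<Theta> \<partial>lborel) = (\<integral>\<^sup>+\<Theta>. ennreal (f \<Theta>) \<partial>M)"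
      unfolding M_def by (rule nn_integral_prior_measure(2)[symmetric]) measurable
    then show ?thesis using nn_integral_eq_integral[OF f(1)] f(2) by simp
  qed
  have ge: "0 \<le> gauss u \<theta> x" for u \<theta> and x :: "real ^ 'q ^ 'n" by (simp add: gauss_def)
  have i1: "integrable M (\<lambda>\<Theta>. gauss vx \<Theta> X)" by (rule M.integrable_mix(1)[OF v(1)])
  have i2: "integrable M (\<lambda>\<Theta>. gauss vx \<Theta> X * gauss vy \<Theta> Y)"
    unfolding gauss_mult[OF v] using v by (intro integrable_mult_right M.integrable_mix) auto
  have "phat_GB K vx vy v0 a b X Y = enn2real (ennreal (\<integral>\<Theta>. gauss vx \<Theta> X * gauss vy \<Theta> Y \<partial>M) / ennreal (M.mix vx X))"
    unfolding phat_GB_def bayes_pred_def normal_dens_eq_gauss M.mix_def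
    by (subst (1 2) nn) (auto intro!: i1 i2 ge mult_nonneg_nonneg)
  also have "\<dots> = M.pred vx vy X Y"
    unfolding M.pred_def using M.mix_pos[OF v(1), of X]
    by (subst divide_ennreal) (auto intro!: Bochner_Integration.integral_nonneg mult_nonneg_nonneg ge divide_nonneg_pos)
  finally show ?thesis by (simp add: M_def)
qed

end

theorem corollary3p2:
  fixes K v\<^sub>x v\<^sub>y v\<^sub>0 a b :: real
  assumes "1 \<le> CARD('r)" and "CARD('r) \<le> CARD('q)"
    and "real CARD('q) - 5 * real CARD('r) - 1 > 0"
    and "v\<^sub>x > 0" and "v\<^sub>y > 0" and "v\<^sub>0 \<ge> v\<^sub>x"
    and "K > 0"
    and "a > 0" and "b > 2"
    and "a + b \<le> (real CARD('q) - 5 * real CARD('r) + 3) / 2"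
  shows "admissible v\<^sub>x v\<^sub>y
           (phat_GB K v\<^sub>x v\<^sub>y v\<^sub>0 a b :: real ^ 'q ^ 'r \<Rightarrow> real ^ 'q ^ 'r \<Rightarrow> real) \<and>
         minimax v\<^sub>x v\<^sub>y
           (phat_GB K v\<^sub>x v\<^sub>y v\<^sub>0 a b :: real ^ 'q ^ 'r \<Rightarrow> real ^ 'q ^ 'r \<Rightarrow> real)"
proof -
  interpret GB_hierarchy K v\<^sub>0 a b using assms by unfold_locales auto
  have "real CARD('r) \<ge> 1" using assms(1) by linarith
  \<comment> \<open>From q > 5 r + 1 and r \<ge> 1 one has q > 6. The stated bound is the condition
    \<alpha> > 1 of \<open>matrix_beta\<close>.\<close>
  then have q: "a + real CARD('q) > 4" using assms by linarith
  show ?thesis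
  proof (rule admissible_minimax_pred[OF gauss_mixture_prior \<open>v\<^sub>x > 0\<close> \<open>v\<^sub>y > 0\<close> phat_GB_eq_pred[OF \<open>v\<^sub>x > 0\<close> \<open>v\<^sub>y > 0\<close>] mixture_condition])
    fix v assume "0 < v" "v \<le> v\<^sub>x"
    then show "0 < v" "v \<le> v\<^sub>0" using assms by auto
  qed (use assms q in auto)
qed

end
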